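(* Let $y=\{y_k;\,k\in\mathbb{Z}\}$ and $z=\{z_k;\,k\in\mathbb{Z}\}$ be two zero-mean, jointly Gaussian, stationary, purely nondeterministic processes taking values in $\mathbb{R}^m$, with spectral densities $\Phi_y$ and $\Phi_z$. Assume that both $\Phi_y$ and $\Phi_z$ are piecewise continuous, coercive spectral densities. Then the time-domain relative entropy rate and the spectral relative entropy rate coincide: $$\mathbb{D}_r(y\|z)=\mathbb{D}_r(d\hat y\|d\hat z).$$
   Context: Write ${\rm j}$ for the imaginary unit and $\mathbb{T}$ for the unit circle. The spectral density $\Phi_y$ is the matrix function on $\mathbb{T}$ with $E[y_{k+l}y_k^\top]=\frac{1}{2\pi}\int_{-\pi}^{\pi}e^{{\rm j}l\vartheta}\Phi_y(e^{{\rm j}\vartheta})\,d\vartheta$ for all $l\in\mathbb{Z}$; similarly for $\Phi_z$. A spectral density $\Phi$ is coercive if there is $\alpha>0$ with $\Phi(e^{{\rm j}\vartheta})-\alpha I_m>0$ a.e. on $\mathbb{T}$. Piecewise continuous means continuous except at finitely many points, with finite one-sided limits there. Relative entropy: for probability densities $p,q$ on $\mathbb{R}^N$, $\mathbb{D}(p\|q)=\int p\log(p/q)$. More generally, for probability laws $P,Q$, it is $\int \log\frac{dP}{dQ}\,dP$ if $P\ll Q$ and $+\infty$ otherwise. For complex random vectors it is computed on the joint law of real and imaginary parts. When the components of a vector are linearly dependent, so that no Lebesgue density exists, the relative entropy is understood as that between the laws. Time-domain relative entropy rate: let $Y_{[-n,n]}$ be the random vector formed by $y_{-n},\dots,y_0,\dots,y_n$,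 with density $p_{Y_{[-n,n]}}$, and similarly $Z_{[-n,n]}$ for $z$. Then $\mathbb{D}_r(y\|z):=\lim_{n\to\infty}\frac{1}{2n+1}\mathbb{D}(p_{Y_{[-n,n]}}\|p_{Z_{[-n,n]}})$, if the limit exists. Spectral relative entropy rate: for $\vartheta_1<\vartheta_2$ put $\chi_k(\vartheta_1,\vartheta_2)=\frac{e^{-{\rm j}\vartheta_2k}-e^{-{\rm j}\vartheta_1k}}{-2\pi {\rm j}k}$ for $k\ne0$ and $\chi_0(\vartheta_1,\vartheta_2)=\frac{\vartheta_2-\vartheta_1}{2\pi}$. Define the $\mathbb{C}^m$-valued random vector $\hat y(e^{{\rm j}\vartheta_1},e^{{\rm j}\vartheta_2}):=\lim_{N\to+\infty}\sum_{k=-N}^N\chi_k(\vartheta_1,\vartheta_2)y_k$ (limit in mean square), and similarly $\hat z$. (This is the stochastic orthogonal measure in the spectral representation $y_k=\int_{-\pi}^{\pi}e^{{\rm j}k\vartheta}d\hat y(e^{{\rm j}\vartheta})$.) For $n\ge1$ let $\vartheta_k=\pi k/n$, $\delta\hat y_k:=\hat y(e^{{\rm j}\vartheta_k},e^{{\rm j}\vartheta_{k+1}})$, $\delta\hat z_k:=\hat z(e^{{\rm j}\vartheta_k},e^{{\rm j}\vartheta_{k+1}})$. Let $\hat Y_{2n}$ and $\hat Z_{2n}$ be the vectors obtained by stacking $\delta\hat y_0,\dots,\delta\hat y_{2n-1}$ and $\delta\hat z_0,\dots,\delta\hat z_{2n-1}$, with laws $p(\hat Y_{2n})$ and $p(\hat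 Z_{2n})$. Then $\mathbb{D}_r(d\hat y\|d\hat z):=\lim_{n\to\infty}\frac{1}{2n}\mathbb{D}(p(\hat Y_{2n})\|p(\hat Z_{2n}))$, if the limit exists. The asserted equality includes the existence of both limits. *)

theory Defs
  imports "HOL-Probability.Probability"
begin

section \<open>Gaussian stationary processes\<close>

text \<open>Constants count as (degenerate) Gaussian variables: nothing prevents the components of
  \<open>y\<close> and \<open>z\<close> from being linearly dependent on each other.\<close>

definition gaussian_rv :: "'a measure \<Rightarrow> ('a \<Rightarrow> real) \<Rightarrow> bool" where
  "gaussian_rv M X \<longleftrightarrow> X \<in> borel_measurable M \<and>
     ((\<exists>\<mu> \<sigma>. 0 < \<sigma> \<and> distributed M lborel X (normal_density \<mu> \<sigma>)) \<or>
      (\<exists>\<mu>. AE \<omega> in M. X \<omega> = \<mu>))"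

definition jointly_gaussian ::
    "'a measure \<Rightarrow> (int \<Rightarrow> 'a \<Rightarrow> real^'m) \<Rightarrow> (int \<Rightarrow> 'a \<Rightarrow> real^'m) \<Rightarrow> bool" where
  "jointly_gaussian M y z \<longleftrightarrow>
     (\<forall>(K :: int set) (a :: int \<Rightarrow> real^'m) (b :: int \<Rightarrow> real^'m). finite K \<longrightarrow>
        gaussian_rv M (\<lambda>\<omega>. \<Sum>k\<in>K. a k \<bullet> y k \<omega> + b k \<bullet> z k \<omega>))"

definition zero_mean :: "'a measure \<Rightarrow> (int \<Rightarrow> 'a \<Rightarrow> real^'m) \<Rightarrow> bool" where
  "zero_mean M y \<longleftrightarrow> (\<forall>k. integrable M (y k) \<and> integral\<^sup>L M (y k) = 0)"

text \<open>Stationarity in the wide sense; for Gaussian processes it is the same as strict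
  stationarity.\<close>

definition stationary :: "'a measure \<Rightarrow> (int \<Rightarrow> 'a \<Rightarrow> real^'m) \<Rightarrow> bool" where
  "stationary M y \<longleftrightarrow>
     (\<forall>k. y k \<in> borel_measurable M \<and> integrable M (\<lambda>\<omega>. (norm (y k \<omega>))\<^sup>2)) \<and>
     (\<forall>k l. integral\<^sup>L M (y k) = integral\<^sup>L M (y l)) \<and>
     (\<forall>k h l i j. (\<integral>\<omega>. y (k + l) \<omega> $ i * y k \<omega> $ j \<partial>M) = (\<integral>\<omega>. y (h + l) \<omega> $ i * y h \<omega> $ j \<partial>M))"

text \<open>\<open>X \<in> past_space M y n\<close>: \<open>X\<close> lies in the closed linear span in \<open>L\<^sup>2\<close> of the components of the
  \<open>y k\<close> with \<open>k \<le> n\<close>.\<close>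

definition past_space :: "'a measure \<Rightarrow> (int \<Rightarrow> 'a \<Rightarrow> real^'m) \<Rightarrow> int \<Rightarrow> ('a \<Rightarrow> real) set" where
  "past_space M y n = {X. X \<in> borel_measurable M \<and> integrable M (\<lambda>\<omega>. (X \<omega>)\<^sup>2) \<and>
     (\<forall>\<epsilon>>0. \<exists>(K :: int set) (a :: int \<Rightarrow> real^'m). finite K \<and> K \<subseteq> {..n} \<and>
        (\<integral>\<omega>. (X \<omega> - (\<Sum>k\<in>K. a k \<bullet> y k \<omega>))\<^sup>2 \<partial>M) < \<epsilon>)}"

definition purely_nondeterministic :: "'a measure \<Rightarrow> (int \<Rightarrow> 'a \<Rightarrow> real^'m) \<Rightarrow> bool" where
  "purely_nondeterministic M y \<longleftrightarrow>
     (\<forall>X \<in> (\<Inter>n. past_space M y n). AE \<omega> in M. X \<omega> = 0)"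

section \<open>Spectral densities\<close>

text \<open>Functions on the unit circle are functions on \<^typ>\<open>complex\<close> of which only the values at
  \<open>cis \<theta> = exp (\<i> * \<theta>)\<close> matter.\<close>

definition is_spectral_density ::
    "'a measure \<Rightarrow> (int \<Rightarrow> 'a \<Rightarrow> real^'m) \<Rightarrow> (complex \<Rightarrow> complex^'m^'m) \<Rightarrow> bool" where
  "is_spectral_density M y \<Phi> \<longleftrightarrow>
     (\<forall>i j. set_integrable lborel {-pi..pi} (\<lambda>\<theta>. \<Phi> (cis \<theta>) $ i $ j)) \<and>
     (\<forall>(k :: int) (l :: int) i j.
        complex_of_real (\<integral>\<omega>. y (k + l) \<omega> $ i * y k \<omega> $ j \<partial>M) =
        1 / (2 * pi) * (LINT \<theta>:{-pi..pi}|lborel. exp (\<i> * of_int l * of_real \<theta>) * \<Phi> (cis \<theta>) $ i $ j))"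

definition hermitian_pos_def :: "complex^'m^'m \<Rightarrow> bool" where
  "hermitian_pos_def A \<longleftrightarrow> (\<forall>i j. A $ i $ j = cnj (A $ j $ i)) \<and>
     (\<forall>v. v \<noteq> 0 \<longrightarrow> 0 < Re (\<Sum>i\<in>UNIV. cnj (v $ i) * (A *v v) $ i))"

definition coercive :: "(complex \<Rightarrow> complex^'m^'m) \<Rightarrow> bool" where
  "coercive \<Phi> \<longleftrightarrow> (\<exists>\<alpha>>0. AE \<theta> in lborel. \<theta> \<in> {-pi..pi} \<longrightarrow>
     hermitian_pos_def (\<Phi> (cis \<theta>) - mat (complex_of_real \<alpha>)))"

definition piecewise_continuous_on_circle :: "(complex \<Rightarrow> complex^'m^'m) \<Rightarrow> bool" where
  "piecewise_continuous_on_circle \<Phi> \<longleftrightarrow>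
     (\<exists>S. finite S \<and> S \<subseteq> sphere 0 1 \<and> continuous_on (sphere 0 1 - S) \<Phi> \<and>
        (\<forall>\<theta>. cis \<theta> \<in> S \<longrightarrow>
           (\<exists>L. ((\<lambda>t. \<Phi> (cis t)) \<longlongrightarrow> L) (at_left \<theta>)) \<and>
           (\<exists>R. ((\<lambda>t. \<Phi> (cis t)) \<longlongrightarrow> R) (at_right \<theta>))))"

section \<open>Relative entropy and the time-domain rate\<close>

text \<open>The negative part of \<open>log (dP/dQ)\<close> is always \<open>P\<close>-integrable when \<open>P\<close> and \<open>Q\<close> are probability
  measures with \<open>P \<lless> Q\<close>, so non-integrability means that the integral is \<open>\<infinity>\<close>. The library's
  \<^const>\<open>KL_divergence\<close> takes the reference measure first and is only meaningful in the
  integrable case.\<close>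

definition rel_entropy :: "'b measure \<Rightarrow> 'b measure \<Rightarrow> ereal" where
  "rel_entropy P Q =
     (if absolutely_continuous Q P \<and> integrable P (entropy_density (exp 1) Q P)
      then ereal (KL_divergence (exp 1) Q P) else \<infinity>)"

text \<open>The joint law of \<open>(X k)\<^sub>k\<^sub>\<in>\<^sub>I\<close> on the product space. For values in \<open>complex^'m\<close>, whose Borel
  sets are those of the pair of real and imaginary parts, this is the joint law of the real and
  imaginary parts.\<close>

definition joint_law ::
    "'a measure \<Rightarrow> 'i set \<Rightarrow> ('i \<Rightarrow> 'a \<Rightarrow> 'b::topological_space) \<Rightarrow> ('i \<Rightarrow> 'b) measure" where
  "joint_law M I X = distr M (\<Pi>\<^sub>M k\<in>I. borel) (\<lambda>\<omega>. \<lambda>k\<in>I. X k \<omega>)"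

text \<open>The two rates are given as relations: ``the limit exists and equals \<open>D\<close>''.\<close>

definition has_time_entropy_rate ::
    "'a measure \<Rightarrow> (int \<Rightarrow> 'a \<Rightarrow> real^'m) \<Rightarrow> (int \<Rightarrow> 'a \<Rightarrow> real^'m) \<Rightarrow> real \<Rightarrow> bool" where
  "has_time_entropy_rate M y z D \<longleftrightarrow>
     (\<lambda>n::nat. rel_entropy (joint_law M {- int n..int n} y) (joint_law M {- int n..int n} z)
               / ereal (2 * real n + 1)) \<longlonglongrightarrow> ereal D"

section \<open>The stochastic orthogonal measure and the spectral rate\<close>

text \<open>The coefficient \<open>\<chi>\<^sub>k(\<theta>\<^sub>1, \<theta>\<^sub>2)\<close>.\<close>

definition arc_coeff :: "real \<Rightarrow> real \<Rightarrow> int \<Rightarrow> complex" where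
  "arc_coeff \<theta>1 \<theta>2 k =
     (if k = 0 then of_real ((\<theta>2 - \<theta>1) / (2 * pi))
      else (exp (- \<i> * of_real \<theta>2 * of_int k) - exp (- \<i> * of_real \<theta>1 * of_int k))
           / (- 2 * of_real pi * \<i> * of_int k))"

definition arc_partial_sum ::
    "(int \<Rightarrow> 'a \<Rightarrow> real^'m) \<Rightarrow> real \<Rightarrow> real \<Rightarrow> nat \<Rightarrow> 'a \<Rightarrow> complex^'m" where
  "arc_partial_sum y \<theta>1 \<theta>2 N \<omega> =
     (\<chi> i. \<Sum>k\<in>{- int N..int N}. arc_coeff \<theta>1 \<theta>2 k * complex_of_real (y k \<omega> $ i))"

definition is_mean_square_limit ::
    "'a measure \<Rightarrow> (nat \<Rightarrow> 'a \<Rightarrow> 'b::euclidean_space) \<Rightarrow> ('a \<Rightarrow> 'b) \<Rightarrow> bool" where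
  "is_mean_square_limit M X Y \<longleftrightarrow> Y \<in> borel_measurable M \<and>
     (\<lambda>N. \<integral>\<^sup>+\<omega>. ennreal ((norm (X N \<omega> - Y \<omega>))\<^sup>2) \<partial>M) \<longlonglongrightarrow> 0"

text \<open>A mean-square limit is determined up to almost sure equality, so the choice of version does
  not affect laws.\<close>

definition spectral_increment ::
    "'a measure \<Rightarrow> (int \<Rightarrow> 'a \<Rightarrow> real^'m) \<Rightarrow> real \<Rightarrow> real \<Rightarrow> 'a \<Rightarrow> complex^'m" where
  "spectral_increment M y \<theta>1 \<theta>2 = (SOME Y. is_mean_square_limit M (arc_partial_sum y \<theta>1 \<theta>2) Y)"

definition grid_increment ::
    "'a measure \<Rightarrow> (int \<Rightarrow> 'a \<Rightarrow> real^'m) \<Rightarrow> nat \<Rightarrow> nat \<Rightarrow> 'a \<Rightarrow> complex^'m" where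
  "grid_increment M y n k =
     spectral_increment M y (pi * real k / real n) (pi * real (k + 1) / real n)"

definition has_spectral_entropy_rate ::
    "'a measure \<Rightarrow> (int \<Rightarrow> 'a \<Rightarrow> real^'m) \<Rightarrow> (int \<Rightarrow> 'a \<Rightarrow> real^'m) \<Rightarrow> real \<Rightarrow> bool" where
  "has_spectral_entropy_rate M y z D \<longleftrightarrow>
     (\<lambda>n::nat. rel_entropy (joint_law M {..<2 * n} (grid_increment M y n))
                           (joint_law M {..<2 * n} (grid_increment M z n))
               / ereal (2 * real n)) \<longlonglongrightarrow> ereal D"

end

theory Submission
  imports Defs
begin

text \<open>
  Both rates equal a number \<open>rate F G\<close> that depends on the two spectral densities only, and the proof computes
  each of them without determinants.

  Let \<open>A\<close> and \<open>B\<close> be the covariance matrices of two centred Gaussian vectors and \<open>\<mu>\<close> the eigenvalues of \<open>A\<close>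
  relative to \<open>B\<close>. The relative entropy is half the sum of \<open>\<mu> - 1 - ln \<mu>\<close> (\<open>gaussian_rel_entropy\<close>), and
  this summand is the integral over \<open>t\<close> in \<open>[0, 1]\<close> of \<open>(\<mu> - 1) - (\<mu> - 1) / (1 + t (\<mu> - 1))\<close>. The sum
  of \<open>(\<mu> - 1) / (1 + t (\<mu> - 1))\<close> is the trace of \<open>(B + t (A - B))\<inverse> (A - B)\<close>. Since coercivity and
  boundedness of the densities confine \<open>\<mu>\<close> to a fixed compact interval, dominated convergence
  reduces both rates to the limit of such traces, divided by the number of time points or of arcs
  (\<open>entropy_rate_limit\<close>).

  In the time domain \<open>A\<close> and \<open>B\<close> are block Toeplitz matrices, and by \<open>toeplitz_trace_limit\<close> the normalised
  traces tend to the mean over the circle of the trace of \<open>(G + t (F - G))\<inverse> (F - G)\<close>. The reason is that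
  the Toeplitz matrix of a pointwise inverse inverts the Toeplitz matrix up to an error whose
  Hilbert--Schmidt norm is small on average; completeness of the trigonometric system is all that enters, so
  that finitely many jumps are harmless.

  In the spectral domain an increment is the image of the indicator of an arc under the isometry that sends
  the process to the exponentials. Increments over disjoint arcs are uncorrelated, with covariances
  proportional to the averages of the density over the arcs, and the increment over a conjugate arc is the
  conjugate. In the real and imaginary parts of the increments over the upper half circle the covariance
  matrices are block diagonal (\<open>grid_increment_family\<close>), the resolvents are formed block by
  block, and the normalised traces are Riemann sums of the same mean (\<open>arc_trace_limit\<close>).
\<close>

section \<open>Matrices over a finite index set\<close>

text \<open>Matrices are functions of two indices of an arbitrary type, restricted to a finite set \<open>I\<close>: the
  covariance matrices below grow with \<open>n\<close>, so that their size cannot be a type.\<close>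

definition mat_prod :: "'i set \<Rightarrow> ('i \<Rightarrow> 'i \<Rightarrow> 'r::comm_ring_1) \<Rightarrow> ('i \<Rightarrow> 'i \<Rightarrow> 'r) \<Rightarrow> 'i \<Rightarrow> 'i \<Rightarrow> 'r" where
  "mat_prod I A B = (\<lambda>i j. \<Sum>k\<in>I. A i k * B k j)"

definition mat_trace :: "'i set \<Rightarrow> ('i \<Rightarrow> 'i \<Rightarrow> 'r::comm_ring_1) \<Rightarrow> 'r" where
  "mat_trace I A = (\<Sum>i\<in>I. A i i)"

definition eq_on :: "'i set \<Rightarrow> ('i \<Rightarrow> 'i \<Rightarrow> 'r) \<Rightarrow> ('i \<Rightarrow> 'i \<Rightarrow> 'r) \<Rightarrow> bool" where
  "eq_on I A B \<longleftrightarrow> (\<forall>i\<in>I. \<forall>j\<in>I. A i j = B i j)"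

definition diag_mat :: "('i \<Rightarrow> 'r::zero) \<Rightarrow> 'i \<Rightarrow> 'i \<Rightarrow> 'r" where
  "diag_mat d = (\<lambda>i j. if i = j then d i else 0)"

definition mat_transp :: "('i \<Rightarrow> 'i \<Rightarrow> 'r) \<Rightarrow> 'i \<Rightarrow> 'i \<Rightarrow> 'r" where
  "mat_transp A = (\<lambda>i j. A j i)"

lemma mat_prod_assoc: "mat_prod I (mat_prod I A B) C = mat_prod I A (mat_prod I B C)"
  unfolding mat_prod_def
  by (intro ext) (simp add: sum_distrib_left sum_distrib_right mult.assoc, rule sum.swap)

lemma mat_prod_cong: "eq_on I A A' \<Longrightarrow> eq_on I B B' \<Longrightarrow> eq_on I (mat_prod I A B) (mat_prod I A' B')"
  unfolding eq_on_def mat_prod_def by (auto intro!: sum.cong)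

lemma mat_prod_cong_left: "eq_on I A A' \<Longrightarrow> eq_on I (mat_prod I A B) (mat_prod I A' B)"
  unfolding eq_on_def mat_prod_def by (auto intro!: sum.cong)

lemma mat_prod_cong_right: "eq_on I B B' \<Longrightarrow> eq_on I (mat_prod I A B) (mat_prod I A B')"
  unfolding eq_on_def mat_prod_def by (auto intro!: sum.cong)

lemma eq_on_refl [simp]: "eq_on I A A" by (simp add: eq_on_def)
lemma eq_on_sym: "eq_on I A B \<Longrightarrow> eq_on I B A" by (simp add: eq_on_def)
lemma eq_on_trans [trans]: "eq_on I A B \<Longrightarrow> eq_on I B C \<Longrightarrow> eq_on I A C" by (simp add: eq_on_def)

text \<open>As transitivity rules these keep calculations that combine \<open>=\<close> and \<open>eq_on\<close> from falling back on
  the higher-order substitution rule.\<close>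

lemma eq_eq_on_trans [trans]: "A = B \<Longrightarrow> eq_on I B C \<Longrightarrow> eq_on I A C" by simp
lemma eq_on_eq_trans [trans]: "eq_on I A B \<Longrightarrow> B = C \<Longrightarrow> eq_on I A C" by simp

lemma mat_trace_cong: "eq_on I A B \<Longrightarrow> mat_trace I A = mat_trace I B"
  unfolding eq_on_def mat_trace_def by (auto intro!: sum.cong)

lemma mat_trace_comm: "mat_trace I (mat_prod I A B) = mat_trace I (mat_prod I B A)"
  unfolding mat_trace_def mat_prod_def by (subst sum.swap) (simp add: mult.commute)

lemma mat_prod_diag_left: "finite I \<Longrightarrow> i \<in> I \<Longrightarrow> mat_prod I (diag_mat d) A i j = d i * A i j"
  unfolding mat_prod_def diag_mat_def by (simp add: if_distrib[of "\<lambda>x. x * _"] cong: if_cong)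

lemma mat_prod_diag_right: "finite I \<Longrightarrow> j \<in> I \<Longrightarrow> mat_prod I A (diag_mat d) i j = A i j * d j"
  unfolding mat_prod_def diag_mat_def by (simp add: if_distrib[of "\<lambda>x. _ * x"] cong: if_cong)

lemma mat_prod_one_left: "finite I \<Longrightarrow> eq_on I (mat_prod I (diag_mat (\<lambda>_. 1)) A) A"
  by (simp add: eq_on_def mat_prod_diag_left)

lemma mat_prod_one_right: "finite I \<Longrightarrow> eq_on I (mat_prod I A (diag_mat (\<lambda>_. 1))) A"
  by (simp add: eq_on_def mat_prod_diag_right)

lemma mat_prod_diag_diag: "finite I \<Longrightarrow> eq_on I (mat_prod I (diag_mat d) (diag_mat e)) (diag_mat (\<lambda>i. d i * e i))"
  by (simp add: eq_on_def mat_prod_diag_left) (simp add: diag_mat_def)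

lemma diag_mat_cong: "(\<And>i. i \<in> I \<Longrightarrow> d i = e i) \<Longrightarrow> eq_on I (diag_mat d) (diag_mat e)"
  by (simp add: eq_on_def diag_mat_def)

lemma mat_transp_mat_prod: "mat_transp (mat_prod I A B) = mat_prod I (mat_transp B) (mat_transp A)"
  by (intro ext) (simp add: mat_transp_def mat_prod_def mult.commute)

lemma mat_transp_diagm [simp]: "mat_transp (diag_mat d) = diag_mat d"
  by (intro ext) (simp add: mat_transp_def diag_mat_def)

lemma mat_transp_cong: "eq_on I A B \<Longrightarrow> eq_on I (mat_transp A) (mat_transp B)"
  by (simp add: eq_on_def mat_transp_def)

section \<open>Simultaneous diagonalisation\<close>

text \<open>The rotation by the angle that annihilates the off-diagonal entry \<open>b\<close> preserves the sum of the squares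
  of all entries, and therefore moves \<open>2 b\<^sup>2\<close> to the diagonal.\<close>

lemma jacobi_angle:
  fixes a b d :: real
  assumes "b \<noteq> 0"
  obtains c s where "c\<^sup>2 + s\<^sup>2 = 1"
    "(c * c * a + 2 * c * s * b + s * s * d)\<^sup>2 + (s * s * a - 2 * c * s * b + c * c * d)\<^sup>2 > a\<^sup>2 + d\<^sup>2"
proof -
  define r where "r = sqrt ((a - d)\<^sup>2 + (2 * b)\<^sup>2)"
  have r2: "r\<^sup>2 = (a - d)\<^sup>2 + (2*b)\<^sup>2" unfolding r_def by simp
  have r: "r > 0" unfolding r_def using assms by (simp add: add_nonneg_pos)
  have "((a - d)/r)\<^sup>2 + (2*b/r)\<^sup>2 = ((a - d)\<^sup>2 + (2*b)\<^sup>2) / r\<^sup>2"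
    by (simp add: power_divide add_divide_distrib)
  also have "\<dots> = 1" unfolding r2[symmetric] using r by simp
  finally have "((a - d)/r)\<^sup>2 + (2*b/r)\<^sup>2 = 1" .
  then obtain \<psi> where psi: "(a - d)/r = cos \<psi>" "2*b/r = sin \<psi>"
    using sincos_total_2pi by metis
  define c where "c = cos (\<psi>/2)"
  define s where "s = sin (\<psi>/2)"
  have cs: "c\<^sup>2 + s\<^sup>2 = 1" by (simp add: c_def s_def)
  have c2: "c\<^sup>2 - s\<^sup>2 = cos \<psi>" unfolding c_def s_def using cos_double[of "\<psi>/2"] by simp
  have s2: "2 * s * c = sin \<psi>" unfolding c_def s_def using sin_double[of "\<psi>/2"] by simp
  define x where "x = c * c * a + 2 * c * s * b + s * s * d"
  define y where "y = s * s * a - 2 * c * s * b + c * c * d"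
  have "x + y = (c\<^sup>2 + s\<^sup>2) * (a + d)" unfolding x_def y_def by (simp add: algebra_simps power2_eq_square)
  then have xy: "x + y = a + d" using cs by simp
  have "x - y = (c\<^sup>2 - s\<^sup>2) * (a - d) + (2 * s * c) * (2 * b)" unfolding x_def y_def by (simp add: algebra_simps power2_eq_square)
  also have "\<dots> = cos \<psi> * (a - d) + sin \<psi> * (2 * b)" using c2 s2 by simp
  also have "\<dots> = r" unfolding psi[symmetric] using r r2 by (simp add: field_simps power2_eq_square)
  finally have "x - y = r" .
  then have d2: "(x - y)\<^sup>2 = (a - d)\<^sup>2 + (2*b)\<^sup>2" using r2 by simp
  have "2 * (x\<^sup>2 + y\<^sup>2) = (x + y)\<^sup>2 + (x - y)\<^sup>2" by (simp add: algebra_simps power2_eq_square)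
  also have "\<dots> = 2 * (a\<^sup>2 + d\<^sup>2 + 2 * b\<^sup>2)" unfolding xy d2 by (simp add: algebra_simps power2_eq_square)
  finally have "x\<^sup>2 + y\<^sup>2 = a\<^sup>2 + d\<^sup>2 + 2 * b\<^sup>2" by simp
  then have "x\<^sup>2 + y\<^sup>2 > a\<^sup>2 + d\<^sup>2" using assms by simp
  with cs that show thesis unfolding x_def y_def by blast
qed

definition bilin :: "'i set \<Rightarrow> ('i \<Rightarrow> 'i \<Rightarrow> real) \<Rightarrow> ('i \<Rightarrow> real) \<Rightarrow> ('i \<Rightarrow> real) \<Rightarrow> real" where
  "bilin I A x y = (\<Sum>k\<in>I. \<Sum>l\<in>I. x k * A k l * y l)"

lemma bilin_lin_left: "bilin I A (\<lambda>k. c * x k + s * y k) z = c * bilin I A x z + s * bilin I A y z"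
  unfolding bilin_def by (simp add: sum_distrib_left sum.distrib[symmetric] algebra_simps)

lemma bilin_lin_right: "bilin I A z (\<lambda>k. c * x k + s * y k) = c * bilin I A z x + s * bilin I A z y"
  unfolding bilin_def by (simp add: sum_distrib_left sum.distrib[symmetric] algebra_simps)

lemma bilin_sym: "(\<forall>k\<in>I. \<forall>l\<in>I. A k l = A l k) \<Longrightarrow> bilin I A x y = bilin I A y x"
  unfolding bilin_def by (subst sum.swap) (auto intro!: sum.cong simp: mult_ac)

lemma bilin_eq_mat_prod: "bilin I A (u i) (v j) = mat_prod I (mat_prod I u A) (mat_transp v) i j"
  unfolding bilin_def mat_prod_def mat_transp_def
  by (simp add: sum_distrib_right) (rule sum.swap)

text \<open>Compactness replaces an induction on the size: among the orthogonal matrices choose one that maximises the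
  sum of the squared diagonal entries. A nonzero off-diagonal entry would allow a Jacobi rotation that
  increases this sum.\<close>

lemma spectral_decomposition:
  fixes A :: "'i \<Rightarrow> 'i \<Rightarrow> real"
  assumes fin: "finite I" and sym: "\<forall>k\<in>I. \<forall>l\<in>I. A k l = A l k"
  obtains u d where "eq_on I (mat_prod I u (mat_transp u)) (diag_mat (\<lambda>_. 1))"
    "eq_on I (mat_prod I (mat_transp u) u) (diag_mat (\<lambda>_. 1))"
    "eq_on I (mat_prod I (mat_prod I u A) (mat_transp u)) (diag_mat d)"
proof -
  \<comment> \<open>Entries outside \<open>I\<close> are frozen at \<open>0\<close>, to keep the set compact for an arbitrary index type.\<close>
  define J where "J i k = (if i \<in> I \<and> k \<in> I then {-1..1::real} else {0})" for i k :: 'i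
  define C where "C = PiE UNIV (\<lambda>i. PiE UNIV (J i))"
  have "compact (PiE UNIV (J i))" for i
  proof -
    have "compactin (product_topology (\<lambda>_::'i. euclidean) UNIV) (PiE UNIV (J i))"
      by (subst compactin_PiE) (auto simp: J_def)
    then show ?thesis by (simp add: euclidean_product_topology)
  qed
  then have "compactin (product_topology (\<lambda>_::'i. euclidean) UNIV) C"
    unfolding C_def by (subst compactin_PiE) auto
  then have compC: "compact C" by (simp add: euclidean_product_topology)
  have cont: "continuous_on S (\<lambda>u::'i\<Rightarrow>'i\<Rightarrow>real. u i k)" for S i k
  proof -
    have "continuous_on UNIV (\<lambda>u::'i\<Rightarrow>'i\<Rightarrow>real. u i k)"
      by (rule continuous_on_product_then_coordinatewise[OF continuous_on_product_coordinates])
    then show ?thesis using continuous_on_subset by blast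
  qed
  define R where "R = {u::'i\<Rightarrow>'i\<Rightarrow>real. \<forall>i\<in>I. \<forall>j\<in>I. (\<Sum>k\<in>I. u i k * u j k) = (if i = j then 1 else 0)}"
  define L where "L = {u::'i\<Rightarrow>'i\<Rightarrow>real. \<forall>i\<in>I. \<forall>j\<in>I. (\<Sum>k\<in>I. u k i * u k j) = (if i = j then 1 else 0)}"
  have cR: "closed {u::'i\<Rightarrow>'i\<Rightarrow>real. (\<Sum>k\<in>I. u i k * u j k) = b}" for i j b
    by (rule closed_Collect_eq) (intro continuous_on_sum continuous_on_mult cont continuous_on_const)+
  have cL: "closed {u::'i\<Rightarrow>'i\<Rightarrow>real. (\<Sum>k\<in>I. u k i * u k j) = b}" for i j b
    by (rule closed_Collect_eq) (intro continuous_on_sum continuous_on_mult cont continuous_on_const)+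
  have "R = (\<Inter>i\<in>I. \<Inter>j\<in>I. {u. (\<Sum>k\<in>I. u i k * u j k) = (if i = j then 1 else 0)})" by (auto simp: R_def)
  then have clR: "closed R" using cR by (simp only:) (intro closed_INT ballI, blast)
  have "L = (\<Inter>i\<in>I. \<Inter>j\<in>I. {u. (\<Sum>k\<in>I. u k i * u k j) = (if i = j then 1 else 0)})" by (auto simp: L_def)
  then have clL: "closed L" using cL by (simp only:) (intro closed_INT ballI, blast)
  define T where "T = C \<inter> (R \<inter> L)"
  have compT: "compact T" unfolding T_def by (intro compact_Int_closed compC closed_Int clR clL)
  have "(\<lambda>i k. if i \<in> I \<and> i = k then 1 else 0) \<in> T" (is "?e \<in> T")
  proof -
    have "(\<Sum>k\<in>I. ?e i k * ?e j k) = (if i = j then 1 else 0)" if "i \<in> I" "j \<in> I" for i j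
    proof -
      have "(\<Sum>k\<in>I. ?e i k * ?e j k) = (\<Sum>k\<in>I. if k = i then if i = j then 1 else 0 else 0)"
        using that by (intro sum.cong) auto
      then show ?thesis using fin that by (simp add: sum.delta)
    qed
    moreover have "(\<Sum>k\<in>I. ?e k i * ?e k j) = (if i = j then 1 else 0)" if "i \<in> I" "j \<in> I" for i j
    proof -
      have "(\<Sum>k\<in>I. ?e k i * ?e k j) = (\<Sum>k\<in>I. if k = i then if i = j then 1 else 0 else 0)"
        using that by (intro sum.cong) auto
      then show ?thesis using fin that by (simp add: sum.delta)
    qed
    moreover have "?e \<in> C" by (auto simp: C_def J_def)
    ultimately show ?thesis by (simp add: T_def R_def L_def)
  qed
  then have ne: "T \<noteq> {}" by auto
  define g where "g u = (\<Sum>i\<in>I. (bilin I A (u i) (u i))\<^sup>2)" for u :: "'i\<Rightarrow>'i\<Rightarrow>real"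
  have "continuous_on T g" unfolding g_def bilin_def
    by (intro continuous_on_sum continuous_on_mult continuous_on_power cont continuous_on_const)
  then obtain u where uT: "u \<in> T" and umax: "\<And>v. v \<in> T \<Longrightarrow> g v \<le> g u"
    using continuous_attains_sup[OF compT ne] by metis
  have off: "bilin I A (u p) (u q) = 0" if p: "p \<in> I" and q: "q \<in> I" and pq: "p \<noteq> q" for p q
  proof (rule ccontr)
    assume "bilin I A (u p) (u q) \<noteq> 0"
    then obtain c s where cs: "c\<^sup>2 + s\<^sup>2 = 1"
      and gt: "(c * c * bilin I A (u p) (u p) + 2 * c * s * bilin I A (u p) (u q) + s * s * bilin I A (u q) (u q))\<^sup>2
        + (s * s * bilin I A (u p) (u p) - 2 * c * s * bilin I A (u p) (u q) + c * c * bilin I A (u q) (u q))\<^sup>2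
        > (bilin I A (u p) (u p))\<^sup>2 + (bilin I A (u q) (u q))\<^sup>2"
      by (rule jacobi_angle)
    define v where "v = u(p := \<lambda>k. c * u p k + s * u q k, q := \<lambda>k. (-s) * u p k + c * u q k)"
    have vp: "v p = (\<lambda>k. c * u p k + s * u q k)" and vq: "v q = (\<lambda>k. (-s) * u p k + c * u q k)"
      and vo: "\<And>i. i \<noteq> p \<Longrightarrow> i \<noteq> q \<Longrightarrow> v i = u i" using pq by (auto simp: v_def)
    have split: "(\<Sum>i\<in>I. F i) = F p + F q + (\<Sum>i\<in>I - {p,q}. F i)" for F :: "'i \<Rightarrow> real"
    proof -
      have "(\<Sum>i\<in>I. F i) = (\<Sum>i\<in>{p,q}. F i) + (\<Sum>i\<in>I - {p,q}. F i)"
        using p q fin by (metis sum.subset_diff add.commute empty_subsetI insert_subset)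
      then show ?thesis using pq by simp
    qed
    have vL: "v \<in> L"
    proof -
      have "(\<Sum>k\<in>I. v k i * v k j) = (\<Sum>k\<in>I. u k i * u k j)" for i j
      proof -
        have "v p i * v p j + v q i * v q j = (c\<^sup>2 + s\<^sup>2) * (u p i * u p j + u q i * u q j)"
          by (simp add: vp vq algebra_simps power2_eq_square)
        then have "v p i * v p j + v q i * v q j = u p i * u p j + u q i * u q j" using cs by simp
        moreover have "(\<Sum>k\<in>I-{p,q}. v k i * v k j) = (\<Sum>k\<in>I-{p,q}. u k i * u k j)"
          by (rule sum.cong) (auto simp: vo)
        ultimately show ?thesis by (simp add: split)
      qed
      then show ?thesis using uT by (simp add: T_def L_def)
    qed
    have vR: "v \<in> R"
    proof -
      define ip where "ip x y = (\<Sum>k\<in>I. x k * y k)" for x y :: "'i \<Rightarrow> real"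
      have ipl: "ip (\<lambda>k. c * x k + s * y k) z = c * ip x z + s * ip y z" for c s x y z
        unfolding ip_def by (simp add: sum_distrib_left sum.distrib[symmetric] algebra_simps)
      have ipr: "ip z (\<lambda>k. c * x k + s * y k) = c * ip z x + s * ip z y" for c s x y z
        unfolding ip_def by (simp add: sum_distrib_left sum.distrib[symmetric] algebra_simps)
      have ou: "i \<in> I \<Longrightarrow> j \<in> I \<Longrightarrow> ip (u i) (u j) = (if i = j then 1 else 0)" for i j
        using uT by (simp add: T_def R_def ip_def)
      have upq: "ip (u p) (u p) = 1" "ip (u q) (u q) = 1" "ip (u p) (u q) = 0" "ip (u q) (u p) = 0"
        using ou p q pq by auto
      have pp: "ip (v p) (v p) = 1" "ip (v q) (v q) = 1"
        unfolding vp vq ipl ipr upq using cs by (simp_all add: power2_eq_square add.commute)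
      have qq: "ip (v p) (v q) = 0" "ip (v q) (v p) = 0"
        unfolding vp vq ipl ipr upq by simp_all
      have op: "ip (v p) (u j) = 0" "ip (v q) (u j) = 0" "ip (u j) (v p) = 0" "ip (u j) (v q) = 0"
        if "j \<in> I" "j \<noteq> p" "j \<noteq> q" for j
        unfolding vp vq ipl ipr using ou that p q by simp_all
      have "ip (v i) (v j) = (if i = j then 1 else 0)" if "i \<in> I" "j \<in> I" for i j
        using that pp qq op vo ou pq
        by (cases "i = p"; cases "i = q"; cases "j = p"; cases "j = q") simp_all
      then show ?thesis by (simp add: R_def ip_def)
    qed
    have vC: "v \<in> C"
    proof -
      have "v i k \<in> J i k" for i k
      proof (cases "i \<in> I \<and> k \<in> I")
        case True
        have "(v i k)\<^sup>2 \<le> (\<Sum>j\<in>I. (v j k)\<^sup>2)" using True fin by (intro member_le_sum) auto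
        also have "\<dots> = 1" using vL True by (simp add: L_def power2_eq_square)
        finally show ?thesis using True by (simp add: J_def abs_square_le_1 abs_le_iff)
      next
        case False
        have u0: "u i k = 0" if "\<not> (i \<in> I \<and> k \<in> I)" for i k
        proof -
          have "u i k \<in> J i k" using uT unfolding T_def C_def by (auto simp: PiE_iff)
          with that show ?thesis by (auto simp: J_def split: if_splits)
        qed
        then have "v i k = 0" using False p q by (cases "i = p"; cases "i = q") (auto simp: vp vq vo)
        then show ?thesis using False by (simp add: J_def)
      qed
      then show ?thesis by (auto simp: C_def)
    qed
    have qp: "bilin I A (u q) (u p) = bilin I A (u p) (u q)" by (rule bilin_sym[OF sym])
    have "bilin I A (v p) (v p) = c * c * bilin I A (u p) (u p) + 2 * c * s * bilin I A (u p) (u q) + s * s * bilin I A (u q) (u q)"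
      unfolding vp bilin_lin_left bilin_lin_right qp by (simp add: algebra_simps)
    moreover have "bilin I A (v q) (v q) = s * s * bilin I A (u p) (u p) - 2 * c * s * bilin I A (u p) (u q) + c * c * bilin I A (u q) (u q)"
      unfolding vq bilin_lin_left bilin_lin_right qp by (simp add: algebra_simps)
    moreover have "(\<Sum>i\<in>I - {p,q}. (bilin I A (v i) (v i))\<^sup>2) = (\<Sum>i\<in>I - {p,q}. (bilin I A (u i) (u i))\<^sup>2)"
      by (rule sum.cong) (auto simp: vo)
    ultimately have "g v > g u" unfolding g_def split using gt by simp
    with umax[of v] vC vR vL show False by (simp add: T_def)
  qed
  show thesis
  proof (rule that)
    show "eq_on I (mat_prod I u (mat_transp u)) (diag_mat (\<lambda>_. 1))"
      using uT by (simp add: eq_on_def mat_prod_def mat_transp_def diag_mat_def T_def R_def)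
    show "eq_on I (mat_prod I (mat_transp u) u) (diag_mat (\<lambda>_. 1))"
      using uT by (simp add: eq_on_def mat_prod_def mat_transp_def diag_mat_def T_def L_def)
    show "eq_on I (mat_prod I (mat_prod I u A) (mat_transp u)) (diag_mat (\<lambda>i. bilin I A (u i) (u i)))"
      using off by (auto simp: eq_on_def bilin_eq_mat_prod[symmetric] diag_mat_def)
  qed
qed

text \<open>Diagonalise \<open>B\<close>, rescale it to the identity, and then diagonalise the transformed \<open>A\<close> by a further
  orthogonal matrix, which preserves the identity. The matrix \<open>w\<close> is the inverse of \<open>v\<close>.\<close>

lemma simultaneous_diagonalisation:
  fixes A B :: "'i \<Rightarrow> 'i \<Rightarrow> real"
  assumes fin: "finite I" and symA: "\<forall>k\<in>I. \<forall>l\<in>I. A k l = A l k"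
    and symB: "\<forall>k\<in>I. \<forall>l\<in>I. B k l = B l k"
    and posB: "\<And>x. \<exists>k\<in>I. x k \<noteq> 0 \<Longrightarrow> 0 < bilin I B x x"
  obtains v w \<mu> where "eq_on I (mat_prod I v w) (diag_mat (\<lambda>_. 1))" "eq_on I (mat_prod I w v) (diag_mat (\<lambda>_. 1))"
    "eq_on I (mat_prod I (mat_prod I v B) (mat_transp v)) (diag_mat (\<lambda>_. 1))"
    "eq_on I (mat_prod I (mat_prod I v A) (mat_transp v)) (diag_mat \<mu>)"
proof -
  let ?one = "diag_mat (\<lambda>_. 1) :: 'i \<Rightarrow> 'i \<Rightarrow> real"
  obtain u d where u: "eq_on I (mat_prod I u (mat_transp u)) ?one" "eq_on I (mat_prod I (mat_transp u) u) ?one"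
    "eq_on I (mat_prod I (mat_prod I u B) (mat_transp u)) (diag_mat d)"
    using spectral_decomposition[OF fin symB] by blast
  have dpos: "d i > 0" if i: "i \<in> I" for i
  proof -
    have "\<exists>k\<in>I. u i k \<noteq> 0"
    proof (rule ccontr)
      assume "\<not> (\<exists>k\<in>I. u i k \<noteq> 0)"
      then have "mat_prod I u (mat_transp u) i i = 0" by (simp add: mat_prod_def)
      then show False using u(1) i by (simp add: eq_on_def diag_mat_def)
    qed
    from posB[of "u i", OF this] show ?thesis
      using u(3) i by (simp add: bilin_eq_mat_prod eq_on_def diag_mat_def)
  qed
  define v0 where "v0 = mat_prod I (diag_mat (\<lambda>i. 1 / sqrt (d i))) u"
  define w0 where "w0 = mat_prod I (mat_transp u) (diag_mat (\<lambda>i. sqrt (d i)))"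
  have dd: "eq_on I (diag_mat (\<lambda>i. 1 / sqrt (d i) * sqrt (d i))) ?one"
  proof (rule diag_mat_cong)
    show "1 / sqrt (d i) * sqrt (d i) = 1" if "i \<in> I" for i using dpos[OF that] by simp
  qed
  have dd': "eq_on I (diag_mat (\<lambda>i. sqrt (d i) * (1 / sqrt (d i)))) ?one"
  proof (rule diag_mat_cong)
    show "sqrt (d i) * (1 / sqrt (d i)) = 1" if "i \<in> I" for i using dpos[OF that] by simp
  qed
  have v0w0: "eq_on I (mat_prod I v0 w0) ?one"
  proof -
    have "mat_prod I v0 w0 = mat_prod I (diag_mat (\<lambda>i. 1 / sqrt (d i))) (mat_prod I (mat_prod I u (mat_transp u)) (diag_mat (\<lambda>i. sqrt (d i))))"
      by (simp add: v0_def w0_def mat_prod_assoc)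
    also have "eq_on I \<dots> (mat_prod I (diag_mat (\<lambda>i. 1 / sqrt (d i))) (mat_prod I ?one (diag_mat (\<lambda>i. sqrt (d i)))))"
      by (rule mat_prod_cong_right[OF mat_prod_cong_left[OF u(1)]])
    also have "eq_on I \<dots> (mat_prod I (diag_mat (\<lambda>i. 1 / sqrt (d i))) (diag_mat (\<lambda>i. sqrt (d i))))"
      by (rule mat_prod_cong_right[OF mat_prod_one_left[OF fin]])
    also have "eq_on I \<dots> (diag_mat (\<lambda>i. 1 / sqrt (d i) * sqrt (d i)))" by (rule mat_prod_diag_diag[OF fin])
    also have "eq_on I \<dots> ?one" by (rule dd)
    finally show ?thesis .
  qed
  have w0v0: "eq_on I (mat_prod I w0 v0) ?one"
  proof -
    have "mat_prod I w0 v0 = mat_prod I (mat_transp u) (mat_prod I (mat_prod I (diag_mat (\<lambda>i. sqrt (d i))) (diag_mat (\<lambda>i. 1 / sqrt (d i)))) u)"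
      by (simp add: v0_def w0_def mat_prod_assoc)
    also have "eq_on I \<dots> (mat_prod I (mat_transp u) (mat_prod I (diag_mat (\<lambda>i. sqrt (d i) * (1 / sqrt (d i)))) u))"
      by (rule mat_prod_cong_right[OF mat_prod_cong_left[OF mat_prod_diag_diag[OF fin]]])
    also have "eq_on I \<dots> (mat_prod I (mat_transp u) (mat_prod I ?one u))"
      by (rule mat_prod_cong_right[OF mat_prod_cong_left[OF dd']])
    also have "eq_on I \<dots> (mat_prod I (mat_transp u) u)" by (rule mat_prod_cong_right[OF mat_prod_one_left[OF fin]])
    also have "eq_on I \<dots> ?one" by (rule u)
    finally show ?thesis .
  qed
  have v0B: "eq_on I (mat_prod I (mat_prod I v0 B) (mat_transp v0)) ?one"
  proof -
    have "mat_prod I (mat_prod I v0 B) (mat_transp v0) = mat_prod I (diag_mat (\<lambda>i. 1 / sqrt (d i)))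
       (mat_prod I (mat_prod I (mat_prod I u B) (mat_transp u)) (diag_mat (\<lambda>i. 1 / sqrt (d i))))"
      by (simp add: v0_def mat_transp_mat_prod mat_prod_assoc)
    also have "eq_on I \<dots> (mat_prod I (diag_mat (\<lambda>i. 1 / sqrt (d i))) (mat_prod I (diag_mat d) (diag_mat (\<lambda>i. 1 / sqrt (d i)))))"
      by (rule mat_prod_cong_right[OF mat_prod_cong_left[OF u(3)]])
    also have "eq_on I \<dots> (mat_prod I (diag_mat (\<lambda>i. 1 / sqrt (d i))) (diag_mat (\<lambda>i. d i * (1 / sqrt (d i)))))"
      by (rule mat_prod_cong_right[OF mat_prod_diag_diag[OF fin]])
    also have "eq_on I \<dots> (diag_mat (\<lambda>i. 1 / sqrt (d i) * (d i * (1 / sqrt (d i)))))" by (rule mat_prod_diag_diag[OF fin])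
    also have "eq_on I \<dots> ?one"
    proof (rule diag_mat_cong)
      show "1 / sqrt (d i) * (d i * (1 / sqrt (d i))) = 1" if "i \<in> I" for i
        using dpos[OF that] by (simp add: field_simps)
    qed
    finally show ?thesis .
  qed
  define A' where "A' = mat_prod I (mat_prod I v0 A) (mat_transp v0)"
  have symA': "\<forall>k\<in>I. \<forall>l\<in>I. A' k l = A' l k"
    using bilin_sym[OF symA] by (auto simp: A'_def bilin_eq_mat_prod[symmetric])
  obtain u' \<mu> where u': "eq_on I (mat_prod I u' (mat_transp u')) ?one" "eq_on I (mat_prod I (mat_transp u') u') ?one"
    "eq_on I (mat_prod I (mat_prod I u' A') (mat_transp u')) (diag_mat \<mu>)"
    using spectral_decomposition[OF fin symA'] by blast
  show thesis
  proof (rule that[of "mat_prod I u' v0" "mat_prod I w0 (mat_transp u')" \<mu>])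
    have "mat_prod I (mat_prod I u' v0) (mat_prod I w0 (mat_transp u')) = mat_prod I u' (mat_prod I (mat_prod I v0 w0) (mat_transp u'))"
      by (simp add: mat_prod_assoc)
    also have "eq_on I \<dots> (mat_prod I u' (mat_prod I ?one (mat_transp u')))" by (rule mat_prod_cong_right[OF mat_prod_cong_left[OF v0w0]])
    also have "eq_on I \<dots> (mat_prod I u' (mat_transp u'))" by (rule mat_prod_cong_right[OF mat_prod_one_left[OF fin]])
    also have "eq_on I \<dots> ?one" by (rule u')
    finally show "eq_on I (mat_prod I (mat_prod I u' v0) (mat_prod I w0 (mat_transp u'))) ?one" .
    have "mat_prod I (mat_prod I w0 (mat_transp u')) (mat_prod I u' v0) = mat_prod I w0 (mat_prod I (mat_prod I (mat_transp u') u') v0)"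
      by (simp add: mat_prod_assoc)
    also have "eq_on I \<dots> (mat_prod I w0 (mat_prod I ?one v0))" by (rule mat_prod_cong_right[OF mat_prod_cong_left[OF u'(2)]])
    also have "eq_on I \<dots> (mat_prod I w0 v0)" by (rule mat_prod_cong_right[OF mat_prod_one_left[OF fin]])
    also have "eq_on I \<dots> ?one" by (rule w0v0)
    finally show "eq_on I (mat_prod I (mat_prod I w0 (mat_transp u')) (mat_prod I u' v0)) ?one" .
    have "mat_prod I (mat_prod I (mat_prod I u' v0) B) (mat_transp (mat_prod I u' v0)) = mat_prod I u' (mat_prod I (mat_prod I (mat_prod I v0 B) (mat_transp v0)) (mat_transp u'))"
      by (simp add: mat_prod_assoc mat_transp_mat_prod)
    also have "eq_on I \<dots> (mat_prod I u' (mat_prod I ?one (mat_transp u')))" by (rule mat_prod_cong_right[OF mat_prod_cong_left[OF v0B]])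
    also have "eq_on I \<dots> (mat_prod I u' (mat_transp u'))" by (rule mat_prod_cong_right[OF mat_prod_one_left[OF fin]])
    also have "eq_on I \<dots> ?one" by (rule u')
    finally show "eq_on I (mat_prod I (mat_prod I (mat_prod I u' v0) B) (mat_transp (mat_prod I u' v0))) ?one" .
    have "mat_prod I (mat_prod I (mat_prod I u' v0) A) (mat_transp (mat_prod I u' v0)) = mat_prod I (mat_prod I u' A') (mat_transp u')"
      by (simp add: mat_prod_assoc mat_transp_mat_prod A'_def)
    also have "eq_on I \<dots> (diag_mat \<mu>)" by (rule u')
    finally show "eq_on I (mat_prod I (mat_prod I (mat_prod I u' v0) A) (mat_transp (mat_prod I u' v0))) (diag_mat \<mu>)" .
  qed
qed

text \<open>In the simultaneously diagonalising coordinates \<open>A\<close> and \<open>B\<close> become the diagonal matrix of \<open>\<mu>\<close> and the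
  identity; the trace does not see the change of coordinates.\<close>

lemma trace_resolvent:
  fixes A B R :: "'i \<Rightarrow> 'i \<Rightarrow> real"
  assumes fin: "finite I"
    and vw: "eq_on I (mat_prod I v w) (diag_mat (\<lambda>_. 1))" and wv: "eq_on I (mat_prod I w v) (diag_mat (\<lambda>_. 1))"
    and vB: "eq_on I (mat_prod I (mat_prod I v B) (mat_transp v)) (diag_mat (\<lambda>_. 1))"
    and vA: "eq_on I (mat_prod I (mat_prod I v A) (mat_transp v)) (diag_mat \<mu>)"
    and nz: "\<And>i. i \<in> I \<Longrightarrow> 1 + t * (\<mu> i - 1) \<noteq> 0"
    and R: "eq_on I (mat_prod I R (\<lambda>i j. B i j + t * (A i j - B i j))) (diag_mat (\<lambda>_. 1))"
  shows "mat_trace I (mat_prod I R (\<lambda>i j. A i j - B i j)) = (\<Sum>i\<in>I. (\<mu> i - 1) / (1 + t * (\<mu> i - 1)))"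
proof -
  let ?one = "diag_mat (\<lambda>_. 1) :: 'i \<Rightarrow> 'i \<Rightarrow> real"
  let ?At = "\<lambda>i j. B i j + t * (A i j - B i j)"
  let ?G = "\<lambda>i j. A i j - B i j"
  let ?c = "\<lambda>i. (\<mu> i - 1) / (1 + t * (\<mu> i - 1))"
  have lin: "mat_prod I (mat_prod I v ?At) (mat_transp v) = (\<lambda>i j. mat_prod I (mat_prod I v B) (mat_transp v) i j
      + t * (mat_prod I (mat_prod I v A) (mat_transp v) i j - mat_prod I (mat_prod I v B) (mat_transp v) i j))"
    unfolding mat_prod_def
    by (intro ext) (simp add: sum_distrib_left sum_distrib_right sum.distrib[symmetric] sum_subtractf[symmetric] algebra_simps)
  have linG: "mat_prod I (mat_prod I v ?G) (mat_transp v) = (\<lambda>i j. mat_prod I (mat_prod I v A) (mat_transp v) i j - mat_prod I (mat_prod I v B) (mat_transp v) i j)"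
    unfolding mat_prod_def
    by (intro ext) (simp add: sum_distrib_left sum_distrib_right sum.distrib[symmetric] sum_subtractf[symmetric] algebra_simps)
  have vAt: "eq_on I (mat_prod I (mat_prod I v ?At) (mat_transp v)) (diag_mat (\<lambda>i. 1 + t * (\<mu> i - 1)))"
    using vA vB unfolding lin eq_on_def diag_mat_def by auto
  have vG: "eq_on I (mat_prod I (mat_prod I v ?G) (mat_transp v)) (diag_mat (\<lambda>i. \<mu> i - 1))"
    using vA vB unfolding linG eq_on_def diag_mat_def by auto
  have Tvw: "eq_on I (mat_prod I (mat_transp v) (mat_transp w)) ?one"
    using mat_transp_cong[OF wv] by (simp add: mat_transp_mat_prod)
  have AtV: "eq_on I (mat_prod I ?At (mat_transp v)) (mat_prod I w (diag_mat (\<lambda>i. 1 + t * (\<mu> i - 1))))"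
  proof -
    have "eq_on I (mat_prod I ?At (mat_transp v)) (mat_prod I ?one (mat_prod I ?At (mat_transp v)))" by (rule eq_on_sym[OF mat_prod_one_left[OF fin]])
    also have "eq_on I \<dots> (mat_prod I (mat_prod I w v) (mat_prod I ?At (mat_transp v)))" by (rule mat_prod_cong_left[OF eq_on_sym[OF wv]])
    also have "\<dots> = mat_prod I w (mat_prod I (mat_prod I v ?At) (mat_transp v))" by (simp add: mat_prod_assoc)
    also have "eq_on I \<dots> (mat_prod I w (diag_mat (\<lambda>i. 1 + t * (\<mu> i - 1))))" by (rule mat_prod_cong_right[OF vAt])
    finally show ?thesis .
  qed
  have G: "eq_on I ?G (mat_prod I w (mat_prod I (diag_mat (\<lambda>i. \<mu> i - 1)) (mat_transp w)))"
  proof -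
    have "eq_on I ?G (mat_prod I ?one (mat_prod I ?G ?one))"
      by (rule eq_on_sym, rule eq_on_trans[OF mat_prod_one_left[OF fin] mat_prod_one_right[OF fin]])
    also have "eq_on I \<dots> (mat_prod I (mat_prod I w v) (mat_prod I ?G (mat_prod I (mat_transp v) (mat_transp w))))"
      by (intro mat_prod_cong eq_on_refl eq_on_sym[OF wv] eq_on_sym[OF Tvw])
    also have "\<dots> = mat_prod I w (mat_prod I (mat_prod I (mat_prod I v ?G) (mat_transp v)) (mat_transp w))" by (simp add: mat_prod_assoc)
    also have "eq_on I \<dots> (mat_prod I w (mat_prod I (diag_mat (\<lambda>i. \<mu> i - 1)) (mat_transp w)))" by (rule mat_prod_cong_right[OF mat_prod_cong_left[OF vG]])
    finally show ?thesis .
  qed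
  let ?X = "mat_prod I (mat_transp v) (mat_prod I (diag_mat ?c) (mat_transp w))"
  have "mat_prod I ?At ?X = mat_prod I (mat_prod I ?At (mat_transp v)) (mat_prod I (diag_mat ?c) (mat_transp w))" by (simp add: mat_prod_assoc)
  also have "eq_on I \<dots> (mat_prod I (mat_prod I w (diag_mat (\<lambda>i. 1 + t * (\<mu> i - 1)))) (mat_prod I (diag_mat ?c) (mat_transp w)))"
    by (rule mat_prod_cong_left[OF AtV])
  also have "\<dots> = mat_prod I w (mat_prod I (mat_prod I (diag_mat (\<lambda>i. 1 + t * (\<mu> i - 1))) (diag_mat ?c)) (mat_transp w))" by (simp add: mat_prod_assoc)
  also have "eq_on I \<dots> (mat_prod I w (mat_prod I (diag_mat (\<lambda>i. (1 + t * (\<mu> i - 1)) * ?c i)) (mat_transp w)))"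
    by (rule mat_prod_cong_right[OF mat_prod_cong_left[OF mat_prod_diag_diag[OF fin]]])
  also have "eq_on I \<dots> (mat_prod I w (mat_prod I (diag_mat (\<lambda>i. \<mu> i - 1)) (mat_transp w)))"
    by (rule mat_prod_cong_right[OF mat_prod_cong_left[OF diag_mat_cong]]) (use nz in simp)
  also have "eq_on I \<dots> ?G" by (rule eq_on_sym[OF G])
  finally have AtX: "eq_on I (mat_prod I ?At ?X) ?G" .
  have "mat_trace I (mat_prod I R ?G) = mat_trace I (mat_prod I R (mat_prod I ?At ?X))" by (rule mat_trace_cong[OF mat_prod_cong_right[OF eq_on_sym[OF AtX]]])
  also have "\<dots> = mat_trace I (mat_prod I (mat_prod I R ?At) ?X)" by (simp add: mat_prod_assoc)
  also have "\<dots> = mat_trace I (mat_prod I ?one ?X)" by (rule mat_trace_cong[OF mat_prod_cong_left[OF R]])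
  also have "\<dots> = mat_trace I ?X" by (intro mat_trace_cong mat_prod_one_left fin)
  also have "\<dots> = mat_trace I (mat_prod I (mat_prod I (diag_mat ?c) (mat_transp w)) (mat_transp v))" by (rule mat_trace_comm)
  also have "\<dots> = mat_trace I (mat_prod I (diag_mat ?c) (mat_prod I (mat_transp w) (mat_transp v)))" by (simp add: mat_prod_assoc)
  also have "\<dots> = mat_trace I (mat_prod I (diag_mat ?c) ?one)"
    using mat_transp_cong[OF vw] by (intro mat_trace_cong mat_prod_cong_right) (simp only: mat_transp_mat_prod mat_transp_diagm)
  also have "\<dots> = mat_trace I (diag_mat ?c)" by (intro mat_trace_cong mat_prod_one_right fin)
  also have "\<dots> = (\<Sum>i\<in>I. ?c i)" by (simp add: mat_trace_def diag_mat_def)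
  finally show ?thesis .
qed

lemma resolvent_exists:
  fixes A B :: "'i \<Rightarrow> 'i \<Rightarrow> real"
  assumes fin: "finite I"
    and vw: "eq_on I (mat_prod I v w) (diag_mat (\<lambda>_. 1))" and wv: "eq_on I (mat_prod I w v) (diag_mat (\<lambda>_. 1))"
    and vB: "eq_on I (mat_prod I (mat_prod I v B) (mat_transp v)) (diag_mat (\<lambda>_. 1))"
    and vA: "eq_on I (mat_prod I (mat_prod I v A) (mat_transp v)) (diag_mat \<mu>)"
    and nz: "\<And>i. i \<in> I \<Longrightarrow> 1 + t * (\<mu> i - 1) \<noteq> 0"
  obtains R where "eq_on I (mat_prod I R (\<lambda>i j. B i j + t * (A i j - B i j))) (diag_mat (\<lambda>_. 1))"
proof -
  let ?one = "diag_mat (\<lambda>_. 1) :: 'i \<Rightarrow> 'i \<Rightarrow> real"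
  let ?At = "\<lambda>i j. B i j + t * (A i j - B i j)"
  let ?d = "diag_mat (\<lambda>i. 1 + t * (\<mu> i - 1))" and ?e = "diag_mat (\<lambda>i. 1 / (1 + t * (\<mu> i - 1)))"
  have lin: "mat_prod I (mat_prod I v ?At) (mat_transp v) = (\<lambda>i j. mat_prod I (mat_prod I v B) (mat_transp v) i j
      + t * (mat_prod I (mat_prod I v A) (mat_transp v) i j - mat_prod I (mat_prod I v B) (mat_transp v) i j))"
    unfolding mat_prod_def
    by (intro ext) (simp add: sum_distrib_left sum_distrib_right sum.distrib[symmetric] sum_subtractf[symmetric] algebra_simps)
  have vAt: "eq_on I (mat_prod I (mat_prod I v ?At) (mat_transp v)) ?d"
    using vA vB unfolding lin eq_on_def diag_mat_def by auto
  have Tvw: "eq_on I (mat_prod I (mat_transp v) (mat_transp w)) ?one"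
    using mat_transp_cong[OF wv] by (simp add: mat_transp_mat_prod)
  have vA': "eq_on I (mat_prod I v ?At) (mat_prod I ?d (mat_transp w))"
  proof -
    have "eq_on I (mat_prod I v ?At) (mat_prod I (mat_prod I v ?At) ?one)" by (rule eq_on_sym[OF mat_prod_one_right[OF fin]])
    also have "eq_on I \<dots> (mat_prod I (mat_prod I v ?At) (mat_prod I (mat_transp v) (mat_transp w)))"
      by (rule mat_prod_cong_right[OF eq_on_sym[OF Tvw]])
    also have "\<dots> = mat_prod I (mat_prod I (mat_prod I v ?At) (mat_transp v)) (mat_transp w)" by (simp add: mat_prod_assoc)
    also have "eq_on I \<dots> (mat_prod I ?d (mat_transp w))" by (rule mat_prod_cong_left[OF vAt])
    finally show ?thesis .
  qed
  have "mat_prod I (mat_prod I (mat_transp v) (mat_prod I ?e v)) ?At = mat_prod I (mat_transp v) (mat_prod I ?e (mat_prod I v ?At))"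
    by (simp add: mat_prod_assoc)
  also have "eq_on I \<dots> (mat_prod I (mat_transp v) (mat_prod I ?e (mat_prod I ?d (mat_transp w))))"
    by (rule mat_prod_cong_right[OF mat_prod_cong_right[OF vA']])
  also have "\<dots> = mat_prod I (mat_transp v) (mat_prod I (mat_prod I ?e ?d) (mat_transp w))" by (simp add: mat_prod_assoc)
  also have "eq_on I \<dots> (mat_prod I (mat_transp v) (mat_prod I ?one (mat_transp w)))"
  proof (rule mat_prod_cong_right[OF mat_prod_cong_left])
    have "eq_on I (mat_prod I ?e ?d) (diag_mat (\<lambda>i. 1 / (1 + t * (\<mu> i - 1)) * (1 + t * (\<mu> i - 1))))"
      by (rule mat_prod_diag_diag[OF fin])
    also have "eq_on I \<dots> ?one" by (rule diag_mat_cong) (use nz in simp)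
    finally show "eq_on I (mat_prod I ?e ?d) ?one" .
  qed
  also have "eq_on I \<dots> (mat_prod I (mat_transp v) (mat_transp w))" by (rule mat_prod_cong_right[OF mat_prod_one_left[OF fin]])
  also have "eq_on I \<dots> ?one" by (rule Tvw)
  finally show thesis by (rule that)
qed

section \<open>Laws determined by characteristic functions\<close>

lemma measurable_cnj [measurable]: "cnj \<in> borel_measurable borel"
  by (intro borel_measurable_continuous_onI continuous_intros)

lemma char_normal:
  assumes "prob_space M" and X: "distributed M lborel X (normal_density \<mu> \<sigma>)" and s: "0 < \<sigma>"
  shows "(\<integral>\<omega>. iexp (t * X \<omega>) \<partial>M) = iexp (t * \<mu>) * of_real (exp (- (t * \<sigma>)\<^sup>2 / 2))"
proof -
  interpret prob_space M by fact
  define Z where "Z = (\<lambda>\<omega>. (X \<omega> - \<mu>) / \<sigma>)"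
  have Z: "distributed M lborel Z std_normal_density"
    using X normal_standard_normal_convert[OF s] by (simp add: Z_def)
  have [measurable]: "Z \<in> borel_measurable M" using distributed_measurable[OF Z] by simp
  have dZ: "distr M borel Z = density lborel std_normal_density"
    using distributed_distr_eq_density[OF Z] by (simp cong: distr_cong)
  have "(\<integral>\<omega>. iexp ((t * \<sigma>) * Z \<omega>) \<partial>M) = char (distr M borel Z) (t * \<sigma>)"
    unfolding char_def by (subst integral_distr) auto
  also have "\<dots> = of_real (exp (- (t * \<sigma>)\<^sup>2 / 2))"
    unfolding dZ char_std_normal_distribution by simp
  finally have 1: "(\<integral>\<omega>. iexp ((t * \<sigma>) * Z \<omega>) \<partial>M) = of_real (exp (- (t * \<sigma>)\<^sup>2 / 2))" .
  have "iexp (t * X \<omega>) = iexp (t * \<mu>) * iexp ((t * \<sigma>) * Z \<omega>)" for \<omega>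
  proof -
    have "t * X \<omega> = t * \<mu> + (t * \<sigma>) * Z \<omega>" using s by (simp add: Z_def field_simps)
    then show ?thesis by (simp only: of_real_add distrib_left exp_add)
  qed
  then show ?thesis using 1 by simp
qed

lemma char_normal_density:
  assumes "0 < \<sigma>"
  shows "char (density lborel (normal_density 0 \<sigma>)) t = of_real (exp (- (\<sigma>\<^sup>2 * t\<^sup>2) / 2))"
proof -
  let ?N = "density lborel (normal_density 0 \<sigma>)"
  have "distributed ?N lborel (\<lambda>x. x) (normal_density 0 \<sigma>)"
  proof -
    have "distr ?N lborel (\<lambda>x. x) = ?N"
      by (rule distr_id2) simp
    then show ?thesis by (auto simp: distributed_def)
  qed
  from char_normal[OF prob_space_normal_density[OF assms] this assms, of t]
  show ?thesis by (simp add: char_def power_mult_distrib mult.commute)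
qed

lemma normal_real_distribution: "0 < \<sigma> \<Longrightarrow> real_distribution (density lborel (normal_density 0 \<sigma>))"
  by (intro real_distribution.intro real_distribution_axioms.intro prob_space_normal_density) simp_all

text \<open>The probability measure with density proportional to \<open>2 + U\<close> gives \<open>X\<close> the same characteristic
  function as \<open>M\<close> does, hence by Levy's uniqueness theorem the same law.\<close>

lemma (in prob_space) weight_factors_real:
  fixes U X :: "'a \<Rightarrow> real"
  assumes [measurable]: "U \<in> borel_measurable M" "X \<in> borel_measurable M"
    and U1: "\<And>\<omega>. \<bar>U \<omega>\<bar> \<le> 1"
    and N: "real_distribution N"
    and X: "\<And>t. (\<integral>\<omega>. iexp (t * X \<omega>) \<partial>M) = char N t"
    and UX: "\<And>t. (\<integral>\<omega>. of_real (U \<omega>) * iexp (t * X \<omega>) \<partial>M) = of_real (\<integral>\<omega>. U \<omega> \<partial>M) * char N t"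
    and B: "B \<in> sets borel"
  shows "(\<integral>\<omega>. U \<omega> * indicator B (X \<omega>) \<partial>M) = (\<integral>\<omega>. U \<omega> \<partial>M) * measure N B"
proof -
  have law: "(\<integral>\<omega>. (2 + V \<omega>) * indicator B (X \<omega>) \<partial>M) = (2 + (\<integral>\<omega>. V \<omega> \<partial>M)) * measure N B"
    if [measurable]: "V \<in> borel_measurable M" and V1: "\<And>\<omega>. \<bar>V \<omega>\<bar> \<le> 1"
      and VX: "\<And>t. (\<integral>\<omega>. of_real (V \<omega>) * iexp (t * X \<omega>) \<partial>M) = of_real (\<integral>\<omega>. V \<omega> \<partial>M) * char N t" for V
  proof -
    define c where "c = 2 + (\<integral>\<omega>. V \<omega> \<partial>M)"
    have iV: "integrable M V" by (rule integrable_const_bound[where B=1]) (use V1 in auto)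
    have "\<bar>\<integral>\<omega>. V \<omega> \<partial>M\<bar> \<le> (\<integral>\<omega>. 1 \<partial>M)"
      by (rule order_trans[OF integral_abs_bound]) (intro integral_mono integrable_abs iV, use V1 in auto)
    then have c: "c \<ge> 1" unfolding c_def by (simp add: prob_space)
    define W where "W = (\<lambda>\<omega>. (2 + V \<omega>) / c)"
    have W0: "W \<omega> \<ge> 0" for \<omega> using V1[of \<omega>] c by (simp add: W_def abs_le_iff)
    have [measurable]: "W \<in> borel_measurable M" by (simp add: W_def)
    have iW: "integrable M W" unfolding W_def using iV by simp
    have W1: "(\<integral>\<omega>. W \<omega> \<partial>M) = 1"
      unfolding W_def using iV c by (simp add: c_def[symmetric] prob_space)
    define M' where "M' = density M (\<lambda>\<omega>. ennreal (W \<omega>))"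
    have prM': "prob_space M'"
    proof
      show "emeasure M' (space M') = 1"
        using nn_integral_eq_integral[OF iW] W0 W1
        by (simp add: M'_def emeasure_density cong: nn_integral_cong_simp)
    qed
    have [measurable]: "X \<in> borel_measurable M'" by (simp add: M'_def)
    have rd: "real_distribution (distr M' borel X)"
      using prob_space.prob_space_distr[OF prM', of X borel]
      by (intro real_distribution.intro real_distribution_axioms.intro) auto
    have "char (distr M' borel X) t = char N t" for t
    proof -
      have i1: "integrable M (\<lambda>\<omega>. iexp (t * X \<omega>))"
        by (rule integrable_const_bound[where B=1]) auto
      have i2: "integrable M (\<lambda>\<omega>. of_real (V \<omega>) * iexp (t * X \<omega>))"
        by (rule integrable_const_bound[where B=1]) (use V1 in \<open>auto simp: norm_mult\<close>)
      have "char (distr M' borel X) t = (\<integral>\<omega>. iexp (t * X \<omega>) \<partial>M')"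
        unfolding char_def by (subst integral_distr) auto
      also have "\<dots> = (\<integral>\<omega>. W \<omega> *\<^sub>R iexp (t * X \<omega>) \<partial>M)"
        unfolding M'_def by (subst integral_density) (use W0 in auto)
      also have "\<dots> = (\<integral>\<omega>. (2 * iexp (t * X \<omega>) + of_real (V \<omega>) * iexp (t * X \<omega>)) / of_real c \<partial>M)"
        by (intro Bochner_Integration.integral_cong refl) (simp add: W_def scaleR_conv_of_real algebra_simps add_divide_distrib)
      also have "\<dots> = (2 * char N t + of_real (\<integral>\<omega>. V \<omega> \<partial>M) * char N t) / of_real c"
        using i1 i2 X[of t] VX[of t] by simp
      also have "\<dots> = char N t" 
      proof -
        have "2 * char N t + of_real (\<integral>\<omega>. V \<omega> \<partial>M) * char N t = of_real c * char N t"
          by (simp add: c_def algebra_simps)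
        then show ?thesis using c by simp
      qed
      finally show ?thesis .
    qed
    then have "distr M' borel X = N" by (intro Levy_uniqueness rd N ext)
    then have "measure N B = measure (distr M' borel X) B" by simp
    also have "\<dots> = (\<integral>x. indicator B x \<partial>distr M' borel X)" using B by simp
    also have "\<dots> = (\<integral>\<omega>. indicator B (X \<omega>) \<partial>M')" using B by (subst integral_distr) auto
    also have "\<dots> = (\<integral>\<omega>. W \<omega> *\<^sub>R indicator B (X \<omega>) \<partial>M)"
      unfolding M'_def using B by (subst integral_density) (use W0 in auto)
    also have "\<dots> = (\<integral>\<omega>. ((2 + V \<omega>) * indicator B (X \<omega>)) / c \<partial>M)" by (simp add: W_def)
    also have "\<dots> = (\<integral>\<omega>. (2 + V \<omega>) * indicator B (X \<omega>) \<partial>M) / c" by simp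
    finally have m: "measure N B = (\<integral>\<omega>. (2 + V \<omega>) * indicator B (X \<omega>) \<partial>M) / c" .
    show ?thesis unfolding c_def[symmetric] m using c by simp
  qed
  have i1: "integrable M (\<lambda>\<omega>. indicator B (X \<omega>) :: real)"
    by (rule integrable_const_bound[where B=1]) (use B in \<open>auto simp: indicator_def\<close>)
  have i2: "integrable M (\<lambda>\<omega>. U \<omega> * indicator B (X \<omega>) :: real)"
    by (rule integrable_const_bound[where B=1]) (use B U1 in \<open>auto simp: indicator_def\<close>)
  have "(\<integral>\<omega>. (2 + U \<omega>) * indicator B (X \<omega>) \<partial>M) = (2 + (\<integral>\<omega>. U \<omega> \<partial>M)) * measure N B"
    by (rule law) (use U1 UX in auto)
  moreover have "(\<integral>\<omega>. (2 + 0) * indicator B (X \<omega>) \<partial>M) = (2 + (\<integral>\<omega>. 0 \<partial>M)) * measure N B"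
    by (rule law[of "\<lambda>_. 0"]) auto
  moreover have "(\<integral>\<omega>. (2 + U \<omega>) * indicator B (X \<omega>) \<partial>M)
      = 2 * (\<integral>\<omega>. indicator B (X \<omega>) \<partial>M) + (\<integral>\<omega>. U \<omega> * indicator B (X \<omega>) \<partial>M)"
    using i1 i2 by (simp add: distrib_right)
  ultimately show ?thesis by (simp add: algebra_simps)
qed

lemma (in prob_space) weight_factors:
  fixes U :: "'a \<Rightarrow> complex" and X :: "'a \<Rightarrow> real"
  assumes [measurable]: "U \<in> borel_measurable M" "X \<in> borel_measurable M"
    and U1: "\<And>\<omega>. cmod (U \<omega>) \<le> 1"
    and N: "real_distribution N"
    and X: "\<And>t. (\<integral>\<omega>. iexp (t * X \<omega>) \<partial>M) = char N t"
    and UX: "\<And>t. (\<integral>\<omega>. U \<omega> * iexp (t * X \<omega>) \<partial>M) = (\<integral>\<omega>. U \<omega> \<partial>M) * char N t"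
    and B: "B \<in> sets borel"
  shows "(\<integral>\<omega>. U \<omega> * indicator B (X \<omega>) \<partial>M) = (\<integral>\<omega>. U \<omega> \<partial>M) * of_real (measure N B)"
proof -
  interpret N: real_distribution N by fact
  have iU: "integrable M U" by (rule integrable_const_bound[where B=1]) (use U1 in auto)
  have iUX: "integrable M (\<lambda>\<omega>. U \<omega> * iexp (t * X \<omega>))" for t
    by (rule integrable_const_bound[where B=1]) (use U1 in \<open>auto simp: norm_mult\<close>)
  have iUX': "integrable M (\<lambda>\<omega>. cnj (U \<omega>) * iexp (t * X \<omega>))" for t
    by (rule integrable_const_bound[where B=1]) (use U1 in \<open>auto simp: norm_mult\<close>)
  have cUX: "(\<integral>\<omega>. cnj (U \<omega>) * iexp (t * X \<omega>) \<partial>M) = cnj (\<integral>\<omega>. U \<omega> \<partial>M) * char N t" for t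
  proof -
    have e: "cnj (iexp (-t * x)) = iexp (t * x)" for x by (simp add: exp_cnj)
    have "(\<integral>\<omega>. cnj (U \<omega>) * iexp (t * X \<omega>) \<partial>M) = (\<integral>\<omega>. cnj (U \<omega> * iexp ((-t) * X \<omega>)) \<partial>M)"
      by (simp add: exp_cnj)
    also have "\<dots> = cnj ((\<integral>\<omega>. U \<omega> \<partial>M) * char N (-t))"
      unfolding UX[symmetric] by (rule Bochner_Integration.integral_cnj)
    also have "cnj (char N (-t)) = char N t"
      unfolding char_def by (simp flip: Bochner_Integration.integral_cnj add: exp_cnj)
    ultimately show ?thesis by simp
  qed
  have re: "(\<integral>\<omega>. Re (U \<omega>) * indicator B (X \<omega>) \<partial>M) = (\<integral>\<omega>. Re (U \<omega>) \<partial>M) * measure N B"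
  proof (rule weight_factors_real[OF _ _ _ N X _ B])
    show "\<bar>Re (U \<omega>)\<bar> \<le> 1" for \<omega> using U1[of \<omega>] abs_Re_le_cmod[of "U \<omega>"] by linarith
    fix t
    have "(\<integral>\<omega>. of_real (Re (U \<omega>)) * iexp (t * X \<omega>) \<partial>M)
        = (\<integral>\<omega>. (U \<omega> * iexp (t * X \<omega>) + cnj (U \<omega>) * iexp (t * X \<omega>)) / 2 \<partial>M)"
      by (intro Bochner_Integration.integral_cong refl) (simp add: complex_add_cnj distrib_right[symmetric])
    also have "\<dots> = ((\<integral>\<omega>. U \<omega> \<partial>M) + cnj (\<integral>\<omega>. U \<omega> \<partial>M)) / 2 * char N t"
      using iUX[of t] iUX'[of t] UX[of t] cUX[of t] by (simp add: algebra_simps)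
    also have "((\<integral>\<omega>. U \<omega> \<partial>M) + cnj (\<integral>\<omega>. U \<omega> \<partial>M)) / 2 = of_real (\<integral>\<omega>. Re (U \<omega>) \<partial>M)"
      using iU by (simp add: complex_add_cnj)
    finally show "(\<integral>\<omega>. of_real (Re (U \<omega>)) * iexp (t * X \<omega>) \<partial>M) = of_real (\<integral>\<omega>. Re (U \<omega>) \<partial>M) * char N t" .
  qed auto
  have im: "(\<integral>\<omega>. Im (U \<omega>) * indicator B (X \<omega>) \<partial>M) = (\<integral>\<omega>. Im (U \<omega>) \<partial>M) * measure N B"
  proof (rule weight_factors_real[OF _ _ _ N X _ B])
    show "\<bar>Im (U \<omega>)\<bar> \<le> 1" for \<omega> using U1[of \<omega>] abs_Im_le_cmod[of "U \<omega>"] by linarith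
    fix t
    have "(\<integral>\<omega>. of_real (Im (U \<omega>)) * iexp (t * X \<omega>) \<partial>M)
        = (\<integral>\<omega>. (U \<omega> * iexp (t * X \<omega>) - cnj (U \<omega>) * iexp (t * X \<omega>)) / (2 * \<i>) \<partial>M)"
    proof (intro Bochner_Integration.integral_cong refl)
      fix \<omega>
      have "of_real (Im (U \<omega>)) = (U \<omega> - cnj (U \<omega>)) / (2 * \<i>)" by (simp add: complex_eq_iff)
      then show "of_real (Im (U \<omega>)) * iexp (t * X \<omega>) = (U \<omega> * iexp (t * X \<omega>) - cnj (U \<omega>) * iexp (t * X \<omega>)) / (2 * \<i>)"
        by (simp only: left_diff_distrib times_divide_eq_left)
    qed
    also have "\<dots> = ((\<integral>\<omega>. U \<omega> \<partial>M) - cnj (\<integral>\<omega>. U \<omega> \<partial>M)) / (2 * \<i>) * char N t"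
      using iUX[of t] iUX'[of t] UX[of t] cUX[of t] by (simp add: algebra_simps diff_divide_distrib)
    also have "((\<integral>\<omega>. U \<omega> \<partial>M) - cnj (\<integral>\<omega>. U \<omega> \<partial>M)) / (2 * \<i>) = of_real (\<integral>\<omega>. Im (U \<omega>) \<partial>M)"
      using iU by (simp add: complex_eq_iff)
    finally show "(\<integral>\<omega>. of_real (Im (U \<omega>)) * iexp (t * X \<omega>) \<partial>M) = of_real (\<integral>\<omega>. Im (U \<omega>) \<partial>M) * char N t" .
  qed auto
  have iB: "integrable M (\<lambda>\<omega>. U \<omega> * indicator B (X \<omega>))"
    by (rule integrable_const_bound[where B=1]) (use B U1 in \<open>auto simp: indicator_def\<close>)
  show ?thesis
  proof (rule complex_eqI)
    have "Re (\<integral>\<omega>. U \<omega> * indicator B (X \<omega>) \<partial>M) = (\<integral>\<omega>. Re (U \<omega>) * indicator B (X \<omega>) \<partial>M)"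
      by (subst integral_Re[OF iB, symmetric]) (auto intro!: Bochner_Integration.integral_cong simp: indicator_def)
    then show "Re (\<integral>\<omega>. U \<omega> * indicator B (X \<omega>) \<partial>M) = Re ((\<integral>\<omega>. U \<omega> \<partial>M) * of_real (measure N B))"
      using re iU by simp
    have "Im (\<integral>\<omega>. U \<omega> * indicator B (X \<omega>) \<partial>M) = (\<integral>\<omega>. Im (U \<omega>) * indicator B (X \<omega>) \<partial>M)"
      by (subst integral_Im[OF iB, symmetric]) (auto intro!: Bochner_Integration.integral_cong simp: indicator_def)
    then show "Im (\<integral>\<omega>. U \<omega> * indicator B (X \<omega>) \<partial>M) = Im ((\<integral>\<omega>. U \<omega> \<partial>M) * of_real (measure N B))"
      using im iU by simp
  qed
qed

text \<open>Coordinates are turned one at a time from characters \<open>exp (\<i> a X)\<close> into indicators: the product over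
  the other coordinates serves as the weight. This yields the probabilities of boxes, which determine the law.\<close>

lemma (in prob_space) product_law:
  fixes X :: "'i \<Rightarrow> 'a \<Rightarrow> real" and N :: "'i \<Rightarrow> real measure"
  assumes fin: "finite I" and Xm: "\<And>i. i \<in> I \<Longrightarrow> X i \<in> borel_measurable M"
    and N: "\<And>i. real_distribution (N i)"
    and chr: "\<And>a. (\<integral>\<omega>. iexp (\<Sum>i\<in>I. a i * X i \<omega>) \<partial>M) = (\<Prod>i\<in>I. char (N i) (a i))"
  shows "distr M (Pi\<^sub>M I (\<lambda>_. borel)) (\<lambda>\<omega>. \<lambda>i\<in>I. X i \<omega>) = Pi\<^sub>M I N"
proof -
  have boxes: "(\<integral>\<omega>. (\<Prod>i\<in>J. indicator (B i) (X i \<omega>)) * iexp (\<Sum>i\<in>I - J. a i * X i \<omega>) \<partial>M)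
      = (\<Prod>i\<in>J. of_real (measure (N i) (B i))) * (\<Prod>i\<in>I - J. char (N i) (a i))"
    if "finite J" "J \<subseteq> I" and B: "\<And>i. i \<in> I \<Longrightarrow> B i \<in> sets borel" for J B a
    using that(1,2)
  proof (induction J arbitrary: a)
    case empty
    then show ?case using chr[of a] by simp
  next
    case (insert j J)
    let ?K = "I - insert j J"
    have j: "j \<in> I" "j \<notin> J" "J \<subseteq> I" using insert by auto
    have IJ: "I - J = insert j ?K" "j \<notin> ?K" "finite ?K" using j fin by auto
    define U where "U \<omega> = (\<Prod>i\<in>J. indicator (B i) (X i \<omega>)) * iexp (\<Sum>i\<in>?K. a i * X i \<omega>)" for \<omega>
    have Xm': "i \<in> I \<Longrightarrow> X i \<in> borel_measurable M" for i by (rule Xm)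
    have ind: "(\<lambda>\<omega>. indicator (B i) (X i \<omega>) :: complex) \<in> borel_measurable M" if "i \<in> I" for i
      using B[OF that] Xm[OF that] by measurable
    have sm: "(\<lambda>\<omega>. \<Sum>i\<in>?K. a i * X i \<omega>) \<in> borel_measurable M"
      by (intro borel_measurable_sum borel_measurable_times borel_measurable_const Xm) auto
    have Um: "U \<in> borel_measurable M"
    proof -
      have "(\<lambda>\<omega>. iexp (\<Sum>i\<in>?K. a i * X i \<omega>)) \<in> borel_measurable M"
        using sm by measurable
      then show ?thesis unfolding U_def
        by (intro borel_measurable_times borel_measurable_prod ind) (use j in auto)
    qed
    have U1: "cmod (U \<omega>) \<le> 1" for \<omega>
    proof -
      have "cmod (U \<omega>) = (\<Prod>i\<in>J. cmod (indicator (B i) (X i \<omega>)))"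
        by (simp add: U_def norm_mult prod_norm)
      also have "\<dots> \<le> (\<Prod>i\<in>J. 1)" by (intro prod_mono) (auto simp: indicator_def)
      finally show ?thesis by simp
    qed
    have upd: "(\<integral>\<omega>. U \<omega> * iexp (t * X j \<omega>) \<partial>M)
       = (\<Prod>i\<in>J. of_real (measure (N i) (B i))) * ((\<Prod>i\<in>?K. char (N i) (a i)) * char (N j) t)" for t
    proof -
      have s: "(\<Sum>i\<in>I - J. (a(j := t)) i * X i \<omega>) = (\<Sum>i\<in>?K. a i * X i \<omega>) + t * X j \<omega>" for \<omega>
        unfolding IJ(1) using IJ(2,3) by (subst sum.insert) (auto intro!: sum.cong)
      have p: "(\<Prod>i\<in>I - J. char (N i) ((a(j := t)) i)) = (\<Prod>i\<in>?K. char (N i) (a i)) * char (N j) t"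
        unfolding IJ(1) using IJ(2,3) by (subst prod.insert) (auto intro!: prod.cong)
      have "U \<omega> * iexp (t * X j \<omega>)
         = (\<Prod>i\<in>J. indicator (B i) (X i \<omega>)) * iexp (\<Sum>i\<in>I - J. (a(j := t)) i * X i \<omega>)" for \<omega>
        unfolding s U_def by (simp only: of_real_add distrib_left exp_add mult.assoc)
      then show ?thesis using insert.IH[OF j(3), of "a(j := t)"] unfolding p by simp
    qed
    have c0: "char (N i) 0 = 1" for i
      using N[of i] by (rule real_distribution.char_zero)
    have U0: "(\<integral>\<omega>. U \<omega> \<partial>M) = (\<Prod>i\<in>J. of_real (measure (N i) (B i))) * (\<Prod>i\<in>?K. char (N i) (a i))"
      using upd[of 0] by (simp add: c0)
    have Xj: "(\<integral>\<omega>. iexp (t * X j \<omega>) \<partial>M) = char (N j) t" for t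
    proof -
      have "(\<Sum>i\<in>I. (if i = j then t else 0) * X i \<omega>) = t * X j \<omega>" for \<omega>
        using j fin by (subst sum.remove[of _ j]) auto
      moreover have "(\<Prod>i\<in>I. char (N i) (if i = j then t else 0)) = char (N j) t"
        using j fin by (subst prod.remove[of _ j]) (auto simp: c0)
      ultimately show ?thesis using chr[of "\<lambda>i. if i = j then t else 0"] by simp
    qed
    have "(\<integral>\<omega>. U \<omega> * indicator (B j) (X j \<omega>) \<partial>M) = (\<integral>\<omega>. U \<omega> \<partial>M) * of_real (measure (N j) (B j))"
      by (rule weight_factors[OF Um Xm[OF j(1)] U1 N Xj _ B[OF j(1)]]) (simp only: upd U0 mult.assoc)
    moreover have eq: "(\<Prod>i\<in>insert j J. indicator (B i) (X i \<omega>)) * iexp (\<Sum>i\<in>?K. a i * X i \<omega>)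
        = U \<omega> * indicator (B j) (X j \<omega>)" for \<omega>
      using insert(1) j by (simp add: U_def mult_ac)
    ultimately show ?case unfolding eq U0 using insert(1) j by (simp add: mult_ac)
  qed
  interpret N: product_prob_space N
    by (rule product_prob_spaceI) (use N in \<open>simp add: real_distribution_def\<close>)
  have meas: "(\<lambda>\<omega>. \<lambda>i\<in>I. X i \<omega>) \<in> measurable M (Pi\<^sub>M I (\<lambda>_. borel))"
    by (rule measurable_restrict) (rule Xm)
  show ?thesis
  proof (rule N.PiM_eqI[OF fin])
    show "sets (distr M (Pi\<^sub>M I (\<lambda>_. borel)) (\<lambda>\<omega>. \<lambda>i\<in>I. X i \<omega>)) = sets (Pi\<^sub>M I N)"
      using N by (auto simp: real_distribution_def real_distribution_axioms_def intro!: sets_PiM_cong)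
  next
    fix A assume "\<And>i. i \<in> I \<Longrightarrow> A i \<in> sets (N i)"
    then have A: "\<And>i. i \<in> I \<Longrightarrow> A i \<in> sets borel"
      using N by (auto simp: real_distribution_def real_distribution_axioms_def)
    have setA: "Pi\<^sub>E I A \<in> sets (Pi\<^sub>M I (\<lambda>_. borel))" using A fin by (intro sets_PiM_I_finite) auto
    let ?E = "(\<lambda>\<omega>. \<lambda>i\<in>I. X i \<omega>) -` Pi\<^sub>E I A \<inter> space M"
    have E: "?E \<in> events" using meas setA by (rule measurable_sets)
    have "complex_of_real (prob ?E) = of_real (\<integral>\<omega>. indicator ?E \<omega> \<partial>M)"
      using E by simp
    also have "\<dots> = (\<integral>\<omega>. of_real (indicator ?E \<omega>) \<partial>M)"
    proof (rule integral_of_real[symmetric], rule integrable_const_bound[where B=1])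
      show "AE \<omega> in M. norm (indicator ?E \<omega> :: real) \<le> 1" by (simp add: indicator_def)
      show "(\<lambda>\<omega>. indicator ?E \<omega> :: real) \<in> borel_measurable M" using E by simp
    qed
    also have "\<dots> = (\<integral>\<omega>. (\<Prod>i\<in>I. indicator (A i) (X i \<omega>)) * iexp (\<Sum>i\<in>I - I. 0 * X i \<omega>) \<partial>M)"
    proof (intro Bochner_Integration.integral_cong refl)
      fix \<omega> assume w: "\<omega> \<in> space M"
      show "of_real (indicator ?E \<omega>) = (\<Prod>i\<in>I. indicator (A i) (X i \<omega>)) * iexp (\<Sum>i\<in>I - I. 0 * X i \<omega>)"
      proof (cases "\<forall>i\<in>I. X i \<omega> \<in> A i")
        case True
        then have "\<omega> \<in> ?E" using w by (auto simp: PiE_iff)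
        with True show ?thesis by simp
      next
        case False
        then obtain i where i: "i \<in> I" "X i \<omega> \<notin> A i" by auto
        then have "\<omega> \<notin> ?E" by (auto simp: PiE_iff)
        moreover have "(\<Prod>i\<in>I. indicator (A i) (X i \<omega>)) = (0::complex)"
          using fin i by (intro prod_zero bexI[of _ i]) auto
        ultimately show ?thesis by simp
      qed
    qed
    also have "\<dots> = (\<Prod>i\<in>I. of_real (measure (N i) (A i)))"
      by (rule trans[OF boxes[OF fin order_refl A]]) simp_all
    finally have "complex_of_real (prob ?E) = of_real (\<Prod>i\<in>I. measure (N i) (A i))" by simp
    then have "prob ?E = (\<Prod>i\<in>I. measure (N i) (A i))" by (simp only: of_real_eq_iff)
    then have "emeasure M ?E = (\<Prod>i\<in>I. emeasure (N i) (A i))"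
      by (simp add: emeasure_eq_measure N.M.emeasure_eq_measure prod_ennreal measure_nonneg)
    then show "emeasure (distr M (Pi\<^sub>M I (\<lambda>_. borel)) (\<lambda>\<omega>. \<lambda>i\<in>I. X i \<omega>)) (Pi\<^sub>E I A) = (\<Prod>i\<in>I. emeasure (N i) (A i))"
      by (simp add: emeasure_distr[OF meas setA])
  qed
qed

section \<open>Relative entropy of Gaussian families\<close>

lemma product_density:
  fixes f :: "'i \<Rightarrow> 'b \<Rightarrow> ennreal"
  assumes fin: "finite I" and L: "\<And>i. prob_space (L i)" and N: "\<And>i. prob_space (N i)"
    and NL: "\<And>i. N i = density (L i) (f i)" and f: "\<And>i. f i \<in> borel_measurable (L i)"
  shows "Pi\<^sub>M I N = density (Pi\<^sub>M I L) (\<lambda>x. \<Prod>i\<in>I. f i (x i))"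
proof -
  interpret L: product_prob_space L
    by (rule product_prob_spaceI) (rule L)
  interpret N: product_prob_space N
    by (rule product_prob_spaceI) (rule N)
  have fm: "(\<lambda>x. \<Prod>i\<in>I. f i (x i)) \<in> borel_measurable (Pi\<^sub>M I L)"
  proof (rule borel_measurable_prod_ennreal)
    fix i assume "i \<in> I"
    then show "(\<lambda>x. f i (x i)) \<in> borel_measurable (Pi\<^sub>M I L)"
      using measurable_compose[OF measurable_component_singleton[of i I L] f[of i]] by simp
  qed
  show ?thesis
  proof (rule N.PiM_eqI[OF fin, symmetric])
    show "sets (density (Pi\<^sub>M I L) (\<lambda>x. \<Prod>i\<in>I. f i (x i))) = sets (Pi\<^sub>M I N)"
      by (auto intro!: sets_PiM_cong simp: NL)
    fix A assume "\<And>i. i \<in> I \<Longrightarrow> A i \<in> sets (N i)"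
    then have A: "\<And>i. i \<in> I \<Longrightarrow> A i \<in> sets (L i)" by (simp add: NL)
    have "emeasure (density (Pi\<^sub>M I L) (\<lambda>x. \<Prod>i\<in>I. f i (x i))) (Pi\<^sub>E I A)
        = (\<integral>\<^sup>+x. (\<Prod>i\<in>I. f i (x i)) * indicator (Pi\<^sub>E I A) x \<partial>Pi\<^sub>M I L)"
      by (rule emeasure_density[OF fm]) (use A fin in \<open>auto intro: sets_PiM_I_finite\<close>)
    also have "\<dots> = (\<integral>\<^sup>+x. (\<Prod>i\<in>I. f i (x i) * indicator (A i) (x i)) \<partial>Pi\<^sub>M I L)"
    proof (rule nn_integral_cong)
      fix x assume x: "x \<in> space (Pi\<^sub>M I L)"
      show "(\<Prod>i\<in>I. f i (x i)) * indicator (Pi\<^sub>E I A) x = (\<Prod>i\<in>I. f i (x i) * indicator (A i) (x i))"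
      proof (cases "\<forall>i\<in>I. x i \<in> A i")
        case True
        then have "x \<in> Pi\<^sub>E I A" using x by (auto simp: space_PiM PiE_iff)
        with True show ?thesis by simp
      next
        case False
        then obtain i where i: "i \<in> I" "x i \<notin> A i" by auto
        then have "x \<notin> Pi\<^sub>E I A" by auto
        moreover have "(\<Prod>i\<in>I. f i (x i) * indicator (A i) (x i)) = 0"
          using i fin by (intro prod_zero) (auto intro!: bexI[of _ i])
        ultimately show ?thesis by simp
      qed
    qed
    also have "\<dots> = (\<Prod>i\<in>I. (\<integral>\<^sup>+x. f i x * indicator (A i) x \<partial>L i))"
      by (rule L.product_nn_integral_prod[OF fin]) (intro borel_measurable_times_ennreal f borel_measurable_indicator A)
    also have "\<dots> = (\<Prod>i\<in>I. emeasure (N i) (A i))"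
      using A by (intro prod.cong refl) (simp add: NL emeasure_density f)
    finally show "emeasure (density (Pi\<^sub>M I L) (\<lambda>x. \<Prod>i\<in>I. f i (x i))) (Pi\<^sub>E I A) = (\<Prod>i\<in>I. emeasure (N i) (A i))" .
  qed
qed

abbreviation "centred_normal v \<equiv> density lborel (normal_density 0 (sqrt v))"

lemma centred_normal_density:
  assumes "0 < v"
  shows "centred_normal v = density (centred_normal 1) (\<lambda>x. ennreal (exp (x\<^sup>2 / 2 - x\<^sup>2 / (2 * v) - ln v / 2)))"
proof -
  have "ennreal (normal_density 0 (sqrt v) x) =
    ennreal (normal_density 0 (sqrt 1) x) * ennreal (exp (x\<^sup>2 / 2 - x\<^sup>2 / (2 * v) - ln v / 2))" for x
  proof -
    have "exp (x\<^sup>2 / 2 - x\<^sup>2 / (2 * v) - ln v / 2) = exp (x\<^sup>2 / 2) * exp (- (x\<^sup>2 / (2 * v))) * inverse (sqrt v)"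
    proof -
      have "exp (ln v / 2) = sqrt v"
        using assms exp_ln[of "sqrt v"] by (simp add: ln_sqrt)
      then have "exp (- (ln v / 2)) = inverse (sqrt v)" by (simp add: exp_minus)
      then show ?thesis by (simp only: diff_conv_add_uminus exp_add)
    qed
    moreover have "exp (- (x\<^sup>2 / 2)) * exp (x\<^sup>2 / 2) = 1" by (simp flip: exp_add)
    moreover have "normal_density 0 (sqrt v) x = inverse (sqrt (2 * pi)) * inverse (sqrt v) * exp (- (x\<^sup>2 / (2 * v)))"
      using assms by (simp add: normal_density_def real_sqrt_mult inverse_eq_divide)
    moreover have "normal_density 0 (sqrt 1) x = inverse (sqrt (2 * pi)) * exp (- (x\<^sup>2 / 2))"
      by (simp add: normal_density_def inverse_eq_divide)
    ultimately have "normal_density 0 (sqrt v) x = normal_density 0 (sqrt 1) x * exp (x\<^sup>2 / 2 - x\<^sup>2 / (2 * v) - ln v / 2)"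
      by (simp only: mult_ac) (simp add: mult.left_commute[of _ "exp (x\<^sup>2 / 2)"] mult.assoc[symmetric])
    then show ?thesis by (simp add: ennreal_mult'')
  qed
  then show ?thesis by (subst density_density_eq) auto
qed

lemma centred_normal_second_moment:
  assumes "0 < v"
  shows "integrable (centred_normal v) (\<lambda>x. x\<^sup>2)" "(\<integral>x. x\<^sup>2 \<partial>centred_normal v) = v"
proof -
  have "has_bochner_integral lborel (\<lambda>x. normal_density 0 (sqrt v) x * (x - 0)^(2 * 1)) (fact (2 * 1) / ((2 / (sqrt v)\<^sup>2)^1 * fact 1))"
    using assms by (intro normal_moment_even) auto
  then have "has_bochner_integral lborel (\<lambda>x. normal_density 0 (sqrt v) x * x\<^sup>2) v"
    using assms by (simp add: fact_numeral)
  then show "integrable (centred_normal v) (\<lambda>x. x\<^sup>2)" "(\<integral>x. x\<^sup>2 \<partial>centred_normal v) = v"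
    by (simp_all add: integrable_density integral_density has_bochner_integral_iff)
qed

text \<open>The bimeasurable coordinates \<open>T\<close> (with almost sure inverse \<open>S\<close>) carry both laws to product measures
  without changing densities or the relative entropy, so that linearly dependent components do no harm as
  long as independent coordinates for them exist.\<close>

lemma rel_entropy_independent_normals:
  fixes Y Z :: "'a \<Rightarrow> 'e" and d :: "'i \<Rightarrow> real"
  assumes "prob_space M" and fin: "finite I"
    and Y[measurable]: "Y \<in> measurable M E" and Z[measurable]: "Z \<in> measurable M E"
    and T[measurable]: "T \<in> measurable E (Pi\<^sub>M I (\<lambda>_. borel))"
    and S[measurable]: "S \<in> measurable (Pi\<^sub>M I (\<lambda>_. borel)) E"
    and STY: "AE \<omega> in M. S (T (Y \<omega>)) = Y \<omega>" and STZ: "AE \<omega> in M. S (T (Z \<omega>)) = Z \<omega>"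
    and d: "\<And>i. 0 < d i"
    and lawY: "distr M (Pi\<^sub>M I (\<lambda>_. borel)) (\<lambda>\<omega>. T (Y \<omega>)) = Pi\<^sub>M I (\<lambda>i. centred_normal (d i))"
    and lawZ: "distr M (Pi\<^sub>M I (\<lambda>_. borel)) (\<lambda>\<omega>. T (Z \<omega>)) = Pi\<^sub>M I (\<lambda>i. centred_normal 1)"
  shows "rel_entropy (distr M E Y) (distr M E Z) = ereal (\<Sum>i\<in>I. (d i - 1 - ln (d i)) / 2)"
proof -
  interpret prob_space M by fact
  define L where "L x = (\<Sum>i\<in>I. (x i)\<^sup>2 / 2 - (x i)\<^sup>2 / (2 * d i) - ln (d i) / 2)" for x :: "'i \<Rightarrow> real"
  let ?B = "Pi\<^sub>M I (\<lambda>_. borel :: real measure)"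
  have Lm[measurable]: "L \<in> borel_measurable ?B" unfolding L_def by measurable
  have setsN: "sets (Pi\<^sub>M I (\<lambda>i. centred_normal (e i))) = sets ?B" for e :: "'i \<Rightarrow> real"
    by (rule sets_PiM_cong) auto
  have pn: "prob_space (centred_normal v)" if "0 < v" for v using that by (intro prob_space_normal_density) simp
  have dens: "Pi\<^sub>M I (\<lambda>i. centred_normal (d i)) = density (Pi\<^sub>M I (\<lambda>i. centred_normal 1)) (\<lambda>x. ennreal (exp (L x)))"
  proof -
    have "Pi\<^sub>M I (\<lambda>i. centred_normal (d i)) = density (Pi\<^sub>M I (\<lambda>i. centred_normal 1))
        (\<lambda>x. \<Prod>i\<in>I. ennreal (exp ((x i)\<^sup>2 / 2 - (x i)\<^sup>2 / (2 * d i) - ln (d i) / 2)))"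
      by (rule product_density[OF fin pn pn centred_normal_density[OF d]]) (auto simp: d)
    then show ?thesis using fin by (simp add: L_def exp_sum prod_ennreal)
  qed
  let ?P = "distr M E Y" and ?Q = "distr M E Z"
  interpret P: prob_space ?P by (rule prob_space_distr) fact
  interpret Q: prob_space ?Q by (rule prob_space_distr) fact
  have PQ: "density ?Q (\<lambda>x. ennreal (exp (L (T x)))) = ?P"
  proof (rule measure_eqI)
    fix A assume "A \<in> sets (density ?Q (\<lambda>x. ennreal (exp (L (T x)))))"
    then have A[measurable]: "A \<in> sets E" by simp
    have "emeasure ?P A = (\<integral>\<^sup>+\<omega>. indicator A (Y \<omega>) \<partial>M)"
      by (simp add: nn_integral_distr flip: nn_integral_indicator)
    also have "\<dots> = (\<integral>\<^sup>+\<omega>. indicator A (S (T (Y \<omega>))) \<partial>M)"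
      by (rule nn_integral_cong_AE) (use STY in eventually_elim, simp)
    also have "\<dots> = (\<integral>\<^sup>+x. indicator A (S x) \<partial>distr M ?B (\<lambda>\<omega>. T (Y \<omega>)))"
      by (subst nn_integral_distr) auto
    also have "\<dots> = (\<integral>\<^sup>+x. ennreal (exp (L x)) * indicator A (S x) \<partial>distr M ?B (\<lambda>\<omega>. T (Z \<omega>)))"
      unfolding lawY dens lawZ[symmetric] by (subst nn_integral_density) auto
    also have "\<dots> = (\<integral>\<^sup>+\<omega>. ennreal (exp (L (T (Z \<omega>)))) * indicator A (S (T (Z \<omega>))) \<partial>M)"
      by (subst nn_integral_distr) auto
    also have "\<dots> = (\<integral>\<^sup>+\<omega>. ennreal (exp (L (T (Z \<omega>)))) * indicator A (Z \<omega>) \<partial>M)"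
      by (rule nn_integral_cong_AE) (use STZ in eventually_elim, simp)
    also have "\<dots> = (\<integral>\<^sup>+x. ennreal (exp (L (T x))) * indicator A x \<partial>?Q)"
      by (subst nn_integral_distr) auto
    also have "\<dots> = emeasure (density ?Q (\<lambda>x. ennreal (exp (L (T x))))) A"
      by (subst emeasure_density) auto
    finally show "emeasure (density ?Q (\<lambda>x. ennreal (exp (L (T x))))) A = emeasure ?P A" by simp
  qed simp
  have ac: "absolutely_continuous ?Q ?P"
    unfolding PQ[symmetric] by (rule absolutely_continuousI_density) simp
  have "AE x in ?Q. ennreal (exp (L (T x))) = RN_deriv ?Q ?P x"
    by (rule Q.RN_deriv_unique[OF _ PQ]) simp
  then have "AE x in ?P. ennreal (exp (L (T x))) = RN_deriv ?Q ?P x"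
    using absolutely_continuous_AE[OF _ ac] by simp
  then have ed: "AE x in ?P. entropy_density (exp 1) ?Q ?P x = L (T x)"
  proof eventually_elim
    case (elim x)
    then have "enn2real (RN_deriv ?Q ?P x) = exp (L (T x))" by (metis enn2real_ennreal exp_ge_zero)
    then show ?case by (simp add: entropy_density_def log_def)
  qed
  have marg: "distr M borel (\<lambda>\<omega>. T (Y \<omega>) i) = centred_normal (d i)" if i: "i \<in> I" for i
  proof -
    have "distr M borel (\<lambda>\<omega>. T (Y \<omega>) i) = distr (distr M ?B (\<lambda>\<omega>. T (Y \<omega>))) borel (\<lambda>x. x i)"
      using i by (subst distr_distr) (auto simp: comp_def)
    also have "\<dots> = distr (Pi\<^sub>M I (\<lambda>i. centred_normal (d i))) (centred_normal (d i)) (\<lambda>x. x i)"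
      unfolding lawY by (rule distr_cong) auto
    also have "\<dots> = centred_normal (d i)"
    proof -
      interpret N: product_prob_space "\<lambda>i. centred_normal (d i)"
        by (rule product_prob_spaceI) (rule pn[OF d])
      show ?thesis by (rule N.PiM_component[OF i])
    qed
    finally show ?thesis .
  qed
  have TY: "(\<lambda>\<omega>. T (Y \<omega>)) \<in> measurable M ?B" by measurable
  have Ti: "(\<lambda>\<omega>. T (Y \<omega>) i) \<in> borel_measurable M" if "i \<in> I" for i
    by (rule measurable_compose[OF TY measurable_component_singleton[OF that]])
  have sq: "integrable M (\<lambda>\<omega>. (T (Y \<omega>) i)\<^sup>2)" "(\<integral>\<omega>. (T (Y \<omega>) i)\<^sup>2 \<partial>M) = d i" if i: "i \<in> I" for i
  proof -
    show "integrable M (\<lambda>\<omega>. (T (Y \<omega>) i)\<^sup>2)"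
      using centred_normal_second_moment(1)[OF d[of i]] Ti[OF i]
      unfolding marg[OF i, symmetric] by (subst (asm) integrable_distr_eq) auto
    show "(\<integral>\<omega>. (T (Y \<omega>) i)\<^sup>2 \<partial>M) = d i"
      using centred_normal_second_moment(2)[OF d[of i]] Ti[OF i]
      unfolding marg[OF i, symmetric] by (subst (asm) integral_distr) auto
  qed
  have iL: "integrable M (\<lambda>\<omega>. L (T (Y \<omega>)))"
    unfolding L_def using sq(1) by (intro Bochner_Integration.integrable_sum Bochner_Integration.integrable_diff) auto
  have "(\<integral>\<omega>. L (T (Y \<omega>)) \<partial>M) = (\<Sum>i\<in>I. \<integral>\<omega>. (T (Y \<omega>) i)\<^sup>2 / 2 - (T (Y \<omega>) i)\<^sup>2 / (2 * d i) - ln (d i) / 2 \<partial>M)"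
    unfolding L_def using sq(1) by (intro Bochner_Integration.integral_sum Bochner_Integration.integrable_diff) auto
  also have "\<dots> = (\<Sum>i\<in>I. (d i - 1 - ln (d i)) / 2)"
  proof (rule sum.cong[OF refl])
    fix i assume i: "i \<in> I"
    show "(\<integral>\<omega>. (T (Y \<omega>) i)\<^sup>2 / 2 - (T (Y \<omega>) i)\<^sup>2 / (2 * d i) - ln (d i) / 2 \<partial>M) = (d i - 1 - ln (d i)) / 2"
      using sq[OF i] d[of i] by (simp add: prob_space diff_divide_distrib)
  qed
  finally have val: "(\<integral>\<omega>. L (T (Y \<omega>)) \<partial>M) = (\<Sum>i\<in>I. (d i - 1 - ln (d i)) / 2)" .
  have "integrable ?P (\<lambda>x. L (T x))" using iL by (simp add: integrable_distr_eq)
  moreover have edm: "entropy_density (exp 1) ?Q ?P \<in> borel_measurable ?P"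
    using measurable_entropy_density[of "exp 1" ?Q ?P] by simp
  ultimately have int: "integrable ?P (entropy_density (exp 1) ?Q ?P)"
    using integrable_cong_AE[OF edm _ ed] by simp
  have "KL_divergence (exp 1) ?Q ?P = (\<integral>x. L (T x) \<partial>?P)"
    unfolding KL_divergence_def by (rule integral_cong_AE[OF edm _ ed]) simp
  also have "\<dots> = (\<integral>\<omega>. L (T (Y \<omega>)) \<partial>M)" by (subst integral_distr) auto
  finally show ?thesis using ac int val by (simp add: rel_entropy_def)
qed

lemma bilin_sum_left: "finite J \<Longrightarrow> bilin I A (\<lambda>k. \<Sum>i\<in>J. a i * v i k) z = (\<Sum>i\<in>J. a i * bilin I A (v i) z)"
proof (induction J rule: finite_induct)
  case empty
  then show ?case by (simp add: bilin_def)
next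
  case (insert j J)
  then show ?case
    using bilin_lin_left[of I A "a j" "v j" 1 "\<lambda>k. \<Sum>i\<in>J. a i * v i k" z] by simp
qed

lemma bilin_sum_right: "finite J \<Longrightarrow> bilin I A z (\<lambda>k. \<Sum>i\<in>J. a i * v i k) = (\<Sum>i\<in>J. a i * bilin I A z (v i))"
proof (induction J rule: finite_induct)
  case empty
  then show ?case by (simp add: bilin_def)
next
  case (insert j J)
  then show ?case
    using bilin_lin_right[of I A z "a j" "v j" 1 "\<lambda>k. \<Sum>i\<in>J. a i * v i k"] by simp
qed

text \<open>Centred Gaussian with covariance matrix \<open>A\<close>, expressed by characteristic functions.\<close>

definition gaussian_family :: "'a measure \<Rightarrow> 'i set \<Rightarrow> ('i \<Rightarrow> 'a \<Rightarrow> real) \<Rightarrow> ('i \<Rightarrow> 'i \<Rightarrow> real) \<Rightarrow> bool" where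
  "gaussian_family M I X A \<longleftrightarrow>
     (\<forall>a. (\<integral>\<omega>. iexp (\<Sum>i\<in>I. a i * X i \<omega>) \<partial>M) = of_real (exp (- bilin I A a a / 2)))"

lemma (in prob_space) gaussian_family_diagonal_law:
  fixes X :: "'i \<Rightarrow> 'a \<Rightarrow> real"
  assumes fin: "finite I" and Xm: "\<And>i. i \<in> I \<Longrightarrow> X i \<in> borel_measurable M"
    and g: "gaussian_family M I X A"
    and vA: "eq_on I (mat_prod I (mat_prod I v A) (mat_transp v)) (diag_mat \<mu>)" and mu: "\<And>i. 0 < \<mu> i"
  shows "distr M (Pi\<^sub>M I (\<lambda>_. borel)) (\<lambda>\<omega>. \<lambda>i\<in>I. \<Sum>k\<in>I. v i k * X k \<omega>) = Pi\<^sub>M I (\<lambda>i. centred_normal (\<mu> i))"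
proof (rule product_law[OF fin])
  show "(\<lambda>\<omega>. \<Sum>k\<in>I. v i k * X k \<omega>) \<in> borel_measurable M" for i
    by (intro borel_measurable_sum borel_measurable_times borel_measurable_const Xm)
  show "real_distribution (centred_normal (\<mu> i))" for i
    using mu[of i] by (intro normal_real_distribution) simp
  fix a :: "'i \<Rightarrow> real"
  let ?b = "\<lambda>k. \<Sum>i\<in>I. a i * v i k"
  have "bilin I A ?b ?b = (\<Sum>i\<in>I. a i * (\<Sum>j\<in>I. a j * bilin I A (v i) (v j)))"
    using fin by (simp add: bilin_sum_left bilin_sum_right)
  also have "\<dots> = (\<Sum>i\<in>I. \<mu> i * (a i)\<^sup>2)"
  proof (rule sum.cong[OF refl])
    fix i assume i: "i \<in> I"
    have "(\<Sum>j\<in>I. a j * bilin I A (v i) (v j)) = (\<Sum>j\<in>I. if i = j then a i * \<mu> i else 0)"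
      using vA i by (intro sum.cong) (auto simp: bilin_eq_mat_prod eq_on_def diag_mat_def)
    then show "a i * (\<Sum>j\<in>I. a j * bilin I A (v i) (v j)) = \<mu> i * (a i)\<^sup>2"
      using i fin by (simp add: power2_eq_square)
  qed
  finally have b: "bilin I A ?b ?b = (\<Sum>i\<in>I. \<mu> i * (a i)\<^sup>2)" .
  have eq: "(\<Sum>i\<in>I. a i * (\<Sum>k\<in>I. v i k * X k \<omega>)) = (\<Sum>k\<in>I. ?b k * X k \<omega>)" for \<omega>
    by (simp add: sum_distrib_left sum_distrib_right mult.assoc) (rule sum.swap)
  have "(\<integral>\<omega>. iexp (\<Sum>i\<in>I. a i * (\<Sum>k\<in>I. v i k * X k \<omega>)) \<partial>M) = of_real (exp (- bilin I A ?b ?b / 2))"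
    unfolding eq using g[unfolded gaussian_family_def, rule_format, of ?b] .
  also have "\<dots> = of_real (exp (\<Sum>i\<in>I. - (\<mu> i * (a i)\<^sup>2) / 2))"
    unfolding b by (simp add: sum_negf sum_divide_distrib)
  also have "\<dots> = (\<Prod>i\<in>I. of_real (exp (- (\<mu> i * (a i)\<^sup>2) / 2)))"
    using fin by (simp only: exp_sum of_real_prod)
  also have "\<dots> = (\<Prod>i\<in>I. char (centred_normal (\<mu> i)) (a i))"
  proof (rule prod.cong[OF refl])
    show "of_real (exp (- (\<mu> i * (a i)\<^sup>2) / 2)) = char (centred_normal (\<mu> i)) (a i)" for i
      using mu[of i] by (subst char_normal_density) auto
  qed
  finally show "(\<integral>\<omega>. iexp (\<Sum>i\<in>I. a i * (\<Sum>k\<in>I. v i k * X k \<omega>)) \<partial>M) = (\<Prod>i\<in>I. char (centred_normal (\<mu> i)) (a i))" .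
qed

text \<open>The properties of the eigenvalues \<open>\<mu>\<close> of \<open>A\<close> relative to \<open>B\<close> from which the limits are computed:
  traces of resolvents along the segment from \<open>B\<close> to \<open>A\<close>, and bounds by comparison of quadratic forms.\<close>

definition relative_spectrum :: "'i set \<Rightarrow> ('i \<Rightarrow> 'i \<Rightarrow> real) \<Rightarrow> ('i \<Rightarrow> 'i \<Rightarrow> real) \<Rightarrow> ('i \<Rightarrow> real) \<Rightarrow> bool" where
  "relative_spectrum I A B \<mu> \<longleftrightarrow>
     (\<forall>t R. 0 \<le> t \<longrightarrow> t \<le> 1 \<longrightarrow> eq_on I (mat_prod I R (\<lambda>i j. B i j + t * (A i j - B i j))) (diag_mat (\<lambda>_. 1)) \<longrightarrow>
        mat_trace I (mat_prod I R (\<lambda>i j. A i j - B i j)) = (\<Sum>i\<in>I. (\<mu> i - 1) / (1 + t * (\<mu> i - 1)))) \<and>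
     (\<forall>t. 0 \<le> t \<longrightarrow> t \<le> 1 \<longrightarrow> (\<exists>R. eq_on I (mat_prod I R (\<lambda>i j. B i j + t * (A i j - B i j))) (diag_mat (\<lambda>_. 1)))) \<and>
     (\<forall>c. (\<forall>x. bilin I A x x \<le> c * bilin I B x x) \<longrightarrow> (\<forall>i\<in>I. \<mu> i \<le> c)) \<and>
     (\<forall>c. (\<forall>x. c * bilin I B x x \<le> bilin I A x x) \<longrightarrow> (\<forall>i\<in>I. c \<le> \<mu> i))"

text \<open>In the coordinates that diagonalise both covariance matrices the components are independent, with
  variances \<open>\<mu> i\<close> and \<open>1\<close>. The determinants of \<open>A\<close> and \<open>B\<close> do not appear: the sum over \<open>\<mu>\<close> will be
  expressed by traces of resolvents.\<close>

lemma gaussian_rel_entropy: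
  fixes Y Z :: "'a \<Rightarrow> 'e" and T :: "'e \<Rightarrow> 'i \<Rightarrow> real"
  assumes "prob_space M" and fin: "finite I"
    and Y[measurable]: "Y \<in> measurable M E" and Z[measurable]: "Z \<in> measurable M E"
    and T[measurable]: "T \<in> measurable E (Pi\<^sub>M I (\<lambda>_. borel))"
    and S[measurable]: "S \<in> measurable (Pi\<^sub>M I (\<lambda>_. borel)) E"
    and STY: "AE \<omega> in M. S (T (Y \<omega>)) = Y \<omega>" and STZ: "AE \<omega> in M. S (T (Z \<omega>)) = Z \<omega>"
    and gY: "gaussian_family M I (\<lambda>i \<omega>. T (Y \<omega>) i) A" and gZ: "gaussian_family M I (\<lambda>i \<omega>. T (Z \<omega>) i) B"
    and symA: "\<forall>k\<in>I. \<forall>l\<in>I. A k l = A l k" and symB: "\<forall>k\<in>I. \<forall>l\<in>I. B k l = B l k"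
    and posA: "\<And>x. \<exists>k\<in>I. x k \<noteq> 0 \<Longrightarrow> 0 < bilin I A x x" and posB: "\<And>x. \<exists>k\<in>I. x k \<noteq> 0 \<Longrightarrow> 0 < bilin I B x x"
  obtains \<mu> where "relative_spectrum I A B \<mu>"
    "rel_entropy (distr M E Y) (distr M E Z) = ereal (\<Sum>i\<in>I. (\<mu> i - 1 - ln (\<mu> i)) / 2)"
proof -
  interpret prob_space M by fact
  obtain v w \<mu>0 where vw: "eq_on I (mat_prod I v w) (diag_mat (\<lambda>_. 1))" and wv: "eq_on I (mat_prod I w v) (diag_mat (\<lambda>_. 1))"
    and vB: "eq_on I (mat_prod I (mat_prod I v B) (mat_transp v)) (diag_mat (\<lambda>_. 1))"
    and vA0: "eq_on I (mat_prod I (mat_prod I v A) (mat_transp v)) (diag_mat \<mu>0)"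
    using simultaneous_diagonalisation[OF fin symA symB posB] by blast
  \<comment> \<open>The product measure takes a variance for every index; off \<open>I\<close> any positive value will do.\<close>
  define \<mu> where "\<mu> i = (if i \<in> I then \<mu>0 i else 1)" for i
  have vA: "eq_on I (mat_prod I (mat_prod I v A) (mat_transp v)) (diag_mat \<mu>)"
    using vA0 by (simp add: eq_on_def diag_mat_def \<mu>_def)
  have Avv: "bilin I A (v i) (v i) = \<mu> i" and Bvv: "bilin I B (v i) (v i) = 1" if "i \<in> I" for i
    using vA vB that by (simp_all add: bilin_eq_mat_prod eq_on_def diag_mat_def)
  have mu: "0 < \<mu> i" for i
  proof (cases "i \<in> I")
    case True
    have "\<exists>k\<in>I. v i k \<noteq> 0"
    proof (rule ccontr)
      assume "\<not> (\<exists>k\<in>I. v i k \<noteq> 0)"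
      then have "bilin I B (v i) (v i) = 0" by (simp add: bilin_def)
      then show False using Bvv[OF True] by simp
    qed
    from posA[OF this] show ?thesis using Avv[OF True] by simp
  qed (simp add: \<mu>_def)
  let ?B = "Pi\<^sub>M I (\<lambda>_. borel :: real measure)"
  define T' where "T' x = (\<lambda>i\<in>I. \<Sum>k\<in>I. v i k * T x k)" for x
  define S' where "S' x = S (\<lambda>k\<in>I. \<Sum>i\<in>I. w k i * x i)" for x
  have Tk: "(\<lambda>x. T x k) \<in> borel_measurable E" if "k \<in> I" for k
    by (rule measurable_compose[OF T measurable_component_singleton[OF that]])
  have T'm: "T' \<in> measurable E ?B"
    unfolding T'_def
    by (intro measurable_restrict borel_measurable_sum borel_measurable_times borel_measurable_const Tk)
  have S'm: "S' \<in> measurable ?B E"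
    unfolding S'_def
    by (rule measurable_compose[OF _ S])
      (intro measurable_restrict borel_measurable_sum borel_measurable_times borel_measurable_const
        measurable_component_singleton)
  have S'T': "S' (T' x) = S (T x)" if x: "x \<in> space E" for x
  proof -
    have "T x \<in> space ?B" using T x by (rule measurable_space)
    then have ext: "T x \<in> extensional I" by (auto simp: space_PiM PiE_def)
    have "(\<Sum>i\<in>I. w k i * (\<Sum>l\<in>I. v i l * T x l)) = T x k" if k: "k \<in> I" for k
    proof -
      have "(\<Sum>i\<in>I. w k i * (\<Sum>l\<in>I. v i l * T x l)) = (\<Sum>l\<in>I. mat_prod I w v k l * T x l)"
        unfolding mat_prod_def by (simp add: sum_distrib_left sum_distrib_right mult.assoc) (rule sum.swap)
      also have "\<dots> = (\<Sum>l\<in>I. if k = l then T x l else 0)"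
        using wv k by (intro sum.cong) (auto simp: eq_on_def diag_mat_def)
      also have "\<dots> = T x k" using k fin by simp
      finally show ?thesis .
    qed
    then have "(\<lambda>k\<in>I. \<Sum>i\<in>I. w k i * T' x i) = T x"
      using ext by (auto simp: T'_def fun_eq_iff restrict_def extensional_def)
    then show ?thesis by (simp add: S'_def)
  qed
  have ent: "rel_entropy (distr M E Y) (distr M E Z) = ereal (\<Sum>i\<in>I. (\<mu> i - 1 - ln (\<mu> i)) / 2)"
  proof (rule rel_entropy_independent_normals[OF \<open>prob_space M\<close> fin Y Z T'm S'm _ _ mu])
    show "AE \<omega> in M. S' (T' (Y \<omega>)) = Y \<omega>"
      using STY AE_space by eventually_elim (simp add: S'T' measurable_space[OF Y])
    show "AE \<omega> in M. S' (T' (Z \<omega>)) = Z \<omega>"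
      using STZ AE_space by eventually_elim (simp add: S'T' measurable_space[OF Z])
    show "distr M ?B (\<lambda>\<omega>. T' (Y \<omega>)) = Pi\<^sub>M I (\<lambda>i. centred_normal (\<mu> i))"
      unfolding T'_def by (rule gaussian_family_diagonal_law[OF fin _ gY vA mu])
        (rule measurable_compose[OF Y Tk])
    show "distr M ?B (\<lambda>\<omega>. T' (Z \<omega>)) = Pi\<^sub>M I (\<lambda>i. centred_normal 1)"
      unfolding T'_def by (rule gaussian_family_diagonal_law[OF fin _ gZ vB])
        (auto intro: measurable_compose[OF Z Tk])
  qed
  have nz: "1 + t * (\<mu> i - 1) \<noteq> 0" if t: "0 \<le> t" "t \<le> 1" for t i
  proof -
    have "1 + t * (\<mu> i - 1) = (1 - t) + t * \<mu> i" by (simp add: algebra_simps)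
    also have "\<dots> > 0"
      using t mu[of i] by (cases "t = 0") (auto intro!: add_nonneg_pos)
    finally show ?thesis by simp
  qed
  have "relative_spectrum I A B \<mu>"
    unfolding relative_spectrum_def
  proof (intro conjI allI impI ballI)
    show "mat_trace I (mat_prod I R (\<lambda>i j. A i j - B i j)) = (\<Sum>i\<in>I. (\<mu> i - 1) / (1 + t * (\<mu> i - 1)))"
      if "0 \<le> t" "t \<le> 1" and R: "eq_on I (mat_prod I R (\<lambda>i j. B i j + t * (A i j - B i j))) (diag_mat (\<lambda>_. 1))" for t R
      by (rule trace_resolvent[OF fin vw wv vB vA nz[OF that(1,2)] R])
    show "\<exists>R. eq_on I (mat_prod I R (\<lambda>i j. B i j + t * (A i j - B i j))) (diag_mat (\<lambda>_. 1))"
      if "0 \<le> t" "t \<le> 1" for t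
      using resolvent_exists[OF fin vw wv vB vA nz[OF that]] by blast
    show "\<mu> i \<le> c" if "\<forall>x. bilin I A x x \<le> c * bilin I B x x" "i \<in> I" for c i
      using spec[OF that(1), of "v i"] Avv Bvv that(2) by simp
    show "c \<le> \<mu> i" if "\<forall>x. c * bilin I B x x \<le> bilin I A x x" "i \<in> I" for c i
      using spec[OF that(1), of "v i"] Avv Bvv that(2) by simp
  qed
  then show thesis using ent by (rule that)
qed

section \<open>Fourier coefficients on the circle\<close>

text \<open>Normalised arc length on the circle, as a measure on the angle.\<close>

definition angle_measure :: "real measure" where
  "angle_measure = density lborel (\<lambda>\<theta>. ennreal (indicator {0..<2*pi} \<theta> / (2 * pi)))"

lemma sets_angle_measure [simp, measurable_cong]: "sets angle_measure = sets borel" by (simp add: angle_measure_def)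
lemma space_angle_measure [simp]: "space angle_measure = UNIV" by (simp add: angle_measure_def)

lemma integral_angle_measure:
  fixes f :: "real \<Rightarrow> 'b::{banach, second_countable_topology}"
  assumes [measurable]: "f \<in> borel_measurable borel"
  shows "(\<integral>\<theta>. f \<theta> \<partial>angle_measure) = (1 / (2 * pi)) *\<^sub>R (LINT \<theta>:{0..2*pi}|lborel. f \<theta>)"
proof -
  have "(\<integral>\<theta>. f \<theta> \<partial>angle_measure) = (\<integral>\<theta>. (indicator {0..<2*pi} \<theta> / (2 * pi)) *\<^sub>R f \<theta> \<partial>lborel)"
    unfolding angle_measure_def by (subst integral_density) auto
  also have "\<dots> = (\<integral>\<theta>. (1 / (2 * pi)) *\<^sub>R (indicator {0..2*pi} \<theta> *\<^sub>R f \<theta>) \<partial>lborel)"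
  proof (rule integral_cong_AE)
    have "AE \<theta> in lborel. \<theta> \<noteq> 2 * pi" by (rule AE_lborel_singleton)
    then show "AE \<theta> in lborel. (indicator {0..<2*pi} \<theta> / (2 * pi)) *\<^sub>R f \<theta> = (1 / (2 * pi)) *\<^sub>R (indicator {0..2*pi} \<theta> *\<^sub>R f \<theta>)"
      by eventually_elim (auto simp: indicator_def)
  qed measurable
  also have "\<dots> = (1 / (2 * pi)) *\<^sub>R (LINT \<theta>:{0..2*pi}|lborel. f \<theta>)"
    unfolding set_lebesgue_integral_def by (rule Bochner_Integration.integral_scaleR_right)
  finally show ?thesis .
qed

text \<open>With a free parameter \<open>t\<close> this stands in for the Cauchy--Schwarz inequality where products are bounded before
  they are summed or integrated; \<open>t\<close> is chosen at the end.\<close>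

lemma weighted_am_gm:
  fixes x y t :: real
  assumes "0 < t"
  shows "x * y \<le> (t * x\<^sup>2 + y\<^sup>2 / t) / 2"
proof -
  have "0 \<le> (t * x - y)\<^sup>2 / t" using assms by simp
  also have "\<dots> = t * x\<^sup>2 + y\<^sup>2 / t - 2 * (x * y)"
    using assms by (simp add: power2_diff power_mult_distrib add_divide_distrib diff_divide_distrib) (simp add: power2_eq_square)
  finally show ?thesis by simp
qed

lemma prob_space_angle_measure: "prob_space angle_measure"
proof
  have "emeasure angle_measure (space angle_measure) = (\<integral>\<^sup>+\<theta>. ennreal (1 / (2*pi)) * indicator {0..<2*pi} \<theta> \<partial>lborel)"
    unfolding angle_measure_def by (subst emeasure_density) (auto intro!: nn_integral_cong simp: indicator_def)
  also have "\<dots> = ennreal (1 / (2*pi)) * ennreal (2 * pi)"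
    by (subst nn_integral_cmult_indicator) auto
  also have "\<dots> = 1" by (simp add: ennreal_mult[symmetric])
  finally show "emeasure angle_measure (space angle_measure) = 1" .
qed

interpretation angle_measure: prob_space angle_measure by (rule prob_space_angle_measure)

lemma AE_unif_iff_lborel:
  assumes "AE \<theta> in lborel. \<theta> \<in> {0..<2*pi} \<longrightarrow> P \<theta>"
  shows "AE \<theta> in angle_measure. P \<theta>"
proof -
  have "AE \<theta> in lborel. 0 < ennreal (indicator {0..<2*pi} \<theta> / (2 * pi)) \<longrightarrow> P \<theta>"
    using assms by eventually_elim (auto simp: indicator_def split: if_splits)
  then show ?thesis unfolding angle_measure_def by (subst AE_density) auto
qed

lemma AE_unif_countable: "AE \<theta> in angle_measure. \<theta> \<notin> X" if "countable X"
proof (rule AE_unif_iff_lborel)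
  show "AE \<theta> in lborel. \<theta> \<in> {0..<2*pi} \<longrightarrow> \<theta> \<notin> X"
    using AE_not_in[OF countable_imp_null_set_lborel[OF that]] by eventually_elim simp
qed

lemma countable_cis_vimage: "finite S \<Longrightarrow> countable {\<theta>. cis \<theta> \<in> S}"
proof -
  assume fin: "finite S"
  have "countable {\<theta>. cis \<theta> = s}" for s
  proof (cases "\<exists>t. cis t = s")
    case True
    then obtain t where t: "cis t = s" ..
    have "{\<theta>. cis \<theta> = s} \<subseteq> range (\<lambda>n::int. t + 2 * pi * of_int n)"
    proof
      fix \<theta> assume "\<theta> \<in> {\<theta>. cis \<theta> = s}"
      then have "sin \<theta> = sin t \<and> cos \<theta> = cos t" using t by (auto simp: complex_eq_iff)
      then obtain n :: int where "\<theta> = t + 2 * pi * n" using sin_cos_eq_iff by blast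
      then show "\<theta> \<in> range (\<lambda>n::int. t + 2 * pi * of_int n)" by auto
    qed
    then show ?thesis by (rule countable_subset) auto
  next
    case False
    then have "{\<theta>. cis \<theta> = s} = {}" by auto
    then show ?thesis by simp
  qed
  then have "countable (\<Union>s\<in>S. {\<theta>. cis \<theta> = s})" by (intro countable_UN countable_finite[OF fin])
  moreover have "{\<theta>. cis \<theta> \<in> S} = (\<Union>s\<in>S. {\<theta>. cis \<theta> = s})" by auto
  ultimately show ?thesis by simp
qed

lemma AE_unif_cis: "finite S \<Longrightarrow> AE \<theta> in angle_measure. cis \<theta> \<notin> S"
  using AE_unif_countable[OF countable_cis_vimage] by simp

text \<open>Boundedness is what the one-sided limits of a piecewise continuous function contribute.\<close>

definition pw_cont :: "(complex \<Rightarrow> complex) \<Rightarrow> bool" where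
  "pw_cont f \<longleftrightarrow> (\<exists>S. finite S \<and> continuous_on (sphere 0 1 - S) f) \<and> (\<exists>B. \<forall>z\<in>sphere 0 1. cmod (f z) \<le> B)"

lemma pw_contI: "finite S \<Longrightarrow> continuous_on (sphere 0 1 - S) f \<Longrightarrow> (\<And>z. cmod z = 1 \<Longrightarrow> cmod (f z) \<le> B) \<Longrightarrow> pw_cont f"
  unfolding pw_cont_def by (intro conjI exI[of _ S] exI[of _ B] ballI) auto

lemma pw_contE:
  assumes "pw_cont f"
  obtains S B where "finite S" "continuous_on (sphere 0 1 - S) f" "0 < B" "\<And>z. cmod z = 1 \<Longrightarrow> cmod (f z) \<le> B"
proof -
  obtain S B where "finite S" "continuous_on (sphere 0 1 - S) f" "\<forall>z\<in>sphere 0 1. cmod (f z) \<le> B"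
    using assms unfolding pw_cont_def by blast
  then show thesis by (intro that[of S "max B 1"]) (auto simp: le_max_iff_disj)
qed

lemma pw_cont_cong: "pw_cont f \<Longrightarrow> (\<And>z. cmod z = 1 \<Longrightarrow> f z = g z) \<Longrightarrow> pw_cont g"
proof -
  assume "pw_cont f" and eq: "\<And>z. cmod z = 1 \<Longrightarrow> f z = g z"
  then obtain S B where S: "finite S" "continuous_on (sphere 0 1 - S) f" "\<And>z. cmod z = 1 \<Longrightarrow> cmod (f z) \<le> B"
    by (metis pw_contE)
  have "continuous_on (sphere 0 1 - S) g" by (rule continuous_on_eq[OF S(2)]) (use eq in auto)
  with S eq show ?thesis by (intro pw_contI[of S _ B]) auto
qed

lemma pw_cont_const [intro, simp]: "pw_cont (\<lambda>z. c)"
  by (rule pw_contI[of "{}" _ "cmod c"]) auto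

lemma pw_cont_powi [intro, simp]: "pw_cont (\<lambda>z. z powi k)"
proof (rule pw_contI[of "{}" _ 1])
  show "continuous_on (sphere 0 1 - {}) (\<lambda>z. z powi k :: complex)"
    by (auto intro!: continuous_intros)
qed (auto simp: norm_power_int)

lemma pw_cont_mult [intro]: assumes "pw_cont f" "pw_cont g" shows "pw_cont (\<lambda>z. f z * g z)"
proof -
  obtain S B where S: "finite S" "continuous_on (sphere 0 1 - S) f" "0 < B" "\<And>z. cmod z = 1 \<Longrightarrow> cmod (f z) \<le> B"
    using pw_contE[OF assms(1)] by blast
  obtain T C where T: "finite T" "continuous_on (sphere 0 1 - T) g" "0 < C" "\<And>z. cmod z = 1 \<Longrightarrow> cmod (g z) \<le> C"
    using pw_contE[OF assms(2)] by blast
  show ?thesis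
  proof (rule pw_contI[of "S \<union> T" _ "B * C"])
    show "continuous_on (sphere 0 1 - (S \<union> T)) (\<lambda>z. f z * g z)"
      by (intro continuous_on_mult continuous_on_subset[OF S(2)] continuous_on_subset[OF T(2)]) auto
    show "cmod (f z * g z) \<le> B * C" if "cmod z = 1" for z
      unfolding norm_mult by (intro mult_mono S(4) T(4) that norm_ge_zero less_imp_le[OF S(3)])
  qed (use S T in auto)
qed

lemma pw_cont_add [intro]: assumes "pw_cont f" "pw_cont g" shows "pw_cont (\<lambda>z. f z + g z)"
proof -
  obtain S B where S: "finite S" "continuous_on (sphere 0 1 - S) f" "0 < B" "\<And>z. cmod z = 1 \<Longrightarrow> cmod (f z) \<le> B"
    using pw_contE[OF assms(1)] by blast
  obtain T C where T: "finite T" "continuous_on (sphere 0 1 - T) g" "0 < C" "\<And>z. cmod z = 1 \<Longrightarrow> cmod (g z) \<le> C"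
    using pw_contE[OF assms(2)] by blast
  show ?thesis
  proof (rule pw_contI[of "S \<union> T" _ "B + C"])
    show "continuous_on (sphere 0 1 - (S \<union> T)) (\<lambda>z. f z + g z)"
      by (intro continuous_on_add continuous_on_subset[OF S(2)] continuous_on_subset[OF T(2)]) auto
    show "cmod (f z + g z) \<le> B + C" if "cmod z = 1" for z
      using norm_triangle_ineq[of "f z" "g z"] S(4)[OF that] T(4)[OF that] by linarith
  qed (use S T in auto)
qed

lemma pw_cont_cnj [intro]: assumes "pw_cont f" shows "pw_cont (\<lambda>z. cnj (f z))"
proof -
  obtain S B where S: "finite S" "continuous_on (sphere 0 1 - S) f" "0 < B" "\<And>z. cmod z = 1 \<Longrightarrow> cmod (f z) \<le> B"
    using pw_contE[OF assms] by blast
  then show ?thesis by (intro pw_contI[of S _ B] continuous_on_cnj) auto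
qed

lemma pw_cont_diff [intro]: assumes "pw_cont f" "pw_cont g" shows "pw_cont (\<lambda>z. f z - g z)"
  using pw_cont_add[OF assms(1) pw_cont_mult[OF pw_cont_const[of "-1"] assms(2)]] by simp

lemma pw_cont_sum [intro]: "(\<And>i. i \<in> K \<Longrightarrow> pw_cont (f i)) \<Longrightarrow> pw_cont (\<lambda>z. \<Sum>i\<in>K. f i z)"
  by (induction K rule: infinite_finite_induct) auto

lemma pw_cont_measurable:
  assumes "pw_cont f" shows "(\<lambda>\<theta>. f (cis \<theta>)) \<in> borel_measurable borel"
proof -
  obtain S where S: "finite S" "continuous_on (sphere 0 1 - S) f" using assms by (metis pw_contE)
  show ?thesis
  proof (rule borel_measurable_continuous_countable_exceptions[OF countable_cis_vimage[OF S(1)]])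
    show "continuous_on (- {\<theta>. cis \<theta> \<in> S}) (\<lambda>\<theta>. f (cis \<theta>))"
      by (rule continuous_on_compose2[OF S(2)]) (auto intro!: continuous_intros)
  qed
qed

lemma pw_cont_integrable: assumes "pw_cont f" shows "integrable angle_measure (\<lambda>\<theta>. f (cis \<theta>))"
proof -
  obtain B where "\<And>z. cmod z = 1 \<Longrightarrow> cmod (f z) \<le> B" using assms by (metis pw_contE)
  then show ?thesis
    using pw_cont_measurable[OF assms] by (intro angle_measure.integrable_const_bound[where B=B]) auto
qed

definition mean :: "(complex \<Rightarrow> complex) \<Rightarrow> complex" where
  "mean f = (\<integral>\<theta>. f (cis \<theta>) \<partial>angle_measure)"

definition mean_sq :: "(complex \<Rightarrow> complex) \<Rightarrow> real" where
  "mean_sq f = (\<integral>\<theta>. (cmod (f (cis \<theta>)))\<^sup>2 \<partial>angle_measure)"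

text \<open>With this sign the covariance of \<open>y (k + l)\<close> and \<open>y k\<close> is the coefficient of index \<open>l\<close>; accordingly
  \<open>f\<close> has the Fourier series with terms \<open>fourier_coef f k * z powi (- k)\<close>.\<close>

definition fourier_coef :: "(complex \<Rightarrow> complex) \<Rightarrow> int \<Rightarrow> complex" where
  "fourier_coef f k = mean (\<lambda>z. z powi k * f z)"

lemma mean_cong: "(\<And>z. cmod z = 1 \<Longrightarrow> f z = g z) \<Longrightarrow> mean f = mean g"
  unfolding mean_def by (intro Bochner_Integration.integral_cong) auto

lemma mean_sq_cong: "(\<And>z. cmod z = 1 \<Longrightarrow> f z = g z) \<Longrightarrow> mean_sq f = mean_sq g"
  unfolding mean_sq_def by (intro Bochner_Integration.integral_cong) auto

lemma mean_add: "pw_cont f \<Longrightarrow> pw_cont g \<Longrightarrow> mean (\<lambda>z. f z + g z) = mean f + mean g"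
  unfolding mean_def by (intro Bochner_Integration.integral_add pw_cont_integrable)

lemma mean_diff: "pw_cont f \<Longrightarrow> pw_cont g \<Longrightarrow> mean (\<lambda>z. f z - g z) = mean f - mean g"
  unfolding mean_def by (intro Bochner_Integration.integral_diff pw_cont_integrable)

lemma mean_cmult: "mean (\<lambda>z. c * f z) = c * mean f"
  unfolding mean_def by simp

lemma mean_sum: "(\<And>i. i \<in> K \<Longrightarrow> pw_cont (f i)) \<Longrightarrow> mean (\<lambda>z. \<Sum>i\<in>K. f i z) = (\<Sum>i\<in>K. mean (f i))"
  unfolding mean_def by (intro Bochner_Integration.integral_sum pw_cont_integrable)

lemma mean_cnj: "mean (\<lambda>z. cnj (f z)) = cnj (mean f)"
  unfolding mean_def by (rule Bochner_Integration.integral_cnj)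

lemma pw_cont_mean_sq_integrable: assumes "pw_cont f" shows "integrable angle_measure (\<lambda>\<theta>. (cmod (f (cis \<theta>)))\<^sup>2)"
proof -
  obtain B where B: "\<And>z. cmod z = 1 \<Longrightarrow> cmod (f z) \<le> B" using assms by (metis pw_contE)
  have [measurable]: "(\<lambda>\<theta>. f (cis \<theta>)) \<in> borel_measurable borel" by (rule pw_cont_measurable[OF assms])
  show ?thesis
    by (rule angle_measure.integrable_const_bound[where B="B\<^sup>2"]) (auto intro!: power_mono B)
qed

lemma mean_sq_eq_mean: assumes "pw_cont f" shows "complex_of_real (mean_sq f) = mean (\<lambda>z. f z * cnj (f z))"
proof -
  have "mean (\<lambda>z. f z * cnj (f z)) = (\<integral>\<theta>. complex_of_real ((cmod (f (cis \<theta>)))\<^sup>2) \<partial>angle_measure)"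
    unfolding mean_def by (intro Bochner_Integration.integral_cong refl) (simp only: complex_norm_square)
  also have "\<dots> = complex_of_real (mean_sq f)" unfolding mean_sq_def
    by (rule integral_of_real[OF pw_cont_mean_sq_integrable[OF assms]])
  finally show ?thesis by simp
qed

lemma mean_sq_nonneg: "0 \<le> mean_sq f" unfolding mean_sq_def by simp

lemma mean_sq_add_le: assumes "pw_cont f" "pw_cont g" shows "mean_sq (\<lambda>z. f z + g z) \<le> 2 * mean_sq f + 2 * mean_sq g"
proof -
  have "mean_sq (\<lambda>z. f z + g z) \<le> (\<integral>\<theta>. 2 * (cmod (f (cis \<theta>)))\<^sup>2 + 2 * (cmod (g (cis \<theta>)))\<^sup>2 \<partial>angle_measure)"
    unfolding mean_sq_def
  proof (rule integral_mono)
    show "integrable angle_measure (\<lambda>\<theta>. (cmod (f (cis \<theta>) + g (cis \<theta>)))\<^sup>2)"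
      by (rule pw_cont_mean_sq_integrable[OF pw_cont_add[OF assms]])
    show "integrable angle_measure (\<lambda>\<theta>. 2 * (cmod (f (cis \<theta>)))\<^sup>2 + 2 * (cmod (g (cis \<theta>)))\<^sup>2)"
      using pw_cont_mean_sq_integrable assms by (intro Bochner_Integration.integrable_add integrable_mult_right)
    show "(cmod (f (cis \<theta>) + g (cis \<theta>)))\<^sup>2 \<le> 2 * (cmod (f (cis \<theta>)))\<^sup>2 + 2 * (cmod (g (cis \<theta>)))\<^sup>2" for \<theta>
    proof -
      have "(cmod (f (cis \<theta>) + g (cis \<theta>)))\<^sup>2 \<le> (cmod (f (cis \<theta>)) + cmod (g (cis \<theta>)))\<^sup>2"
        by (intro power_mono norm_triangle_ineq norm_ge_zero)
      also have "\<dots> \<le> 2 * (cmod (f (cis \<theta>)))\<^sup>2 + 2 * (cmod (g (cis \<theta>)))\<^sup>2"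
        using sum_squares_bound[of "cmod (f (cis \<theta>))" "cmod (g (cis \<theta>))"] by (simp add: power2_sum)
      finally show ?thesis .
    qed
  qed
  also have "\<dots> = 2 * mean_sq f + 2 * mean_sq g"
    unfolding mean_sq_def using pw_cont_mean_sq_integrable assms by (subst Bochner_Integration.integral_add) auto
  finally show ?thesis .
qed

lemma mean_mult_le:
  assumes "pw_cont f" "pw_cont g" "0 < t"
  shows "cmod (mean (\<lambda>z. f z * g z)) \<le> (t * mean_sq f + mean_sq g / t) / 2"
proof -
  have "cmod (mean (\<lambda>z. f z * g z)) \<le> (\<integral>\<theta>. cmod (f (cis \<theta>) * g (cis \<theta>)) \<partial>angle_measure)"
    unfolding mean_def by (rule integral_norm_bound)
  also have "\<dots> \<le> (\<integral>\<theta>. (t * (cmod (f (cis \<theta>)))\<^sup>2 + (cmod (g (cis \<theta>)))\<^sup>2 / t) / 2 \<partial>angle_measure)"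
  proof (rule integral_mono)
    show "integrable angle_measure (\<lambda>\<theta>. cmod (f (cis \<theta>) * g (cis \<theta>)))"
      using pw_cont_integrable[OF pw_cont_mult[OF assms(1,2)]] by (rule integrable_norm)
    show "integrable angle_measure (\<lambda>\<theta>. (t * (cmod (f (cis \<theta>)))\<^sup>2 + (cmod (g (cis \<theta>)))\<^sup>2 / t) / 2)"
      using pw_cont_mean_sq_integrable assms by auto
    fix \<theta>
    show "cmod (f (cis \<theta>) * g (cis \<theta>)) \<le> (t * (cmod (f (cis \<theta>)))\<^sup>2 + (cmod (g (cis \<theta>)))\<^sup>2 / t) / 2"
      unfolding norm_mult by (rule weighted_am_gm[OF assms(3)])
  qed
  also have "\<dots> = (t * mean_sq f + mean_sq g / t) / 2"
    unfolding mean_sq_def using pw_cont_mean_sq_integrable assms by simp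
  finally show ?thesis .
qed

lemma mean_powi: "mean (\<lambda>z. z powi k) = (if k = 0 then 1 else 0)"
proof (cases "k = 0")
  case True
  then show ?thesis using angle_measure.prob_space by (simp add: mean_def)
next
  case False
  define F where "F w = exp (\<i> * of_int k * w) / (\<i> * of_int k)" for w :: complex
  have d: "((\<lambda>\<theta>. F (of_real \<theta>)) has_vector_derivative cis \<theta> powi k) (at \<theta> within X)" for \<theta> X
  proof -
    have "(F has_field_derivative exp (\<i> * of_int k * of_real \<theta>)) (at (of_real \<theta>))"
      unfolding F_def using False by (auto intro!: derivative_eq_intros)
    moreover have "exp (\<i> * of_int k * of_real \<theta>) = cis \<theta> powi k"
      by (simp add: cis_power_int) (simp add: cis_conv_exp mult.assoc)
    ultimately show ?thesis using has_vector_derivative_real_field by fastforce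
  qed
  have "(\<integral>\<theta>. indicator {0..2*pi} \<theta> *\<^sub>R (cis \<theta> powi k) \<partial>lborel) = F (of_real (2*pi)) - F (of_real 0)"
    by (rule integral_FTC_Icc[OF _ d]) (auto intro!: continuous_intros)
  also have "F (of_real (2*pi)) = F (of_real 0)"
  proof -
    have "exp (\<i> * of_int k * of_real (2 * pi)) = 1"
      using exp_integer_2pi[of "of_int k"] by (simp add: mult_ac)
    then show ?thesis by (simp add: F_def)
  qed
  finally have "(LINT \<theta>:{0..2*pi}|lborel. cis \<theta> powi k) = 0"
    by (simp add: set_lebesgue_integral_def)
  then show ?thesis
    using False integral_angle_measure[OF pw_cont_measurable[OF pw_cont_powi[of k]]] by (simp add: mean_def)
qed

lemma cnj_powi: "cmod z = 1 \<Longrightarrow> cnj (z powi k) = z powi (- k)"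
proof -
  assume z: "cmod z = 1"
  then have "z * cnj z = 1" by (simp add: complex_norm_square[symmetric])
  then have "cnj z = inverse z" using z by (metis inverse_unique)
  then show ?thesis by (simp add: power_int_inverse power_int_minus)
qed

lemma powi_add_circle: "cmod z = 1 \<Longrightarrow> z powi (k + l) = z powi k * z powi l"
  by (rule power_int_add) auto

abbreviation trig :: "int set \<Rightarrow> (int \<Rightarrow> complex) \<Rightarrow> complex \<Rightarrow> complex" where
  "trig K a z \<equiv> (\<Sum>k\<in>K. a k * z powi (- k))"

lemma mean_trig_mult:
  assumes "pw_cont f" shows "mean (\<lambda>z. trig K a z * f z) = (\<Sum>k\<in>K. a k * fourier_coef f (- k))"
proof -
  have "mean (\<lambda>z. trig K a z * f z) = mean (\<lambda>z. \<Sum>k\<in>K. a k * (z powi (- k) * f z))"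
    by (simp add: sum_distrib_right mult.assoc)
  also have "\<dots> = (\<Sum>k\<in>K. mean (\<lambda>z. a k * (z powi (- k) * f z)))"
    by (rule mean_sum) (intro pw_cont_mult pw_cont_const pw_cont_powi assms)
  finally show ?thesis by (simp add: mean_cmult fourier_coef_def)
qed

lemma fourier_coef_powi: "fourier_coef (\<lambda>z. z powi (- k)) l = (if l = k then 1 else 0)"
proof -
  have "fourier_coef (\<lambda>z. z powi (- k)) l = mean (\<lambda>z. z powi (l - k))"
    unfolding fourier_coef_def by (rule mean_cong) (simp add: powi_add_circle[symmetric])
  then show ?thesis by (simp add: mean_powi)
qed

lemma fourier_coef_cnj: "fourier_coef (\<lambda>z. cnj (f z)) k = cnj (fourier_coef f (- k))"
  unfolding fourier_coef_def mean_cnj[symmetric]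
  by (rule mean_cong) (simp add: cnj_powi del: complex_cnj_power_int)

lemma pw_cont_trig [intro, simp]: "pw_cont (trig K a)"
  by (intro pw_cont_sum pw_cont_mult pw_cont_const pw_cont_powi)

text \<open>The best approximation property of Fourier partial sums, and Bessel's inequality, can be read off from this
  identity.\<close>

lemma mean_sq_diff_trig:
  assumes f: "pw_cont f" and fin: "finite K"
  shows "mean_sq (\<lambda>z. f z - trig K a z) = mean_sq f - (\<Sum>k\<in>K. (cmod (fourier_coef f k))\<^sup>2) + (\<Sum>k\<in>K. (cmod (fourier_coef f k - a k))\<^sup>2)"
proof -
  have pf: "mean (\<lambda>z. trig K a z * cnj (f z)) = (\<Sum>k\<in>K. a k * cnj (fourier_coef f k))"
    by (subst mean_trig_mult) (auto intro: f simp: fourier_coef_cnj)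
  have "mean (\<lambda>z. cnj (trig K a z) * f z) = cnj (mean (\<lambda>z. trig K a z * cnj (f z)))"
    unfolding mean_cnj[symmetric] by (simp only: complex_cnj_mult complex_cnj_cnj)
  then have fp: "mean (\<lambda>z. f z * cnj (trig K a z)) = (\<Sum>k\<in>K. cnj (a k) * fourier_coef f k)"
    unfolding pf by (simp add: mult.commute)
  have pp: "mean (\<lambda>z. trig K a z * cnj (trig K a z)) = (\<Sum>k\<in>K. a k * cnj (a k))"
  proof -
    have "fourier_coef (trig K a) k = a k" if k: "k \<in> K" for k
    proof -
      have "fourier_coef (trig K a) k = mean (\<lambda>z. \<Sum>l\<in>K. a l * (z powi k * z powi (- l)))"
        unfolding fourier_coef_def by (simp add: sum_distrib_left mult_ac)
      also have "\<dots> = (\<Sum>l\<in>K. a l * fourier_coef (\<lambda>z. z powi (- l)) k)"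
        by (subst mean_sum, intro pw_cont_mult pw_cont_const pw_cont_powi, simp only: mean_cmult fourier_coef_def)
      also have "\<dots> = (\<Sum>l\<in>K. if l = k then a l else 0)" by (intro sum.cong) (auto simp: fourier_coef_powi)
      finally show ?thesis using k fin by simp
    qed
    then show ?thesis
      by (simp only: mean_trig_mult[OF pw_cont_cnj[OF pw_cont_trig]] fourier_coef_cnj minus_minus cong: sum.cong)
  qed
  have "complex_of_real (mean_sq (\<lambda>z. f z - trig K a z))
      = mean (\<lambda>z. (f z * cnj (f z) - f z * cnj (trig K a z)) - (trig K a z * cnj (f z) - trig K a z * cnj (trig K a z)))"
    unfolding mean_sq_eq_mean[OF pw_cont_diff[OF f pw_cont_trig]] by (rule mean_cong) (simp only: complex_cnj_diff algebra_simps)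
  also have "\<dots> = complex_of_real (mean_sq f) - (\<Sum>k\<in>K. cnj (a k) * fourier_coef f k) - ((\<Sum>k\<in>K. a k * cnj (fourier_coef f k)) - (\<Sum>k\<in>K. a k * cnj (a k)))"
    unfolding mean_sq_eq_mean[OF f] fp[symmetric] pf[symmetric] pp[symmetric]
    by (simp only: mean_diff pw_cont_diff pw_cont_mult pw_cont_cnj pw_cont_trig f)
  also have "\<dots> = complex_of_real (mean_sq f - (\<Sum>k\<in>K. (cmod (fourier_coef f k))\<^sup>2) + (\<Sum>k\<in>K. (cmod (fourier_coef f k - a k))\<^sup>2))"
  proof -
    have "(\<Sum>k\<in>K. of_real ((cmod (fourier_coef f k - a k))\<^sup>2)) = (\<Sum>k\<in>K. of_real ((cmod (fourier_coef f k))\<^sup>2))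
        - (\<Sum>k\<in>K. cnj (a k) * fourier_coef f k) - ((\<Sum>k\<in>K. a k * cnj (fourier_coef f k)) - (\<Sum>k\<in>K. a k * cnj (a k)))"
      unfolding complex_norm_square sum_subtractf[symmetric]
      by (intro sum.cong refl) (simp add: algebra_simps)
    then show ?thesis by simp
  qed
  finally show ?thesis by (simp only: of_real_eq_iff)
qed

lemma bessel: "pw_cont f \<Longrightarrow> finite K \<Longrightarrow> (\<Sum>k\<in>K. (cmod (fourier_coef f k))\<^sup>2) \<le> mean_sq f"
  using mean_sq_diff_trig[of f K "fourier_coef f"] mean_sq_nonneg[of "\<lambda>z. f z - trig K (fourier_coef f) z"] by simp

section \<open>Trigonometric polynomials are dense\<close>

definition trig_poly :: "(complex \<Rightarrow> complex) \<Rightarrow> bool" where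
  "trig_poly f \<longleftrightarrow> (\<exists>K a. finite K \<and> (\<forall>z. cmod z = 1 \<longrightarrow> f z = trig K a z))"

lemma trig_poly_monom: "trig_poly (\<lambda>z. c * z powi k)"
  unfolding trig_poly_def by (intro exI[of _ "{- k}"] exI[of _ "\<lambda>_. c"]) auto

lemma trig_poly_add: assumes "trig_poly f" "trig_poly g" shows "trig_poly (\<lambda>z. f z + g z)"
proof -
  obtain K a where K: "finite K" "\<And>z. cmod z = 1 \<Longrightarrow> f z = trig K a z" using assms(1) unfolding trig_poly_def by blast
  obtain L b where L: "finite L" "\<And>z. cmod z = 1 \<Longrightarrow> g z = trig L b z" using assms(2) unfolding trig_poly_def by blast
  have "f z + g z = trig (K \<union> L) (\<lambda>k. (if k \<in> K then a k else 0) + (if k \<in> L then b k else 0)) z" if z: "cmod z = 1" for z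
  proof -
    have "trig K a z = (\<Sum>k\<in>K \<union> L. (if k \<in> K then a k else 0) * z powi (- k))"
      using K(1) L(1) by (intro sum.mono_neutral_cong_left) auto
    moreover have "trig L b z = (\<Sum>k\<in>K \<union> L. (if k \<in> L then b k else 0) * z powi (- k))"
      using K(1) L(1) by (intro sum.mono_neutral_cong_left) auto
    ultimately show ?thesis using K(2)[OF z] L(2)[OF z] by (simp only: distrib_right sum.distrib)
  qed
  moreover have "finite (K \<union> L)" using K(1) L(1) by simp
  ultimately show ?thesis unfolding trig_poly_def
    by (intro exI[of _ "K \<union> L"] exI[of _ "\<lambda>k. (if k \<in> K then a k else 0) + (if k \<in> L then b k else 0)"]) simp
qed

lemma trig_poly_sum: "(\<And>i. i \<in> K \<Longrightarrow> trig_poly (f i)) \<Longrightarrow> trig_poly (\<lambda>z. \<Sum>i\<in>K. f i z)"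
proof (induction K rule: infinite_finite_induct)
  case (insert x F)
  then show ?case by (simp add: trig_poly_add)
qed (use trig_poly_monom[of 0 0] in simp_all)

lemma trig_poly_cong: "trig_poly f \<Longrightarrow> (\<And>z. cmod z = 1 \<Longrightarrow> g z = f z) \<Longrightarrow> trig_poly g"
  unfolding trig_poly_def by auto

lemma trig_poly_mult: assumes "trig_poly f" "trig_poly g" shows "trig_poly (\<lambda>z. f z * g z)"
proof -
  obtain K a where K: "finite K" "\<And>z. cmod z = 1 \<Longrightarrow> f z = trig K a z" using assms(1) unfolding trig_poly_def by blast
  obtain L b where L: "finite L" "\<And>z. cmod z = 1 \<Longrightarrow> g z = trig L b z" using assms(2) unfolding trig_poly_def by blast
  have "trig_poly (\<lambda>z. \<Sum>k\<in>K. \<Sum>l\<in>L. (a k * b l) * z powi (- k + - l))"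
    by (intro trig_poly_sum trig_poly_monom)
  then show ?thesis
  proof (rule trig_poly_cong)
    fix z :: complex assume z: "cmod z = 1"
    show "f z * g z = (\<Sum>k\<in>K. \<Sum>l\<in>L. (a k * b l) * z powi (- k + - l))"
      unfolding K(2)[OF z] L(2)[OF z] sum_product powi_add_circle[OF z] by (simp only: mult_ac)
  qed
qed

text \<open>On the circle, \<open>Re z\<close> and \<open>Im z\<close> are trigonometric polynomials; this turns the Stone--Weierstrass theorem
  for real polynomial functions in the plane into one for trigonometric polynomials.\<close>

lemma trig_poly_real_polynomial:
  fixes p :: "complex \<Rightarrow> real"
  assumes "real_polynomial_function p"
  shows "trig_poly (\<lambda>z. of_real (p z))"
  using assms
proof (induction rule: real_polynomial_function.induct)
  case (linear f)
  then interpret bounded_linear f .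
  have f: "f z = Re z * f 1 + Im z * f \<i>" for z
  proof -
    have "z = Re z *\<^sub>R 1 + Im z *\<^sub>R \<i>" by (simp add: complex_eq_iff)
    then have "f z = f (Re z *\<^sub>R 1 + Im z *\<^sub>R \<i>)" by simp
    then show ?thesis by (simp only: add scaleR real_scaleR_def)
  qed
  have "trig_poly (\<lambda>z. ((f 1 - \<i> * f \<i>) / 2) * z powi 1 + ((f 1 + \<i> * f \<i>) / 2) * z powi (-1))"
    by (intro trig_poly_add trig_poly_monom)
  then show ?case
  proof (rule trig_poly_cong)
    fix z :: complex assume z: "cmod z = 1"
    have c: "z powi (-1) = cnj z" using cnj_powi[OF z, of 1] by simp
    show "of_real (f z) = ((f 1 - \<i> * f \<i>) / 2) * z powi 1 + ((f 1 + \<i> * f \<i>) / 2) * z powi (-1)"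
      unfolding f[of z] c power_int_1_right by (simp add: complex_eq_iff field_simps)
  qed
next
  case (const c)
  then show ?case using trig_poly_monom[of "of_real c" 0] by simp
next
  case (add f g)
  then show ?case by (simp add: trig_poly_add)
next
  case (mult f g)
  then show ?case by (simp add: trig_poly_mult)
qed

lemma trig_poly_pw_cont: assumes "trig_poly f" shows "pw_cont f"
proof -
  obtain K a where K: "finite K" "\<And>z. cmod z = 1 \<Longrightarrow> f z = trig K a z" using assms unfolding trig_poly_def by blast
  have "pw_cont (trig K a)" by (rule pw_cont_trig)
  then show ?thesis by (rule pw_cont_cong) (simp add: K(2))
qed

lemma mean_sq_le_sup:
  assumes "pw_cont f" and "\<And>z. cmod z = 1 \<Longrightarrow> cmod (f z) \<le> e"
  shows "mean_sq f \<le> e\<^sup>2"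
proof -
  have "mean_sq f \<le> (\<integral>\<theta>. e\<^sup>2 \<partial>angle_measure)"
    unfolding mean_sq_def by (intro integral_mono pw_cont_mean_sq_integrable[OF assms(1)] power_mono assms(2)) auto
  then show ?thesis using angle_measure.prob_space by simp
qed

lemma continuous_trig_poly_dense:
  assumes "continuous_on (sphere 0 1) g" "0 < e"
  obtains q where "trig_poly q" "mean_sq (\<lambda>z. g z - q z) < e"
proof -
  define d where "d = sqrt (e / 2)"
  have d: "0 < d" "d\<^sup>2 < e" using assms(2) by (auto simp: d_def)
  obtain p where p: "polynomial_function p" "\<And>z. z \<in> sphere 0 1 \<Longrightarrow> norm (g z - p z) < d"
    using Stone_Weierstrass_polynomial_function[OF compact_sphere assms(1) d(1)] by blast
  have "real_polynomial_function (Re \<circ> p)" "real_polynomial_function (Im \<circ> p)"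
    using p(1) bounded_linear_Re bounded_linear_Im unfolding polynomial_function_def by auto
  then have "trig_poly (\<lambda>z. of_real ((Re \<circ> p) z) + (\<i> * z powi 0) * of_real ((Im \<circ> p) z))"
    by (intro trig_poly_add trig_poly_mult trig_poly_real_polynomial trig_poly_monom)
  then have tp: "trig_poly p" by (rule trig_poly_cong) (simp add: complex_eq)
  obtain B where "\<forall>x\<in>g ` sphere 0 1. cmod x \<le> B"
    using compact_imp_bounded[OF compact_continuous_image[OF assms(1) compact_sphere]]
    unfolding bounded_iff by blast
  then have B: "cmod (g z) \<le> B" if "cmod z = 1" for z using that by auto
  have "pw_cont g" using assms(1) B by (intro pw_contI[of "{}" _ B]) auto
  then have "pw_cont (\<lambda>z. g z - p z)" using trig_poly_pw_cont[OF tp] by (intro pw_cont_diff)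
  then have "mean_sq (\<lambda>z. g z - p z) \<le> d\<^sup>2" by (rule mean_sq_le_sup) (use p(2) in \<open>auto intro: less_imp_le\<close>)
  with d(2) tp that show thesis by fastforce
qed

text \<open>Multiplication by a cut-off that vanishes at the discontinuities makes \<open>f\<close> continuous, at a small cost
  in mean square by dominated convergence.\<close>

lemma trig_poly_dense:
  assumes f: "pw_cont f" and e: "0 < e"
  obtains q where "trig_poly q" "mean_sq (\<lambda>z. f z - q z) < e"
proof -
  obtain S0 B where S0: "finite S0" "continuous_on (sphere 0 1 - S0) f" "0 < B" "\<And>z. cmod z = 1 \<Longrightarrow> cmod (f z) \<le> B"
    using pw_contE[OF f] by blast
  \<comment> \<open>The distance to the empty set is \<open>0\<close> by convention, so a point is inserted.\<close>
  define S where "S = insert 1 S0"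
  have S: "finite S" "S \<noteq> {}" "closed S" "continuous_on (sphere 0 1 - S) f"
    using S0 by (auto simp: S_def intro: continuous_on_subset finite_imp_closed)
  define \<phi> where "\<phi> n z = min 1 (real (Suc n) * infdist z S)" for n z
  have phi01: "0 \<le> \<phi> n z" "\<phi> n z \<le> 1" for n z by (auto simp: \<phi>_def infdist_nonneg)
  have phic: "continuous_on X (\<phi> n)" for X n unfolding \<phi>_def
    by (intro continuous_intros)
  have phi0: "\<phi> n z = 0" if "z \<in> S" for n z using that by (simp add: \<phi>_def)
  define g where "g n z = of_real (\<phi> n z) * f z" for n z
  have gc: "continuous_on (sphere 0 1) (g n)" for n
    unfolding continuous_on_eq_continuous_within
  proof
    fix z :: complex assume z: "z \<in> sphere 0 1"
    show "continuous (at z within sphere 0 1) (g n)"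
    proof (cases "z \<in> S")
      case False
      have "continuous_on (sphere 0 1 - S) (g n)"
        unfolding g_def by (intro continuous_on_mult S(4) continuous_on_of_real phic)
      then have "continuous (at z within (sphere 0 1 - S)) (g n)"
        using z False by (simp add: continuous_on_eq_continuous_within)
      moreover have "at z within (sphere 0 1 - S) = at z within sphere 0 1"
        using False S(3) by (intro at_within_nhd[of z "- S"]) auto
      ultimately show ?thesis by (simp add: continuous_within)
    next
      case True
      have "((\<lambda>w. \<phi> n w * B) \<longlongrightarrow> \<phi> n z * B) (at z within sphere 0 1)"
        using phic[of "sphere 0 1" n] z by (intro tendsto_intros) (auto simp: continuous_on_def)
      then have "((\<lambda>w. \<phi> n w * B) \<longlongrightarrow> 0) (at z within sphere 0 1)" using phi0[OF True] by simp
      then have "(g n \<longlongrightarrow> 0) (at z within sphere 0 1)"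
      proof (rule Lim_null_comparison[rotated])
        show "\<forall>\<^sub>F w in at z within sphere 0 1. norm (g n w) \<le> \<phi> n w * B"
          unfolding eventually_at_topological
          by (intro exI[of _ UNIV]) (auto simp: g_def norm_mult phi01 intro!: mult_left_mono S0(4))
      qed
      then show ?thesis using phi0[OF True] by (simp add: continuous_within g_def)
    qed
  qed
  have gB: "cmod (g n z) \<le> B" if "cmod z = 1" for n z
  proof -
    have "\<phi> n z * cmod (f z) \<le> 1 * B"
      by (intro mult_mono phi01 S0(4) that) auto
    then show ?thesis by (simp add: g_def norm_mult phi01)
  qed
  have gpc: "pw_cont (g n)" for n using gc gB by (intro pw_contI[of "{}" _ B]) auto
  have "(\<lambda>n. mean_sq (\<lambda>z. f z - g n z)) \<longlonglongrightarrow> (\<integral>\<theta>. 0 \<partial>angle_measure)"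
    unfolding mean_sq_def
  proof (rule integral_dominated_convergence[where w="\<lambda>_. (2 * B)\<^sup>2"])
    show "(\<lambda>\<theta>. (cmod (f (cis \<theta>) - g n (cis \<theta>)))\<^sup>2) \<in> borel_measurable angle_measure" for n
      by (rule borel_measurable_integrable[OF pw_cont_mean_sq_integrable[OF pw_cont_diff[OF f gpc]]])
    show "AE \<theta> in angle_measure. (\<lambda>n. (cmod (f (cis \<theta>) - g n (cis \<theta>)))\<^sup>2) \<longlonglongrightarrow> 0"
      using AE_unif_cis[OF S(1)]
    proof eventually_elim
      case (elim \<theta>)
      then have "infdist (cis \<theta>) S > 0" using S by (metis infdist_nonneg in_closed_iff_infdist_zero order_le_less)
      then obtain n0 where n0: "1 < real n0 * infdist (cis \<theta>) S" using reals_Archimedean3 by blast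
      have "\<forall>\<^sub>F n in sequentially. (cmod (f (cis \<theta>) - g n (cis \<theta>)))\<^sup>2 = 0"
      proof (rule eventually_sequentiallyI[of n0])
        fix n assume "n0 \<le> n"
        then have "real n0 * infdist (cis \<theta>) S \<le> real (Suc n) * infdist (cis \<theta>) S"
          by (intro mult_right_mono infdist_nonneg) auto
        then have "\<phi> n (cis \<theta>) = 1" using n0 by (simp add: \<phi>_def)
        then show "(cmod (f (cis \<theta>) - g n (cis \<theta>)))\<^sup>2 = 0" by (simp add: g_def)
      qed
      then show ?case by (rule tendsto_eventually)
    qed
    show "AE \<theta> in angle_measure. norm ((cmod (f (cis \<theta>) - g n (cis \<theta>)))\<^sup>2) \<le> (2 * B)\<^sup>2" for n
    proof (rule AE_I2)
      fix \<theta>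
      have "cmod (f (cis \<theta>) - g n (cis \<theta>)) \<le> 2 * B"
        using norm_triangle_ineq4[of "f (cis \<theta>)" "g n (cis \<theta>)"] S0(4)[of "cis \<theta>"] gB[of "cis \<theta>" n] by simp
      from power_mono[OF this, of 2]
      show "norm ((cmod (f (cis \<theta>) - g n (cis \<theta>)))\<^sup>2) \<le> (2 * B)\<^sup>2" by simp
    qed
  qed auto
  then have "\<forall>\<^sub>F n in sequentially. mean_sq (\<lambda>z. f z - g n z) < e / 4"
    using e by (intro order_tendstoD(2)[where y=0]) auto
  then obtain n where n: "mean_sq (\<lambda>z. f z - g n z) < e / 4" by (auto simp: eventually_sequentially)
  obtain q where q: "trig_poly q" "mean_sq (\<lambda>z. g n z - q z) < e / 4"
    using continuous_trig_poly_dense[OF gc, of "e / 4" n] e by auto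
  have "mean_sq (\<lambda>z. f z - q z) = mean_sq (\<lambda>z. (f z - g n z) + (g n z - q z))" by simp
  also have "\<dots> \<le> 2 * mean_sq (\<lambda>z. f z - g n z) + 2 * mean_sq (\<lambda>z. g n z - q z)"
    by (intro mean_sq_add_le pw_cont_diff f gpc trig_poly_pw_cont q)
  also have "\<dots> < e" using n q(2) by simp
  finally show thesis using that q(1) by blast
qed

text \<open>A partial sum is at least as close to \<open>f\<close> as any trigonometric polynomial of the same degree.\<close>

lemma fourier_partial_sums:
  assumes f: "pw_cont f"
  shows "(\<lambda>n. mean_sq (\<lambda>z. f z - trig {- int n..int n} (fourier_coef f) z)) \<longlonglongrightarrow> 0"
proof (rule LIMSEQ_I)
  fix e :: real assume e: "0 < e"
  obtain q where q: "trig_poly q" "mean_sq (\<lambda>z. f z - q z) < e" using trig_poly_dense[OF f e] by blast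
  obtain K a where K: "finite K" "\<And>z. cmod z = 1 \<Longrightarrow> q z = trig K a z" using q(1) unfolding trig_poly_def by blast
  obtain n0 :: nat where n0: "\<And>k. k \<in> K \<Longrightarrow> \<bar>k\<bar> \<le> int n0"
  proof -
    have "\<bar>k\<bar> \<le> int (nat (\<Sum>k\<in>K. \<bar>k\<bar>))" if "k \<in> K" for k
      using member_le_sum[OF that, of abs] K(1) by (simp add: sum_nonneg)
    then show ?thesis using that by blast
  qed
  have "norm (mean_sq (\<lambda>z. f z - trig {- int n..int n} (fourier_coef f) z) - 0) < e" if n: "n \<ge> n0" for n
  proof -
    let ?N = "{- int n..int n}"
    let ?a = "\<lambda>k. if k \<in> K then a k else 0"
    have "K \<subseteq> ?N" using n0 n by fastforce
    then have mat_trace: "trig ?N ?a z = trig K a z" for z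
      by (intro sum.mono_neutral_cong_right) auto
    have "mean_sq (\<lambda>z. f z - trig ?N (fourier_coef f) z) \<le> mean_sq (\<lambda>z. f z - trig ?N ?a z)"
      using f by (simp add: mean_sq_diff_trig sum_nonneg del: sum.If_cases)
    also have "\<dots> = mean_sq (\<lambda>z. f z - q z)" unfolding mat_trace by (rule mean_sq_cong) (simp add: K(2))
    finally show ?thesis using q(2) mean_sq_nonneg[of "\<lambda>z. f z - trig ?N (fourier_coef f) z"] by simp
  qed
  then show "\<exists>n0. \<forall>n\<ge>n0. norm (mean_sq (\<lambda>z. f z - trig {- int n..int n} (fourier_coef f) z) - 0) < e" by blast
qed

section \<open>Averages of Toeplitz products\<close>

text \<open>The normalised trace of the product of two Toeplitz matrices with scalar symbols \<open>f\<close> and \<open>g\<close>.\<close>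

definition toeplitz_avg :: "nat \<Rightarrow> (complex \<Rightarrow> complex) \<Rightarrow> (complex \<Rightarrow> complex) \<Rightarrow> complex" where
  "toeplitz_avg n f g = (\<Sum>l\<in>{- int n..int n}. \<Sum>p\<in>{- int n..int n}. fourier_coef f (p - l) * fourier_coef g (l - p)) / of_nat (2 * n + 1)"

lemma fourier_coef_diff: "pw_cont f \<Longrightarrow> pw_cont g \<Longrightarrow> fourier_coef (\<lambda>z. f z - g z) k = fourier_coef f k - fourier_coef g k"
  unfolding fourier_coef_def by (simp add: right_diff_distrib mean_diff pw_cont_mult)

lemma toeplitz_avg_diff: "pw_cont f \<Longrightarrow> pw_cont f' \<Longrightarrow> toeplitz_avg n (\<lambda>z. f z - f' z) g = toeplitz_avg n f g - toeplitz_avg n f' g"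
  unfolding toeplitz_avg_def by (simp add: fourier_coef_diff left_diff_distrib sum_subtractf diff_divide_distrib)

text \<open>Uniform in \<open>n\<close>, since each row is bounded by Bessel's inequality; this makes the limit
  stable under approximation in mean square.\<close>

lemma toeplitz_avg_le:
  assumes f: "pw_cont f" and g: "pw_cont g" and t: "0 < t"
  shows "cmod (toeplitz_avg n f g) \<le> (t * mean_sq f + mean_sq g / t) / 2"
proof -
  let ?N = "{- int n..int n}"
  have cardN: "card ?N = 2 * n + 1" by simp
  have "cmod (\<Sum>l\<in>?N. \<Sum>p\<in>?N. fourier_coef f (p - l) * fourier_coef g (l - p))
     \<le> (\<Sum>l\<in>?N. \<Sum>p\<in>?N. (t * (cmod (fourier_coef f (p - l)))\<^sup>2 + (cmod (fourier_coef g (l - p)))\<^sup>2 / t) / 2)"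
    by (intro order_trans[OF norm_sum] sum_mono) (simp only: norm_mult weighted_am_gm[OF t])
  also have "\<dots> \<le> (\<Sum>l\<in>?N. (t * mean_sq f + mean_sq g / t) / 2)"
  proof (rule sum_mono)
    fix l
    have 1: "(\<Sum>p\<in>?N. (cmod (fourier_coef f (p - l)))\<^sup>2) \<le> mean_sq f"
    proof -
      have "(\<Sum>p\<in>?N. (cmod (fourier_coef f (p - l)))\<^sup>2) = (\<Sum>k\<in>(\<lambda>p. p - l) ` ?N. (cmod (fourier_coef f k))\<^sup>2)"
        by (subst sum.reindex) (auto simp: inj_on_def)
      then show ?thesis using bessel[OF f] by simp
    qed
    have 2: "(\<Sum>p\<in>?N. (cmod (fourier_coef g (l - p)))\<^sup>2) \<le> mean_sq g"
    proof -
      have "(\<Sum>p\<in>?N. (cmod (fourier_coef g (l - p)))\<^sup>2) = (\<Sum>k\<in>(\<lambda>p. l - p) ` ?N. (cmod (fourier_coef g k))\<^sup>2)"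
        by (subst sum.reindex) (auto simp: inj_on_def)
      then show ?thesis using bessel[OF g] by simp
    qed
    have "(\<Sum>p\<in>?N. (t * (cmod (fourier_coef f (p - l)))\<^sup>2 + (cmod (fourier_coef g (l - p)))\<^sup>2 / t) / 2)
      = (t * (\<Sum>p\<in>?N. (cmod (fourier_coef f (p - l)))\<^sup>2) + (\<Sum>p\<in>?N. (cmod (fourier_coef g (l - p)))\<^sup>2) / t) / 2"
      by (simp add: sum_distrib_left sum_divide_distrib sum.distrib add_divide_distrib)
    also have "\<dots> \<le> (t * mean_sq f + mean_sq g / t) / 2"
      using 1 2 t by (intro divide_right_mono add_mono mult_left_mono) auto
    finally show "(\<Sum>p\<in>?N. (t * (cmod (fourier_coef f (p - l)))\<^sup>2 + (cmod (fourier_coef g (l - p)))\<^sup>2 / t) / 2) \<le> (t * mean_sq f + mean_sq g / t) / 2" .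
  qed
  also have "\<dots> = real (2 * n + 1) * ((t * mean_sq f + mean_sq g / t) / 2)" by simp
  finally show ?thesis
    unfolding toeplitz_avg_def norm_divide by (simp add: divide_le_eq mult.commute norm_of_nat del: of_nat_add of_nat_mult of_nat_Suc)
qed

text \<open>For a monomial only one coefficient of \<open>g\<close> contributes, with the proportion of the rows in which the shift
  by \<open>a\<close> stays in the window; this proportion tends to \<open>1\<close>.\<close>

lemma toeplitz_avg_monom:
  shows "(\<lambda>n. toeplitz_avg n (\<lambda>z. z powi (- a)) g) \<longlonglongrightarrow> mean (\<lambda>z. z powi (- a) * g z)"
proof -
  have eq: "toeplitz_avg n (\<lambda>z. z powi (- a)) g = of_real (real (card {l\<in>{- int n..int n}. a + l \<in> {- int n..int n}}) / real (2 * n + 1)) * fourier_coef g (- a)" for n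
  proof -
    let ?N = "{- int n..int n}"
    have "(\<Sum>l\<in>?N. \<Sum>p\<in>?N. fourier_coef (\<lambda>z. z powi (- a)) (p - l) * fourier_coef g (l - p)) = (\<Sum>l\<in>?N. \<Sum>p\<in>?N. if p = a + l then fourier_coef g (- a) else 0)"
      by (intro sum.cong refl) (auto simp: fourier_coef_powi)
    also have "\<dots> = (\<Sum>l\<in>?N. if a + l \<in> ?N then fourier_coef g (- a) else 0)" by (intro sum.cong refl) (simp add: sum.delta)
    also have "\<dots> = of_nat (card {l\<in>?N. a + l \<in> ?N}) * fourier_coef g (- a)"
      by (subst sum.inter_filter[symmetric]) auto
    finally show ?thesis by (simp add: toeplitz_avg_def)
  qed
  have lim: "(\<lambda>n. real (card {l\<in>{- int n..int n}. a + l \<in> {- int n..int n}}) / real (2 * n + 1)) \<longlonglongrightarrow> 1"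
  proof (rule tendsto_sandwich)
    have "filterlim (\<lambda>n. real (2 * n + 1)) at_top sequentially"
      by (rule filterlim_compose[OF filterlim_real_sequentially filterlim_subseq]) (simp add: strict_mono_def)
    then have "(\<lambda>n. real_of_int \<bar>a\<bar> / real (2 * n + 1)) \<longlonglongrightarrow> 0"
      by (intro tendsto_divide_0[OF tendsto_const] filterlim_at_top_imp_at_infinity)
    then show "(\<lambda>n. 1 - real_of_int \<bar>a\<bar> / real (2 * n + 1)) \<longlonglongrightarrow> 1"
      using tendsto_diff[OF tendsto_const[of 1]] by fastforce
    show "(\<lambda>n. 1) \<longlonglongrightarrow> (1::real)" by simp
    have lo: "1 - real_of_int \<bar>a\<bar> / real (2 * n + 1) \<le> real (card {l\<in>{- int n..int n}. a + l \<in> {- int n..int n}}) / real (2 * n + 1)" for n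
    proof -
      have "{l\<in>{- int n..int n}. a + l \<in> {- int n..int n}} = {max (- int n) (- int n - a)..min (int n) (int n - a)}" by auto
      then have "int (card {l\<in>{- int n..int n}. a + l \<in> {- int n..int n}}) \<ge> int (2 * n + 1) - \<bar>a\<bar>" by auto
      then have "real_of_int (int (card {l\<in>{- int n..int n}. a + l \<in> {- int n..int n}})) \<ge> real_of_int (int (2 * n + 1) - \<bar>a\<bar>)"
        by (simp only: of_int_le_iff)
      then have "real (card {l\<in>{- int n..int n}. a + l \<in> {- int n..int n}}) \<ge> real (2 * n + 1) - real_of_int \<bar>a\<bar>" by simp
      then have "(real (2 * n + 1) - real_of_int \<bar>a\<bar>) / real (2 * n + 1) \<le> real (card {l\<in>{- int n..int n}. a + l \<in> {- int n..int n}}) / real (2 * n + 1)"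
        by (intro divide_right_mono) auto
      then show ?thesis by (simp add: diff_divide_distrib)
    qed
    then show "\<forall>\<^sub>F n in sequentially. 1 - real_of_int \<bar>a\<bar> / real (2 * n + 1) \<le> real (card {l\<in>{- int n..int n}. a + l \<in> {- int n..int n}}) / real (2 * n + 1)" by simp
    have "card {l\<in>{- int n..int n}. a + l \<in> {- int n..int n}} \<le> 2 * n + 1" for n
    proof -
      have "card {l\<in>{- int n..int n}. a + l \<in> {- int n..int n}} \<le> card {- int n..int n}"
        by (rule card_mono) auto
      also have "\<dots> = 2 * n + 1" by simp
      finally show ?thesis .
    qed
    then have "real (card {l\<in>{- int n..int n}. a + l \<in> {- int n..int n}}) / real (2 * n + 1) \<le> 1" for n
      by (subst divide_le_eq_1) (auto simp only: of_nat_le_iff)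
    then show "\<forall>\<^sub>F n in sequentially. real (card {l\<in>{- int n..int n}. a + l \<in> {- int n..int n}}) / real (2 * n + 1) \<le> 1" by simp
  qed
  have "(\<lambda>n. of_real (real (card {l\<in>{- int n..int n}. a + l \<in> {- int n..int n}}) / real (2 * n + 1)) * fourier_coef g (- a)) \<longlonglongrightarrow> of_real 1 * fourier_coef g (- a)"
    by (intro tendsto_mult tendsto_of_real lim tendsto_const)
  then show ?thesis unfolding eq by (simp add: fourier_coef_def)
qed

lemma toeplitz_avg_tendsto:
  assumes f: "pw_cont f" and g: "pw_cont g"
  shows "(\<lambda>n. toeplitz_avg n f g) \<longlonglongrightarrow> mean (\<lambda>z. f z * g z)"
proof (rule LIMSEQ_I)
  fix e :: real assume e: "0 < e"
  \<comment> \<open>This \<open>t\<close> bounds the share of \<open>g\<close> in the estimate of \<open>toeplitz_avg\<close>, and then \<open>d\<close> that of \<open>f - q\<close>.\<close>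
  define t where "t = 2 * (mean_sq g + 1) / e"
  have t: "0 < t" using e mean_sq_nonneg[of g] by (simp add: t_def)
  define d where "d = e / (2 * t)"
  have d: "0 < d" using e t by (simp add: d_def)
  obtain q where q: "trig_poly q" "mean_sq (\<lambda>z. f z - q z) < d" using trig_poly_dense[OF f d] by blast
  have pq: "pw_cont q" by (rule trig_poly_pw_cont[OF q(1)])
  define E where "E = (t * mean_sq (\<lambda>z. f z - q z) + mean_sq g / t) / 2"
  have small: "E < e / 2"
  proof -
    have "t * mean_sq (\<lambda>z. f z - q z) < t * d" using t q(2) by simp
    also have "t * d = e / 2" using t by (simp add: d_def)
    finally have 1: "t * mean_sq (\<lambda>z. f z - q z) < e / 2" .
    have "mean_sq g / t = (e / 2) * (mean_sq g / (mean_sq g + 1))" by (simp add: t_def)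
    also have "\<dots> \<le> (e / 2) * 1" using e mean_sq_nonneg[of g] by (intro mult_left_mono) (auto simp: divide_le_eq_1)
    finally show ?thesis using 1 by (simp add: E_def)
  qed
  obtain K a where K: "finite K" "\<And>z. cmod z = 1 \<Longrightarrow> q z = trig K a z" using q(1) unfolding trig_poly_def by blast
  have "(\<lambda>n. toeplitz_avg n q g) \<longlonglongrightarrow> mean (\<lambda>z. q z * g z)"
  proof -
    have c: "fourier_coef q k = (\<Sum>l\<in>K. a l * fourier_coef (\<lambda>z. z powi (- l)) k)" for k
    proof -
      have "fourier_coef q k = mean (\<lambda>z. \<Sum>l\<in>K. a l * (z powi k * z powi (- l)))"
        unfolding fourier_coef_def by (rule mean_cong) (simp add: K(2) sum_distrib_left mult_ac)
      also have "\<dots> = (\<Sum>l\<in>K. mean (\<lambda>z. a l * (z powi k * z powi (- l))))"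
        by (rule mean_sum) (intro pw_cont_mult pw_cont_const pw_cont_powi)
      finally show ?thesis by (simp add: mean_cmult fourier_coef_def)
    qed
    have "toeplitz_avg n q g = (\<Sum>l\<in>K. a l * toeplitz_avg n (\<lambda>z. z powi (- l)) g)" for n
    proof -
      let ?N = "{- int n..int n}"
      have "(\<Sum>l\<in>?N. \<Sum>p\<in>?N. fourier_coef q (p - l) * fourier_coef g (l - p))
         = (\<Sum>l\<in>?N. \<Sum>p\<in>?N. \<Sum>k\<in>K. a k * (fourier_coef (\<lambda>z. z powi (- k)) (p - l) * fourier_coef g (l - p)))"
        unfolding c by (simp add: sum_distrib_right mult.assoc)
      also have "\<dots> = (\<Sum>l\<in>?N. \<Sum>k\<in>K. \<Sum>p\<in>?N. a k * (fourier_coef (\<lambda>z. z powi (- k)) (p - l) * fourier_coef g (l - p)))"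
        by (intro sum.cong refl sum.swap)
      also have "\<dots> = (\<Sum>k\<in>K. \<Sum>l\<in>?N. \<Sum>p\<in>?N. a k * (fourier_coef (\<lambda>z. z powi (- k)) (p - l) * fourier_coef g (l - p)))"
        by (rule sum.swap)
      also have "\<dots> = (\<Sum>k\<in>K. a k * (\<Sum>l\<in>?N. \<Sum>p\<in>?N. fourier_coef (\<lambda>z. z powi (- k)) (p - l) * fourier_coef g (l - p)))"
        by (simp only: sum_distrib_left)
      finally have X: "(\<Sum>l\<in>?N. \<Sum>p\<in>?N. fourier_coef q (p - l) * fourier_coef g (l - p))
        = (\<Sum>k\<in>K. a k * (\<Sum>l\<in>?N. \<Sum>p\<in>?N. fourier_coef (\<lambda>z. z powi (- k)) (p - l) * fourier_coef g (l - p)))" .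
      show ?thesis unfolding toeplitz_avg_def X by (simp only: sum_divide_distrib[where A=K] times_divide_eq_right)
    qed
    moreover have "mean (\<lambda>z. q z * g z) = (\<Sum>l\<in>K. a l * mean (\<lambda>z. z powi (- l) * g z))"
    proof -
      have "mean (\<lambda>z. q z * g z) = mean (\<lambda>z. trig K a z * g z)" by (rule mean_cong) (simp add: K(2))
      then show ?thesis by (simp only: mean_trig_mult[OF g] fourier_coef_def)
    qed
    ultimately show ?thesis by (simp only:) (intro tendsto_sum tendsto_mult tendsto_const toeplitz_avg_monom)
  qed
  moreover have "0 < e - 2 * E" using small by simp
  ultimately obtain n0 where n0: "\<And>n. n \<ge> n0 \<Longrightarrow> norm (toeplitz_avg n q g - mean (\<lambda>z. q z * g z)) < e - 2 * E"
    using LIMSEQ_D by blast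
  have "norm (toeplitz_avg n f g - mean (\<lambda>z. f z * g z)) < e" if n: "n \<ge> n0" for n
  proof -
    have "toeplitz_avg n f g - toeplitz_avg n q g = toeplitz_avg n (\<lambda>z. f z - q z) g"
      by (rule toeplitz_avg_diff[OF f pq, symmetric])
    then have 1: "cmod (toeplitz_avg n f g - toeplitz_avg n q g) \<le> E"
      using toeplitz_avg_le[OF pw_cont_diff[OF f pq] g t, of n] by (simp add: E_def)
    have "mean (\<lambda>z. f z * g z) - mean (\<lambda>z. q z * g z) = mean (\<lambda>z. (f z - q z) * g z)"
      unfolding left_diff_distrib by (rule mean_diff[symmetric]) (intro pw_cont_mult f g pq)+
    then have 2: "cmod (mean (\<lambda>z. f z * g z) - mean (\<lambda>z. q z * g z)) \<le> E"
      using mean_mult_le[OF pw_cont_diff[OF f pq] g t] by (simp add: E_def)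
    have eq: "toeplitz_avg n f g - mean (\<lambda>z. f z * g z) = (toeplitz_avg n f g - toeplitz_avg n q g)
       + (toeplitz_avg n q g - mean (\<lambda>z. q z * g z)) - (mean (\<lambda>z. f z * g z) - mean (\<lambda>z. q z * g z))" by simp
    have "cmod (toeplitz_avg n f g - mean (\<lambda>z. f z * g z)) \<le> cmod (toeplitz_avg n f g - toeplitz_avg n q g)
       + cmod (toeplitz_avg n q g - mean (\<lambda>z. q z * g z)) + cmod (mean (\<lambda>z. f z * g z) - mean (\<lambda>z. q z * g z))"
      unfolding eq
      using norm_triangle_ineq4[of "(toeplitz_avg n f g - toeplitz_avg n q g) + (toeplitz_avg n q g - mean (\<lambda>z. q z * g z))"
          "mean (\<lambda>z. f z * g z) - mean (\<lambda>z. q z * g z)"]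
        norm_triangle_ineq[of "toeplitz_avg n f g - toeplitz_avg n q g" "toeplitz_avg n q g - mean (\<lambda>z. q z * g z)"]
      by linarith
    also have "\<dots> < e" using 1 2 n0[OF n] by linarith
    finally show ?thesis .
  qed
  then show "\<exists>n0. \<forall>n\<ge>n0. norm (toeplitz_avg n f g - mean (\<lambda>z. f z * g z)) < e" by blast
qed

section \<open>Coercive matrices and matrix symbols\<close>

definition herm_form :: "complex^'m^'m \<Rightarrow> complex^'m \<Rightarrow> complex" where
  "herm_form A v = (\<Sum>i\<in>UNIV. \<Sum>j\<in>UNIV. cnj (v $ i) * A $ i $ j * v $ j)"

text \<open>A bound on the real part of the form passes to averages, convex combinations and Toeplitz matrices.\<close>

definition coercive_mat :: "real \<Rightarrow> complex^'m^'m \<Rightarrow> bool" where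
  "coercive_mat \<alpha> A \<longleftrightarrow> (\<forall>v. \<alpha> * (norm v)\<^sup>2 \<le> Re (herm_form A v))"

lemma norm_vec_power2: "(norm (v::complex^'m))\<^sup>2 = (\<Sum>i\<in>UNIV. (cmod (v $ i))\<^sup>2)"
  unfolding norm_vec_def L2_set_def by (simp add: sum_nonneg)

lemma herm_form_mult: "herm_form A v = (\<Sum>i\<in>UNIV. cnj (v $ i) * (A *v v) $ i)"
  unfolding herm_form_def matrix_vector_mult_def by (simp add: sum_distrib_left mult.assoc)

lemma coercive_mat_solve_bound:
  assumes "0 < \<alpha>" "coercive_mat \<alpha> A" "A *v x = axis j 1"
  shows "cmod (x $ i) \<le> 1 / \<alpha>"
proof -
  have "herm_form A x = (\<Sum>i\<in>UNIV. if i = j then cnj (x $ i) else 0)"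
    unfolding herm_form_mult assms(3) by (intro sum.cong refl) (auto simp: axis_def)
  then have q: "herm_form A x = cnj (x $ j)" by simp
  have "\<alpha> * (norm x)\<^sup>2 \<le> Re (herm_form A x)" using assms(2) by (simp add: coercive_mat_def)
  also have "\<dots> \<le> cmod (x $ j)" unfolding q using complex_Re_le_cmod[of "cnj (x $ j)"] by simp
  also have "\<dots> \<le> norm x" by (rule Finite_Cartesian_Product.norm_nth_le)
  finally have "norm x * (\<alpha> * norm x) \<le> norm x * 1" by (simp add: power2_eq_square mult_ac)
  then have "\<alpha> * norm x \<le> 1"
    by (cases "norm x = 0") (use assms(1) in auto)
  then have "norm x \<le> 1 / \<alpha>" using assms(1) by (simp add: field_simps)
  then show ?thesis using Finite_Cartesian_Product.norm_nth_le[of x i] by linarith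
qed

text \<open>Positivity makes the matrix injective, and testing with a column of the inverse bounds that column. The
  last formula, Cramer's rule, is there for the continuity of the inverse.\<close>

lemma coercive_mat_inverse:
  assumes "0 < \<alpha>" "coercive_mat \<alpha> A"
  shows "A ** matrix_inv A = mat 1" "matrix_inv A ** A = mat 1" "det A \<noteq> 0"
    "cmod (matrix_inv A $ i $ j) \<le> 1 / \<alpha>"
    "matrix_inv A $ i $ j = det (\<chi> r c. if c = i then axis j 1 $ r else A $ r $ c) / det A"
proof -
  have "x = 0" if "A *v x = 0" for x
  proof -
    have "\<alpha> * (norm x)\<^sup>2 \<le> Re (herm_form A x)" using assms(2) by (simp add: coercive_mat_def)
    also have "\<dots> = 0" unfolding herm_form_mult that by simp
    finally have "(norm x)\<^sup>2 \<le> 0" using assms(1) by (simp add: mult_le_0_iff)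
    then show ?thesis by simp
  qed
  then obtain B where "B ** A = mat 1" using matrix_left_invertible_ker[of A] by blast
  then have inv: "invertible A" unfolding invertible_def using matrix_left_right_inverse by blast
  then have I: "A ** matrix_inv A = mat 1 \<and> matrix_inv A ** A = mat 1"
    unfolding invertible_def matrix_inv_def by (rule someI_ex)
  then show "A ** matrix_inv A = mat 1" "matrix_inv A ** A = mat 1" by auto
  show d: "det A \<noteq> 0" using inv by (simp add: invertible_det_nz)
  define x where "x = matrix_inv A *v axis j 1"
  have Ax: "A *v x = axis j 1" unfolding x_def using I by (simp add: matrix_vector_mul_assoc)
  have xi: "x $ i = matrix_inv A $ i $ j"
    unfolding x_def by (simp add: matrix_vector_mult_def axis_def if_distrib[of "\<lambda>x. _ * x"] cong: if_cong)
  show "cmod (matrix_inv A $ i $ j) \<le> 1 / \<alpha>"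
    using coercive_mat_solve_bound[OF assms Ax, of i] xi by simp
  have "x = (\<chi> k. det (\<chi> r c. if c = k then axis j 1 $ r else A $ r $ c) / det A)"
    using Ax cramer[OF d] by blast
  then show "matrix_inv A $ i $ j = det (\<chi> r c. if c = i then axis j 1 $ r else A $ r $ c) / det A"
    using xi by simp
qed

lemma tendsto_det:
  fixes A :: "'b \<Rightarrow> complex^'m^'m"
  assumes "\<And>i j. ((\<lambda>n. A n $ i $ j) \<longlongrightarrow> A0 $ i $ j) F"
  shows "((\<lambda>n. det (A n)) \<longlongrightarrow> det A0) F"
  unfolding det_def by (intro tendsto_sum tendsto_mult tendsto_prod tendsto_const assms)

lemma matrix_inv_tendsto:
  fixes A :: "'b \<Rightarrow> complex^'m^'m"
  assumes "0 < \<alpha>" "\<And>n. coercive_mat \<alpha> (A n)" "coercive_mat \<alpha> A0"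
    and lim: "\<And>i j. ((\<lambda>n. A n $ i $ j) \<longlongrightarrow> A0 $ i $ j) F"
  shows "((\<lambda>n. matrix_inv (A n) $ i $ j) \<longlongrightarrow> matrix_inv A0 $ i $ j) F"
  unfolding coercive_mat_inverse(5)[OF assms(1,2)] coercive_mat_inverse(5)[OF assms(1,3)]
proof (intro tendsto_divide tendsto_det)
  show "((\<lambda>n. (\<chi> r c. if c = i then axis j 1 $ r else A n $ r $ c) $ k $ l)
     \<longlongrightarrow> (\<chi> r c. if c = i then axis j 1 $ r else A0 $ r $ c) $ k $ l) F" for k l
    using lim by (cases "l = i") auto
qed (use lim coercive_mat_inverse(3)[OF assms(1,3)] in auto)

text \<open>The bounds hold at every point of the circle, rather than almost everywhere, so that the inverse matrix is
  under control pointwise.\<close>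

definition symbol :: "real \<Rightarrow> real \<Rightarrow> (complex \<Rightarrow> complex^'m^'m) \<Rightarrow> bool" where
  "symbol \<alpha> \<beta> F \<longleftrightarrow> 0 < \<alpha> \<and> (\<forall>i j. pw_cont (\<lambda>z. F z $ i $ j)) \<and>
     (\<forall>z. cmod z = 1 \<longrightarrow> coercive_mat \<alpha> (F z) \<and> (\<forall>v. Re (herm_form (F z) v) \<le> \<beta> * (norm v)\<^sup>2))"

definition interpolate :: "(complex \<Rightarrow> complex^'m^'m) \<Rightarrow> (complex \<Rightarrow> complex^'m^'m) \<Rightarrow> real \<Rightarrow> complex \<Rightarrow> complex^'m^'m" where
  "interpolate F G t z = (\<chi> i j. G z $ i $ j + of_real t * (F z $ i $ j - G z $ i $ j))"

lemma herm_form_interpolate: "herm_form (interpolate F G t z) v = (1 - of_real t) * herm_form (G z) v + of_real t * herm_form (F z) v"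
  unfolding herm_form_def interpolate_def
  by (simp add: sum_distrib_left sum.distrib[symmetric] algebra_simps)

lemma symbol_interpolate:
  assumes "symbol \<alpha> \<beta> F" "symbol \<alpha> \<beta> G" "0 \<le> t" "t \<le> 1"
  shows "symbol \<alpha> \<beta> (interpolate F G t)"
proof -
  have "pw_cont (\<lambda>z. interpolate F G t z $ i $ j)" for i j
    unfolding interpolate_def using assms(1,2) by (auto simp: symbol_def intro!: pw_cont_add pw_cont_mult pw_cont_diff)
  moreover have "coercive_mat \<alpha> (interpolate F G t z) \<and> (\<forall>v. Re (herm_form (interpolate F G t z) v) \<le> \<beta> * (norm v)\<^sup>2)" if z: "cmod z = 1" for z
  proof -
    have "\<alpha> * (norm v)\<^sup>2 \<le> Re (herm_form (interpolate F G t z) v) \<and> Re (herm_form (interpolate F G t z) v) \<le> \<beta> * (norm v)\<^sup>2" for v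
    proof -
      have e: "Re (herm_form (interpolate F G t z) v) = (1 - t) * Re (herm_form (G z) v) + t * Re (herm_form (F z) v)"
        unfolding herm_form_interpolate by simp
      have F: "\<alpha> * (norm v)\<^sup>2 \<le> Re (herm_form (F z) v)" "Re (herm_form (F z) v) \<le> \<beta> * (norm v)\<^sup>2"
        and G: "\<alpha> * (norm v)\<^sup>2 \<le> Re (herm_form (G z) v)" "Re (herm_form (G z) v) \<le> \<beta> * (norm v)\<^sup>2"
        using assms(1,2) z by (auto simp: symbol_def coercive_mat_def)
      have "(1 - t) * (\<alpha> * (norm v)\<^sup>2) + t * (\<alpha> * (norm v)\<^sup>2) \<le> (1 - t) * Re (herm_form (G z) v) + t * Re (herm_form (F z) v)"
        using assms(3,4) F G by (intro add_mono mult_left_mono) auto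
      moreover have "(1 - t) * Re (herm_form (G z) v) + t * Re (herm_form (F z) v) \<le> (1 - t) * (\<beta> * (norm v)\<^sup>2) + t * (\<beta> * (norm v)\<^sup>2)"
        using assms(3,4) F G by (intro add_mono mult_left_mono) auto
      ultimately show ?thesis unfolding e by (simp add: algebra_simps)
    qed
    then show ?thesis by (simp add: coercive_mat_def)
  qed
  ultimately show ?thesis using assms(1) by (simp add: symbol_def)
qed

lemma pw_cont_common_exceptions:
  fixes F :: "complex \<Rightarrow> complex^'m^'m"
  assumes "\<And>i j. pw_cont (\<lambda>z. F z $ i $ j)"
  obtains S where "finite S" "\<And>i j. continuous_on (sphere 0 1 - S) (\<lambda>z. F z $ i $ j)"
proof -
  have "\<forall>i j. \<exists>S. finite S \<and> continuous_on (sphere 0 1 - S) (\<lambda>z. F z $ i $ j)"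
    using assms unfolding pw_cont_def by blast
  then obtain S where S: "\<And>i j. finite (S i j)" "\<And>i j. continuous_on (sphere 0 1 - S i j) (\<lambda>z. F z $ i $ j)"
    by metis
  show thesis
  proof (rule that[of "\<Union>i. \<Union>j. S i j"])
    show "finite (\<Union>i. \<Union>j. S i j)" using S(1) by simp
    show "continuous_on (sphere 0 1 - (\<Union>i. \<Union>j. S i j)) (\<lambda>z. F z $ i $ j)" for i j
      by (rule continuous_on_subset[OF S(2)]) auto
  qed
qed

lemma symbol_inverse_pw_cont:
  assumes F: "symbol \<alpha> \<beta> F"
  shows "pw_cont (\<lambda>z. matrix_inv (F z) $ i $ j)"
proof -
  have a: "0 < \<alpha>" and c: "\<And>z. cmod z = 1 \<Longrightarrow> coercive_mat \<alpha> (F z)" using F by (auto simp: symbol_def)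
  obtain S where S: "finite S" "\<And>i j. continuous_on (sphere 0 1 - S) (\<lambda>z. F z $ i $ j)"
    using pw_cont_common_exceptions[of F] F by (auto simp: symbol_def)
  show ?thesis
  proof (rule pw_contI[OF S(1)])
    show "cmod (matrix_inv (F z) $ i $ j) \<le> 1 / \<alpha>" if "cmod z = 1" for z
      by (rule coercive_mat_inverse(4)[OF a c[OF that]])
    have e: "det (\<chi> r c. if c = i then axis j 1 $ r else F z $ r $ c) / det (F z) = matrix_inv (F z) $ i $ j"
      if "z \<in> sphere 0 1 - S" for z
      by (rule coercive_mat_inverse(5)[OF a c, symmetric]) (use that in auto)
    have f: "continuous_on (sphere 0 1 - S) (\<lambda>z. (\<chi> r c. if c = i then axis j 1 $ r else F z $ r $ c) $ k $ l)" for k l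
      using S(2) by (cases "l = i") auto
    have nz: "\<forall>z\<in>sphere 0 1 - S. det (F z) \<noteq> 0" using coercive_mat_inverse(3)[OF a c] by auto
    have "continuous_on (sphere 0 1 - S) (\<lambda>z. det (\<chi> r c. if c = i then axis j 1 $ r else F z $ r $ c) / det (F z))"
    proof (rule continuous_on_divide[OF _ _ nz])
      show "continuous_on (sphere 0 1 - S) (\<lambda>z. det (F z))"
        unfolding det_def by (intro continuous_on_sum continuous_on_mult continuous_on_prod continuous_on_const S(2))
      show "continuous_on (sphere 0 1 - S) (\<lambda>z. det (\<chi> r c. if c = i then axis j 1 $ r else F z $ r $ c))"
        unfolding det_def by (intro continuous_on_sum continuous_on_mult continuous_on_prod continuous_on_const f)
    qed
    then show "continuous_on (sphere 0 1 - S) (\<lambda>z. matrix_inv (F z) $ i $ j)"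
      by (rule continuous_on_eq) (rule e)
  qed
qed

section \<open>Regular versions of the spectral densities\<close>

text \<open>One-sided limits give local bounds, which compactness of an interval of angles makes uniform.\<close>

lemma piecewise_continuous_bounded:
  fixes \<Phi> :: "complex \<Rightarrow> complex^'m^'m"
  assumes "piecewise_continuous_on_circle \<Phi>"
  obtains S B where "finite S" "continuous_on (sphere 0 1 - S) \<Phi>" "\<And>z. cmod z = 1 \<Longrightarrow> norm (\<Phi> z) \<le> B"
proof -
  obtain S where S: "finite S" "continuous_on (sphere 0 1 - S) \<Phi>"
    and lr: "\<And>\<theta>. cis \<theta> \<in> S \<Longrightarrow> (\<exists>L. ((\<lambda>t. \<Phi> (cis t)) \<longlongrightarrow> L) (at_left \<theta>)) \<and> (\<exists>R. ((\<lambda>t. \<Phi> (cis t)) \<longlongrightarrow> R) (at_right \<theta>))"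
    using assms unfolding piecewise_continuous_on_circle_def by blast
  have evb: "\<exists>B. \<forall>\<^sub>F t in F. norm (f t) \<le> B" if "(f \<longlongrightarrow> L) F" for f :: "real \<Rightarrow> complex^'m^'m" and L F
  proof -
    have "\<forall>\<^sub>F t in F. dist (f t) L < 1" by (rule tendstoD[OF that]) simp
    then have "\<forall>\<^sub>F t in F. norm (f t) \<le> norm L + 1"
    proof eventually_elim
      case (elim t)
      then show ?case using norm_triangle_sub[of "f t" L] by (simp add: dist_norm)
    qed
    then show ?thesis by blast
  qed
  have loc: "\<exists>d>0. \<exists>B. \<forall>t. \<bar>t - \<theta>\<bar> < d \<longrightarrow> norm (\<Phi> (cis t)) \<le> B" for \<theta>
  proof -
    have "\<exists>B. \<forall>\<^sub>F t in at \<theta>. norm (\<Phi> (cis t)) \<le> B"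
    proof (cases "cis \<theta> \<in> S")
      case True
      then obtain L R where "((\<lambda>t. \<Phi> (cis t)) \<longlongrightarrow> L) (at_left \<theta>)" "((\<lambda>t. \<Phi> (cis t)) \<longlongrightarrow> R) (at_right \<theta>)"
        using lr by blast
      then obtain B1 B2 where "\<forall>\<^sub>F t in at_left \<theta>. norm (\<Phi> (cis t)) \<le> B1" "\<forall>\<^sub>F t in at_right \<theta>. norm (\<Phi> (cis t)) \<le> B2"
        using evb by metis
      then have "\<forall>\<^sub>F t in at_left \<theta>. norm (\<Phi> (cis t)) \<le> max B1 B2" "\<forall>\<^sub>F t in at_right \<theta>. norm (\<Phi> (cis t)) \<le> max B1 B2"
        by (auto elim: eventually_mono)
      then show ?thesis using eventually_at_split by blast
    next
      case False
      have "open (- {t. cis t \<in> S})"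
      proof -
        have "closed (cis -` S)" using S(1) by (intro closed_vimage finite_imp_closed continuous_intros)
        then show ?thesis by (simp add: closed_def vimage_def)
      qed
      moreover have "continuous_on (- {t. cis t \<in> S}) (\<lambda>t. \<Phi> (cis t))"
        by (rule continuous_on_compose2[OF S(2)]) (auto intro!: continuous_intros)
      ultimately have "isCont (\<lambda>t. \<Phi> (cis t)) \<theta>" using False by (simp add: continuous_on_eq_continuous_at)
      then show ?thesis using evb by (auto simp: isCont_def)
    qed
    then obtain B d where "0 < d" and Bd: "\<And>t. t \<noteq> \<theta> \<Longrightarrow> dist t \<theta> < d \<Longrightarrow> norm (\<Phi> (cis t)) \<le> B"
      by (auto simp: eventually_at)
    have "norm (\<Phi> (cis t)) \<le> max B (norm (\<Phi> (cis \<theta>)))" if "\<bar>t - \<theta>\<bar> < d" for t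
      using Bd[of t] that by (cases "t = \<theta>") (auto simp: dist_real_def le_max_iff_disj)
    with \<open>0 < d\<close> show ?thesis by blast
  qed
  have "(0::real) \<le> 2 * pi" by simp
  then have "\<exists>B. \<forall>t. 0 \<le> t \<and> t \<le> 2 * pi \<longrightarrow> norm (\<Phi> (cis t)) \<le> B"
  proof (induction rule: Bolzano)
    case (trans a b c)
    then obtain B1 B2 where "\<forall>t. a \<le> t \<and> t \<le> b \<longrightarrow> norm (\<Phi> (cis t)) \<le> B1" "\<forall>t. b \<le> t \<and> t \<le> c \<longrightarrow> norm (\<Phi> (cis t)) \<le> B2"
      by blast
    then have "\<forall>t. a \<le> t \<and> t \<le> c \<longrightarrow> norm (\<Phi> (cis t)) \<le> max B1 B2"
      by (metis le_cases le_max_iff_disj)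
    then show ?case by blast
  next
    case (local x)
    obtain d B where d: "0 < d" "\<And>t. \<bar>t - x\<bar> < d \<Longrightarrow> norm (\<Phi> (cis t)) \<le> B" using loc by blast
    have "\<exists>B. \<forall>t. a \<le> t \<and> t \<le> b \<longrightarrow> norm (\<Phi> (cis t)) \<le> B" if "a \<le> x \<and> x \<le> b \<and> b - a < d" for a b
      using that by (intro exI[of _ B] allI impI d(2)) auto
    then show ?case using d(1) by blast
  qed
  then obtain B where B: "\<And>t. 0 \<le> t \<Longrightarrow> t \<le> 2 * pi \<Longrightarrow> norm (\<Phi> (cis t)) \<le> B" by blast
  have "norm (\<Phi> z) \<le> B" if "cmod z = 1" for z
  proof -
    have "z = cis (Arg2pi z)" using that complex_norm_eq_1_exp[of z] by (simp add: cis_conv_exp)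
    then show ?thesis using B[of "Arg2pi z"] Arg2pi[of z] by (metis less_imp_le)
  qed
  with S that show thesis by blast
qed

lemma AE_lborel_interval:
  fixes a b :: real
  assumes "AE t in lborel. t \<in> {-pi..pi} \<longrightarrow> P t" "a < b" "{a<..<b} \<subseteq> {-pi..pi}"
  obtains t where "t \<in> {a<..<b}" "P t"
proof -
  have "\<exists>t\<in>{a<..<b}. P t"
  proof (rule ccontr)
    assume n: "\<not> (\<exists>t\<in>{a<..<b}. P t)"
    have "AE t in lborel. t \<notin> {a<..<b}"
      using assms(1) by eventually_elim (use n assms(3) in blast)
    then have "emeasure lborel {a<..<b} = 0"
      by (subst (asm) AE_iff_measurable[where N="{a<..<b}"]) auto
    then show False using assms(2) by simp
  qed
  with that show thesis by blast
qed

lemma herm_form_le: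
  fixes A :: "complex^'m^'m"
  assumes "norm A \<le> B"
  shows "Re (herm_form A v) \<le> (real CARD('m))\<^sup>2 * B * (norm v)\<^sup>2"
proof -
  have e: "cmod (cnj (v $ i) * A $ i $ j * v $ j) \<le> B * (norm v)\<^sup>2" for i j
  proof -
    have "cmod (A $ i $ j) \<le> B"
      using Finite_Cartesian_Product.norm_nth_le[of "A $ i" j] Finite_Cartesian_Product.norm_nth_le[of A i] assms by linarith
    then have "cmod (v $ i) * cmod (A $ i $ j) * cmod (v $ j) \<le> norm v * B * norm v"
      by (intro mult_mono Finite_Cartesian_Product.norm_nth_le mult_nonneg_nonneg) (auto intro: order_trans[OF norm_ge_zero assms])
    then show ?thesis by (simp add: norm_mult power2_eq_square mult_ac)
  qed
  have "Re (herm_form A v) \<le> cmod (herm_form A v)" by (rule complex_Re_le_cmod)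
  also have "\<dots> \<le> (\<Sum>i\<in>(UNIV::'m set). \<Sum>j\<in>(UNIV::'m set). B * (norm v)\<^sup>2)"
  proof -
    have "cmod (herm_form A v) \<le> (\<Sum>i\<in>UNIV. cmod (\<Sum>j\<in>UNIV. cnj (v $ i) * A $ i $ j * v $ j))"
      unfolding herm_form_def by (rule norm_sum)
    also have "\<dots> \<le> (\<Sum>i\<in>UNIV. \<Sum>j\<in>UNIV. cmod (cnj (v $ i) * A $ i $ j * v $ j))"
      by (intro sum_mono norm_sum)
    also have "\<dots> \<le> (\<Sum>i\<in>(UNIV::'m set). \<Sum>j\<in>(UNIV::'m set). B * (norm v)\<^sup>2)"
      by (intro sum_mono e)
    finally show ?thesis .
  qed
  also have "\<dots> = (real CARD('m))\<^sup>2 * B * (norm v)\<^sup>2" by (simp add: power2_eq_square)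
  finally show ?thesis .
qed

lemma herm_form_diff: "herm_form (A - B) v = herm_form A v - herm_form B v"
  unfolding herm_form_def by (simp add: sum_subtractf[symmetric] algebra_simps)

lemma herm_form_scalar: "herm_form (mat c) v = c * of_real ((norm v)\<^sup>2)"
proof -
  have "herm_form (mat c) v = (\<Sum>i\<in>UNIV. cnj (v $ i) * c * v $ i)"
    unfolding herm_form_def mat_def by (intro sum.cong refl) (simp add: if_distrib[of "\<lambda>x. _ * x * _"] cong: if_cong)
  also have "\<dots> = (\<Sum>i\<in>UNIV. c * of_real ((cmod (v $ i))\<^sup>2))"
    by (intro sum.cong refl) (simp add: complex_norm_square mult_ac del: of_real_power)
  finally show ?thesis by (simp only: norm_vec_power2 of_real_sum sum_distrib_left)
qed

text \<open>Coercivity almost everywhere extends to all points of continuity, and the values at the remaining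
  finitely many points may be changed without affecting any integral.\<close>

lemma regular_version:
  fixes \<Phi> :: "complex \<Rightarrow> complex^'m^'m"
  assumes pw: "piecewise_continuous_on_circle \<Phi>" and co: "coercive \<Phi>"
  obtains \<alpha> \<beta> F S where "symbol \<alpha> \<beta> F" "finite S" "\<And>z. z \<notin> S \<Longrightarrow> F z = \<Phi> z"
proof -
  obtain S B where S: "finite S" "continuous_on (sphere 0 1 - S) \<Phi>" and B: "\<And>z. cmod z = 1 \<Longrightarrow> norm (\<Phi> z) \<le> B"
    using piecewise_continuous_bounded[OF pw] by blast
  obtain \<alpha> where a: "0 < \<alpha>" and ae: "AE \<theta> in lborel. \<theta> \<in> {-pi..pi} \<longrightarrow> hermitian_pos_def (\<Phi> (cis \<theta>) - mat (complex_of_real \<alpha>))"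
    using co unfolding coercive_def by blast
  have coercive_mat: "coercive_mat \<alpha> (\<Phi> z)" if z: "cmod z = 1" "z \<notin> S" for z
    unfolding coercive_mat_def
  proof (rule allI, rule ccontr)
    fix v assume neg: "\<not> \<alpha> * (norm v)\<^sup>2 \<le> Re (herm_form (\<Phi> z) v)"
    define h where "h t = Re (herm_form (\<Phi> (cis t)) v) - \<alpha> * (norm v)\<^sup>2" for t
    define \<theta> where "\<theta> = Arg z"
    have z0: "z \<noteq> 0" using z by auto
    have th: "cis \<theta> = z" "-pi < \<theta>" "\<theta> \<le> pi"
      using z cis_Arg[OF z0] Arg_bounded[of z] by (auto simp: \<theta>_def sgn_div_norm)
    have "closed (cis -` S)" using S(1) by (intro closed_vimage finite_imp_closed continuous_intros)
    then have op: "open (- {t. cis t \<in> S})" by (simp add: closed_def vimage_def)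
    have "continuous_on (- {t. cis t \<in> S}) (\<lambda>t. \<Phi> (cis t))"
      by (rule continuous_on_compose2[OF S(2)]) (auto intro!: continuous_intros)
    then have c0: "isCont (\<lambda>t. \<Phi> (cis t)) \<theta>" using op z(2) th(1) by (simp add: continuous_on_eq_continuous_at)
    have "((\<lambda>t. h t) \<longlongrightarrow> h \<theta>) (at \<theta>)"
      unfolding h_def herm_form_def by (intro tendsto_intros tendsto_vec_nth c0[unfolded isCont_def])
    moreover have "h \<theta> < 0" using neg by (simp add: h_def th)
    ultimately have "\<forall>\<^sub>F t in at \<theta>. h t < 0" by (rule order_tendstoD)
    then obtain d where d: "0 < d" "\<And>t. t \<noteq> \<theta> \<Longrightarrow> dist t \<theta> < d \<Longrightarrow> h t < 0" by (auto simp: eventually_at)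
    obtain t where t: "t \<in> {max (-pi) (\<theta> - d)<..<\<theta>}" "hermitian_pos_def (\<Phi> (cis t) - mat (complex_of_real \<alpha>))"
      by (rule AE_lborel_interval[OF ae, of "max (-pi) (\<theta> - d)" \<theta>]) (use th d(1) in auto)
    have "v \<noteq> 0" using neg by (auto simp: herm_form_def)
    then have "0 < Re (herm_form (\<Phi> (cis t) - mat (complex_of_real \<alpha>)) v)"
      using t(2) unfolding hermitian_pos_def_def herm_form_mult by blast
    then have "0 < h t" unfolding herm_form_diff herm_form_scalar h_def by simp
    moreover have "h t < 0" using t(1) by (intro d(2)) (auto simp: dist_real_def)
    ultimately show False by simp
  qed
  \<comment> \<open>At the exceptional points any coercive value will do.\<close>
  define F where "F z = (if z \<in> S then mat 1 else \<Phi> z)" for z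
  define \<alpha>' where "\<alpha>' = min \<alpha> 1"
  define \<beta> where "\<beta> = max ((real CARD('m))\<^sup>2 * B) 1"
  have "symbol \<alpha>' \<beta> F"
    unfolding symbol_def
  proof (intro conjI allI impI)
    show "0 < \<alpha>'" using a by (simp add: \<alpha>'_def)
    fix i j
    show "pw_cont (\<lambda>z. F z $ i $ j)"
    proof (rule pw_contI[OF S(1)])
      show "continuous_on (sphere 0 1 - S) (\<lambda>z. F z $ i $ j)"
        by (rule continuous_on_eq[of _ "\<lambda>z. \<Phi> z $ i $ j"]) (auto simp: F_def intro!: continuous_intros S(2))
      show "cmod (F z $ i $ j) \<le> max B 1" if "cmod z = 1" for z
      proof (cases "z \<in> S")
        case True
        then show ?thesis by (simp add: F_def mat_def le_max_iff_disj)
      next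
        case False
        then show ?thesis
          using Finite_Cartesian_Product.norm_nth_le[of "\<Phi> z $ i" j] Finite_Cartesian_Product.norm_nth_le[of "\<Phi> z" i] B[OF that] by (simp add: F_def)
      qed
    qed
  next
    fix z :: complex assume z: "cmod z = 1"
    show "coercive_mat \<alpha>' (F z)"
      unfolding coercive_mat_def
    proof
      fix v
      show "\<alpha>' * (norm v)\<^sup>2 \<le> Re (herm_form (F z) v)"
      proof (cases "z \<in> S")
        case True
        have "\<alpha>' * (norm v)\<^sup>2 \<le> 1 * (norm v)\<^sup>2" by (intro mult_right_mono) (auto simp: \<alpha>'_def)
        then show ?thesis using True by (simp add: F_def herm_form_scalar)
      next
        case False
        have "\<alpha>' * (norm v)\<^sup>2 \<le> \<alpha> * (norm v)\<^sup>2" by (intro mult_right_mono) (auto simp: \<alpha>'_def)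
        then show ?thesis using coercive_mat[OF z False] False by (auto simp: F_def coercive_mat_def intro: order_trans)
      qed
    qed
    fix v
    show "Re (herm_form (F z) v) \<le> \<beta> * (norm v)\<^sup>2"
    proof (cases "z \<in> S")
      case True
      have "1 * (norm v)\<^sup>2 \<le> \<beta> * (norm v)\<^sup>2" by (intro mult_right_mono) (auto simp: \<beta>_def)
      then show ?thesis using True by (simp add: F_def herm_form_scalar)
    next
      case False
      have "Re (herm_form (\<Phi> z) v) \<le> (real CARD('m))\<^sup>2 * B * (norm v)\<^sup>2" by (rule herm_form_le[OF B[OF z]])
      also have "\<dots> \<le> \<beta> * (norm v)\<^sup>2" by (intro mult_right_mono) (auto simp: \<beta>_def)
      finally show ?thesis using False by (simp add: F_def)
    qed
  qed
  with S(1) that show thesis by (auto simp: F_def)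
qed

lemma symbol_mono:
  assumes F: "symbol \<alpha> \<beta> F" and "0 < \<alpha>'" "\<alpha>' \<le> \<alpha>" "\<beta> \<le> \<beta>'"
  shows "symbol \<alpha>' \<beta>' F"
proof -
  have "\<alpha>' * (norm v)\<^sup>2 \<le> Re (herm_form (F z) v) \<and> Re (herm_form (F z) v) \<le> \<beta>' * (norm v)\<^sup>2" if "cmod z = 1" for z v
  proof -
    have "\<alpha>' * (norm v)\<^sup>2 \<le> \<alpha> * (norm v)\<^sup>2" "\<beta> * (norm v)\<^sup>2 \<le> \<beta>' * (norm v)\<^sup>2"
      using assms(3,4) by (simp_all add: mult_right_mono)
    moreover have "\<alpha> * (norm v)\<^sup>2 \<le> Re (herm_form (F z) v)" "Re (herm_form (F z) v) \<le> \<beta> * (norm v)\<^sup>2"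
      using F that by (auto simp: symbol_def coercive_mat_def)
    ultimately show ?thesis by linarith
  qed
  then show ?thesis using F assms(2) by (simp add: symbol_def coercive_mat_def)
qed

lemma integral_circle_shift:
  assumes f: "pw_cont f"
  shows "(LINT \<theta>:{-pi..pi}|lborel. f (cis \<theta>)) = (LINT \<theta>:{0..2*pi}|lborel. f (cis \<theta>))"
proof -
  obtain B where B: "\<And>z. cmod z = 1 \<Longrightarrow> cmod (f z) \<le> B" using f by (metis pw_contE)
  have [measurable]: "(\<lambda>\<theta>. f (cis \<theta>)) \<in> borel_measurable borel" by (rule pw_cont_measurable[OF f])
  have int: "integrable lborel (\<lambda>\<theta>. indicator A \<theta> *\<^sub>R f (cis \<theta>))"
    if [measurable]: "A \<in> sets borel" and "emeasure lborel A < \<infinity>" for A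
  proof (rule integrableI_bounded_set_indicator[where B=B])
    show "AE \<theta> in lborel. \<theta> \<in> A \<longrightarrow> cmod (f (cis \<theta>)) \<le> B" using B by simp
  qed (use that in auto)
  let ?I = "\<lambda>A. \<integral>\<theta>. indicator A \<theta> *\<^sub>R f (cis \<theta>) \<partial>lborel"
  have add: "?I (A \<union> A') = ?I A + ?I A'"
    if "A \<inter> A' = {}" "A \<in> sets borel" "A' \<in> sets borel" "emeasure lborel A < \<infinity>" "emeasure lborel A' < \<infinity>" for A A'
  proof -
    have "?I (A \<union> A') = (\<integral>\<theta>. indicator A \<theta> *\<^sub>R f (cis \<theta>) + indicator A' \<theta> *\<^sub>R f (cis \<theta>) \<partial>lborel)"
      using that(1) by (intro Bochner_Integration.integral_cong refl) (auto simp: indicator_def)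
    then show ?thesis using int that by simp
  qed
  have ne: "?I A = ?I A'" if "A - A' \<union> (A' - A) \<subseteq> {c}" "A \<in> sets borel" "A' \<in> sets borel" for A A' c
  proof (rule integral_cong_AE)
    show "AE \<theta> in lborel. indicator A \<theta> *\<^sub>R f (cis \<theta>) = indicator A' \<theta> *\<^sub>R f (cis \<theta>)"
      using AE_lborel_singleton[of c] by eventually_elim (use that(1) in \<open>auto simp: indicator_def\<close>)
  qed (use that in measurable)
  have shift: "?I {-pi..<0} = ?I {pi..<2*pi}"
  proof -
    have "?I {-pi..<0} = (\<integral>\<theta>. indicator {-pi..<0} (- (2 * pi) + \<theta>) *\<^sub>R f (cis (- (2 * pi) + \<theta>)) \<partial>lborel)"
      using lborel_integral_real_affine[of 1 "\<lambda>\<theta>. indicator {-pi..<0} \<theta> *\<^sub>R f (cis \<theta>)" "- (2 * pi)"] by simp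
    also have "\<dots> = ?I {pi..<2*pi}"
    proof (intro Bochner_Integration.integral_cong refl)
      fix \<theta> :: real
      have "cis (- (2 * pi) + \<theta>) = cis \<theta>" by (simp add: complex_eq_iff cos_diff sin_diff)
      then show "indicator {-pi..<0} (- (2 * pi) + \<theta>) *\<^sub>R f (cis (- (2 * pi) + \<theta>)) = indicator {pi..<2*pi} \<theta> *\<^sub>R f (cis \<theta>)"
        by (auto simp: indicator_def)
    qed
    finally show ?thesis .
  qed
  have "?I {-pi..pi} = ?I {-pi..<pi}" by (rule ne[of _ _ pi]) auto
  also have "{-pi..<pi} = {-pi..<0} \<union> {0..<pi}" by auto
  also have "?I ({-pi..<0} \<union> {0..<pi}) = ?I {0..<pi} + ?I {pi..<2*pi}"
    by (subst add) (auto simp: shift)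
  also have "\<dots> = ?I ({0..<pi} \<union> {pi..<2*pi})" by (rule add[symmetric]) auto
  also have "\<dots> = ?I {0..2*pi}" by (rule ne[of _ _ "2 * pi"]) auto
  finally show ?thesis unfolding set_lebesgue_integral_def .
qed

lemma covariance_eq_coefficient:
  fixes y :: "int \<Rightarrow> 'a \<Rightarrow> real^'m"
  assumes sd: "is_spectral_density M y \<Phi>" and F: "\<And>i j. pw_cont (\<lambda>z. F z $ i $ j)"
    and S: "finite S" "\<And>z. z \<notin> S \<Longrightarrow> F z = \<Phi> z"
  shows "complex_of_real (\<integral>\<omega>. y k \<omega> $ i * y l \<omega> $ j \<partial>M) = fourier_coef (\<lambda>z. F z $ i $ j) (k - l)"
proof -
  let ?g = "\<lambda>z. z powi (k - l) * F z $ i $ j"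
  have g: "pw_cont ?g" by (intro pw_cont_mult pw_cont_powi F)
  have [measurable]: "(\<lambda>\<theta>. ?g (cis \<theta>)) \<in> borel_measurable borel" by (rule pw_cont_measurable[OF g])
  have e: "exp (\<i> * of_int (k - l) * of_real \<theta>) = cis \<theta> powi (k - l)" for \<theta>
    by (simp add: cis_power_int) (simp add: cis_conv_exp mult.assoc)
  have sI: "set_integrable lborel {-pi..pi} (\<lambda>\<theta>. \<Phi> (cis \<theta>) $ i $ j)"
    using sd by (simp add: is_spectral_density_def)
  have ae: "AE \<theta> in lborel. cis \<theta> \<notin> S"
    using AE_not_in[OF countable_imp_null_set_lborel[OF countable_cis_vimage[OF S(1)]]] by simp
  have m: "(\<lambda>\<theta>. indicator {-pi..pi} \<theta> *\<^sub>R (\<Phi> (cis \<theta>) $ i $ j)) \<in> borel_measurable lborel"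
    using sI unfolding set_integrable_def by (rule borel_measurable_integrable)
  have m2: "(\<lambda>\<theta>. cis \<theta> powi (k - l)) \<in> borel_measurable lborel"
    using pw_cont_measurable[OF pw_cont_powi[of "k - l"]] by simp
  have "complex_of_real (\<integral>\<omega>. y (l + (k - l)) \<omega> $ i * y l \<omega> $ j \<partial>M)
     = 1 / (2 * pi) * (LINT \<theta>:{-pi..pi}|lborel. exp (\<i> * of_int (k - l) * of_real \<theta>) * \<Phi> (cis \<theta>) $ i $ j)"
    using sd unfolding is_spectral_density_def by blast
  also have "(LINT \<theta>:{-pi..pi}|lborel. exp (\<i> * of_int (k - l) * of_real \<theta>) * \<Phi> (cis \<theta>) $ i $ j)
     = (LINT \<theta>:{-pi..pi}|lborel. ?g (cis \<theta>))"
    unfolding set_lebesgue_integral_def e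
  proof (rule integral_cong_AE)
    have "(\<lambda>\<theta>. cis \<theta> powi (k - l) * (indicator {-pi..pi} \<theta> *\<^sub>R (\<Phi> (cis \<theta>) $ i $ j))) \<in> borel_measurable lborel"
      by (rule borel_measurable_times[OF m2 m])
    then show "(\<lambda>\<theta>. indicator {-pi..pi} \<theta> *\<^sub>R (cis \<theta> powi (k - l) * \<Phi> (cis \<theta>) $ i $ j)) \<in> borel_measurable lborel"
      by (simp add: scaleR_conv_of_real mult.left_commute)
    show "AE \<theta> in lborel. indicator {-pi..pi} \<theta> *\<^sub>R (cis \<theta> powi (k - l) * \<Phi> (cis \<theta>) $ i $ j) = indicator {-pi..pi} \<theta> *\<^sub>R ?g (cis \<theta>)"
      using ae by eventually_elim (simp add: S(2))
  qed measurable
  also have "\<dots> = (LINT \<theta>:{0..2*pi}|lborel. ?g (cis \<theta>))" by (rule integral_circle_shift[OF g])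
  finally show ?thesis
    using integral_angle_measure[of "\<lambda>\<theta>. ?g (cis \<theta>)"] by (simp add: fourier_coef_def mean_def scaleR_conv_of_real)
qed

section \<open>Traces of Toeplitz matrices\<close>

definition toeplitz :: "(complex \<Rightarrow> complex^'m^'m) \<Rightarrow> int \<times> 'm \<Rightarrow> int \<times> 'm \<Rightarrow> complex" where
  "toeplitz F a b = fourier_coef (\<lambda>z. F z $ snd a $ snd b) (fst a - fst b)"

definition window :: "nat \<Rightarrow> (int \<times> 'm) set" where
  "window n = {- int n..int n} \<times> UNIV"

lemma finite_window [simp]: "finite (window n :: (int \<times> 'm::finite) set)" by (simp add: window_def)

lemma sum_window: "(\<Sum>a\<in>window n. f a) = (\<Sum>k\<in>{- int n..int n}. \<Sum>i\<in>(UNIV::'m::finite set). f (k, i))"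
  unfolding window_def by (simp add: sum.cartesian_product)

definition frobenius_sq :: "'i set \<Rightarrow> ('i \<Rightarrow> 'i \<Rightarrow> complex) \<Rightarrow> real" where
  "frobenius_sq I A = (\<Sum>a\<in>I. \<Sum>b\<in>I. (cmod (A a b))\<^sup>2)"

lemma mat_trace_mat_prod_le:
  assumes t: "0 < t"
  shows "cmod (mat_trace I (mat_prod I D X)) \<le> (t * frobenius_sq I D + frobenius_sq I X / t) / 2"
proof -
  have "cmod (mat_trace I (mat_prod I D X)) \<le> (\<Sum>a\<in>I. cmod (\<Sum>b\<in>I. D a b * X b a))"
    unfolding mat_trace_def mat_prod_def by (rule norm_sum)
  also have "\<dots> \<le> (\<Sum>a\<in>I. \<Sum>b\<in>I. cmod (D a b * X b a))"
    by (intro sum_mono norm_sum)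
  also have "\<dots> \<le> (\<Sum>a\<in>I. \<Sum>b\<in>I. (t * (cmod (D a b))\<^sup>2 + (cmod (X b a))\<^sup>2 / t) / 2)"
    unfolding norm_mult by (intro sum_mono weighted_am_gm t)
  also have "\<dots> = (t * frobenius_sq I D + (\<Sum>a\<in>I. \<Sum>b\<in>I. (cmod (X b a))\<^sup>2) / t) / 2"
    by (simp add: frobenius_sq_def sum_distrib_left sum_divide_distrib sum.distrib add_divide_distrib)
  also have "(\<Sum>a\<in>I. \<Sum>b\<in>I. (cmod (X b a))\<^sup>2) = frobenius_sq I X" unfolding frobenius_sq_def by (rule sum.swap)
  finally show ?thesis .
qed

lemma mean_Re_mono:
  assumes "pw_cont f" "pw_cont g" "\<And>z. cmod z = 1 \<Longrightarrow> Re (f z) \<le> Re (g z)"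
  shows "Re (mean f) \<le> Re (mean g)"
  unfolding mean_def integral_Re[OF pw_cont_integrable[OF assms(1)], symmetric] integral_Re[OF pw_cont_integrable[OF assms(2)], symmetric]
  by (intro integral_mono integrable_Re pw_cont_integrable assms) simp

lemma mean_sq_trig: "finite K \<Longrightarrow> mean_sq (trig K a) = (\<Sum>k\<in>K. (cmod (a k))\<^sup>2)"
proof -
  assume fin: "finite K"
  have c0: "fourier_coef (\<lambda>z. 0) k = 0" for k by (simp add: fourier_coef_def mean_def)
  have "mean_sq (trig K a) = mean_sq (\<lambda>z. 0 - trig K a z)" by (simp add: mean_sq_def)
  also have "\<dots> = (\<Sum>k\<in>K. (cmod (a k))\<^sup>2)"
    by (subst mean_sq_diff_trig[OF pw_cont_const fin]) (simp add: c0 mean_sq_def)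
  finally show ?thesis .
qed

lemma mean_trig_trig:
  assumes f: "pw_cont f"
  shows "mean (\<lambda>z. cnj (trig K a z) * f z * trig L b z) = (\<Sum>k\<in>K. \<Sum>l\<in>L. cnj (a k) * fourier_coef f (k - l) * b l)"
proof -
  have "mean (\<lambda>z. cnj (trig K a z) * f z * trig L b z)
     = mean (\<lambda>z. \<Sum>k\<in>K. \<Sum>l\<in>L. (cnj (a k) * b l) * (z powi (k - l) * f z))"
  proof (rule mean_cong)
    fix z :: complex assume z: "cmod z = 1"
    have "cnj (trig K a z) = (\<Sum>k\<in>K. cnj (a k) * z powi k)"
      unfolding cnj_sum complex_cnj_mult cnj_powi[OF z] by simp
    then have "cnj (trig K a z) * f z * trig L b z = (\<Sum>k\<in>K. cnj (a k) * z powi k) * trig L b z * f z" by simp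
    also have "\<dots> = (\<Sum>k\<in>K. \<Sum>l\<in>L. (cnj (a k) * z powi k) * (b l * z powi (- l)) * f z)"
      unfolding sum_product by (simp only: sum_distrib_right)
    also have "\<dots> = (\<Sum>k\<in>K. \<Sum>l\<in>L. (cnj (a k) * b l) * (z powi (k - l) * f z))"
      using powi_add_circle[OF z, of _ "- _"] by (intro sum.cong refl) (simp add: mult_ac)
    finally show "cnj (trig K a z) * f z * trig L b z = (\<Sum>k\<in>K. \<Sum>l\<in>L. (cnj (a k) * b l) * (z powi (k - l) * f z))" .
  qed
  also have "\<dots> = (\<Sum>k\<in>K. mean (\<lambda>z. \<Sum>l\<in>L. (cnj (a k) * b l) * (z powi (k - l) * f z)))"
    by (rule mean_sum) (intro pw_cont_sum pw_cont_mult pw_cont_const pw_cont_powi f)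
  also have "\<dots> = (\<Sum>k\<in>K. \<Sum>l\<in>L. mean (\<lambda>z. (cnj (a k) * b l) * (z powi (k - l) * f z)))"
    by (intro sum.cong refl mean_sum) (intro pw_cont_mult pw_cont_const pw_cont_powi f)
  finally show ?thesis unfolding mean_cmult fourier_coef_def by (simp add: mult_ac)
qed

text \<open>The quadratic form of a Toeplitz matrix is the mean of the quadratic forms of its symbol.\<close>

lemma toeplitz_coercive:
  fixes F :: "complex \<Rightarrow> complex^'m^'m"
  assumes F: "symbol \<alpha> \<beta> F"
  defines "Q u n \<equiv> Re (\<Sum>a\<in>window n. \<Sum>b\<in>window n. cnj (u a) * toeplitz F a b * u b)"
  shows "\<alpha> * (\<Sum>a\<in>window n. (cmod (u a))\<^sup>2) \<le> Q u n" "Q u n \<le> \<beta> * (\<Sum>a\<in>window n. (cmod (u a))\<^sup>2)"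
proof -
  let ?K = "{- int n..int n}"
  have pcF: "pw_cont (\<lambda>z. F z $ i $ j)" for i j using F by (simp add: symbol_def)
  define w where "w z = (\<chi> j. trig ?K (\<lambda>l. u (l, j)) z)" for z
  have wj: "w z $ j = trig ?K (\<lambda>l. u (l, j)) z" for z j by (simp add: w_def)
  have pcw: "pw_cont (\<lambda>z. w z $ j)" for j unfolding wj by (rule pw_cont_trig)
  have pcq: "pw_cont (\<lambda>z. herm_form (F z) (w z))" unfolding herm_form_def by (intro pw_cont_sum pw_cont_mult pw_cont_cnj pcw pcF)
  have "mean (\<lambda>z. herm_form (F z) (w z)) = (\<Sum>i\<in>UNIV. mean (\<lambda>z. \<Sum>j\<in>UNIV. cnj (w z $ i) * F z $ i $ j * w z $ j))"
    unfolding herm_form_def by (rule mean_sum) (intro pw_cont_sum pw_cont_mult pw_cont_cnj pcw pcF)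
  also have "\<dots> = (\<Sum>i\<in>UNIV. \<Sum>j\<in>UNIV. mean (\<lambda>z. cnj (w z $ i) * F z $ i $ j * w z $ j))"
    by (intro sum.cong refl mean_sum) (intro pw_cont_sum pw_cont_mult pw_cont_cnj pcw pcF)
  also have "\<dots> = (\<Sum>i\<in>UNIV. \<Sum>j\<in>UNIV. \<Sum>k\<in>?K. \<Sum>l\<in>?K. cnj (u (k, i)) * toeplitz F (k, i) (l, j) * u (l, j))"
    unfolding wj mean_trig_trig[OF pcF] by (simp add: toeplitz_def)
  also have "\<dots> = (\<Sum>i\<in>UNIV. \<Sum>k\<in>?K. \<Sum>l\<in>?K. \<Sum>j\<in>UNIV. cnj (u (k, i)) * toeplitz F (k, i) (l, j) * u (l, j))"
    by (subst sum.swap[of _ ?K]) (subst sum.swap[of _ ?K UNIV], rule refl)?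
  also have "\<dots> = (\<Sum>k\<in>?K. \<Sum>i\<in>UNIV. \<Sum>l\<in>?K. \<Sum>j\<in>UNIV. cnj (u (k, i)) * toeplitz F (k, i) (l, j) * u (l, j))"
    by (rule sum.swap)
  finally have Q: "Q u n = Re (mean (\<lambda>z. herm_form (F z) (w z)))"
    by (simp add: Q_def sum_window)
  have pcn: "pw_cont (\<lambda>z. \<Sum>j\<in>UNIV. w z $ j * cnj (w z $ j))" by (intro pw_cont_sum pw_cont_mult pw_cont_cnj pcw)
  have nrm: "of_real ((norm (w z))\<^sup>2) = (\<Sum>j\<in>UNIV. w z $ j * cnj (w z $ j))" for z
    unfolding norm_vec_power2 of_real_sum by (intro sum.cong refl complex_norm_square)
  have "mean (\<lambda>z. \<Sum>j\<in>UNIV. w z $ j * cnj (w z $ j)) = (\<Sum>j\<in>UNIV. of_real (mean_sq (\<lambda>z. w z $ j)))"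
    by (subst mean_sum) (auto intro!: pw_cont_mult pw_cont_cnj pcw simp: mean_sq_eq_mean[OF pcw])
  also have "\<dots> = of_real (\<Sum>j\<in>UNIV. \<Sum>l\<in>?K. (cmod (u (l, j)))\<^sup>2)"
    unfolding wj by (simp add: mean_sq_trig)
  also have "(\<Sum>j\<in>UNIV. \<Sum>l\<in>?K. (cmod (u (l, j)))\<^sup>2) = (\<Sum>a\<in>window n. (cmod (u a))\<^sup>2)"
    unfolding sum_window by (rule sum.swap)
  finally have N: "mean (\<lambda>z. \<Sum>j\<in>UNIV. w z $ j * cnj (w z $ j)) = of_real (\<Sum>a\<in>window n. (cmod (u a))\<^sup>2)" .
  have "Re (mean (\<lambda>z. of_real \<alpha> * (\<Sum>j\<in>UNIV. w z $ j * cnj (w z $ j)))) \<le> Re (mean (\<lambda>z. herm_form (F z) (w z)))"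
  proof (rule mean_Re_mono[OF pw_cont_mult[OF pw_cont_const pcn] pcq])
    fix z :: complex assume "cmod z = 1"
    then have "\<alpha> * (norm (w z))\<^sup>2 \<le> Re (herm_form (F z) (w z))" using F by (simp add: symbol_def coercive_mat_def)
    then show "Re (of_real \<alpha> * (\<Sum>j\<in>UNIV. w z $ j * cnj (w z $ j))) \<le> Re (herm_form (F z) (w z))"
      unfolding nrm[symmetric] by simp
  qed
  then show "\<alpha> * (\<Sum>a\<in>window n. (cmod (u a))\<^sup>2) \<le> Q u n" unfolding mean_cmult N Q by simp
  have "Re (mean (\<lambda>z. herm_form (F z) (w z))) \<le> Re (mean (\<lambda>z. of_real \<beta> * (\<Sum>j\<in>UNIV. w z $ j * cnj (w z $ j))))"
  proof (rule mean_Re_mono[OF pcq pw_cont_mult[OF pw_cont_const pcn]])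
    fix z :: complex assume "cmod z = 1"
    then have "Re (herm_form (F z) (w z)) \<le> \<beta> * (norm (w z))\<^sup>2" using F by (simp add: symbol_def)
    then show "Re (herm_form (F z) (w z)) \<le> Re (of_real \<beta> * (\<Sum>j\<in>UNIV. w z $ j * cnj (w z $ j)))"
      unfolding nrm[symmetric] by simp
  qed
  then show "Q u n \<le> \<beta> * (\<Sum>a\<in>window n. (cmod (u a))\<^sup>2)" unfolding mean_cmult N Q by simp
qed

text \<open>Each row \<open>x\<close> of \<open>X\<close> becomes the solution \<open>y\<close> of \<open>y T(F) = x\<close>, whose norm is at most \<open>1 / \<alpha>\<close> times the norm
  of \<open>x\<close> because the quadratic form of \<open>T(F)\<close> is at least \<open>\<alpha>\<close>.\<close>

lemma frobenius_sq_mult_left_inverse_le: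
  fixes F :: "complex \<Rightarrow> complex^'m^'m"
  assumes F: "symbol \<alpha> \<beta> F" and R: "eq_on (window n) (mat_prod (window n) R (toeplitz F)) (diag_mat (\<lambda>_. 1))"
  shows "frobenius_sq (window n) (mat_prod (window n) X R) \<le> frobenius_sq (window n) X / \<alpha>\<^sup>2"
proof -
  let ?I = "window n :: (int \<times> 'm) set"
  have a: "0 < \<alpha>" using F by (simp add: symbol_def)
  have "(\<Sum>b\<in>?I. (cmod (mat_prod ?I X R a b))\<^sup>2) \<le> (\<Sum>b\<in>?I. (cmod (X a b))\<^sup>2) / \<alpha>\<^sup>2" if "a \<in> ?I" for a
  proof -
    define y where "y b = mat_prod ?I X R a b" for b
    have yT: "(\<Sum>b\<in>?I. y b * toeplitz F b c) = X a c" if c: "c \<in> ?I" for c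
    proof -
      have "(\<Sum>b\<in>?I. y b * toeplitz F b c) = mat_prod ?I (mat_prod ?I X R) (toeplitz F) a c" by (simp add: y_def mat_prod_def)
      also have "\<dots> = mat_prod ?I X (mat_prod ?I R (toeplitz F)) a c" by (simp add: mat_prod_assoc)
      also have "\<dots> = mat_prod ?I X (diag_mat (\<lambda>_. 1)) a c"
        using mat_prod_cong_right[OF R, of X] \<open>a \<in> ?I\<close> c by (simp add: eq_on_def)
      also have "\<dots> = X a c" using c by (simp add: mat_prod_diag_right)
      finally show ?thesis .
    qed
    let ?u = "\<lambda>b. cnj (y b)"
    have "(\<Sum>b\<in>?I. \<Sum>c\<in>?I. cnj (?u b) * toeplitz F b c * ?u c) = (\<Sum>c\<in>?I. (\<Sum>b\<in>?I. y b * toeplitz F b c) * cnj (y c))"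
      by (subst sum.swap) (simp add: sum_distrib_right)
    also have "\<dots> = (\<Sum>c\<in>?I. X a c * cnj (y c))" by (intro sum.cong refl) (simp add: yT)
    finally have "\<alpha> * (\<Sum>b\<in>?I. (cmod (?u b))\<^sup>2) \<le> Re (\<Sum>c\<in>?I. X a c * cnj (y c))"
      using toeplitz_coercive(1)[OF F, where u="?u" and n=n] by simp
    also have "\<dots> \<le> (\<Sum>c\<in>?I. cmod (y c) * cmod (X a c))"
      by (rule order_trans[OF complex_Re_le_cmod order_trans[OF norm_sum]]) (simp add: norm_mult mult.commute)
    also have "\<dots> \<le> (\<Sum>c\<in>?I. (\<alpha> * (cmod (y c))\<^sup>2 + (cmod (X a c))\<^sup>2 / \<alpha>) / 2)"
      by (intro sum_mono weighted_am_gm a)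
    also have "\<dots> = (\<alpha> * (\<Sum>c\<in>?I. (cmod (y c))\<^sup>2) + (\<Sum>c\<in>?I. (cmod (X a c))\<^sup>2) / \<alpha>) / 2"
      by (simp add: sum_distrib_left sum_divide_distrib sum.distrib add_divide_distrib)
    finally have "\<alpha> * (\<Sum>c\<in>?I. (cmod (y c))\<^sup>2) \<le> (\<Sum>c\<in>?I. (cmod (X a c))\<^sup>2) / \<alpha>" by simp
    then have "(\<Sum>c\<in>?I. (cmod (y c))\<^sup>2) \<le> (\<Sum>c\<in>?I. (cmod (X a c))\<^sup>2) / \<alpha> / \<alpha>"
      using a by (simp add: pos_le_divide_eq mult.commute)
    then show ?thesis by (simp add: y_def power2_eq_square)
  qed
  then have "frobenius_sq ?I (mat_prod ?I X R) \<le> (\<Sum>a\<in>?I. (\<Sum>b\<in>?I. (cmod (X a b))\<^sup>2) / \<alpha>\<^sup>2)"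
    unfolding frobenius_sq_def by (intro sum_mono)
  then show ?thesis by (simp add: frobenius_sq_def sum_divide_distrib)
qed

lemma bessel_shift: "pw_cont f \<Longrightarrow> finite K \<Longrightarrow> (\<Sum>k\<in>K. (cmod (fourier_coef f (k - l)))\<^sup>2) \<le> mean_sq f"
proof -
  assume f: "pw_cont f" and K: "finite K"
  have "(\<Sum>k\<in>K. (cmod (fourier_coef f (k - l)))\<^sup>2) = (\<Sum>k\<in>(\<lambda>k. k - l) ` K. (cmod (fourier_coef f k))\<^sup>2)"
    by (subst sum.reindex) (auto simp: inj_on_def)
  then show ?thesis using bessel[OF f, of "(\<lambda>k. k - l) ` K"] K by simp
qed

lemma frobenius_sq_toeplitz_le:
  fixes G :: "complex \<Rightarrow> complex^'m^'m"
  assumes G: "\<And>i j. pw_cont (\<lambda>z. G z $ i $ j)"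
  shows "frobenius_sq (window n) (toeplitz G) \<le> real (2 * n + 1) * (\<Sum>i\<in>UNIV. \<Sum>j\<in>UNIV. mean_sq (\<lambda>z. G z $ i $ j))"
proof -
  let ?K = "{- int n..int n}"
  have "frobenius_sq (window n) (toeplitz G) = (\<Sum>k\<in>?K. \<Sum>i\<in>UNIV. \<Sum>l\<in>?K. \<Sum>j\<in>UNIV. (cmod (fourier_coef (\<lambda>z. G z $ i $ j) (k - l)))\<^sup>2)"
    by (simp add: frobenius_sq_def sum_window toeplitz_def)
  also have "\<dots> = (\<Sum>l\<in>?K. \<Sum>k\<in>?K. \<Sum>i\<in>UNIV. \<Sum>j\<in>UNIV. (cmod (fourier_coef (\<lambda>z. G z $ i $ j) (k - l)))\<^sup>2)"
  proof -
    have "(\<Sum>k\<in>?K. \<Sum>i\<in>UNIV. \<Sum>l\<in>?K. \<Sum>j\<in>UNIV. (cmod (fourier_coef (\<lambda>z. G z $ i $ j) (k - l)))\<^sup>2)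
      = (\<Sum>k\<in>?K. \<Sum>l\<in>?K. \<Sum>i\<in>UNIV. \<Sum>j\<in>UNIV. (cmod (fourier_coef (\<lambda>z. G z $ i $ j) (k - l)))\<^sup>2)"
      by (intro sum.cong refl sum.swap)
    also have "\<dots> = (\<Sum>l\<in>?K. \<Sum>k\<in>?K. \<Sum>i\<in>UNIV. \<Sum>j\<in>UNIV. (cmod (fourier_coef (\<lambda>z. G z $ i $ j) (k - l)))\<^sup>2)"
      by (rule sum.swap)
    finally show ?thesis .
  qed
  also have "\<dots> \<le> (\<Sum>l\<in>?K. \<Sum>i\<in>UNIV. \<Sum>j\<in>UNIV. mean_sq (\<lambda>z. G z $ i $ j))"
  proof (rule sum_mono)
    fix l
    have "(\<Sum>k\<in>?K. \<Sum>i\<in>UNIV. \<Sum>j\<in>UNIV. (cmod (fourier_coef (\<lambda>z. G z $ i $ j) (k - l)))\<^sup>2)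
       = (\<Sum>i\<in>UNIV. \<Sum>j\<in>UNIV. \<Sum>k\<in>?K. (cmod (fourier_coef (\<lambda>z. G z $ i $ j) (k - l)))\<^sup>2)"
      by (subst sum.swap) (intro sum.cong refl sum.swap)
    also have "\<dots> \<le> (\<Sum>i\<in>UNIV. \<Sum>j\<in>UNIV. mean_sq (\<lambda>z. G z $ i $ j))"
      by (intro sum_mono bessel_shift G) simp
    finally show "(\<Sum>k\<in>?K. \<Sum>i\<in>UNIV. \<Sum>j\<in>UNIV. (cmod (fourier_coef (\<lambda>z. G z $ i $ j) (k - l)))\<^sup>2)
       \<le> (\<Sum>i\<in>UNIV. \<Sum>j\<in>UNIV. mean_sq (\<lambda>z. G z $ i $ j))" .
  qed
  also have "\<dots> = real (2 * n + 1) * (\<Sum>i\<in>UNIV. \<Sum>j\<in>UNIV. mean_sq (\<lambda>z. G z $ i $ j))" by simp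
  finally show ?thesis .
qed

lemma fourier_coef_shift: "fourier_coef (\<lambda>z. f z * z powi (- p)) k = fourier_coef f (k - p)"
proof -
  have "z powi k * (f z * z powi (- p)) = z powi (k - p) * f z" if "cmod z = 1" for z
    using powi_add_circle[OF that, of k "- p"] by simp
  then show ?thesis unfolding fourier_coef_def by (rule mean_cong)
qed

lemma fourier_coef_sum: "(\<And>i. i \<in> K \<Longrightarrow> pw_cont (f i)) \<Longrightarrow> fourier_coef (\<lambda>z. \<Sum>i\<in>K. f i z) k = (\<Sum>i\<in>K. fourier_coef (f i) k)"
  unfolding fourier_coef_def sum_distrib_left by (rule mean_sum) (intro pw_cont_mult pw_cont_powi)

lemma fourier_coef_cmult: "fourier_coef (\<lambda>z. c * f z) k = c * fourier_coef f k"
proof -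
  have "(\<lambda>z. z powi k * (c * f z)) = (\<lambda>z. c * (z powi k * f z))" by (simp add: mult_ac)
  then show ?thesis unfolding fourier_coef_def by (simp only: mean_cmult)
qed

lemma mean_sq_mult_le:
  assumes "pw_cont f" "pw_cont g" "\<And>z. cmod z = 1 \<Longrightarrow> cmod (f z) \<le> B"
  shows "mean_sq (\<lambda>z. f z * g z) \<le> B\<^sup>2 * mean_sq g"
proof -
  have "mean_sq (\<lambda>z. f z * g z) \<le> (\<integral>\<theta>. B\<^sup>2 * (cmod (g (cis \<theta>)))\<^sup>2 \<partial>angle_measure)"
    unfolding mean_sq_def
  proof (rule integral_mono)
    show "integrable angle_measure (\<lambda>\<theta>. (cmod (f (cis \<theta>) * g (cis \<theta>)))\<^sup>2)"
      by (rule pw_cont_mean_sq_integrable[OF pw_cont_mult[OF assms(1,2)]])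
    show "integrable angle_measure (\<lambda>\<theta>. B\<^sup>2 * (cmod (g (cis \<theta>)))\<^sup>2)"
      using pw_cont_mean_sq_integrable[OF assms(2)] by simp
    show "(cmod (f (cis \<theta>) * g (cis \<theta>)))\<^sup>2 \<le> B\<^sup>2 * (cmod (g (cis \<theta>)))\<^sup>2" for \<theta>
      unfolding norm_mult power_mult_distrib
      by (intro mult_right_mono power_mono assms(3)) auto
  qed
  then show ?thesis by (simp add: mean_sq_def)
qed

lemma mean_sq_sum_le:
  assumes "\<And>i. i \<in> K \<Longrightarrow> pw_cont (f i)"
  shows "mean_sq (\<lambda>z. \<Sum>i\<in>K. f i z) \<le> real (card K) * (\<Sum>i\<in>K. mean_sq (f i))"
proof -
  have "mean_sq (\<lambda>z. \<Sum>i\<in>K. f i z) \<le> (\<integral>\<theta>. real (card K) * (\<Sum>i\<in>K. (cmod (f i (cis \<theta>)))\<^sup>2) \<partial>angle_measure)"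
    unfolding mean_sq_def
  proof (rule integral_mono)
    show "integrable angle_measure (\<lambda>\<theta>. (cmod (\<Sum>i\<in>K. f i (cis \<theta>)))\<^sup>2)"
      by (rule pw_cont_mean_sq_integrable[OF pw_cont_sum[OF assms]])
    show "integrable angle_measure (\<lambda>\<theta>. real (card K) * (\<Sum>i\<in>K. (cmod (f i (cis \<theta>)))\<^sup>2))"
      by (intro integrable_mult_right Bochner_Integration.integrable_sum pw_cont_mean_sq_integrable assms)
    fix \<theta>
    have "(cmod (\<Sum>i\<in>K. f i (cis \<theta>)))\<^sup>2 \<le> (\<Sum>i\<in>K. cmod (f i (cis \<theta>)))\<^sup>2"
      by (intro power_mono norm_sum) auto
    also have "\<dots> \<le> (\<Sum>i\<in>K. (cmod (f i (cis \<theta>)))\<^sup>2) * real (card K)"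
      by (rule sum_squared_le_sum_of_squares)
    finally show "(cmod (\<Sum>i\<in>K. f i (cis \<theta>)))\<^sup>2 \<le> real (card K) * (\<Sum>i\<in>K. (cmod (f i (cis \<theta>)))\<^sup>2)"
      by (simp add: mult.commute)
  qed
  also have "\<dots> = real (card K) * (\<Sum>i\<in>K. mean_sq (f i))"
    unfolding mean_sq_def using pw_cont_mean_sq_integrable[OF assms] by (simp add: Bochner_Integration.integral_sum)
  finally show ?thesis .
qed

text \<open>Column \<open>(l, j)\<close> of \<open>1 - T(F) T(H)\<close>, for \<open>F H = 1\<close>, is the Fourier transform of \<open>F\<close> applied to
  the part of the trigonometric expansion of \<open>H e\<^sub>j z\<^sup>-\<^sup>l\<close> that the window misses; by Bessel's
  inequality and Parseval's identity it is small in mean square.\<close>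

lemma frobenius_sq_inverse_defect_le:
  fixes F H :: "complex \<Rightarrow> complex^'m^'m"
  assumes F: "\<And>i j. pw_cont (\<lambda>z. F z $ i $ j)" and H: "\<And>i j. pw_cont (\<lambda>z. H z $ i $ j)"
    and FH: "\<And>z. cmod z = 1 \<Longrightarrow> F z ** H z = mat 1"
    and B: "\<And>z i j. cmod z = 1 \<Longrightarrow> cmod (F z $ i $ j) \<le> B"
  shows "frobenius_sq (window n) (\<lambda>a b. diag_mat (\<lambda>_. 1) a b - mat_prod (window n) (toeplitz F) (toeplitz H) a b)
    \<le> real (2 * n + 1) * ((real CARD('m))\<^sup>2 * B\<^sup>2 *
        (\<Sum>j\<in>UNIV. \<Sum>r\<in>UNIV. mean_sq (\<lambda>z. H z $ r $ j) - Re (toeplitz_avg n (\<lambda>z. H z $ r $ j) (\<lambda>z. cnj (H z $ r $ j)))))"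
proof -
  let ?K = "{- int n..int n}"
  define D where "D a b = diag_mat (\<lambda>_. 1) a b - mat_prod (window n) (toeplitz F) (toeplitz H) a b" for a b :: "int \<times> 'm"
  define c where "c r j = fourier_coef (\<lambda>z. H z $ r $ j)" for r j
  define g where "g l j r z = H z $ r $ j * z powi (- l) - trig ?K (\<lambda>p. c r j (p - l)) z" for l j r z
  have pcg: "pw_cont (g l j r)" for l j r unfolding g_def by (intro pw_cont_diff pw_cont_mult H pw_cont_powi pw_cont_trig)
  have Dcf: "D (k, i) (l, j) = fourier_coef (\<lambda>z. \<Sum>r\<in>UNIV. F z $ i $ r * g l j r z) k" for k i l j
  proof -
    have "fourier_coef (\<lambda>z. \<Sum>r\<in>UNIV. F z $ i $ r * g l j r z) k
      = fourier_coef (\<lambda>z. (\<Sum>r\<in>UNIV. F z $ i $ r * H z $ r $ j) * z powi (- l) - (\<Sum>r\<in>UNIV. \<Sum>p\<in>?K. c r j (p - l) * (F z $ i $ r * z powi (- p)))) k"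
      unfolding g_def by (simp add: right_diff_distrib sum_subtractf sum_distrib_left sum_distrib_right mult_ac)
    also have "\<dots> = fourier_coef (\<lambda>z. \<Sum>r\<in>UNIV. F z $ i $ r * H z $ r $ j) (k - l) - (\<Sum>r\<in>UNIV. \<Sum>p\<in>?K. c r j (p - l) * fourier_coef (\<lambda>z. F z $ i $ r) (k - p))"
      by (simp only: fourier_coef_diff fourier_coef_sum fourier_coef_cmult fourier_coef_shift pw_cont_sum pw_cont_mult pw_cont_const pw_cont_powi F H)
    also have "fourier_coef (\<lambda>z. \<Sum>r\<in>UNIV. F z $ i $ r * H z $ r $ j) (k - l) = (if (k, i) = (l, j) then 1 else 0)"
    proof -
      have "fourier_coef (\<lambda>z. \<Sum>r\<in>UNIV. F z $ i $ r * H z $ r $ j) (k - l) = mean (\<lambda>z. (if i = j then 1 else 0) * z powi (k - l))"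
        unfolding fourier_coef_def
      proof (rule mean_cong)
        fix z :: complex assume z: "cmod z = 1"
        have "(\<Sum>r\<in>UNIV. F z $ i $ r * H z $ r $ j) = (F z ** H z) $ i $ j" by (simp add: matrix_matrix_mult_def)
        then show "z powi (k - l) * (\<Sum>r\<in>UNIV. F z $ i $ r * H z $ r $ j) = (if i = j then 1 else 0) * z powi (k - l)"
          unfolding FH[OF z] by (simp add: mat_def)
      qed
      then show ?thesis unfolding mean_cmult mean_powi by simp
    qed
    also have "(\<Sum>r\<in>UNIV. \<Sum>p\<in>?K. c r j (p - l) * fourier_coef (\<lambda>z. F z $ i $ r) (k - p)) = mat_prod (window n) (toeplitz F) (toeplitz H) (k, i) (l, j)"
      unfolding mat_prod_def sum_window toeplitz_def c_def by (subst sum.swap) (simp add: mult.commute)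
    finally show ?thesis by (simp add: D_def diag_mat_def)
  qed
  have nrmg: "mean_sq (g l j r) = mean_sq (\<lambda>z. H z $ r $ j) - (\<Sum>p\<in>?K. (cmod (c r j (p - l)))\<^sup>2)" for l j r
  proof -
    have "mean_sq (g l j r) = mean_sq (\<lambda>z. H z $ r $ j * z powi (- l)) - (\<Sum>p\<in>?K. (cmod (c r j (p - l)))\<^sup>2)"
      unfolding g_def by (subst mean_sq_diff_trig) (auto intro!: pw_cont_mult H simp: fourier_coef_shift c_def)
    also have "mean_sq (\<lambda>z. H z $ r $ j * z powi (- l)) = mean_sq (\<lambda>z. H z $ r $ j)"
      unfolding mean_sq_def by (simp add: norm_mult norm_power_int)
    finally show ?thesis .
  qed
  have col: "(\<Sum>k\<in>?K. (cmod (D (k, i) (l, j)))\<^sup>2)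
      \<le> real CARD('m) * B\<^sup>2 * (\<Sum>r\<in>UNIV. mean_sq (\<lambda>z. H z $ r $ j) - (\<Sum>p\<in>?K. (cmod (c r j (p - l)))\<^sup>2))" for i l j
  proof -
    have "(\<Sum>k\<in>?K. (cmod (D (k, i) (l, j)))\<^sup>2) \<le> mean_sq (\<lambda>z. \<Sum>r\<in>UNIV. F z $ i $ r * g l j r z)"
      unfolding Dcf by (intro bessel pw_cont_sum pw_cont_mult F pcg) simp
    also have "\<dots> \<le> real CARD('m) * (\<Sum>r\<in>UNIV. mean_sq (\<lambda>z. F z $ i $ r * g l j r z))"
      by (intro mean_sq_sum_le pw_cont_mult F pcg)
    also have "\<dots> \<le> real CARD('m) * (\<Sum>r\<in>UNIV. B\<^sup>2 * mean_sq (g l j r))"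
      by (intro mult_left_mono sum_mono mean_sq_mult_le F pcg B) auto
    also have "\<dots> = real CARD('m) * B\<^sup>2 * (\<Sum>r\<in>UNIV. mean_sq (g l j r))"
      by (simp add: sum_distrib_left mult.assoc)
    finally show ?thesis unfolding nrmg .
  qed
  have "frobenius_sq (window n) D = (\<Sum>k\<in>?K. \<Sum>i\<in>UNIV. \<Sum>b\<in>window n. (cmod (D (k, i) b))\<^sup>2)"
    by (simp add: frobenius_sq_def sum_window)
  also have "\<dots> = (\<Sum>i\<in>UNIV. \<Sum>b\<in>window n. \<Sum>k\<in>?K. (cmod (D (k, i) b))\<^sup>2)"
  proof -
    have "(\<Sum>k\<in>?K. \<Sum>i\<in>UNIV. \<Sum>b\<in>window n. (cmod (D (k, i) b))\<^sup>2) = (\<Sum>i\<in>UNIV. \<Sum>k\<in>?K. \<Sum>b\<in>window n. (cmod (D (k, i) b))\<^sup>2)"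
      by (rule sum.swap)
    also have "\<dots> = (\<Sum>i\<in>UNIV. \<Sum>b\<in>window n. \<Sum>k\<in>?K. (cmod (D (k, i) b))\<^sup>2)"
      by (intro sum.cong refl sum.swap)
    finally show ?thesis .
  qed
  also have "\<dots> = (\<Sum>i\<in>UNIV. \<Sum>l\<in>?K. \<Sum>j\<in>UNIV. \<Sum>k\<in>?K. (cmod (D (k, i) (l, j)))\<^sup>2)"
    by (simp only: sum_window)
  also have "\<dots> \<le> (\<Sum>i\<in>(UNIV::'m set). \<Sum>l\<in>?K. \<Sum>j\<in>UNIV. real CARD('m) * B\<^sup>2 * (\<Sum>r\<in>UNIV. mean_sq (\<lambda>z. H z $ r $ j) - (\<Sum>p\<in>?K. (cmod (c r j (p - l)))\<^sup>2)))"
    by (intro sum_mono col)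
  also have "\<dots> = real CARD('m) * (real CARD('m) * B\<^sup>2 * (\<Sum>l\<in>?K. \<Sum>j\<in>UNIV. \<Sum>r\<in>UNIV. mean_sq (\<lambda>z. H z $ r $ j) - (\<Sum>p\<in>?K. (cmod (c r j (p - l)))\<^sup>2)))"
    by (simp only: sum_constant sum_distrib_left[symmetric])
  also have "(\<Sum>l\<in>?K. \<Sum>j\<in>UNIV. \<Sum>r\<in>UNIV. mean_sq (\<lambda>z. H z $ r $ j) - (\<Sum>p\<in>?K. (cmod (c r j (p - l)))\<^sup>2))
     = (\<Sum>j\<in>UNIV. \<Sum>r\<in>UNIV. \<Sum>l\<in>?K. mean_sq (\<lambda>z. H z $ r $ j) - (\<Sum>p\<in>?K. (cmod (c r j (p - l)))\<^sup>2))"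
    by (subst sum.swap) (intro sum.cong refl sum.swap)
  also have "\<dots> = (\<Sum>j\<in>UNIV. \<Sum>r\<in>UNIV. real (2 * n + 1) * (mean_sq (\<lambda>z. H z $ r $ j) - Re (toeplitz_avg n (\<lambda>z. H z $ r $ j) (\<lambda>z. cnj (H z $ r $ j)))))"
  proof (intro sum.cong refl)
    fix j r
    have "toeplitz_avg n (\<lambda>z. H z $ r $ j) (\<lambda>z. cnj (H z $ r $ j)) = (\<Sum>l\<in>?K. \<Sum>p\<in>?K. of_real ((cmod (c r j (p - l)))\<^sup>2)) / of_nat (2 * n + 1)"
      unfolding toeplitz_avg_def fourier_coef_cnj minus_diff_eq c_def complex_norm_square ..
    also have "\<dots> = of_real ((\<Sum>l\<in>?K. \<Sum>p\<in>?K. (cmod (c r j (p - l)))\<^sup>2) / real (2 * n + 1))" by simp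
    finally have "real (2 * n + 1) * Re (toeplitz_avg n (\<lambda>z. H z $ r $ j) (\<lambda>z. cnj (H z $ r $ j))) = (\<Sum>l\<in>?K. \<Sum>p\<in>?K. (cmod (c r j (p - l)))\<^sup>2)"
      by simp
    then show "(\<Sum>l\<in>?K. mean_sq (\<lambda>z. H z $ r $ j) - (\<Sum>p\<in>?K. (cmod (c r j (p - l)))\<^sup>2))
      = real (2 * n + 1) * (mean_sq (\<lambda>z. H z $ r $ j) - Re (toeplitz_avg n (\<lambda>z. H z $ r $ j) (\<lambda>z. cnj (H z $ r $ j))))"
      unfolding right_diff_distrib sum_subtractf by simp
  qed
  also have "real CARD('m) * (real CARD('m) * B\<^sup>2 * \<dots>) = real (2 * n + 1) * ((real CARD('m))\<^sup>2 * B\<^sup>2 *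
        (\<Sum>j\<in>UNIV. \<Sum>r\<in>UNIV. mean_sq (\<lambda>z. H z $ r $ j) - Re (toeplitz_avg n (\<lambda>z. H z $ r $ j) (\<lambda>z. cnj (H z $ r $ j)))))"
    by (simp only: sum_distrib_left[symmetric] power2_eq_square mult_ac)
  finally show ?thesis by (simp only: D_def)
qed

lemma mat_trace_toeplitz_product:
  fixes H G :: "complex \<Rightarrow> complex^'m^'m"
  shows "mat_trace (window n) (mat_prod (window n) (toeplitz H) (toeplitz G)) / of_nat (2 * n + 1)
    = (\<Sum>i\<in>UNIV. \<Sum>j\<in>UNIV. toeplitz_avg n (\<lambda>z. H z $ i $ j) (\<lambda>z. G z $ j $ i))"
proof -
  let ?K = "{- int n..int n}"
  let ?f = "\<lambda>i j k l. fourier_coef (\<lambda>z. H z $ i $ j) (k - l) * fourier_coef (\<lambda>z. G z $ j $ i) (l - k)"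
  have "mat_trace (window n) (mat_prod (window n) (toeplitz H) (toeplitz G)) = (\<Sum>k\<in>?K. \<Sum>i\<in>UNIV. \<Sum>l\<in>?K. \<Sum>j\<in>UNIV. ?f i j k l)"
    by (simp add: mat_trace_def mat_prod_def sum_window toeplitz_def)
  also have "\<dots> = (\<Sum>i\<in>UNIV. \<Sum>k\<in>?K. \<Sum>l\<in>?K. \<Sum>j\<in>UNIV. ?f i j k l)" by (rule sum.swap)
  also have "\<dots> = (\<Sum>i\<in>UNIV. \<Sum>k\<in>?K. \<Sum>j\<in>UNIV. \<Sum>l\<in>?K. ?f i j k l)" by (intro sum.cong refl sum.swap)
  also have "\<dots> = (\<Sum>i\<in>UNIV. \<Sum>j\<in>UNIV. \<Sum>k\<in>?K. \<Sum>l\<in>?K. ?f i j k l)" by (intro sum.cong refl sum.swap)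
  also have "\<dots> = (\<Sum>i\<in>UNIV. \<Sum>j\<in>UNIV. \<Sum>l\<in>?K. \<Sum>k\<in>?K. ?f i j k l)" by (intro sum.cong refl sum.swap)
  finally show ?thesis by (simp only: toeplitz_avg_def sum_divide_distrib)
qed

text \<open>Write \<open>H\<close> for the pointwise inverse of \<open>F\<close> and \<open>D = 1 - T(F) T(H)\<close>. As \<open>R T(F) = 1\<close>, the difference
  \<open>R - T(H)\<close> is \<open>R D\<close>, so that the traces of \<open>R T(G)\<close> and \<open>T(H) T(G)\<close> differ by that of \<open>D (T(G) R)\<close>. The
  squared Hilbert--Schmidt norm of \<open>D\<close> is of smaller order than \<open>n\<close> and that of \<open>T(G) R\<close> is of order
  \<open>n\<close>; the trace of \<open>T(H) T(G)\<close> is an average of Toeplitz products.\<close>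

theorem toeplitz_trace_limit:
  fixes F G :: "complex \<Rightarrow> complex^'m^'m"
  assumes F: "symbol \<alpha> \<beta> F" and G: "\<And>i j. pw_cont (\<lambda>z. G z $ i $ j)"
    and R: "\<And>n. eq_on (window n) (mat_prod (window n) (R n) (toeplitz F)) (diag_mat (\<lambda>_. 1))"
  shows "(\<lambda>n. mat_trace (window n) (mat_prod (window n) (R n) (toeplitz G)) / of_nat (2 * n + 1))
    \<longlonglongrightarrow> (\<Sum>i\<in>UNIV. \<Sum>j\<in>UNIV. mean (\<lambda>z. matrix_inv (F z) $ i $ j * G z $ j $ i))"
proof -
  define H where "H z = matrix_inv (F z)" for z
  have a: "0 < \<alpha>" and pcF: "\<And>i j. pw_cont (\<lambda>z. F z $ i $ j)" and coF: "\<And>z. cmod z = 1 \<Longrightarrow> coercive_mat \<alpha> (F z)"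
    using F by (auto simp: symbol_def)
  have pcH: "pw_cont (\<lambda>z. H z $ i $ j)" for i j unfolding H_def by (rule symbol_inverse_pw_cont[OF F])
  have FH: "F z ** H z = mat 1" if "cmod z = 1" for z unfolding H_def by (rule coercive_mat_inverse(1)[OF a coF[OF that]])
  have "\<forall>i j. \<exists>B. \<forall>z. cmod z = 1 \<longrightarrow> cmod (F z $ i $ j) \<le> B" using pcF by (metis pw_contE)
  then obtain B0 where B0: "\<And>i j z. cmod z = 1 \<Longrightarrow> cmod (F z $ i $ j) \<le> B0 i j" by metis
  define B where "B = (\<Sum>i\<in>UNIV. \<Sum>j\<in>UNIV. \<bar>B0 i j\<bar>)"
  have B: "cmod (F z $ i $ j) \<le> B" if "cmod z = 1" for z i j
  proof -
    have "cmod (F z $ i $ j) \<le> \<bar>B0 i j\<bar>" using B0[OF that, of i j] by simp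
    also have "\<dots> \<le> (\<Sum>j\<in>UNIV. \<bar>B0 i j\<bar>)" by (rule member_le_sum) auto
    also have "\<dots> \<le> B" unfolding B_def by (rule member_le_sum) (auto intro: sum_nonneg)
    finally show ?thesis .
  qed
  define d where "d n = (real CARD('m))\<^sup>2 * B\<^sup>2 *
        (\<Sum>j\<in>UNIV. \<Sum>r\<in>UNIV. mean_sq (\<lambda>z. H z $ r $ j) - Re (toeplitz_avg n (\<lambda>z. H z $ r $ j) (\<lambda>z. cnj (H z $ r $ j))))" for n
  have d0: "d \<longlonglongrightarrow> 0"
  proof -
    have "(\<lambda>n. Re (toeplitz_avg n (\<lambda>z. H z $ r $ j) (\<lambda>z. cnj (H z $ r $ j)))) \<longlonglongrightarrow> mean_sq (\<lambda>z. H z $ r $ j)" for r j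
      using tendsto_Re[OF toeplitz_avg_tendsto[OF pcH pw_cont_cnj[OF pcH], of r j r j]]
      unfolding mean_sq_eq_mean[OF pcH, symmetric] by simp
    then have "d \<longlonglongrightarrow> (real CARD('m))\<^sup>2 * B\<^sup>2 * (\<Sum>j\<in>(UNIV::'m set). \<Sum>r\<in>(UNIV::'m set). mean_sq (\<lambda>z. H z $ r $ j) - mean_sq (\<lambda>z. H z $ r $ j))"
      unfolding d_def by (intro tendsto_intros)
    then show ?thesis by simp
  qed
  define C where "C = (\<Sum>i\<in>UNIV. \<Sum>j\<in>UNIV. mean_sq (\<lambda>z. G z $ i $ j)) / \<alpha>\<^sup>2"
  have C0: "0 \<le> C" unfolding C_def by (intro divide_nonneg_nonneg sum_nonneg mean_sq_nonneg) auto
  define E where "E n = mat_trace (window n) (mat_prod (window n) (R n) (toeplitz G)) / of_nat (2 * n + 1)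
      - mat_trace (window n) (mat_prod (window n) (toeplitz H) (toeplitz G)) / of_nat (2 * n + 1)" for n
  have Ebound: "cmod (E n) \<le> (t * d n + C / t) / 2" if t: "0 < t" for n t
  proof -
    let ?I = "window n :: (int \<times> 'm) set" and ?N = "real (2 * n + 1)"
    define D where "D a b = diag_mat (\<lambda>_. 1) a b - mat_prod ?I (toeplitz F) (toeplitz H) a b" for a b
    let ?X = "mat_prod ?I (toeplitz G) (R n)"
    have RD: "eq_on ?I (mat_prod ?I (R n) D) (\<lambda>a b. R n a b - toeplitz H a b)"
    proof -
      have 1: "mat_prod ?I (R n) D = (\<lambda>a b. mat_prod ?I (R n) (diag_mat (\<lambda>_. 1)) a b - mat_prod ?I (mat_prod ?I (R n) (toeplitz F)) (toeplitz H) a b)"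
        unfolding mat_prod_assoc unfolding D_def mat_prod_def[of ?I "R n"] by (simp add: right_diff_distrib sum_subtractf)
      have 2: "eq_on ?I (mat_prod ?I (mat_prod ?I (R n) (toeplitz F)) (toeplitz H)) (mat_prod ?I (diag_mat (\<lambda>_. 1)) (toeplitz H))"
        by (rule mat_prod_cong_left[OF R])
      show ?thesis unfolding 1 using 2 by (simp add: eq_on_def mat_prod_diag_left mat_prod_diag_right)
    qed
    have "mat_trace ?I (mat_prod ?I D ?X) = mat_trace ?I (mat_prod ?I (mat_prod ?I D (toeplitz G)) (R n))" by (simp add: mat_prod_assoc)
    also have "\<dots> = mat_trace ?I (mat_prod ?I (R n) (mat_prod ?I D (toeplitz G)))" by (rule mat_trace_comm)
    also have "\<dots> = mat_trace ?I (mat_prod ?I (mat_prod ?I (R n) D) (toeplitz G))" by (simp add: mat_prod_assoc)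
    also have "\<dots> = mat_trace ?I (mat_prod ?I (\<lambda>a b. R n a b - toeplitz H a b) (toeplitz G))"
      by (rule mat_trace_cong[OF mat_prod_cong_left[OF RD]])
    also have "\<dots> = mat_trace ?I (mat_prod ?I (R n) (toeplitz G)) - mat_trace ?I (mat_prod ?I (toeplitz H) (toeplitz G))"
      by (simp add: mat_trace_def mat_prod_def left_diff_distrib sum_subtractf)
    finally have tE: "E n = mat_trace ?I (mat_prod ?I D ?X) / of_nat (2 * n + 1)" by (simp add: E_def diff_divide_distrib)
    have hD: "frobenius_sq ?I D \<le> ?N * d n"
      unfolding D_def[abs_def] d_def by (rule frobenius_sq_inverse_defect_le[OF pcF pcH FH B])
    have hX: "frobenius_sq ?I ?X \<le> ?N * C"
    proof -
      have "frobenius_sq ?I ?X \<le> frobenius_sq ?I (toeplitz G) / \<alpha>\<^sup>2" by (rule frobenius_sq_mult_left_inverse_le[OF F R])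
      also have "\<dots> \<le> (?N * (\<Sum>i\<in>UNIV. \<Sum>j\<in>UNIV. mean_sq (\<lambda>z. G z $ i $ j))) / \<alpha>\<^sup>2"
        by (intro divide_right_mono frobenius_sq_toeplitz_le G) simp
      finally show ?thesis by (simp add: C_def)
    qed
    have "cmod (mat_trace ?I (mat_prod ?I D ?X)) \<le> (t * frobenius_sq ?I D + frobenius_sq ?I ?X / t) / 2" by (rule mat_trace_mat_prod_le[OF t])
    also have "\<dots> \<le> (t * (?N * d n) + (?N * C) / t) / 2"
      using t by (intro divide_right_mono add_mono mult_left_mono hD hX) auto
    also have "\<dots> = ?N * ((t * d n + C / t) / 2)" by (simp add: field_simps)
    finally have b: "cmod (mat_trace ?I (mat_prod ?I D ?X)) \<le> ?N * ((t * d n + C / t) / 2)" .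
    have "cmod (E n) = cmod (mat_trace ?I (mat_prod ?I D ?X)) / ?N" unfolding tE norm_divide norm_of_nat ..
    also have "\<dots> \<le> (t * d n + C / t) / 2" using b by (subst pos_divide_le_eq) (auto simp: mult.commute)
    finally show ?thesis .
  qed
  have E0: "E \<longlonglongrightarrow> 0"
  proof (rule LIMSEQ_I)
    fix e :: real assume e: "0 < e"
    define t where "t = (C + 1) / e"
    have t: "0 < t" using e C0 by (simp add: t_def)
    have ct: "C / t < e" using e C0 t by (simp add: t_def field_simps)
    have "\<forall>\<^sub>F n in sequentially. t * d n < e"
      using tendsto_mult[OF tendsto_const[of t] d0] e by (intro order_tendstoD(2)[where y=0]) auto
    then have "\<forall>\<^sub>F n in sequentially. norm (E n - 0) < e"
    proof eventually_elim
      case (elim n)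
      then show ?case using ct Ebound[OF t, of n] by simp
    qed
    then show "\<exists>n0. \<forall>n\<ge>n0. norm (E n - 0) < e" by (simp add: eventually_sequentially)
  qed
  have "(\<lambda>n. mat_trace (window n) (mat_prod (window n) (toeplitz H) (toeplitz G)) / of_nat (2 * n + 1)) \<longlonglongrightarrow> (\<Sum>i\<in>UNIV. \<Sum>j\<in>UNIV. mean (\<lambda>z. H z $ i $ j * G z $ j $ i))"
    unfolding mat_trace_toeplitz_product by (intro tendsto_sum toeplitz_avg_tendsto pcH G)
  from tendsto_add[OF E0 this] show ?thesis by (simp add: E_def[abs_def] H_def)
qed

section \<open>From eigenvalues to entropy rates\<close>

text \<open>This removes the logarithm: sums of the integrand over the eigenvalues are traces of
  resolvents.\<close>

lemma entropy_summand_integral: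
  assumes x: "0 < (x::real)"
  shows "x - 1 - ln x = (\<integral>t. ((x - 1) - (x - 1) / (1 + t * (x - 1))) * indicator {0..1} t \<partial>lborel)"
proof -
  have pos: "0 < 1 + t * (x - 1)" if "0 \<le> t" "t \<le> 1" for t
  proof -
    have "1 + t * (x - 1) = (1 - t) + t * x" by (simp add: algebra_simps)
    also have "\<dots> > 0" using that x by (cases "t = 0") (auto intro!: add_nonneg_pos)
    finally show ?thesis .
  qed
  have "(\<integral>t. ((x - 1) - (x - 1) / (1 + t * (x - 1))) * indicator {0..1} t \<partial>lborel)
     = (1 * (x - 1) - ln (1 + 1 * (x - 1))) - (0 * (x - 1) - ln (1 + 0 * (x - 1)))"
  proof (rule integral_FTC_Icc_real)
    fix t :: real assume t: "0 \<le> t" "t \<le> 1"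
    show "DERIV (\<lambda>t. t * (x - 1) - ln (1 + t * (x - 1))) t :> (x - 1) - (x - 1) / (1 + t * (x - 1))"
      using pos[OF t] by (auto intro!: derivative_eq_intros)
    show "isCont (\<lambda>t. (x - 1) - (x - 1) / (1 + t * (x - 1))) t"
      using pos[OF t] by (intro continuous_intros) auto
  qed simp
  then show ?thesis by simp
qed

lemma resolvent_summand_bound:
  assumes c: "0 < c" "c \<le> 1" and x: "c \<le> x" "x \<le> C" and t: "0 \<le> t" "t \<le> (1::real)"
  shows "\<bar>(x - 1) - (x - 1) / (1 + t * (x - 1))\<bar> \<le> (C + 1) + (C + 1) / c"
proof -
  have "1 + t * (x - 1) = (1 - t) * 1 + t * x" by (simp add: algebra_simps)
  also have "\<dots> \<ge> (1 - t) * c + t * c" using t c x by (intro add_mono mult_left_mono) auto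
  finally have d: "c \<le> 1 + t * (x - 1)" by (simp add: algebra_simps)
  have x1: "\<bar>x - 1\<bar> \<le> C + 1" using c x by auto
  have "\<bar>(x - 1) / (1 + t * (x - 1))\<bar> = \<bar>x - 1\<bar> / (1 + t * (x - 1))" using d c by simp
  also have "\<dots> \<le> (C + 1) / c" using d c x1 by (intro frac_le) auto
  finally show ?thesis using x1 abs_triangle_ineq4[of "x - 1" "(x - 1) / (1 + t * (x - 1))"] by linarith
qed

text \<open>Dominated convergence in \<open>t\<close>. Both domains use this with their own weight \<open>w n\<close>; since the normalised
  traces have the same limit \<open>\<psi>\<close>, so have the normalised relative entropies.\<close>

lemma entropy_rate_limit:
  fixes \<mu> :: "nat \<Rightarrow> 'i \<Rightarrow> real" and w :: "nat \<Rightarrow> real"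
  assumes fin: "\<And>n. finite (I n)" and w: "\<And>n. 0 \<le> w n" and crd: "\<And>n. real (card (I n)) \<le> K * w n"
    and c: "0 < c" "c \<le> 1" and mu: "\<And>n i. i \<in> I n \<Longrightarrow> c \<le> \<mu> n i \<and> \<mu> n i \<le> C"
    and lim: "\<And>t. 0 \<le> t \<Longrightarrow> t \<le> 1 \<Longrightarrow> (\<lambda>n. (\<Sum>i\<in>I n. (\<mu> n i - 1) / (1 + t * (\<mu> n i - 1))) / w n) \<longlonglongrightarrow> \<psi> t"
  shows "(\<lambda>n. (\<Sum>i\<in>I n. (\<mu> n i - 1 - ln (\<mu> n i)) / 2) / w n) \<longlonglongrightarrow> (\<integral>t. (\<psi> 0 - \<psi> t) * indicator {0..1} t \<partial>lborel) / 2"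
proof -
  define \<phi> where "\<phi> x t = (x - 1) - (x - 1) / (1 + t * (x - 1))" for x t :: real
  have [measurable]: "\<phi> x \<in> borel_measurable borel" for x unfolding \<phi>_def by measurable
  define B where "B = (\<bar>C\<bar> + 1) + (\<bar>C\<bar> + 1) / c"
  have B: "\<bar>\<phi> (\<mu> n i) t * indicator {0..1} t\<bar> \<le> B * indicator {0..1} t" if "i \<in> I n" for n i t
    using resolvent_summand_bound[OF c, of "\<mu> n i" "\<bar>C\<bar>" t] mu[OF that] by (auto simp: \<phi>_def B_def indicator_def)
  have B0: "0 \<le> B" using c by (simp add: B_def)
  have iB: "integrable lborel (\<lambda>t. b * indicator {0..1::real} t :: real)" for b
    by (intro integrable_mult_right integrable_real_indicator) auto
  have int: "integrable lborel (\<lambda>t. \<phi> (\<mu> n i) t * indicator {0..1} t)" if "i \<in> I n" for n i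
  proof (rule Bochner_Integration.integrable_bound[OF iB[of B]])
    show "AE t in lborel. norm (\<phi> (\<mu> n i) t * indicator {0..1} t) \<le> norm (B * indicator {0..1} t)"
      by (rule AE_I2) (simp only: real_norm_def order_trans[OF B[OF that] abs_ge_self])
  qed measurable
  define g where "g n t = (\<Sum>i\<in>I n. \<phi> (\<mu> n i) t * indicator {0..1} t) / w n" for n t
  have eq: "(\<Sum>i\<in>I n. (\<mu> n i - 1 - ln (\<mu> n i)) / 2) / w n = (\<integral>t. g n t \<partial>lborel) / 2" for n
  proof -
    have "(\<integral>t. g n t \<partial>lborel) = (\<Sum>i\<in>I n. \<integral>t. \<phi> (\<mu> n i) t * indicator {0..1} t \<partial>lborel) / w n"
      unfolding g_def by (simp add: Bochner_Integration.integral_sum int)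
    also have "\<dots> = (\<Sum>i\<in>I n. \<mu> n i - 1 - ln (\<mu> n i)) / w n"
    proof -
      have "(\<integral>t. \<phi> (\<mu> n i) t * indicator {0..1} t \<partial>lborel) = \<mu> n i - 1 - ln (\<mu> n i)" if "i \<in> I n" for i
        unfolding \<phi>_def by (rule entropy_summand_integral[symmetric]) (use mu[OF that] c in auto)
      then show ?thesis by simp
    qed
    finally show ?thesis by (simp add: sum_divide_distrib mult.commute)
  qed
  have "(\<lambda>n. \<integral>t. g n t \<partial>lborel) \<longlonglongrightarrow> (\<integral>t. (\<psi> 0 - \<psi> t) * indicator {0..1} t \<partial>lborel)"
  proof (rule integral_dominated_convergence[where w="\<lambda>t. (\<bar>K\<bar> * B) * indicator {0..1} t"])
    have glim: "(\<lambda>n. g n t) \<longlonglongrightarrow> (\<psi> 0 - \<psi> t) * indicator {0..1} t" for t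
    proof (cases "t \<in> {0..1}")
      case True
      have geq: "g n t = (\<Sum>i\<in>I n. (\<mu> n i - 1) / (1 + 0 * (\<mu> n i - 1))) / w n - (\<Sum>i\<in>I n. (\<mu> n i - 1) / (1 + t * (\<mu> n i - 1))) / w n" for n
        using True by (simp add: g_def \<phi>_def sum_subtractf diff_divide_distrib)
      have "(\<lambda>n. g n t) \<longlonglongrightarrow> \<psi> 0 - \<psi> t"
        unfolding geq by (rule tendsto_diff[OF lim lim]) (use True in auto)
      then show ?thesis using True by simp
    next
      case False
      then show ?thesis by (simp add: g_def)
    qed
    then show "AE t in lborel. (\<lambda>n. g n t) \<longlonglongrightarrow> (\<psi> 0 - \<psi> t) * indicator {0..1} t" by simp
    show gm: "g n \<in> borel_measurable lborel" for n unfolding g_def by measurable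
    show "(\<lambda>t. (\<psi> 0 - \<psi> t) * indicator {0..1} t) \<in> borel_measurable lborel"
      by (rule borel_measurable_LIMSEQ_real[OF glim gm])
    show "integrable lborel (\<lambda>t. (\<bar>K\<bar> * B) * indicator {0..1::real} t :: real)" by (rule iB)
    show "AE t in lborel. norm (g n t) \<le> (\<bar>K\<bar> * B) * indicator {0..1} t" for n
    proof (rule AE_I2)
      fix t :: real
      have "norm (\<Sum>i\<in>I n. \<phi> (\<mu> n i) t * indicator {0..1} t) \<le> (\<Sum>i\<in>I n. B * indicator {0..1} t)"
        by (rule sum_norm_le) (use B in simp)
      also have "\<dots> = real (card (I n)) * (B * indicator {0..1} t)" by simp
      also have "\<dots> \<le> (\<bar>K\<bar> * w n) * (B * indicator {0..1} t)"
      proof (rule mult_right_mono)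
        have "K * w n \<le> \<bar>K\<bar> * w n" using w[of n] by (intro mult_right_mono) auto
        then show "real (card (I n)) \<le> \<bar>K\<bar> * w n" using crd[of n] by linarith
      qed (use B0 in auto)
      finally have 1: "norm (\<Sum>i\<in>I n. \<phi> (\<mu> n i) t * indicator {0..1} t) \<le> w n * (\<bar>K\<bar> * B * indicator {0..1} t)"
        by (simp add: mult_ac)
      show "norm (g n t) \<le> (\<bar>K\<bar> * B) * indicator {0..1} t"
      proof (cases "w n = 0")
        case False
        then have "0 < w n" using w[of n] by simp
        then show ?thesis using 1 by (simp add: g_def divide_le_eq mult.commute)
      qed (simp add: g_def B0)
    qed
  qed
  then show ?thesis unfolding eq by (intro tendsto_divide tendsto_const) auto
qed

section \<open>Gaussian processes with a given symbol\<close>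

text \<open>Everything that is used about one of the processes: square integrable components, covariances equal to the
  Fourier coefficients of \<open>F\<close>, and centred Gaussian linear combinations.\<close>

definition gaussian_process :: "'a measure \<Rightarrow> (int \<Rightarrow> 'a \<Rightarrow> real^'m) \<Rightarrow> (complex \<Rightarrow> complex^'m^'m) \<Rightarrow> bool" where
  "gaussian_process M y F \<longleftrightarrow>
     (\<forall>k. y k \<in> borel_measurable M) \<and> (\<forall>k i. integrable M (\<lambda>\<omega>. (y k \<omega> $ i)\<^sup>2)) \<and>
     (\<forall>k l i j. complex_of_real (\<integral>\<omega>. y k \<omega> $ i * y l \<omega> $ j \<partial>M) = fourier_coef (\<lambda>z. F z $ i $ j) (k - l)) \<and>
     (\<forall>K a. finite K \<longrightarrow> (\<integral>\<omega>. iexp (\<Sum>k\<in>K. a k \<bullet> y k \<omega>) \<partial>M)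
        = of_real (exp (- (\<integral>\<omega>. (\<Sum>k\<in>K. a k \<bullet> y k \<omega>)\<^sup>2 \<partial>M) / 2)))"

lemma gaussian_rv_char:
  assumes "prob_space M" and g: "gaussian_rv M X" and m: "(\<integral>\<omega>. X \<omega> \<partial>M) = 0"
  shows "(\<integral>\<omega>. iexp (X \<omega>) \<partial>M) = of_real (exp (- (\<integral>\<omega>. (X \<omega>)\<^sup>2 \<partial>M) / 2))"
proof -
  interpret prob_space M by fact
  have X[measurable]: "X \<in> borel_measurable M" using g by (simp add: gaussian_rv_def)
  from g consider \<mu> \<sigma> where "0 < \<sigma>" "distributed M lborel X (normal_density \<mu> \<sigma>)" | \<mu> where "AE \<omega> in M. X \<omega> = \<mu>"
    unfolding gaussian_rv_def by blast
  then show ?thesis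
  proof cases
    case (1 \<mu> \<sigma>)
    have mu: "\<mu> = 0" using normal_distributed_expectation[OF 1] m by simp
    have "(\<integral>\<omega>. (X \<omega>)\<^sup>2 \<partial>M) = \<sigma>\<^sup>2" using normal_distributed_variance[OF 1] m by simp
    then show ?thesis using char_normal[OF \<open>prob_space M\<close> 1(2,1), of 1] mu by simp
  next
    case (2 \<mu>)
    have "(\<integral>\<omega>. X \<omega> \<partial>M) = (\<integral>\<omega>. \<mu> \<partial>M)" by (rule integral_cong_AE) (use 2 in auto)
    then have mu: "\<mu> = 0" using m by (simp add: prob_space)
    have "(\<integral>\<omega>. iexp (X \<omega>) \<partial>M) = (\<integral>\<omega>. 1 \<partial>M)"
      by (rule integral_cong_AE) (use 2 in \<open>auto simp: mu\<close>)
    moreover have "(\<integral>\<omega>. (X \<omega>)\<^sup>2 \<partial>M) = (\<integral>\<omega>. 0 \<partial>M)"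
      by (rule integral_cong_AE) (use 2 in \<open>auto simp: mu\<close>)
    ultimately show ?thesis by (simp add: prob_space)
  qed
qed

lemma gaussian_processI:
  fixes y z :: "int \<Rightarrow> 'a \<Rightarrow> real^'m"
  assumes pr: "prob_space M" and jg: "jointly_gaussian M y z" and zm: "zero_mean M y" and st: "stationary M y"
    and sd: "is_spectral_density M y \<Phi>" and F: "\<And>i j. pw_cont (\<lambda>z. F z $ i $ j)"
    and S: "finite S" "\<And>z. z \<notin> S \<Longrightarrow> F z = \<Phi> z"
  shows "gaussian_process M y F"
  unfolding gaussian_process_def
proof (intro conjI allI impI)
  have ym: "y k \<in> borel_measurable M" and ysq: "integrable M (\<lambda>\<omega>. (norm (y k \<omega>))\<^sup>2)" for k
    using st by (auto simp: stationary_def)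
  show "y k \<in> borel_measurable M" for k by (rule ym)
  show "integrable M (\<lambda>\<omega>. (y k \<omega> $ i)\<^sup>2)" for k i
  proof (rule Bochner_Integration.integrable_bound[OF ysq[of k]])
    have "(\<lambda>\<omega>. y k \<omega> \<bullet> axis i 1) \<in> borel_measurable M" using ym[of k] by measurable
    then show "(\<lambda>\<omega>. (y k \<omega> $ i)\<^sup>2) \<in> borel_measurable M" by (simp add: inner_axis)
    have "(y k \<omega> $ i)\<^sup>2 \<le> (norm (y k \<omega>))\<^sup>2" for \<omega>
      using Finite_Cartesian_Product.norm_nth_le[of "y k \<omega>" i] by (simp add: abs_le_square_iff[symmetric])
    then show "AE \<omega> in M. norm ((y k \<omega> $ i)\<^sup>2) \<le> norm ((norm (y k \<omega>))\<^sup>2)" by simp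
  qed
  show "complex_of_real (\<integral>\<omega>. y k \<omega> $ i * y l \<omega> $ j \<partial>M) = fourier_coef (\<lambda>z. F z $ i $ j) (k - l)" for k l i j
    by (rule covariance_eq_coefficient[OF sd F S])
  fix K :: "int set" and a :: "int \<Rightarrow> real^'m" assume K: "finite K"
  have yint: "integrable M (y k)" "(\<integral>\<omega>. y k \<omega> \<partial>M) = 0" for k using zm by (auto simp: zero_mean_def)
  show "(\<integral>\<omega>. iexp (\<Sum>k\<in>K. a k \<bullet> y k \<omega>) \<partial>M) = of_real (exp (- (\<integral>\<omega>. (\<Sum>k\<in>K. a k \<bullet> y k \<omega>)\<^sup>2 \<partial>M) / 2))"
  proof (rule gaussian_rv_char[OF pr])
    show "gaussian_rv M (\<lambda>\<omega>. \<Sum>k\<in>K. a k \<bullet> y k \<omega>)"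
      using jg[unfolded jointly_gaussian_def, rule_format, OF K, of a "\<lambda>_. 0"] by simp
    have "(\<integral>\<omega>. (\<Sum>k\<in>K. a k \<bullet> y k \<omega>) \<partial>M) = (\<Sum>k\<in>K. \<integral>\<omega>. a k \<bullet> y k \<omega> \<partial>M)"
      by (intro Bochner_Integration.integral_sum integrable_inner_right yint)
    also have "\<dots> = 0" using yint by simp
    finally show "(\<integral>\<omega>. (\<Sum>k\<in>K. a k \<bullet> y k \<omega>) \<partial>M) = 0" .
  qed
qed

lemma jointly_gaussian_commute: "jointly_gaussian M y z \<Longrightarrow> jointly_gaussian M z y"
  unfolding jointly_gaussian_def by (subst add.commute) blast

lemma process_component_measurable:
  assumes "gaussian_process M y F" shows "(\<lambda>\<omega>. y k \<omega> $ i) \<in> borel_measurable M"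
proof -
  have "y k \<in> borel_measurable M" using assms by (simp add: gaussian_process_def)
  then have "(\<lambda>\<omega>. y k \<omega> \<bullet> axis i 1) \<in> borel_measurable M" by measurable
  then show ?thesis by (simp add: inner_axis)
qed

lemma integrable_product_of_squares:
  fixes f g :: "'a \<Rightarrow> real"
  assumes "f \<in> borel_measurable M" "g \<in> borel_measurable M"
    and f: "integrable M (\<lambda>\<omega>. (f \<omega>)\<^sup>2)" and g: "integrable M (\<lambda>\<omega>. (g \<omega>)\<^sup>2)"
  shows "integrable M (\<lambda>\<omega>. f \<omega> * g \<omega>)"
proof (rule Bochner_Integration.integrable_bound[OF Bochner_Integration.integrable_add[OF f g]])
  show "(\<lambda>\<omega>. f \<omega> * g \<omega>) \<in> borel_measurable M" using assms(1,2) by measurable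
  have "\<bar>x * y\<bar> \<le> x\<^sup>2 + y\<^sup>2" for x y :: real
    using sum_squares_bound[of "\<bar>x\<bar>" "\<bar>y\<bar>"] mult_nonneg_nonneg[OF abs_ge_zero[of x] abs_ge_zero[of y]]
    unfolding abs_mult power2_abs by linarith
  then show "AE \<omega> in M. norm (f \<omega> * g \<omega>) \<le> norm ((f \<omega>)\<^sup>2 + (g \<omega>)\<^sup>2)" by (intro AE_I2) simp
qed

lemma process_product_integrable:
  assumes "gaussian_process M y F" shows "integrable M (\<lambda>\<omega>. y k \<omega> $ i * y l \<omega> $ j)"
  using assms by (intro integrable_product_of_squares process_component_measurable[OF assms])
    (auto simp: gaussian_process_def)

section \<open>The time-domain rate\<close>

definition covar :: "'a measure \<Rightarrow> (int \<Rightarrow> 'a \<Rightarrow> real^'m) \<Rightarrow> int \<times> 'm \<Rightarrow> int \<times> 'm \<Rightarrow> real" where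
  "covar M y a b = (\<integral>\<omega>. y (fst a) \<omega> $ snd a * y (fst b) \<omega> $ snd b \<partial>M)"

lemma of_real_covar: "gaussian_process M y F \<Longrightarrow> complex_of_real (covar M y a b) = toeplitz F a b"
  by (simp add: gaussian_process_def covar_def toeplitz_def)

lemma covar_sym: "covar M y a b = covar M y b a"
  by (simp add: covar_def mult.commute)

lemma second_moment_eq_bilin:
  assumes y: "gaussian_process M y F"
  shows "(\<integral>\<omega>. (\<Sum>a\<in>window n. u a * y (fst a) \<omega> $ snd a)\<^sup>2 \<partial>M) = bilin (window n) (covar M y) u u"
proof -
  have "(\<integral>\<omega>. (\<Sum>a\<in>window n. u a * y (fst a) \<omega> $ snd a)\<^sup>2 \<partial>M)
    = (\<integral>\<omega>. (\<Sum>a\<in>window n. \<Sum>b\<in>window n. (u a * u b) * (y (fst a) \<omega> $ snd a * y (fst b) \<omega> $ snd b)) \<partial>M)"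
    by (simp add: power2_eq_square sum_product mult_ac)
  also have "\<dots> = (\<Sum>a\<in>window n. \<Sum>b\<in>window n. (u a * u b) * covar M y a b)"
    unfolding covar_def
    by (simp add: Bochner_Integration.integral_sum process_product_integrable[OF y])
  finally show ?thesis by (simp add: bilin_def mult_ac)
qed

lemma process_combination:
  "(\<Sum>a\<in>window n. u a * y (fst a) \<omega> $ snd a) = (\<Sum>k\<in>{- int n..int n}. (\<chi> j. u (k, j)) \<bullet> (y k \<omega> :: real^'m))"
  by (simp add: sum_window inner_vec_def)

lemma gaussian_process_char:
  assumes y: "gaussian_process M y F" and fin: "finite K"
  shows "(\<integral>\<omega>. iexp (\<Sum>k\<in>K. a k \<bullet> y k \<omega>) \<partial>M) = of_real (exp (- (\<integral>\<omega>. (\<Sum>k\<in>K. a k \<bullet> y k \<omega>)\<^sup>2 \<partial>M) / 2))"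
proof -
  have A: "\<forall>K a. finite K \<longrightarrow> (\<integral>\<omega>. iexp (\<Sum>k\<in>K. a k \<bullet> y k \<omega>) \<partial>M)
        = of_real (exp (- (\<integral>\<omega>. (\<Sum>k\<in>K. a k \<bullet> y k \<omega>)\<^sup>2 \<partial>M) / 2))"
    using y unfolding gaussian_process_def by (elim conjE)
  show ?thesis by (rule A[THEN spec, THEN spec, THEN mp, OF fin])
qed

lemma process_gaussian_family:
  assumes y: "gaussian_process M y F"
  shows "gaussian_family M (window n) (\<lambda>a \<omega>. y (fst a) \<omega> $ snd a) (covar M y)"
  unfolding gaussian_family_def
proof
  fix u
  have "(\<integral>\<omega>. iexp (\<Sum>k\<in>{- int n..int n}. (\<chi> j. u (k, j)) \<bullet> y k \<omega>) \<partial>M)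
     = of_real (exp (- (\<integral>\<omega>. (\<Sum>k\<in>{- int n..int n}. (\<chi> j. u (k, j)) \<bullet> y k \<omega>)\<^sup>2 \<partial>M) / 2))"
    by (rule gaussian_process_char[OF y]) simp
  moreover have "(\<Sum>k\<in>{- int n..int n}. (\<chi> j. u (k, j)) \<bullet> y k \<omega>) = (\<Sum>a\<in>window n. u a * y (fst a) \<omega> $ snd a)" for \<omega>
    by (rule process_combination[symmetric])
  ultimately show "(\<integral>\<omega>. iexp (\<Sum>a\<in>window n. u a * y (fst a) \<omega> $ snd a) \<partial>M) = of_real (exp (- bilin (window n) (covar M y) u u / 2))"
    by (simp only: second_moment_eq_bilin[OF y])
qed

lemma covar_form_bounds:
  fixes y :: "int \<Rightarrow> 'a \<Rightarrow> real^'m"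
  assumes y: "gaussian_process M y F" and F: "symbol \<alpha> \<beta> F"
  shows "\<alpha> * (\<Sum>a\<in>window n. (u a)\<^sup>2) \<le> bilin (window n) (covar M y) u u" "bilin (window n) (covar M y) u u \<le> \<beta> * (\<Sum>a\<in>window n. (u a)\<^sup>2)"
proof -
  let ?u = "\<lambda>a. complex_of_real (u a)"
  have "(\<Sum>a\<in>window n. \<Sum>b\<in>window n. cnj (?u a) * toeplitz F a b * ?u b) = of_real (bilin (window n) (covar M y) u u)"
    unfolding bilin_def by (simp add: of_real_covar[OF y])
  then have "Re (\<Sum>a\<in>window n. \<Sum>b\<in>window n. cnj (?u a) * toeplitz F a b * ?u b) = bilin (window n) (covar M y) u u" by simp
  then show "\<alpha> * (\<Sum>a\<in>window n. (u a)\<^sup>2) \<le> bilin (window n) (covar M y) u u" "bilin (window n) (covar M y) u u \<le> \<beta> * (\<Sum>a\<in>window n. (u a)\<^sup>2)"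
    using toeplitz_coercive[OF F, where u="?u" and n=n] by simp_all
qed

lemma borel_measurable_vec_lambda:
  fixes f :: "'m::finite \<Rightarrow> 'a \<Rightarrow> 'b::euclidean_space"
  assumes "\<And>j. f j \<in> borel_measurable M"
  shows "(\<lambda>\<omega>. \<chi> j. f j \<omega>) \<in> borel_measurable M"
proof -
  have "(\<lambda>\<omega>. (\<chi> j. f j \<omega>) \<bullet> b) \<in> borel_measurable M" if bB: "b \<in> Basis" for b
  proof -
    obtain i u where b: "b = axis i u" using bB unfolding Basis_vec_def by blast
    show ?thesis unfolding b inner_axis using assms[of i] by simp
  qed
  then show ?thesis by (subst borel_measurable_euclidean_space) auto
qed

lemma fourier_coef_add: "pw_cont f \<Longrightarrow> pw_cont g \<Longrightarrow> fourier_coef (\<lambda>z. f z + g z) k = fourier_coef f k + fourier_coef g k"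
  unfolding fourier_coef_def by (simp add: distrib_left mean_add pw_cont_mult)

text \<open>The limit of the normalised traces in both domains.\<close>

definition limit_trace :: "(complex \<Rightarrow> complex^'m^'m) \<Rightarrow> (complex \<Rightarrow> complex^'m^'m) \<Rightarrow> real \<Rightarrow> real" where
  "limit_trace F G t = Re (\<Sum>i\<in>UNIV. \<Sum>j\<in>UNIV. mean (\<lambda>z. matrix_inv (interpolate F G t z) $ i $ j * (F z $ j $ i - G z $ j $ i)))"

definition rate :: "(complex \<Rightarrow> complex^'m^'m) \<Rightarrow> (complex \<Rightarrow> complex^'m^'m) \<Rightarrow> real" where
  "rate F G = (\<integral>t. (limit_trace F G 0 - limit_trace F G t) * indicator {0..1} t \<partial>lborel) / 2"

lemma positive_form:
  fixes u :: "'i \<Rightarrow> real"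
  assumes "finite I" "0 < \<alpha>" "\<alpha> * (\<Sum>a\<in>I. (u a)\<^sup>2) \<le> b" "\<exists>k\<in>I. u k \<noteq> 0"
  shows "0 < b"
proof -
  obtain k where "k \<in> I" "u k \<noteq> 0" using assms(4) by blast
  then have "0 < (\<Sum>a\<in>I. (u a)\<^sup>2)" using assms(1) by (intro sum_pos2[of I k]) auto
  then show ?thesis using assms(2,3) by (meson less_le_trans mult_pos_pos)
qed

lemma compare_forms:
  fixes s a b \<alpha> \<beta> :: real
  assumes "0 < \<alpha>" "\<alpha> * s \<le> a" "a \<le> \<beta> * s" "\<alpha> * s \<le> b" "b \<le> \<beta> * s" "0 \<le> s" "\<alpha> \<le> \<beta>"
  shows "(\<alpha> / \<beta>) * b \<le> a" "a \<le> (\<beta> / \<alpha>) * b"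
proof -
  have "(\<alpha> / \<beta>) * b \<le> (\<alpha> / \<beta>) * (\<beta> * s)" using assms by (intro mult_left_mono) auto
  also have "\<dots> = \<alpha> * s" using assms by simp
  finally show "(\<alpha> / \<beta>) * b \<le> a" using assms(2) by linarith
  have "a \<le> (\<beta> / \<alpha>) * (\<alpha> * s)" using assms by simp
  also have "\<dots> \<le> (\<beta> / \<alpha>) * b" using assms by (intro mult_left_mono) auto
  finally show "a \<le> (\<beta> / \<alpha>) * b" .
qed

text \<open>The covariance matrices are Toeplitz matrices with symbols \<open>F\<close> and \<open>G\<close>; their convex
  combinations have the symbols \<open>interpolate F G t\<close>.\<close>

theorem time_entropy_rate:
  fixes y z :: "int \<Rightarrow> 'a \<Rightarrow> real^'m"
  assumes pr: "prob_space M" and y: "gaussian_process M y F" and z: "gaussian_process M z G"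
    and F: "symbol \<alpha> \<beta> F" and G: "symbol \<alpha> \<beta> G" and ab: "\<alpha> \<le> \<beta>"
  shows "has_time_entropy_rate M y z (rate F G)"
proof -
  interpret prob_space M by fact
  have a: "0 < \<alpha>" using F by (simp add: symbol_def)
  let ?I = "\<lambda>n. window n :: (int \<times> 'm) set"
  let ?A = "covar M y" and ?B = "covar M z"
  have ex: "\<exists>\<mu>. relative_spectrum (?I n) ?A ?B \<mu> \<and>
      rel_entropy (joint_law M {- int n..int n} y) (joint_law M {- int n..int n} z) = ereal (\<Sum>i\<in>?I n. (\<mu> i - 1 - ln (\<mu> i)) / 2)" for n
  proof -
    let ?K = "{- int n..int n}"
    define E where "E = Pi\<^sub>M ?K (\<lambda>_. borel :: (real^'m) measure)"
    define T where "T x = (\<lambda>a\<in>?I n. x (fst a) $ snd a)" for x :: "int \<Rightarrow> real^'m"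
    define S where "S v = (\<lambda>k\<in>?K. \<chi> j. v (k, j))" for v :: "int \<times> 'm \<Rightarrow> real"
    have vm: "(\<lambda>\<omega>. \<lambda>k\<in>?K. x k \<omega>) \<in> measurable M E" if "\<And>k. x k \<in> borel_measurable M" for x
      unfolding E_def by (intro measurable_restrict that)
    have Tm: "T \<in> measurable E (Pi\<^sub>M (?I n) (\<lambda>_. borel))"
      unfolding T_def E_def
    proof (rule measurable_restrict)
      fix b :: "int \<times> 'm" assume "b \<in> ?I n"
      then have "fst b \<in> ?K" by (auto simp: window_def)
      then have "(\<lambda>x. x (fst b)) \<in> borel_measurable (Pi\<^sub>M ?K (\<lambda>_. borel :: (real^'m) measure))"
        by (rule measurable_component_singleton)
      then have "(\<lambda>x. x (fst b) \<bullet> axis (snd b) 1) \<in> borel_measurable (Pi\<^sub>M ?K (\<lambda>_. borel :: (real^'m) measure))"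
        by measurable
      then show "(\<lambda>x. x (fst b) $ snd b) \<in> borel_measurable (Pi\<^sub>M ?K (\<lambda>_. borel :: (real^'m) measure))"
        by (simp add: inner_axis)
    qed
    have Sm: "S \<in> measurable (Pi\<^sub>M (?I n) (\<lambda>_. borel)) E"
      unfolding S_def E_def
      by (intro measurable_restrict borel_measurable_vec_lambda measurable_component_singleton) (auto simp: window_def)
    have ST: "S (T (\<lambda>k\<in>?K. x k \<omega>)) = (\<lambda>k\<in>?K. x k \<omega>)" for x \<omega>
      by (auto simp: S_def T_def fun_eq_iff restrict_def window_def vec_eq_iff)
    have Tx: "T (\<lambda>k\<in>?K. x k \<omega>) b = x (fst b) \<omega> $ snd b" if "b \<in> ?I n" for x \<omega> b
      using that by (auto simp: T_def window_def)
    have gf: "gaussian_family M (?I n) (\<lambda>b \<omega>. T (\<lambda>k\<in>?K. x k \<omega>) b) (covar M x)" if "gaussian_process M x H" for x H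
      using process_gaussian_family[OF that, of n] unfolding gaussian_family_def
      by (simp add: Tx cong: sum.cong)
    have pos: "0 < bilin (?I n) (covar M x) u u" if "gaussian_process M x H" "symbol \<alpha> \<beta> H" "\<exists>k\<in>?I n. u k \<noteq> 0" for x H u
      by (rule positive_form[OF finite_window a covar_form_bounds(1)[OF that(1,2)] that(3)])
    have ym: "y k \<in> borel_measurable M" and zm: "z k \<in> borel_measurable M" for k
      using y z by (auto simp: gaussian_process_def)
    have yE: "(\<lambda>\<omega>. \<lambda>k\<in>?K. y k \<omega>) \<in> measurable M E" and zE: "(\<lambda>\<omega>. \<lambda>k\<in>?K. z k \<omega>) \<in> measurable M E"
      by (rule vm, rule ym, rule vm, rule zm)
    have STE: "AE \<omega> in M. S (T (\<lambda>k\<in>?K. x k \<omega>)) = (\<lambda>k\<in>?K. x k \<omega>)" for x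
      by (rule AE_I2) (rule ST)
    have symC: "\<forall>k\<in>?I n. \<forall>l\<in>?I n. covar M x k l = covar M x l k" for x
      using covar_sym by blast
    show ?thesis
      unfolding joint_law_def E_def[symmetric]
      by (rule gaussian_rel_entropy[where Y="\<lambda>\<omega>. \<lambda>k\<in>?K. y k \<omega>" and Z="\<lambda>\<omega>. \<lambda>k\<in>?K. z k \<omega>" and A="?A" and B="?B",
            OF pr finite_window yE zE Tm Sm STE STE gf[OF y] gf[OF z] symC symC pos[OF y F] pos[OF z G]])
        blast+
  qed
  have "\<exists>\<mu>. \<forall>n. relative_spectrum (?I n) ?A ?B (\<mu> n) \<and>
      rel_entropy (joint_law M {- int n..int n} y) (joint_law M {- int n..int n} z) = ereal (\<Sum>i\<in>?I n. (\<mu> n i - 1 - ln (\<mu> n i)) / 2)"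
    by (rule choice, rule allI, rule ex)
  then obtain \<mu> where mu: "\<forall>n. relative_spectrum (?I n) ?A ?B (\<mu> n) \<and>
      rel_entropy (joint_law M {- int n..int n} y) (joint_law M {- int n..int n} z) = ereal (\<Sum>i\<in>?I n. (\<mu> n i - 1 - ln (\<mu> n i)) / 2)" ..
  have spec: "relative_spectrum (?I n) ?A ?B (\<mu> n)"
    and mu1: "rel_entropy (joint_law M {- int n..int n} y) (joint_law M {- int n..int n} z) = ereal (\<Sum>i\<in>?I n. (\<mu> n i - 1 - ln (\<mu> n i)) / 2)" for n
    using mu by blast+
  have mu3: "\<alpha> / \<beta> \<le> \<mu> n i \<and> \<mu> n i \<le> \<beta> / \<alpha>" if i: "i \<in> ?I n" for n i
  proof -
    have "(\<alpha> / \<beta>) * bilin (?I n) ?B x x \<le> bilin (?I n) ?A x x" "bilin (?I n) ?A x x \<le> (\<beta> / \<alpha>) * bilin (?I n) ?B x x" for x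
      by (rule compare_forms[OF a covar_form_bounds[OF y F] covar_form_bounds[OF z G] sum_nonneg ab], simp)+
    then show ?thesis using spec[of n] i unfolding relative_spectrum_def by blast
  qed
  have pcF: "pw_cont (\<lambda>z. F z $ i $ j)" and pcG: "pw_cont (\<lambda>z. G z $ i $ j)" for i j using F G by (auto simp: symbol_def)
  have "(\<lambda>n. (\<Sum>i\<in>?I n. (\<mu> n i - 1 - ln (\<mu> n i)) / 2) / real (2 * n + 1)) \<longlonglongrightarrow> rate F G"
    unfolding rate_def
  proof (rule entropy_rate_limit[where K="real CARD('m)" and c="\<alpha> / \<beta>" and C="\<beta> / \<alpha>"])
    show "real (card (?I n)) \<le> real CARD('m) * real (2 * n + 1)" for n
      by (simp add: window_def card_cartesian_product)
    show "0 < \<alpha> / \<beta>" "\<alpha> / \<beta> \<le> 1" using a ab by auto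
    show "\<alpha> / \<beta> \<le> \<mu> n i \<and> \<mu> n i \<le> \<beta> / \<alpha>" if "i \<in> ?I n" for n i by (rule mu3[OF that])
    fix t :: real assume t: "0 \<le> t" "t \<le> 1"
    have exR: "\<exists>R. eq_on (?I n) (mat_prod (?I n) R (\<lambda>i j. ?B i j + t * (?A i j - ?B i j))) (diag_mat (\<lambda>_. 1))" for n
      using spec[of n] t unfolding relative_spectrum_def by blast
    have "\<exists>R. \<forall>n. eq_on (?I n) (mat_prod (?I n) (R n) (\<lambda>i j. ?B i j + t * (?A i j - ?B i j))) (diag_mat (\<lambda>_. 1))"
      by (rule choice, rule allI, rule exR)
    then obtain R where R1: "\<And>n. eq_on (?I n) (mat_prod (?I n) (R n) (\<lambda>i j. ?B i j + t * (?A i j - ?B i j))) (diag_mat (\<lambda>_. 1))"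
      by blast
    have R2: "mat_trace (?I n) (mat_prod (?I n) (R n) (\<lambda>i j. ?A i j - ?B i j)) = (\<Sum>i\<in>?I n. (\<mu> n i - 1) / (1 + t * (\<mu> n i - 1)))" for n
      using spec[of n] t R1[of n] unfolding relative_spectrum_def by blast
    define Rc where "Rc n i j = complex_of_real (R n i j)" for n i j
    define D where "D z = (\<chi> i j. F z $ i $ j - G z $ i $ j)" for z
    have pcD: "pw_cont (\<lambda>z. D z $ i $ j)" for i j unfolding D_def using pcF pcG by (simp add: pw_cont_diff)
    have tD: "toeplitz D i j = of_real (?A i j - ?B i j)" for i j
      unfolding of_real_diff of_real_covar[OF y] of_real_covar[OF z]
      by (simp add: toeplitz_def D_def fourier_coef_diff[OF pcF pcG])
    have tmix: "toeplitz (interpolate F G t) i j = of_real (?B i j + t * (?A i j - ?B i j))" for i j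
    proof -
      have "toeplitz (interpolate F G t) i j = fourier_coef (\<lambda>z. G z $ snd i $ snd j + of_real t * (F z $ snd i $ snd j - G z $ snd i $ snd j)) (fst i - fst j)"
        by (simp add: toeplitz_def interpolate_def)
      also have "\<dots> = toeplitz G i j + of_real t * (toeplitz F i j - toeplitz G i j)"
        unfolding toeplitz_def fourier_coef_add[OF pcG pw_cont_mult[OF pw_cont_const pw_cont_diff[OF pcF pcG]]]
        by (simp only: fourier_coef_cmult fourier_coef_diff[OF pcF pcG])
      finally show ?thesis by (simp add: of_real_covar[OF y] of_real_covar[OF z])
    qed
    have "eq_on (?I n) (mat_prod (?I n) (Rc n) (toeplitz (interpolate F G t))) (diag_mat (\<lambda>_. 1))" for n
    proof -
      have "mat_prod (?I n) (Rc n) (toeplitz (interpolate F G t)) i j = of_real (mat_prod (?I n) (R n) (\<lambda>i j. ?B i j + t * (?A i j - ?B i j)) i j)" for i j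
        unfolding mat_prod_def tmix Rc_def by simp
      then show ?thesis using R1[of n] by (simp add: eq_on_def diag_mat_def)
    qed
    from toeplitz_trace_limit[OF symbol_interpolate[OF F G t] pcD this]
    have "(\<lambda>n. mat_trace (window n) (mat_prod (window n) (Rc n) (toeplitz D)) / of_nat (2 * n + 1))
      \<longlonglongrightarrow> (\<Sum>i\<in>UNIV. \<Sum>j\<in>UNIV. mean (\<lambda>z. matrix_inv (interpolate F G t z) $ i $ j * D z $ j $ i))" .
    from tendsto_Re[OF this]
    have "(\<lambda>n. Re (mat_trace (window n) (mat_prod (window n) (Rc n) (toeplitz D)) / of_nat (2 * n + 1))) \<longlonglongrightarrow> limit_trace F G t"
      by (simp add: limit_trace_def D_def)
    moreover have "Re (mat_trace (window n) (mat_prod (window n) (Rc n) (toeplitz D)) / of_nat (2 * n + 1))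
       = (\<Sum>i\<in>?I n. (\<mu> n i - 1) / (1 + t * (\<mu> n i - 1))) / real (2 * n + 1)" for n
    proof -
      have "mat_trace (window n) (mat_prod (window n) (Rc n) (toeplitz D)) = of_real (mat_trace (?I n) (mat_prod (?I n) (R n) (\<lambda>i j. ?A i j - ?B i j)))"
        unfolding mat_trace_def mat_prod_def tD Rc_def by simp
      then have "mat_trace (window n) (mat_prod (window n) (Rc n) (toeplitz D)) / of_nat (2 * n + 1)
        = of_real ((\<Sum>i\<in>?I n. (\<mu> n i - 1) / (1 + t * (\<mu> n i - 1))) / real (2 * n + 1))" by (simp add: R2)
      then show ?thesis by (simp only: Re_complex_of_real)
    qed
    ultimately show "(\<lambda>n. (\<Sum>i\<in>?I n. (\<mu> n i - 1) / (1 + t * (\<mu> n i - 1))) / real (2 * n + 1)) \<longlonglongrightarrow> limit_trace F G t" by simp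
  qed auto
  then have "(\<lambda>n. ereal ((\<Sum>i\<in>?I n. (\<mu> n i - 1 - ln (\<mu> n i)) / 2) / real (2 * n + 1))) \<longlonglongrightarrow> ereal (rate F G)" by (rule tendsto_ereal)
  moreover have er: "ereal r / ereal (2 * real n + 1) = ereal (r / real (2 * n + 1))" for r n
  proof -
    have "0 < 2 * real n + 1" by (rule add_nonneg_pos) auto
    then have "2 * real n + 1 \<noteq> 0" by linarith
    moreover have "real (2 * n + 1) = 2 * real n + 1" by simp
    ultimately show ?thesis by simp
  qed
  ultimately show ?thesis unfolding has_time_entropy_rate_def mu1 by (simp only: er)
qed

section \<open>Mean-square limits\<close>

text \<open>The geometric rates are matched so that a mean-square bound by \<open>(1/4) ^ k\<close> gives summable first moments.\<close>

lemma nn_integral_le_of_square: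
  fixes f :: "'a \<Rightarrow> real"
  assumes "prob_space M" and [measurable]: "f \<in> borel_measurable M" and f0: "\<And>\<omega>. 0 \<le> f \<omega>"
    and sq: "(\<integral>\<^sup>+\<omega>. ennreal ((f \<omega>)\<^sup>2) \<partial>M) \<le> ennreal ((1/4) ^ k)"
  shows "(\<integral>\<^sup>+\<omega>. ennreal (f \<omega>) \<partial>M) \<le> ennreal ((1/2) ^ k)"
proof -
  interpret prob_space M by fact
  have "(\<integral>\<^sup>+\<omega>. ennreal (f \<omega>) \<partial>M) \<le> (\<integral>\<^sup>+\<omega>. ennreal (2 ^ k / 2) * ennreal ((f \<omega>)\<^sup>2) + ennreal ((1/2) ^ k / 2) \<partial>M)"
  proof (rule nn_integral_mono)
    fix \<omega>
    have "f \<omega> * 1 \<le> (2 ^ k * (f \<omega>)\<^sup>2 + 1\<^sup>2 / 2 ^ k) / 2" by (rule weighted_am_gm) simp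
    then have "f \<omega> \<le> 2 ^ k / 2 * (f \<omega>)\<^sup>2 + (1/2) ^ k / 2" by (simp add: power_divide add_divide_distrib)
    then have "ennreal (f \<omega>) \<le> ennreal (2 ^ k / 2 * (f \<omega>)\<^sup>2 + (1/2) ^ k / 2)" by (rule ennreal_leI)
    also have "\<dots> = ennreal (2 ^ k / 2) * ennreal ((f \<omega>)\<^sup>2) + ennreal ((1/2) ^ k / 2)"
      by (subst ennreal_plus) (auto simp: ennreal_mult[symmetric])
    finally show "ennreal (f \<omega>) \<le> ennreal (2 ^ k / 2) * ennreal ((f \<omega>)\<^sup>2) + ennreal ((1/2) ^ k / 2)" .
  qed
  also have "\<dots> = ennreal (2 ^ k / 2) * (\<integral>\<^sup>+\<omega>. ennreal ((f \<omega>)\<^sup>2) \<partial>M) + ennreal ((1/2) ^ k / 2)"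
    by (subst nn_integral_add) (auto simp: nn_integral_cmult emeasure_space_1)
  also have "\<dots> \<le> ennreal (2 ^ k / 2) * ennreal ((1/4) ^ k) + ennreal ((1/2) ^ k / 2)"
    by (intro add_mono mult_left_mono sq) auto
  also have "\<dots> = ennreal (2 ^ k / 2 * (1/4) ^ k + (1/2) ^ k / 2)"
    by (subst ennreal_plus) (auto simp: ennreal_mult[symmetric])
  also have "2 ^ k / 2 * (1/4) ^ k + (1/2) ^ k / 2 = ((1/2) ^ k :: real)"
  proof -
    have "(2::real) ^ k * (1/4) ^ k = (1/2) ^ k" unfolding power_mult_distrib[symmetric] by simp
    then show ?thesis by simp
  qed
  finally show ?thesis .
qed

text \<open>Completeness of the space of square integrable random vectors: along a fast subsequence the
  increments are almost surely summable, and Fatou's lemma identifies the limit.\<close>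

lemma mean_square_complete:
  fixes X :: "nat \<Rightarrow> 'a \<Rightarrow> 'b::euclidean_space"
  assumes "prob_space M" and Xm[measurable]: "\<And>n. X n \<in> borel_measurable M"
    and cauchy: "\<And>e::real. 0 < e \<Longrightarrow> \<exists>N. \<forall>m\<ge>N. \<forall>n\<ge>N. (\<integral>\<^sup>+\<omega>. ennreal ((norm (X m \<omega> - X n \<omega>))\<^sup>2) \<partial>M) \<le> ennreal e"
  obtains Y where "is_mean_square_limit M X Y"
proof -
  interpret prob_space M by fact
  have "\<forall>k. \<exists>N. \<forall>m\<ge>N. \<forall>n\<ge>N. (\<integral>\<^sup>+\<omega>. ennreal ((norm (X m \<omega> - X n \<omega>))\<^sup>2) \<partial>M) \<le> ennreal ((1/4) ^ k)"
    using cauchy by simp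
  then obtain N where N: "\<And>k m n. m \<ge> N k \<Longrightarrow> n \<ge> N k \<Longrightarrow> (\<integral>\<^sup>+\<omega>. ennreal ((norm (X m \<omega> - X n \<omega>))\<^sup>2) \<partial>M) \<le> ennreal ((1/4) ^ k)"
    by metis
  \<comment> \<open>Dominates every \<open>N k\<close> and is increasing.\<close>
  define r where "r k = (\<Sum>i\<le>k. N i) + k" for k
  have rN: "N k \<le> r k" and rS: "r k \<le> r (Suc k)" and rk: "k \<le> r k" for k
  proof -
    show "N k \<le> r k" using member_le_sum[of k "{..k}" N] by (simp add: r_def)
    show "r k \<le> r (Suc k)" "k \<le> r k" by (simp_all add: r_def)
  qed
  define D where "D k \<omega> = norm (X (r (Suc k)) \<omega> - X (r k) \<omega>)" for k \<omega>
  have [measurable]: "D k \<in> borel_measurable M" for k unfolding D_def by measurable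
  have "(\<integral>\<^sup>+\<omega>. ennreal (D k \<omega>) \<partial>M) \<le> ennreal ((1/2) ^ k)" for k
    by (rule nn_integral_le_of_square[OF \<open>prob_space M\<close>])
      (use N[of k "r (Suc k)" "r k"] rN[of k] rS[of k] in \<open>auto simp: D_def\<close>)
  then have "(\<Sum>k. \<integral>\<^sup>+\<omega>. ennreal (D k \<omega>) \<partial>M) \<le> (\<Sum>k. ennreal ((1/2) ^ k))"
    by (intro suminf_le) auto
  also have "\<dots> = ennreal (\<Sum>k. (1/2) ^ k)" by (rule suminf_ennreal2) (auto intro: summable_geometric)
  finally have "(\<Sum>k. \<integral>\<^sup>+\<omega>. ennreal (D k \<omega>) \<partial>M) < \<infinity>" by (simp add: less_top[symmetric] top.extremum_unique) (auto simp: top_unique)?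
  then have "(\<integral>\<^sup>+\<omega>. (\<Sum>k. ennreal (D k \<omega>)) \<partial>M) \<noteq> \<infinity>" by (subst nn_integral_suminf) auto
  then have "AE \<omega> in M. (\<Sum>k. ennreal (D k \<omega>)) \<noteq> \<infinity>" by (intro nn_integral_PInf_AE) auto
  then have conv: "AE \<omega> in M. convergent (\<lambda>k. X (r k) \<omega>)"
  proof eventually_elim
    case (elim \<omega>)
    have "summable (\<lambda>k. D k \<omega>)"
      by (rule summable_suminf_not_top) (use elim in \<open>auto simp: D_def\<close>)
    then have "summable (\<lambda>k. X (r (Suc k)) \<omega> - X (r k) \<omega>)"
      by (rule summable_norm_cancel[OF summable_cong[THEN iffD1, rotated]]) (simp add: D_def)
    then have "convergent (\<lambda>n. \<Sum>k<n. X (r (Suc k)) \<omega> - X (r k) \<omega>)" by (simp add: summable_iff_convergent)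
    moreover have "(\<Sum>k<n. X (r (Suc k)) \<omega> - X (r k) \<omega>) = X (r n) \<omega> - X (r 0) \<omega>" for n
      by (rule sum_lessThan_telescope)
    ultimately have "convergent (\<lambda>n. X (r n) \<omega> - X (r 0) \<omega>)" by (simp only:)
    then have "convergent (\<lambda>n. X (r n) \<omega> - X (r 0) \<omega> + X (r 0) \<omega>)" by (intro convergent_add convergent_const)
    then show ?case by simp
  qed
  define Y where "Y \<omega> = lim (\<lambda>k. X (r k) \<omega>)" for \<omega>
  have Ym[measurable]: "Y \<in> borel_measurable M" unfolding Y_def[abs_def] by (rule borel_measurable_lim_metric) simp
  have YL: "AE \<omega> in M. (\<lambda>k. X (r k) \<omega>) \<longlonglongrightarrow> Y \<omega>"
    using conv by eventually_elim (simp add: Y_def convergent_LIMSEQ_iff)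
  have small: "\<exists>N. \<forall>n\<ge>N. (\<integral>\<^sup>+\<omega>. ennreal ((norm (X n \<omega> - Y \<omega>))\<^sup>2) \<partial>M) \<le> ennreal e" if e: "0 < e" for e :: real
  proof -
    obtain N0 where N0: "\<And>m n. m \<ge> N0 \<Longrightarrow> n \<ge> N0 \<Longrightarrow> (\<integral>\<^sup>+\<omega>. ennreal ((norm (X m \<omega> - X n \<omega>))\<^sup>2) \<partial>M) \<le> ennreal e"
      using cauchy[OF e] by blast
    have "(\<integral>\<^sup>+\<omega>. ennreal ((norm (X n \<omega> - Y \<omega>))\<^sup>2) \<partial>M) \<le> ennreal e" if n: "n \<ge> N0" for n
    proof -
      have "(\<integral>\<^sup>+\<omega>. ennreal ((norm (X n \<omega> - Y \<omega>))\<^sup>2) \<partial>M) = (\<integral>\<^sup>+\<omega>. liminf (\<lambda>k. ennreal ((norm (X n \<omega> - X (r k) \<omega>))\<^sup>2)) \<partial>M)"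
      proof (rule nn_integral_cong_AE)
        show "AE \<omega> in M. ennreal ((norm (X n \<omega> - Y \<omega>))\<^sup>2) = liminf (\<lambda>k. ennreal ((norm (X n \<omega> - X (r k) \<omega>))\<^sup>2))"
          using YL
        proof eventually_elim
          case (elim \<omega>)
          then have "(\<lambda>k. ennreal ((norm (X n \<omega> - X (r k) \<omega>))\<^sup>2)) \<longlonglongrightarrow> ennreal ((norm (X n \<omega> - Y \<omega>))\<^sup>2)"
            by (intro tendsto_ennrealI tendsto_intros)
          from lim_imp_Liminf[OF trivial_limit_sequentially this] show ?case by simp
        qed
      qed
      also have "\<dots> \<le> liminf (\<lambda>k. \<integral>\<^sup>+\<omega>. ennreal ((norm (X n \<omega> - X (r k) \<omega>))\<^sup>2) \<partial>M)"
        by (rule nn_integral_liminf) measurable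
      also have "\<dots> \<le> liminf (\<lambda>k::nat. ennreal e)"
      proof (rule Liminf_mono)
        show "\<forall>\<^sub>F k in sequentially. (\<integral>\<^sup>+\<omega>. ennreal ((norm (X n \<omega> - X (r k) \<omega>))\<^sup>2) \<partial>M) \<le> ennreal e"
          by (rule eventually_sequentiallyI[of N0]) (intro N0 n order_trans[OF _ rk])
      qed
      also have "\<dots> = ennreal e" by (simp add: Liminf_const)
      finally show ?thesis .
    qed
    then show ?thesis by blast
  qed
  have "(\<lambda>n. \<integral>\<^sup>+\<omega>. ennreal ((norm (X n \<omega> - Y \<omega>))\<^sup>2) \<partial>M) \<longlonglongrightarrow> 0"
  proof (rule tendsto_zero_ennreal)
    fix e :: real assume e: "0 < e"
    obtain N where N: "\<forall>n\<ge>N. (\<integral>\<^sup>+\<omega>. ennreal ((norm (X n \<omega> - Y \<omega>))\<^sup>2) \<partial>M) \<le> ennreal (e/2)"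
      using small[of "e/2"] e by auto
    show "\<forall>\<^sub>F n in sequentially. (\<integral>\<^sup>+\<omega>. ennreal ((norm (X n \<omega> - Y \<omega>))\<^sup>2) \<partial>M) < ennreal e"
    proof (rule eventually_sequentiallyI[of N])
      fix n assume "N \<le> n"
      then have "(\<integral>\<^sup>+\<omega>. ennreal ((norm (X n \<omega> - Y \<omega>))\<^sup>2) \<partial>M) \<le> ennreal (e/2)" using N by blast
      also have "\<dots> < ennreal e" using e by (intro ennreal_lessI) auto
      finally show "(\<integral>\<^sup>+\<omega>. ennreal ((norm (X n \<omega> - Y \<omega>))\<^sup>2) \<partial>M) < ennreal e" .
    qed
  qed
  then show thesis using Ym that unfolding is_mean_square_limit_def by blast
qed

definition mean_sq_lim :: "'a measure \<Rightarrow> (nat \<Rightarrow> 'a \<Rightarrow> real) \<Rightarrow> ('a \<Rightarrow> real) \<Rightarrow> bool" where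
  "mean_sq_lim M X Y \<longleftrightarrow> (\<forall>n. X n \<in> borel_measurable M \<and> integrable M (\<lambda>\<omega>. (X n \<omega>)\<^sup>2)) \<and>
     Y \<in> borel_measurable M \<and> integrable M (\<lambda>\<omega>. (Y \<omega>)\<^sup>2) \<and>
     (\<lambda>n. \<integral>\<omega>. (X n \<omega> - Y \<omega>)\<^sup>2 \<partial>M) \<longlonglongrightarrow> 0"

lemma square_add_le: "(x + y)\<^sup>2 \<le> 2 * x\<^sup>2 + 2 * (y::real)\<^sup>2"
  using sum_squares_bound[of x y] by (simp add: power2_sum)

lemma square_integrable_add:
  fixes f g :: "'a \<Rightarrow> real"
  assumes [measurable]: "f \<in> borel_measurable M" "g \<in> borel_measurable M"
    and i: "integrable M (\<lambda>\<omega>. (f \<omega>)\<^sup>2)" "integrable M (\<lambda>\<omega>. (g \<omega>)\<^sup>2)"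
  shows "integrable M (\<lambda>\<omega>. (f \<omega> + g \<omega>)\<^sup>2)"
proof (rule Bochner_Integration.integrable_bound)
  show "integrable M (\<lambda>\<omega>. 2 * (f \<omega>)\<^sup>2 + 2 * (g \<omega>)\<^sup>2)" using i by simp
  show "AE \<omega> in M. norm ((f \<omega> + g \<omega>)\<^sup>2) \<le> norm (2 * (f \<omega>)\<^sup>2 + 2 * (g \<omega>)\<^sup>2)"
    by (rule AE_I2) (simp add: square_add_le)
qed measurable

lemma square_integrable_diff:
  fixes f g :: "'a \<Rightarrow> real"
  assumes [measurable]: "f \<in> borel_measurable M" "g \<in> borel_measurable M"
    and i: "integrable M (\<lambda>\<omega>. (f \<omega>)\<^sup>2)" "integrable M (\<lambda>\<omega>. (g \<omega>)\<^sup>2)"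
  shows "integrable M (\<lambda>\<omega>. (f \<omega> - g \<omega>)\<^sup>2)"
  using square_integrable_add[of f M "\<lambda>\<omega>. - g \<omega>"] assms by simp

lemma mean_sq_lim_add:
  assumes X: "mean_sq_lim M X Y" and X': "mean_sq_lim M X' Y'"
  shows "mean_sq_lim M (\<lambda>n \<omega>. X n \<omega> + X' n \<omega>) (\<lambda>\<omega>. Y \<omega> + Y' \<omega>)"
proof -
  have m[measurable]: "\<And>n. X n \<in> borel_measurable M" "\<And>n. X' n \<in> borel_measurable M" "Y \<in> borel_measurable M" "Y' \<in> borel_measurable M"
    and i: "\<And>n. integrable M (\<lambda>\<omega>. (X n \<omega>)\<^sup>2)" "\<And>n. integrable M (\<lambda>\<omega>. (X' n \<omega>)\<^sup>2)" "integrable M (\<lambda>\<omega>. (Y \<omega>)\<^sup>2)" "integrable M (\<lambda>\<omega>. (Y' \<omega>)\<^sup>2)"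
    and l: "(\<lambda>n. \<integral>\<omega>. (X n \<omega> - Y \<omega>)\<^sup>2 \<partial>M) \<longlonglongrightarrow> 0" "(\<lambda>n. \<integral>\<omega>. (X' n \<omega> - Y' \<omega>)\<^sup>2 \<partial>M) \<longlonglongrightarrow> 0"
    using X X' by (auto simp: mean_sq_lim_def)
  have d: "integrable M (\<lambda>\<omega>. (X n \<omega> - Y \<omega>)\<^sup>2)" "integrable M (\<lambda>\<omega>. (X' n \<omega> - Y' \<omega>)\<^sup>2)" for n
    by (intro square_integrable_diff m i)+
  have "(\<lambda>n. \<integral>\<omega>. ((X n \<omega> + X' n \<omega>) - (Y \<omega> + Y' \<omega>))\<^sup>2 \<partial>M) \<longlonglongrightarrow> 0"
  proof (rule tendsto_sandwich[OF _ _ tendsto_const])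
    show "(\<lambda>n. 2 * (\<integral>\<omega>. (X n \<omega> - Y \<omega>)\<^sup>2 \<partial>M) + 2 * (\<integral>\<omega>. (X' n \<omega> - Y' \<omega>)\<^sup>2 \<partial>M)) \<longlonglongrightarrow> 0"
      using tendsto_add[OF tendsto_mult[OF tendsto_const[of 2] l(1)] tendsto_mult[OF tendsto_const[of 2] l(2)]] by simp
    show "\<forall>\<^sub>F n in sequentially. (\<integral>\<omega>. ((X n \<omega> + X' n \<omega>) - (Y \<omega> + Y' \<omega>))\<^sup>2 \<partial>M)
      \<le> 2 * (\<integral>\<omega>. (X n \<omega> - Y \<omega>)\<^sup>2 \<partial>M) + 2 * (\<integral>\<omega>. (X' n \<omega> - Y' \<omega>)\<^sup>2 \<partial>M)"
    proof (rule always_eventually, rule allI)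
      fix n
      have "(\<integral>\<omega>. ((X n \<omega> + X' n \<omega>) - (Y \<omega> + Y' \<omega>))\<^sup>2 \<partial>M) \<le> (\<integral>\<omega>. 2 * (X n \<omega> - Y \<omega>)\<^sup>2 + 2 * (X' n \<omega> - Y' \<omega>)\<^sup>2 \<partial>M)"
      proof (rule integral_mono)
        show "integrable M (\<lambda>\<omega>. ((X n \<omega> + X' n \<omega>) - (Y \<omega> + Y' \<omega>))\<^sup>2)"
          by (intro square_integrable_diff square_integrable_add borel_measurable_add m i)
        show "integrable M (\<lambda>\<omega>. 2 * (X n \<omega> - Y \<omega>)\<^sup>2 + 2 * (X' n \<omega> - Y' \<omega>)\<^sup>2)" using d by simp
        show "((X n \<omega> + X' n \<omega>) - (Y \<omega> + Y' \<omega>))\<^sup>2 \<le> 2 * (X n \<omega> - Y \<omega>)\<^sup>2 + 2 * (X' n \<omega> - Y' \<omega>)\<^sup>2" for \<omega>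
          using square_add_le[of "X n \<omega> - Y \<omega>" "X' n \<omega> - Y' \<omega>"] by (simp add: algebra_simps)
      qed
      then show "(\<integral>\<omega>. ((X n \<omega> + X' n \<omega>) - (Y \<omega> + Y' \<omega>))\<^sup>2 \<partial>M)
        \<le> 2 * (\<integral>\<omega>. (X n \<omega> - Y \<omega>)\<^sup>2 \<partial>M) + 2 * (\<integral>\<omega>. (X' n \<omega> - Y' \<omega>)\<^sup>2 \<partial>M)" using d by simp
    qed
  qed auto
  then show ?thesis unfolding mean_sq_lim_def using m i by (auto intro!: square_integrable_add)
qed

lemma mean_sq_lim_cmult:
  assumes "mean_sq_lim M X Y" shows "mean_sq_lim M (\<lambda>n \<omega>. c * X n \<omega>) (\<lambda>\<omega>. c * Y \<omega>)"
proof -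
  have "(\<lambda>n. c\<^sup>2 * (\<integral>\<omega>. (X n \<omega> - Y \<omega>)\<^sup>2 \<partial>M)) \<longlonglongrightarrow> c\<^sup>2 * 0"
    using assms by (intro tendsto_mult tendsto_const) (simp add: mean_sq_lim_def)
  then have "(\<lambda>n. \<integral>\<omega>. (c * X n \<omega> - c * Y \<omega>)\<^sup>2 \<partial>M) \<longlonglongrightarrow> 0"
    by (simp add: right_diff_distrib[symmetric] power_mult_distrib)
  then show ?thesis using assms
    by (auto simp: mean_sq_lim_def power_mult_distrib intro!: borel_measurable_times)
qed

lemma mean_sq_lim_zero: "mean_sq_lim M (\<lambda>n \<omega>. 0) (\<lambda>\<omega>. 0)"
  by (simp add: mean_sq_lim_def)

lemma mean_sq_lim_sum:
  "(\<And>a. a \<in> J \<Longrightarrow> mean_sq_lim M (X a) (Y a)) \<Longrightarrow> mean_sq_lim M (\<lambda>n \<omega>. \<Sum>a\<in>J. X a n \<omega>) (\<lambda>\<omega>. \<Sum>a\<in>J. Y a \<omega>)"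
  by (induction J rule: infinite_finite_induct) (auto intro: mean_sq_lim_add mean_sq_lim_zero)

lemma abs_add_double_le:
  fixes u v p q :: real
  assumes "\<bar>v\<bar> \<le> (p + q) / 2" "0 \<le> u"
  shows "\<bar>u + 2 * v\<bar> \<le> u + (p + q)"
proof -
  have "2 * \<bar>v\<bar> \<le> p + q" using assms(1) by simp
  then show ?thesis using assms(2) by (simp add: abs_if split: if_splits)
qed

lemma less_of_le_midpoint: "x < e \<Longrightarrow> c \<le> (x + e) / 2 \<Longrightarrow> c < e" for x e c :: real
  by (simp add: field_simps)

lemma less_of_le_sum_halves: "c \<le> x + y \<Longrightarrow> x < e / 2 \<Longrightarrow> y < e / 2 \<Longrightarrow> c < e" for x y e c :: real
  by (simp add: field_simps)

lemma mean_sq_lim_square: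
  assumes X: "mean_sq_lim M X Y"
  shows "(\<lambda>n. \<integral>\<omega>. (X n \<omega>)\<^sup>2 \<partial>M) \<longlonglongrightarrow> (\<integral>\<omega>. (Y \<omega>)\<^sup>2 \<partial>M)"
proof (rule LIMSEQ_I)
  fix e :: real assume e: "0 < e"
  have m[measurable]: "\<And>n. X n \<in> borel_measurable M" "Y \<in> borel_measurable M"
    and i: "\<And>n. integrable M (\<lambda>\<omega>. (X n \<omega>)\<^sup>2)" "integrable M (\<lambda>\<omega>. (Y \<omega>)\<^sup>2)"
    and l: "(\<lambda>n. \<integral>\<omega>. (X n \<omega> - Y \<omega>)\<^sup>2 \<partial>M) \<longlonglongrightarrow> 0"
    using X by (auto simp: mean_sq_lim_def)
  have d: "integrable M (\<lambda>\<omega>. (X n \<omega> - Y \<omega>)\<^sup>2)" for n by (intro square_integrable_diff m i)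
  define c where "c = (\<integral>\<omega>. (Y \<omega>)\<^sup>2 \<partial>M)"
  have c: "0 \<le> c" unfolding c_def by simp
  \<comment> \<open>Makes the second term of the bound below, which does not tend to \<open>0\<close>, at most \<open>e / 2\<close>.\<close>
  define t where "t = 2 * (c + 1) / e"
  have t: "0 < t" using e c by (simp add: t_def)
  have ct: "c / t < e / 2" using e c by (simp add: t_def field_simps)
  have bound: "\<bar>(\<integral>\<omega>. (X n \<omega>)\<^sup>2 \<partial>M) - c\<bar> \<le> (1 + t) * (\<integral>\<omega>. (X n \<omega> - Y \<omega>)\<^sup>2 \<partial>M) + c / t" for n
  proof -
    have p: "\<bar>x\<^sup>2 - y\<^sup>2\<bar> \<le> (1 + t) * (x - y)\<^sup>2 + y\<^sup>2 / t" for x y :: real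
    proof -
      have "x\<^sup>2 - y\<^sup>2 = (x - y)\<^sup>2 + 2 * ((x - y) * y)" by (simp add: power2_eq_square algebra_simps)
      moreover have "\<bar>(x - y) * y\<bar> \<le> (t * (x - y)\<^sup>2 + y\<^sup>2 / t) / 2"
        using weighted_am_gm[OF t, of "\<bar>x - y\<bar>" "\<bar>y\<bar>"] by (simp add: abs_mult)
      ultimately have "\<bar>x\<^sup>2 - y\<^sup>2\<bar> \<le> (x - y)\<^sup>2 + (t * (x - y)\<^sup>2 + y\<^sup>2 / t)"
        using abs_add_double_le[OF _ zero_le_power2[of "x - y"]] by simp
      then show ?thesis by (simp add: distrib_right)
    qed
    have "(\<integral>\<omega>. (X n \<omega>)\<^sup>2 \<partial>M) - c = (\<integral>\<omega>. (X n \<omega>)\<^sup>2 - (Y \<omega>)\<^sup>2 \<partial>M)" unfolding c_def using i by simp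
    then have "\<bar>(\<integral>\<omega>. (X n \<omega>)\<^sup>2 \<partial>M) - c\<bar> \<le> (\<integral>\<omega>. \<bar>(X n \<omega>)\<^sup>2 - (Y \<omega>)\<^sup>2\<bar> \<partial>M)" using integral_abs_bound by simp
    also have "\<dots> \<le> (\<integral>\<omega>. (1 + t) * (X n \<omega> - Y \<omega>)\<^sup>2 + (Y \<omega>)\<^sup>2 / t \<partial>M)"
      using i d p by (intro integral_mono) auto
    also have "\<dots> = (1 + t) * (\<integral>\<omega>. (X n \<omega> - Y \<omega>)\<^sup>2 \<partial>M) + c / t" unfolding c_def using i d by simp
    finally show ?thesis .
  qed
  have "\<forall>\<^sub>F n in sequentially. (1 + t) * (\<integral>\<omega>. (X n \<omega> - Y \<omega>)\<^sup>2 \<partial>M) < e / 2"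
    using tendsto_mult[OF tendsto_const[of "1 + t"] l] e by (intro order_tendstoD(2)[where y=0]) auto
  then have "\<forall>\<^sub>F n in sequentially. norm ((\<integral>\<omega>. (X n \<omega>)\<^sup>2 \<partial>M) - c) < e"
  proof eventually_elim
    case (elim n)
    then show ?case unfolding real_norm_def by (rule less_of_le_sum_halves[OF bound _ ct])
  qed
  then show "\<exists>n0. \<forall>n\<ge>n0. norm ((\<integral>\<omega>. (X n \<omega>)\<^sup>2 \<partial>M) - (\<integral>\<omega>. (Y \<omega>)\<^sup>2 \<partial>M)) < e"
    by (simp add: eventually_sequentially c_def)
qed

lemma mean_sq_lim_product:
  assumes X: "mean_sq_lim M X Y" and X': "mean_sq_lim M X' Y'"
  shows "(\<lambda>n. \<integral>\<omega>. X n \<omega> * X' n \<omega> \<partial>M) \<longlonglongrightarrow> (\<integral>\<omega>. Y \<omega> * Y' \<omega> \<partial>M)"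
proof -
  have pol: "(\<integral>\<omega>. f \<omega> * g \<omega> \<partial>M) = ((\<integral>\<omega>. (f \<omega> + g \<omega>)\<^sup>2 \<partial>M) - (\<integral>\<omega>. (f \<omega>)\<^sup>2 \<partial>M) - (\<integral>\<omega>. (g \<omega>)\<^sup>2 \<partial>M)) / 2"
    if "f \<in> borel_measurable M" "g \<in> borel_measurable M" "integrable M (\<lambda>\<omega>. (f \<omega>)\<^sup>2)" "integrable M (\<lambda>\<omega>. (g \<omega>)\<^sup>2)" for f g :: "'a \<Rightarrow> real"
  proof -
    have "integrable M (\<lambda>\<omega>. f \<omega> * g \<omega>)" by (rule integrable_product_of_squares) fact+
    then show ?thesis using that by (simp add: power2_sum mult.assoc)
  qed
  have 1: "(\<integral>\<omega>. X n \<omega> * X' n \<omega> \<partial>M) = ((\<integral>\<omega>. (X n \<omega> + X' n \<omega>)\<^sup>2 \<partial>M) - (\<integral>\<omega>. (X n \<omega>)\<^sup>2 \<partial>M) - (\<integral>\<omega>. (X' n \<omega>)\<^sup>2 \<partial>M)) / 2" for n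
    by (rule pol) (use X X' in \<open>auto simp: mean_sq_lim_def\<close>)
  have 2: "(\<integral>\<omega>. Y \<omega> * Y' \<omega> \<partial>M) = ((\<integral>\<omega>. (Y \<omega> + Y' \<omega>)\<^sup>2 \<partial>M) - (\<integral>\<omega>. (Y \<omega>)\<^sup>2 \<partial>M) - (\<integral>\<omega>. (Y' \<omega>)\<^sup>2 \<partial>M)) / 2"
    by (rule pol) (use X X' in \<open>auto simp: mean_sq_lim_def\<close>)
  show ?thesis unfolding 1 2
    by (intro tendsto_divide tendsto_diff mean_sq_lim_square mean_sq_lim_add X X' tendsto_const) simp
qed

text \<open>The map \<open>x \<mapsto> exp (\<i> x)\<close> is Lipschitz.\<close>

lemma mean_sq_lim_char:
  assumes "prob_space M" and X: "mean_sq_lim M X Y"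
  shows "(\<lambda>n. \<integral>\<omega>. iexp (X n \<omega>) \<partial>M) \<longlonglongrightarrow> (\<integral>\<omega>. iexp (Y \<omega>) \<partial>M)"
proof (rule LIMSEQ_I)
  interpret prob_space M by fact
  fix e :: real assume e: "0 < e"
  have m[measurable]: "\<And>n. X n \<in> borel_measurable M" "Y \<in> borel_measurable M"
    and i: "\<And>n. integrable M (\<lambda>\<omega>. (X n \<omega>)\<^sup>2)" "integrable M (\<lambda>\<omega>. (Y \<omega>)\<^sup>2)"
    and l: "(\<lambda>n. \<integral>\<omega>. (X n \<omega> - Y \<omega>)\<^sup>2 \<partial>M) \<longlonglongrightarrow> 0"
    using X by (auto simp: mean_sq_lim_def)
  have d: "integrable M (\<lambda>\<omega>. (X n \<omega> - Y \<omega>)\<^sup>2)" for n by (intro square_integrable_diff m i)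
  have ie: "integrable M (\<lambda>\<omega>. iexp (f \<omega>))" if [measurable]: "f \<in> borel_measurable M" for f
    by (rule integrable_const_bound[where B=1]) auto
  define t where "t = 1 / e"
  have t: "0 < t" using e by (simp add: t_def)
  have bound: "cmod ((\<integral>\<omega>. iexp (X n \<omega>) \<partial>M) - (\<integral>\<omega>. iexp (Y \<omega>) \<partial>M)) \<le> (t * (\<integral>\<omega>. (X n \<omega> - Y \<omega>)\<^sup>2 \<partial>M) + e) / 2" for n
  proof -
    have p: "cmod (iexp x - iexp y) \<le> (t * (x - y)\<^sup>2 + e) / 2" for x y :: real
    proof -
      have "iexp x - iexp y = iexp y * (iexp (x - y) - 1)"
        by (simp add: right_diff_distrib exp_diff)
      then have "cmod (iexp x - iexp y) = cmod (iexp (x - y) - 1)" by (simp add: norm_mult)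
      also have "\<dots> \<le> \<bar>x - y\<bar>" using iexp_approx1[of "x - y" 0] by simp
      also have "\<dots> \<le> (t * (x - y)\<^sup>2 + e) / 2"
        using weighted_am_gm[OF t, of "\<bar>x - y\<bar>" 1] by (simp add: t_def)
      finally show ?thesis .
    qed
    have "cmod ((\<integral>\<omega>. iexp (X n \<omega>) \<partial>M) - (\<integral>\<omega>. iexp (Y \<omega>) \<partial>M)) = cmod (\<integral>\<omega>. iexp (X n \<omega>) - iexp (Y \<omega>) \<partial>M)"
      using ie m by (simp only: Bochner_Integration.integral_diff)
    also have "\<dots> \<le> (\<integral>\<omega>. cmod (iexp (X n \<omega>) - iexp (Y \<omega>)) \<partial>M)" by (rule integral_norm_bound)
    also have "\<dots> \<le> (\<integral>\<omega>. (t * (X n \<omega> - Y \<omega>)\<^sup>2 + e) / 2 \<partial>M)"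
    proof (rule integral_mono)
      show "integrable M (\<lambda>\<omega>. cmod (iexp (X n \<omega>) - iexp (Y \<omega>)))"
        by (intro integrable_norm Bochner_Integration.integrable_diff ie m)
      show "integrable M (\<lambda>\<omega>. (t * (X n \<omega> - Y \<omega>)\<^sup>2 + e) / 2)" using d by simp
    qed (rule p)
    also have "\<dots> = (t * (\<integral>\<omega>. (X n \<omega> - Y \<omega>)\<^sup>2 \<partial>M) + e) / 2" using d by (simp add: prob_space)
    finally show ?thesis .
  qed
  have "\<forall>\<^sub>F n in sequentially. t * (\<integral>\<omega>. (X n \<omega> - Y \<omega>)\<^sup>2 \<partial>M) < e"
    using tendsto_mult[OF tendsto_const[of t] l] e by (intro order_tendstoD(2)[where y=0]) auto
  then have "\<forall>\<^sub>F n in sequentially. norm ((\<integral>\<omega>. iexp (X n \<omega>) \<partial>M) - (\<integral>\<omega>. iexp (Y \<omega>) \<partial>M)) < e"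
  proof eventually_elim
    case (elim n)
    then show ?case by (rule less_of_le_midpoint) (rule bound)
  qed
  then show "\<exists>n0. \<forall>n\<ge>n0. norm ((\<integral>\<omega>. iexp (X n \<omega>) \<partial>M) - (\<integral>\<omega>. iexp (Y \<omega>) \<partial>M)) < e"
    by (simp add: eventually_sequentially)
qed

text \<open>Mean-square limits of centred Gaussian variables are centred Gaussian: variances and characteristic
  functions converge.\<close>

lemma mean_sq_lim_gaussian:
  assumes "prob_space M" and X: "mean_sq_lim M X Y"
    and g: "\<And>n. (\<integral>\<omega>. iexp (X n \<omega>) \<partial>M) = of_real (exp (- (\<integral>\<omega>. (X n \<omega>)\<^sup>2 \<partial>M) / 2))"
  shows "(\<integral>\<omega>. iexp (Y \<omega>) \<partial>M) = of_real (exp (- (\<integral>\<omega>. (Y \<omega>)\<^sup>2 \<partial>M) / 2))"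
proof (rule LIMSEQ_unique[OF mean_sq_lim_char[OF assms(1) X]])
  have "(\<lambda>n. complex_of_real (exp (- (\<integral>\<omega>. (X n \<omega>)\<^sup>2 \<partial>M) / 2))) \<longlonglongrightarrow> of_real (exp (- (\<integral>\<omega>. (Y \<omega>)\<^sup>2 \<partial>M) / 2))"
    by (intro tendsto_of_real tendsto_exp tendsto_divide tendsto_minus mean_sq_lim_square X tendsto_const) simp
  then show "(\<lambda>n. \<integral>\<omega>. iexp (X n \<omega>) \<partial>M) \<longlonglongrightarrow> of_real (exp (- (\<integral>\<omega>. (Y \<omega>)\<^sup>2 \<partial>M) / 2))" unfolding g .
qed

section \<open>Indicators of arcs\<close>

text \<open>The arc is described by \<open>Arg2pi\<close>, whose values in \<open>[0, 2\<pi>)\<close> match the grid \<open>\<pi> k / n\<close> for \<open>k < 2 n\<close>; half-open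
  arcs partition the circle.\<close>

definition arc_ind :: "nat \<Rightarrow> nat \<Rightarrow> complex \<Rightarrow> complex" where
  "arc_ind n k z = (if pi * real k / real n \<le> Arg2pi z \<and> Arg2pi z < pi * real (k + 1) / real n then 1 else 0)"

lemma Arg2pi_cis: "0 \<le> t \<Longrightarrow> t < 2 * pi \<Longrightarrow> Arg2pi (cis t) = t"
  by (rule Arg2pi_unique[of 1 t]) (auto simp: cis_conv_exp)

lemma cis_Arg2pi: "cmod z = 1 \<Longrightarrow> cis (Arg2pi z) = z"
  using complex_norm_eq_1_exp[of z] by (simp add: cis_conv_exp)

lemma pw_cont_arc_ind: "pw_cont (arc_ind n k)"
proof -
  define a where "a = pi * real k / real n"
  define b where "b = pi * real (k + 1) / real n"
  have arc: "arc_ind n k z = (if a \<le> Arg2pi z \<and> Arg2pi z < b then 1 else 0)" for z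
    by (simp add: arc_ind_def a_def b_def)
  show ?thesis
  proof (rule pw_contI[of "{1, cis a, cis b}" _ 1])
    show "continuous_on (sphere 0 1 - {1, cis a, cis b}) (arc_ind n k)"
    proof (rule continuous_at_imp_continuous_on, rule ballI)
      fix z assume z: "z \<in> sphere 0 1 - {1, cis a, cis b}"
      then have z1: "cmod z = 1" by simp
      have "z \<notin> \<real>\<^sub>\<ge>\<^sub>0"
      proof
        assume "z \<in> \<real>\<^sub>\<ge>\<^sub>0"
        then obtain r where "z = of_real r" "0 \<le> r" using nonneg_Reals_cases by blast
        then show False using z1 z by auto
      qed
      then have "continuous (at z) Arg2pi" by (rule continuous_at_Arg2pi)
      then have lim: "(Arg2pi \<longlongrightarrow> Arg2pi z) (at z)" by (simp add: isCont_def continuous_at)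
      have ne: "Arg2pi z \<noteq> a" "Arg2pi z \<noteq> b" using cis_Arg2pi[OF z1] z by auto
      have "\<forall>\<^sub>F w in at z. arc_ind n k w = arc_ind n k z"
      proof -
        consider "Arg2pi z < a" | "b < Arg2pi z" | "a < Arg2pi z" "Arg2pi z < b" using ne by linarith
        then show ?thesis
        proof cases
          case 1
          have "\<forall>\<^sub>F w in at z. Arg2pi w < a" by (rule order_tendstoD(2)[OF lim 1])
          then show ?thesis by eventually_elim (use 1 in \<open>simp add: arc\<close>)
        next
          case 2
          have "\<forall>\<^sub>F w in at z. b < Arg2pi w" by (rule order_tendstoD(1)[OF lim 2])
          then show ?thesis by eventually_elim (use 2 in \<open>simp add: arc\<close>)
        next
          case 3
          have "\<forall>\<^sub>F w in at z. a < Arg2pi w" "\<forall>\<^sub>F w in at z. Arg2pi w < b"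
            by (rule order_tendstoD(1)[OF lim 3(1)], rule order_tendstoD(2)[OF lim 3(2)])
          then show ?thesis by eventually_elim (use 3 in \<open>simp add: arc\<close>)
        qed
      qed
      then have "(arc_ind n k \<longlongrightarrow> arc_ind n k z) (at z)" by (rule tendsto_eventually)
      then show "isCont (arc_ind n k) z" by (simp add: isCont_def)
    qed
  qed (auto simp: arc_ind_def)
qed

lemma arc_ind_cnj [simp]: "cnj (arc_ind n k z) = arc_ind n k z"
  by (simp add: arc_ind_def)

lemma arc_ind_disjoint:
  assumes "0 < n" shows "arc_ind n k z * arc_ind n l z = (if k = l then arc_ind n k z else 0)"
proof (cases "k = l")
  case False
  have "\<not> (pi * real k / real n \<le> t \<and> t < pi * real (k + 1) / real n \<and> pi * real l / real n \<le> t \<and> t < pi * real (l + 1) / real n)" for t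
  proof
    assume A: "pi * real k / real n \<le> t \<and> t < pi * real (k + 1) / real n \<and> pi * real l / real n \<le> t \<and> t < pi * real (l + 1) / real n"
    then have "pi * real k / real n < pi * real (l + 1) / real n" "pi * real l / real n < pi * real (k + 1) / real n" by linarith+
    then have "real k < real (l + 1)" "real l < real (k + 1)" using assms by (simp_all add: divide_less_cancel)
    then show False using False by linarith
  qed
  then show ?thesis using False by (auto simp: arc_ind_def)
qed (simp add: arc_ind_def)

lemma integral_powi_interval:
  assumes ab: "a \<le> b"
  shows "(\<integral>\<theta>. indicator {a..b} \<theta> *\<^sub>R (cis \<theta> powi l) \<partial>lborel)
    = (if l = 0 then of_real (b - a) else (exp (\<i> * of_int l * of_real b) - exp (\<i> * of_int l * of_real a)) / (\<i> * of_int l))"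
proof (cases "l = 0")
  case True
  have "(\<integral>\<theta>. indicator {a..b} \<theta> *\<^sub>R (1::complex) \<partial>lborel) = of_real (b - a)"
    using ab by (simp add: lebesgue_integral_const scaleR_conv_of_real)
  then show ?thesis using True by simp
next
  case False
  define F where "F w = exp (\<i> * of_int l * w) / (\<i> * of_int l)" for w :: complex
  have d: "((\<lambda>\<theta>. F (of_real \<theta>)) has_vector_derivative cis \<theta> powi l) (at \<theta> within X)" for \<theta> X
  proof -
    have "(F has_field_derivative exp (\<i> * of_int l * of_real \<theta>)) (at (of_real \<theta>))"
      unfolding F_def using False by (auto intro!: derivative_eq_intros)
    moreover have "exp (\<i> * of_int l * of_real \<theta>) = cis \<theta> powi l"
      by (simp add: cis_power_int) (simp add: cis_conv_exp mult.assoc)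
    ultimately show ?thesis using has_vector_derivative_real_field by fastforce
  qed
  have "(\<integral>\<theta>. indicator {a..b} \<theta> *\<^sub>R (cis \<theta> powi l) \<partial>lborel) = F (of_real b) - F (of_real a)"
    by (rule integral_FTC_Icc[OF ab d]) (auto intro!: continuous_intros)
  then show ?thesis using False by (simp add: F_def diff_divide_distrib)
qed

text \<open>The prescribed coefficients \<open>\<chi>\<^sub>k\<close> are the conjugate Fourier coefficients of the indicator of the arc.\<close>

lemma fourier_coef_arc_ind:
  assumes n: "0 < n" and k: "k < 2 * n"
  shows "cnj (fourier_coef (arc_ind n k) l) = arc_coeff (pi * real k / real n) (pi * real (k + 1) / real n) l"
proof -
  define a where "a = pi * real k / real n"
  define b where "b = pi * real (k + 1) / real n"
  have ab: "0 \<le> a" "a \<le> b" "b \<le> 2 * pi"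
  proof -
    show "0 \<le> a" by (simp add: a_def)
    show "a \<le> b" unfolding a_def b_def by (intro divide_right_mono mult_left_mono) auto
    have "real (k + 1) \<le> 2 * real n" using k by linarith
    then have "pi * real (k + 1) \<le> pi * (2 * real n)" by (intro mult_left_mono) auto
    then show "b \<le> 2 * pi" unfolding b_def using n by (simp add: divide_le_eq mult_ac)
  qed
  have arc: "arc_ind n k z = (if a \<le> Arg2pi z \<and> Arg2pi z < b then 1 else 0)" for z
    by (simp add: arc_ind_def a_def b_def)
  have pcm: "pw_cont (\<lambda>z. z powi l * arc_ind n k z)" by (intro pw_cont_mult pw_cont_powi pw_cont_arc_ind)
  have [measurable]: "(\<lambda>\<theta>. cis \<theta> powi l * arc_ind n k (cis \<theta>)) \<in> borel_measurable borel"
    by (rule pw_cont_measurable[OF pcm])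
  have [measurable]: "(\<lambda>\<theta>. cis \<theta> powi l) \<in> borel_measurable borel" by (rule pw_cont_measurable[OF pw_cont_powi])
  have "fourier_coef (arc_ind n k) l = (1 / (2 * pi)) *\<^sub>R (\<integral>\<theta>. indicator {0..2*pi} \<theta> *\<^sub>R (cis \<theta> powi l * arc_ind n k (cis \<theta>)) \<partial>lborel)"
    unfolding fourier_coef_def mean_def by (subst integral_angle_measure) (simp_all add: set_lebesgue_integral_def)
  also have "(\<integral>\<theta>. indicator {0..2*pi} \<theta> *\<^sub>R (cis \<theta> powi l * arc_ind n k (cis \<theta>)) \<partial>lborel) = (\<integral>\<theta>. indicator {a..b} \<theta> *\<^sub>R (cis \<theta> powi l) \<partial>lborel)"
  proof (rule integral_cong_AE)
    show "AE \<theta> in lborel. indicator {0..2*pi} \<theta> *\<^sub>R (cis \<theta> powi l * arc_ind n k (cis \<theta>)) = indicator {a..b} \<theta> *\<^sub>R (cis \<theta> powi l)"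
      using AE_lborel_singleton[of b] AE_lborel_singleton[of "2 * pi"]
    proof eventually_elim
      case (elim \<theta>)
      show ?case
      proof (cases "0 \<le> \<theta> \<and> \<theta> < 2 * pi")
        case True
        then show ?thesis using elim ab by (auto simp: arc Arg2pi_cis indicator_def)
      next
        case False
        then show ?thesis using elim ab by (auto simp: indicator_def)
      qed
    qed
  qed measurable
  finally have c: "fourier_coef (arc_ind n k) l = (1 / (2 * pi)) *\<^sub>R (if l = 0 then of_real (b - a) else (exp (\<i> * of_int l * of_real b) - exp (\<i> * of_int l * of_real a)) / (\<i> * of_int l))"
    unfolding integral_powi_interval[OF ab(2)] .
  have ce: "cnj (exp (\<i> * of_int l * of_real t)) = exp (- \<i> * of_real t * of_int l)" for t
    by (simp add: exp_cnj mult_ac)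
  show ?thesis
    unfolding c arc_coeff_def a_def[symmetric] b_def[symmetric]
    by (simp add: scaleR_conv_of_real exp_cnj mult_ac)
qed

text \<open>The arcs \<open>k\<close> and \<open>2 n - 1 - k\<close> are complex conjugates of each other.\<close>

lemma arc_coeff_reflect:
  assumes n: "0 < n" and k: "k < 2 * n"
  shows "arc_coeff (pi * real (2 * n - 1 - k) / real n) (pi * real (2 * n - 1 - k + 1) / real n) l
    = cnj (arc_coeff (pi * real k / real n) (pi * real (k + 1) / real n) l)"
proof -
  define a where "a = pi * real k / real n"
  define b where "b = pi * real (k + 1) / real n"
  have "real (2 * n - 1 - k) = 2 * real n - real (k + 1)" using k by simp
  then have a': "pi * real (2 * n - 1 - k) / real n = 2 * pi - b" using n by (simp add: b_def field_simps)
  have "real (2 * n - 1 - k + 1) = 2 * real n - real k" using k by simp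
  then have b': "pi * real (2 * n - 1 - k + 1) / real n = 2 * pi - a" using n by (simp add: a_def field_simps)
  have e: "exp (- \<i> * of_real (2 * pi - t) * of_int l) = cnj (exp (- \<i> * of_real t * of_int l))" for t
  proof -
    have "exp (- \<i> * of_real (2 * pi - t) * of_int l) = exp (\<i> * of_real t * of_int l) * exp (- (2 * of_real pi * \<i> * of_int l))"
      by (simp add: exp_add[symmetric] algebra_simps)
    also have "exp (- (2 * of_real pi * \<i> * of_int l)) = 1"
      using exp_integer_2pi[of "of_int (- l)"] by (simp add: mult_ac)
    finally show ?thesis by (simp add: exp_cnj)
  qed
  have e2: "cnj (exp (- \<i> * of_real t * of_int l)) = exp (\<i> * of_real t * of_int l)" for t
    by (simp add: exp_cnj)
  show ?thesis
  proof (cases "l = 0")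
    case True
    then show ?thesis unfolding a' b' unfolding a_def[symmetric] b_def[symmetric] by (simp add: arc_coeff_def)
  next
    case False
    have "arc_coeff (2 * pi - b) (2 * pi - a) l = (exp (\<i> * of_real a * of_int l) - exp (\<i> * of_real b * of_int l)) / (- 2 * of_real pi * \<i> * of_int l)"
      using False by (simp only: arc_coeff_def e e2 if_False)
    also have "\<dots> = (exp (\<i> * of_real b * of_int l) - exp (\<i> * of_real a * of_int l)) / (2 * of_real pi * \<i> * of_int l)"
    proof -
      have neg: "(p - q) / (- 2 * r * s * t) = (q - p) / (2 * r * s * t)" for p q r s t :: complex
        by (simp add: minus_divide_left)
      show ?thesis by (rule neg)
    qed
    also have "\<dots> = cnj (arc_coeff a b l)"
      using False by (simp only: arc_coeff_def if_False complex_cnj_divide complex_cnj_diff e2) simp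
    finally show ?thesis unfolding a' b' unfolding a_def[symmetric] b_def[symmetric] .
  qed
qed

section \<open>Second moments of linear functionals of the process\<close>

text \<open>The optimal \<open>t\<close> in the weighted inequality is the quotient of the norms; vanishing norms are
  treated separately.\<close>

lemma cauchy_schwarz_mean:
  assumes f: "pw_cont f" and g: "pw_cont g"
  shows "cmod (mean (\<lambda>z. f z * g z)) \<le> sqrt (mean_sq f) * sqrt (mean_sq g)"
proof -
  define m where "m = cmod (mean (\<lambda>z. f z * g z))"
  have b: "m \<le> (t * mean_sq f + mean_sq g / t) / 2" if "0 < t" for t
    unfolding m_def by (rule mean_mult_le[OF f g that])
  have F: "0 \<le> mean_sq f" and G: "0 \<le> mean_sq g" by (rule mean_sq_nonneg)+
  have m0: "m \<le> 0" if "mean_sq f = 0 \<or> mean_sq g = 0"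
  proof (rule ccontr)
    assume "\<not> m \<le> 0"
    then have m: "0 < m" by simp
    show False
    proof (cases "mean_sq f = 0")
      case True
      have t: "0 < mean_sq g / m + 1" using m G by (simp add: add_nonneg_pos)
      define x where "x = mean_sq g / (mean_sq g / m + 1)"
      have 1: "m \<le> x / 2" using b[OF t] True by (simp add: x_def)
      have "mean_sq g \<le> m * (mean_sq g / m + 1)" using m by (simp add: distrib_left)
      then have 2: "x \<le> m" using t by (simp add: x_def divide_le_eq)
      show False using 1 2 m by simp
    next
      case False
      then have g0: "mean_sq g = 0" and f0: "0 < mean_sq f" using that F by auto
      have "m \<le> (m / mean_sq f * mean_sq f) / 2" using b[of "m / mean_sq f"] m f0 g0 by simp
      then show False using m f0 by simp
    qed
  qed
  show ?thesis
  proof (cases "mean_sq f = 0 \<or> mean_sq g = 0")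
    case True
    then show ?thesis using m0 by (auto simp: m_def)
  next
    case False
    then have pos: "0 < sqrt (mean_sq f)" "0 < sqrt (mean_sq g)" using F G by auto
    define x where "x = sqrt (mean_sq f)"
    define y where "y = sqrt (mean_sq g)"
    have xy: "mean_sq f = x * x" "mean_sq g = y * y" "0 < x" "0 < y" using F G pos by (auto simp: x_def y_def)
    have "m \<le> ((y / x) * (x * x) + (y * y) / (y / x)) / 2" using b[of "y / x"] xy by simp
    also have "\<dots> = x * y" using xy by (simp add: field_simps)
    finally show ?thesis by (simp add: m_def x_def y_def)
  qed
qed

lemma mean_triple_tendsto:
  assumes f: "pw_cont f" and g: "pw_cont g" and h: "pw_cont h"
  shows "(\<lambda>N. mean (\<lambda>z. cnj (trig {- int N..int N} (fourier_coef g) z) * f z * trig {- int N..int N} (fourier_coef h) z))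
    \<longlonglongrightarrow> mean (\<lambda>z. cnj (g z) * f z * h z)"
proof -
  obtain B where B: "0 < B" "\<And>z. cmod z = 1 \<Longrightarrow> cmod (f z) \<le> B" using pw_contE[OF f] by metis
  let ?S = "\<lambda>N g. trig {- int N..int N} (fourier_coef g)"
  define d where "d N g = sqrt (mean_sq (\<lambda>z. g z - ?S N g z))" for N g
  have d0: "(\<lambda>N. d N g) \<longlonglongrightarrow> 0" if "pw_cont g" for g
    using tendsto_real_sqrt[OF fourier_partial_sums[OF that]] by (simp add: d_def)
  have dsym: "mean_sq (\<lambda>z. ?S N g z - g z) = mean_sq (\<lambda>z. g z - ?S N g z)" for N g
    unfolding mean_sq_def by (simp add: norm_minus_commute)
  have nc: "mean_sq (\<lambda>z. cnj (u z)) = mean_sq u" for u by (simp add: mean_sq_def)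
  have fm: "sqrt (mean_sq (\<lambda>z. f z * u z)) \<le> B * sqrt (mean_sq u)" if "pw_cont u" for u
  proof -
    have "sqrt (mean_sq (\<lambda>z. f z * u z)) \<le> sqrt (B\<^sup>2 * mean_sq u)" by (intro real_sqrt_le_mono mean_sq_mult_le f that B)
    then show ?thesis using B(1) by (simp add: real_sqrt_mult)
  qed
  have bound: "cmod (mean (\<lambda>z. cnj (?S N g z) * f z * ?S N h z) - mean (\<lambda>z. cnj (g z) * f z * h z))
      \<le> d N g * (B * sqrt (mean_sq h)) + sqrt (mean_sq g) * (B * d N h)" for N
  proof -
    have pS: "pw_cont (?S N g)" "pw_cont (?S N h)" by (rule pw_cont_trig)+
    have "mean (\<lambda>z. cnj (?S N g z) * f z * ?S N h z) - mean (\<lambda>z. cnj (g z) * f z * h z)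
       = mean (\<lambda>z. cnj (?S N g z - g z) * (f z * ?S N h z) + cnj (g z) * (f z * (?S N h z - h z)))"
      by (subst mean_diff[symmetric]) (auto intro!: pw_cont_mult pw_cont_cnj f g h pS simp del: cnj_sum simp: algebra_simps)
    also have "\<dots> = mean (\<lambda>z. cnj (?S N g z - g z) * (f z * ?S N h z)) + mean (\<lambda>z. cnj (g z) * (f z * (?S N h z - h z)))"
      by (rule mean_add) (intro pw_cont_mult pw_cont_cnj pw_cont_diff f g h pS)+
    finally have e: "mean (\<lambda>z. cnj (?S N g z) * f z * ?S N h z) - mean (\<lambda>z. cnj (g z) * f z * h z)
      = mean (\<lambda>z. cnj (?S N g z - g z) * (f z * ?S N h z)) + mean (\<lambda>z. cnj (g z) * (f z * (?S N h z - h z)))" .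
    have "cmod (mean (\<lambda>z. cnj (?S N g z - g z) * (f z * ?S N h z))) \<le> sqrt (mean_sq (\<lambda>z. cnj (?S N g z - g z))) * sqrt (mean_sq (\<lambda>z. f z * ?S N h z))"
      by (rule cauchy_schwarz_mean) (intro pw_cont_mult pw_cont_cnj pw_cont_diff f g h pS)+
    also have "\<dots> \<le> d N g * (B * sqrt (mean_sq h))"
    proof (rule mult_mono)
      show "sqrt (mean_sq (\<lambda>z. cnj (?S N g z - g z))) \<le> d N g" unfolding nc dsym d_def by simp
      have "sqrt (mean_sq (?S N h)) \<le> sqrt (mean_sq h)" by (subst mean_sq_trig) (auto intro!: bessel h)
      then have "B * sqrt (mean_sq (?S N h)) \<le> B * sqrt (mean_sq h)" using B(1) by simp
      then show "sqrt (mean_sq (\<lambda>z. f z * ?S N h z)) \<le> B * sqrt (mean_sq h)" using fm[OF pS(2)] by linarith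
    qed (auto simp: d_def mean_sq_nonneg)
    finally have 1: "cmod (mean (\<lambda>z. cnj (?S N g z - g z) * (f z * ?S N h z))) \<le> d N g * (B * sqrt (mean_sq h))" .
    have "cmod (mean (\<lambda>z. cnj (g z) * (f z * (?S N h z - h z)))) \<le> sqrt (mean_sq (\<lambda>z. cnj (g z))) * sqrt (mean_sq (\<lambda>z. f z * (?S N h z - h z)))"
      by (rule cauchy_schwarz_mean) (intro pw_cont_mult pw_cont_cnj pw_cont_diff f g h pS)+
    also have "\<dots> \<le> sqrt (mean_sq g) * (B * d N h)"
      unfolding nc using fm[OF pw_cont_diff[OF pS(2) h]] unfolding dsym d_def[symmetric]
      by (intro mult_left_mono) (auto simp: mean_sq_nonneg)
    finally have 2: "cmod (mean (\<lambda>z. cnj (g z) * (f z * (?S N h z - h z)))) \<le> sqrt (mean_sq g) * (B * d N h)" .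
    show ?thesis unfolding e by (rule order_trans[OF norm_triangle_ineq add_mono[OF 1 2]])
  qed
  have "(\<lambda>N. d N g * (B * sqrt (mean_sq h)) + sqrt (mean_sq g) * (B * d N h)) \<longlonglongrightarrow> 0 * (B * sqrt (mean_sq h)) + sqrt (mean_sq g) * (B * 0)"
    by (intro tendsto_intros d0 g h)
  then have "(\<lambda>N. d N g * (B * sqrt (mean_sq h)) + sqrt (mean_sq g) * (B * d N h)) \<longlonglongrightarrow> 0" by simp
  then have "(\<lambda>N. mean (\<lambda>z. cnj (?S N g z) * f z * ?S N h z) - mean (\<lambda>z. cnj (g z) * f z * h z)) \<longlonglongrightarrow> 0"
    by (rule Lim_null_comparison[rotated]) (use bound in simp)
  then show ?thesis by (rule LIM_zero_cancel)
qed

text \<open>The isometry between the span of the process and trigonometric polynomials, for the inner product weighted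
  by the spectral density.\<close>

lemma complex_moment:
  fixes a b :: "int \<Rightarrow> complex"
  assumes y: "gaussian_process M y F" and F: "pw_cont (\<lambda>z. F z $ i $ j)"
  defines "V \<equiv> (\<lambda>K a i \<omega>. \<Sum>k\<in>K. a k * complex_of_real (y k \<omega> $ i))"
  shows "integrable M (\<lambda>\<omega>. V K a i \<omega> * cnj (V L b j \<omega>))"
    "(\<integral>\<omega>. V K a i \<omega> * cnj (V L b j \<omega>) \<partial>M)
      = mean (\<lambda>z. cnj (trig K (\<lambda>k. cnj (a k)) z) * F z $ i $ j * trig L (\<lambda>l. cnj (b l)) z)"
proof -
  have e: "V K a i \<omega> * cnj (V L b j \<omega>) = (\<Sum>k\<in>K. \<Sum>l\<in>L. (a k * cnj (b l)) * complex_of_real (y k \<omega> $ i * y l \<omega> $ j))" for \<omega>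
    by (simp add: V_def sum_product mult_ac)
  have i: "integrable M (\<lambda>\<omega>. (a k * cnj (b l)) * complex_of_real (y k \<omega> $ i * y l \<omega> $ j))" for k l
    by (intro integrable_mult_right integrable_of_real process_product_integrable[OF y])
  show "integrable M (\<lambda>\<omega>. V K a i \<omega> * cnj (V L b j \<omega>))"
    unfolding e by (intro Bochner_Integration.integrable_sum i)
  have "(\<integral>\<omega>. V K a i \<omega> * cnj (V L b j \<omega>) \<partial>M) = (\<Sum>k\<in>K. \<Sum>l\<in>L. \<integral>\<omega>. (a k * cnj (b l)) * complex_of_real (y k \<omega> $ i * y l \<omega> $ j) \<partial>M)"
    unfolding e by (simp add: Bochner_Integration.integral_sum i Bochner_Integration.integrable_sum del: of_real_mult)
  also have "\<dots> = (\<Sum>k\<in>K. \<Sum>l\<in>L. (a k * cnj (b l)) * fourier_coef (\<lambda>z. F z $ i $ j) (k - l))"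
  proof (intro sum.cong refl)
    fix k l
    have "(\<integral>\<omega>. (a k * cnj (b l)) * complex_of_real (y k \<omega> $ i * y l \<omega> $ j) \<partial>M) = (a k * cnj (b l)) * of_real (\<integral>\<omega>. y k \<omega> $ i * y l \<omega> $ j \<partial>M)"
      by (simp only: integral_of_real[OF process_product_integrable[OF y]] integral_mult_right_zero)
    also have "of_real (\<integral>\<omega>. y k \<omega> $ i * y l \<omega> $ j \<partial>M) = fourier_coef (\<lambda>z. F z $ i $ j) (k - l)"
      using y by (simp add: gaussian_process_def)
    finally show "(\<integral>\<omega>. (a k * cnj (b l)) * complex_of_real (y k \<omega> $ i * y l \<omega> $ j) \<partial>M) = (a k * cnj (b l)) * fourier_coef (\<lambda>z. F z $ i $ j) (k - l)" .
  qed
  also have "\<dots> = mean (\<lambda>z. cnj (trig K (\<lambda>k. cnj (a k)) z) * F z $ i $ j * trig L (\<lambda>l. cnj (b l)) z)"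
    unfolding mean_trig_trig[OF F] by (simp add: mult_ac)
  finally show "(\<integral>\<omega>. V K a i \<omega> * cnj (V L b j \<omega>) \<partial>M)
      = mean (\<lambda>z. cnj (trig K (\<lambda>k. cnj (a k)) z) * F z $ i $ j * trig L (\<lambda>l. cnj (b l)) z)" .
qed

section \<open>Spectral increments\<close>

definition fourier_sum :: "(int \<Rightarrow> 'a \<Rightarrow> real^'m) \<Rightarrow> (complex \<Rightarrow> complex) \<Rightarrow> nat \<Rightarrow> 'a \<Rightarrow> complex^'m" where
  "fourier_sum y g N \<omega> = (\<chi> i. \<Sum>l\<in>{- int N..int N}. cnj (fourier_coef g l) * complex_of_real (y l \<omega> $ i))"

lemma arc_partial_sum_eq:
  assumes "0 < n" "k < 2 * n"
  shows "arc_partial_sum y (pi * real k / real n) (pi * real (k + 1) / real n) = fourier_sum y (arc_ind n k)"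
  by (intro ext) (simp only: arc_partial_sum_def fourier_sum_def fourier_coef_arc_ind[OF assms])

lemma fourier_sum_moment:
  assumes y: "gaussian_process M y F" and F: "pw_cont (\<lambda>z. F z $ i $ j)"
  shows "integrable M (\<lambda>\<omega>. fourier_sum y g N \<omega> $ i * cnj (fourier_sum y h N' \<omega> $ j))"
    "(\<integral>\<omega>. fourier_sum y g N \<omega> $ i * cnj (fourier_sum y h N' \<omega> $ j) \<partial>M)
      = mean (\<lambda>z. cnj (trig {- int N..int N} (fourier_coef g) z) * F z $ i $ j * trig {- int N'..int N'} (fourier_coef h) z)"
  using complex_moment[OF y F, where K="{- int N..int N}" and a="\<lambda>l. cnj (fourier_coef g l)" and L="{- int N'..int N'}" and b="\<lambda>l. cnj (fourier_coef h l)"]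
  by (simp_all only: fourier_sum_def vec_lambda_beta complex_cnj_cnj)

lemma fourier_sum_measurable:
  assumes y: "gaussian_process M y F"
  shows "(\<lambda>\<omega>. fourier_sum y g N \<omega> $ i) \<in> borel_measurable M" "fourier_sum y g N \<in> borel_measurable M"
proof -
  have "(\<lambda>\<omega>. complex_of_real (y l \<omega> $ i)) \<in> borel_measurable M" for l i
    by (rule measurable_compose[OF process_component_measurable[OF y] borel_measurable_of_real])
  then have m: "(\<lambda>\<omega>. \<Sum>l\<in>{- int N..int N}. cnj (fourier_coef g l) * complex_of_real (y l \<omega> $ i)) \<in> borel_measurable M" for i
    by (intro borel_measurable_sum borel_measurable_times borel_measurable_const)
  show "(\<lambda>\<omega>. fourier_sum y g N \<omega> $ i) \<in> borel_measurable M" using m[of i] by (simp add: fourier_sum_def)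
  show "fourier_sum y g N \<in> borel_measurable M"
    unfolding fourier_sum_def[abs_def] by (rule borel_measurable_vec_lambda[OF m])
qed

text \<open>The second moment of a difference of partial sums is a quadratic form of the density in the
  corresponding trigonometric polynomials, so that convergence of Fourier series in the mean gives
  the Cauchy property.\<close>

lemma fourier_sum_distance:
  assumes y: "gaussian_process M y F" and F: "pw_cont (\<lambda>z. F z $ i $ i)"
    and B: "\<And>z. cmod z = 1 \<Longrightarrow> cmod (F z $ i $ i) \<le> B" "0 < B" and g: "pw_cont g"
  shows "integrable M (\<lambda>\<omega>. (cmod (fourier_sum y g m \<omega> $ i - fourier_sum y g n \<omega> $ i))\<^sup>2)"
    "(\<integral>\<omega>. (cmod (fourier_sum y g m \<omega> $ i - fourier_sum y g n \<omega> $ i))\<^sup>2 \<partial>M)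
      \<le> 2 * B * (mean_sq (\<lambda>z. g z - trig {- int m..int m} (fourier_coef g) z) + mean_sq (\<lambda>z. g z - trig {- int n..int n} (fourier_coef g) z))"
proof -
  let ?V = "\<lambda>m \<omega>. fourier_sum y g m \<omega> $ i"
  define S where "S m = trig {- int m..int m} (fourier_coef g)" for m
  define p where "p z = S m z - S n z" for z
  have pS: "pw_cont (S m)" for m unfolding S_def by (rule pw_cont_trig)
  have pp: "pw_cont p" unfolding p_def by (intro pw_cont_diff pS)
  have int: "integrable M (\<lambda>\<omega>. ?V a \<omega> * cnj (?V b \<omega>))"
    and val: "(\<integral>\<omega>. ?V a \<omega> * cnj (?V b \<omega>) \<partial>M) = mean (\<lambda>z. cnj (S a z) * F z $ i $ i * S b z)" for a b
    unfolding S_def by (rule fourier_sum_moment[OF y F])+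
  have e: "complex_of_real ((cmod (?V m \<omega> - ?V n \<omega>))\<^sup>2)
     = (?V m \<omega> * cnj (?V m \<omega>) - ?V m \<omega> * cnj (?V n \<omega>)) - (?V n \<omega> * cnj (?V m \<omega>) - ?V n \<omega> * cnj (?V n \<omega>))" for \<omega>
    by (simp only: complex_norm_square complex_cnj_diff) (simp add: algebra_simps)
  have i1: "integrable M (\<lambda>\<omega>. complex_of_real ((cmod (?V m \<omega> - ?V n \<omega>))\<^sup>2))"
    unfolding e by (intro Bochner_Integration.integrable_diff int)
  from integrable_Re[OF this] show i2: "integrable M (\<lambda>\<omega>. (cmod (?V m \<omega> - ?V n \<omega>))\<^sup>2)" by (simp only: Re_complex_of_real)
  have pm: "pw_cont (\<lambda>z. cnj (S a z) * F z $ i $ i * S b z)" for a b by (intro pw_cont_mult pw_cont_cnj pS F)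
  have "complex_of_real (\<integral>\<omega>. (cmod (?V m \<omega> - ?V n \<omega>))\<^sup>2 \<partial>M) = (\<integral>\<omega>. complex_of_real ((cmod (?V m \<omega> - ?V n \<omega>))\<^sup>2) \<partial>M)"
    by (rule integral_of_real[OF i2, symmetric])
  also have "\<dots> = (mean (\<lambda>z. cnj (S m z) * F z $ i $ i * S m z) - mean (\<lambda>z. cnj (S m z) * F z $ i $ i * S n z))
     - (mean (\<lambda>z. cnj (S n z) * F z $ i $ i * S m z) - mean (\<lambda>z. cnj (S n z) * F z $ i $ i * S n z))"
    unfolding e by (simp only: Bochner_Integration.integral_diff Bochner_Integration.integrable_diff int val)
  also have "\<dots> = mean (\<lambda>z. (cnj (S m z) * F z $ i $ i * S m z - cnj (S m z) * F z $ i $ i * S n z)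
     - (cnj (S n z) * F z $ i $ i * S m z - cnj (S n z) * F z $ i $ i * S n z))"
    by (simp only: mean_diff pw_cont_diff pm)
  also have "\<dots> = mean (\<lambda>z. cnj (p z) * (F z $ i $ i * p z))"
    unfolding p_def by (rule mean_cong) (simp add: algebra_simps)
  finally have I: "complex_of_real (\<integral>\<omega>. (cmod (?V m \<omega> - ?V n \<omega>))\<^sup>2 \<partial>M) = mean (\<lambda>z. cnj (p z) * (F z $ i $ i * p z))" .
  have c: "cmod (mean (\<lambda>z. cnj (p z) * (F z $ i $ i * p z))) \<le> sqrt (mean_sq (\<lambda>z. cnj (p z))) * sqrt (mean_sq (\<lambda>z. F z $ i $ i * p z))"
    by (rule cauchy_schwarz_mean) (intro pw_cont_mult pw_cont_cnj pp F)+
  have "sqrt (mean_sq (\<lambda>z. F z $ i $ i * p z)) \<le> sqrt (B\<^sup>2 * mean_sq p)"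
    by (rule real_sqrt_le_mono, rule mean_sq_mult_le[OF F pp B(1)])
  then have c2: "sqrt (mean_sq (\<lambda>z. F z $ i $ i * p z)) \<le> B * sqrt (mean_sq p)" using B(2) by (simp add: real_sqrt_mult)
  have nc: "mean_sq (\<lambda>z. cnj (p z)) = mean_sq p" by (simp add: mean_sq_def)
  have "sqrt (mean_sq p) * sqrt (mean_sq (\<lambda>z. F z $ i $ i * p z)) \<le> sqrt (mean_sq p) * (B * sqrt (mean_sq p))"
    by (rule mult_left_mono[OF c2]) (simp add: mean_sq_nonneg)
  also have "\<dots> = B * mean_sq p" using mean_sq_nonneg[of p] by simp
  finally have c3: "cmod (mean (\<lambda>z. cnj (p z) * (F z $ i $ i * p z))) \<le> B * mean_sq p" using c unfolding nc by linarith
  define U where "U = (\<integral>\<omega>. (cmod (?V m \<omega> - ?V n \<omega>))\<^sup>2 \<partial>M)"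
  have U1: "U \<le> B * mean_sq p"
  proof -
    have "U \<le> cmod (complex_of_real U)" by simp
    then show ?thesis using c3 unfolding U_def I by linarith
  qed
  have "mean_sq (\<lambda>z. (S m z - g z) + (g z - S n z)) \<le> 2 * mean_sq (\<lambda>z. S m z - g z) + 2 * mean_sq (\<lambda>z. g z - S n z)"
    by (intro mean_sq_add_le pw_cont_diff pS g)
  moreover have "mean_sq (\<lambda>z. S m z - g z) = mean_sq (\<lambda>z. g z - S m z)"
    unfolding mean_sq_def by (simp add: norm_minus_commute)
  moreover have "(\<lambda>z. (S m z - g z) + (g z - S n z)) = p" by (auto simp: p_def)
  ultimately have "mean_sq p \<le> 2 * (mean_sq (\<lambda>z. g z - S m z) + mean_sq (\<lambda>z. g z - S n z))" by simp
  then have "B * mean_sq p \<le> B * (2 * (mean_sq (\<lambda>z. g z - S m z) + mean_sq (\<lambda>z. g z - S n z)))"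
    using B(2) by (intro mult_left_mono) auto
  then have "U \<le> 2 * B * (mean_sq (\<lambda>z. g z - S m z) + mean_sq (\<lambda>z. g z - S n z))" using U1 by (simp add: mult_ac)
  then show "(\<integral>\<omega>. (cmod (?V m \<omega> - ?V n \<omega>))\<^sup>2 \<partial>M)
      \<le> 2 * B * (mean_sq (\<lambda>z. g z - trig {- int m..int m} (fourier_coef g) z) + mean_sq (\<lambda>z. g z - trig {- int n..int n} (fourier_coef g) z))"
    unfolding U_def S_def .
qed

lemma fourier_sum_limit_exists:
  fixes y :: "int \<Rightarrow> 'a \<Rightarrow> real^'m"
  assumes pr: "prob_space M" and y: "gaussian_process M y F" and F: "\<And>i j. pw_cont (\<lambda>z. F z $ i $ j)" and g: "pw_cont g"
  obtains D where "is_mean_square_limit M (fourier_sum y g) D"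
proof (rule mean_square_complete[OF pr fourier_sum_measurable(2)[OF y]])
  let ?V = "fourier_sum y g"
  fix e :: real assume e: "0 < e"
  have "\<forall>i. \<exists>B. 0 < B \<and> (\<forall>z. cmod z = 1 \<longrightarrow> cmod (F z $ i $ i) \<le> B)" using pw_contE[OF F] by metis
  then obtain B where B: "\<And>i. 0 < B i" "\<And>i z. cmod z = 1 \<Longrightarrow> cmod (F z $ i $ i) \<le> B i" by metis
  define C where "C = (\<Sum>i\<in>(UNIV::'m set). 2 * B i)"
  have C: "0 < C" unfolding C_def by (rule sum_pos) (auto simp: B)
  define d where "d m = mean_sq (\<lambda>z. g z - trig {- int m..int m} (fourier_coef g) z)" for m
  have "d \<longlonglongrightarrow> 0" unfolding d_def by (rule fourier_partial_sums[OF g])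
  moreover have eC: "0 < e / (2 * C)" using e C by simp
  ultimately have "\<forall>\<^sub>F n in sequentially. d n < e / (2 * C)" by (rule order_tendstoD(2))
  then obtain N where N: "\<And>n. n \<ge> N \<Longrightarrow> d n < e / (2 * C)" unfolding eventually_sequentially by blast
  show "\<exists>N. \<forall>m\<ge>N. \<forall>n\<ge>N. (\<integral>\<^sup>+\<omega>. ennreal ((norm (?V m \<omega> - ?V n \<omega>))\<^sup>2) \<partial>M) \<le> ennreal e"
  proof (intro exI allI impI)
    fix m n assume mn: "N \<le> m" "N \<le> n"
    have i: "integrable M (\<lambda>\<omega>. (cmod (?V m \<omega> $ i - ?V n \<omega> $ i))\<^sup>2)" for i
      by (rule fourier_sum_distance(1)[OF y F B(2) B(1) g])
    have v: "(\<integral>\<omega>. (cmod (?V m \<omega> $ i - ?V n \<omega> $ i))\<^sup>2 \<partial>M) \<le> 2 * B i * (d m + d n)" for i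
      unfolding d_def by (rule fourier_sum_distance(2)[OF y F B(2) B(1) g])
    have nv: "(norm (?V m \<omega> - ?V n \<omega>))\<^sup>2 = (\<Sum>i\<in>UNIV. (cmod (?V m \<omega> $ i - ?V n \<omega> $ i))\<^sup>2)" for \<omega>
      by (simp add: norm_vec_power2)
    have "(\<integral>\<^sup>+\<omega>. ennreal ((norm (?V m \<omega> - ?V n \<omega>))\<^sup>2) \<partial>M) = ennreal (\<integral>\<omega>. (norm (?V m \<omega> - ?V n \<omega>))\<^sup>2 \<partial>M)"
      by (rule nn_integral_eq_integral) (auto simp only: nv intro!: Bochner_Integration.integrable_sum i AE_I2 sum_nonneg zero_le_power2)
    moreover have "(\<integral>\<omega>. (norm (?V m \<omega> - ?V n \<omega>))\<^sup>2 \<partial>M) \<le> e"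
    proof -
      have "(\<integral>\<omega>. (norm (?V m \<omega> - ?V n \<omega>))\<^sup>2 \<partial>M) = (\<Sum>i\<in>UNIV. \<integral>\<omega>. (cmod (?V m \<omega> $ i - ?V n \<omega> $ i))\<^sup>2 \<partial>M)"
        unfolding nv by (rule Bochner_Integration.integral_sum) (rule i)
      also have "\<dots> \<le> (\<Sum>i\<in>UNIV. 2 * B i * (d m + d n))" by (intro sum_mono v)
      also have "\<dots> = C * (d m + d n)" by (simp only: C_def sum_distrib_right)
      also have "\<dots> \<le> C * (e / (2 * C) + e / (2 * C))"
        using C N[OF mn(1)] N[OF mn(2)] by (intro mult_left_mono add_mono) auto
      also have "\<dots> = e" using C by (simp add: field_simps)
      finally show ?thesis .
    qed
    ultimately show "(\<integral>\<^sup>+\<omega>. ennreal ((norm (?V m \<omega> - ?V n \<omega>))\<^sup>2) \<partial>M) \<le> ennreal e"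
      by (simp add: ennreal_leI)
  qed
qed (use that in blast)

lemma grid_increment_limit:
  fixes y :: "int \<Rightarrow> 'a \<Rightarrow> real^'m"
  assumes pr: "prob_space M" and y: "gaussian_process M y F" and F: "\<And>i j. pw_cont (\<lambda>z. F z $ i $ j)"
    and n: "0 < n" "k < 2 * n"
  shows "is_mean_square_limit M (fourier_sum y (arc_ind n k)) (grid_increment M y n k)"
proof -
  obtain D where D: "is_mean_square_limit M (fourier_sum y (arc_ind n k)) D"
    by (rule fourier_sum_limit_exists[OF pr y F pw_cont_arc_ind])
  show ?thesis unfolding grid_increment_def spectral_increment_def arc_partial_sum_eq[OF n]
    by (rule someI[of "is_mean_square_limit M (fourier_sum y (arc_ind n k))", OF D])
qed

section \<open>Real coordinates of the increments\<close>

text \<open>The real coordinates of a complex number, the real part for \<open>True\<close> and the imaginary part for \<open>False\<close>.\<close>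

definition part :: "bool \<Rightarrow> complex \<Rightarrow> real" where
  "part b c = (if b then Re c else Im c)"

text \<open>Multiplication by a complex number as a real matrix, indexed by the coordinates of \<open>part\<close>.\<close>

definition rep :: "complex \<Rightarrow> bool \<Rightarrow> bool \<Rightarrow> real" where
  "rep c b b' = (if b = b' then Re c else if b' then Im c else - Im c)"

text \<open>The matrix of \<open>w \<mapsto> c * cnj w\<close>: half of it is the contribution of products without conjugation to the
  covariance of real coordinates.\<close>

definition rep_refl :: "complex \<Rightarrow> bool \<Rightarrow> bool \<Rightarrow> real" where
  "rep_refl c b b' = (if b = b' then if b then Re c else - Re c else Im c)"

lemma rep_refl_zero: "rep_refl 0 b b' = 0" by (simp add: rep_refl_def)

lemma part_mult_part: "part b x * part b' y = (rep (x * cnj y) b b' + rep_refl (x * y) b b') / 2"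
  by (simp add: part_def rep_def rep_refl_def algebra_simps)

lemma abs_part_le: "\<bar>part b c\<bar> \<le> cmod c"
  by (simp add: part_def abs_Re_le_cmod abs_Im_le_cmod)

lemma part_diff: "part b (x - y) = part b x - part b y" by (simp add: part_def)

lemma part_measurable: "f \<in> borel_measurable M \<Longrightarrow> (\<lambda>\<omega>. part b (f \<omega>)) \<in> borel_measurable M"
  by (cases b) (simp_all add: part_def)

lemma vec_nth_borel_measurable:
  fixes f :: "'a \<Rightarrow> complex^'m"
  assumes "f \<in> borel_measurable M" shows "(\<lambda>\<omega>. f \<omega> $ i) \<in> borel_measurable M"
  by (rule borel_measurable_continuous_on[OF _ assms, of "\<lambda>v. v $ i"]) (intro continuous_intros)

text \<open>The limit is square integrable because some partial sum is at finite distance from it.\<close>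

lemma increment_parts_converge:
  fixes y :: "int \<Rightarrow> 'a \<Rightarrow> real^'m"
  assumes y: "gaussian_process M y F" and F: "\<And>i j. pw_cont (\<lambda>z. F z $ i $ j)"
    and D: "is_mean_square_limit M (fourier_sum y g) D"
  shows "mean_sq_lim M (\<lambda>N \<omega>. part b (fourier_sum y g N \<omega> $ i)) (\<lambda>\<omega>. part b (D \<omega> $ i))"
proof -
  let ?V = "fourier_sum y g"
  let ?X = "\<lambda>N \<omega>. part b (?V N \<omega> $ i)" and ?Y = "\<lambda>\<omega>. part b (D \<omega> $ i)"
  have Dm: "D \<in> borel_measurable M" and lim: "(\<lambda>N. \<integral>\<^sup>+\<omega>. ennreal ((norm (?V N \<omega> - D \<omega>))\<^sup>2) \<partial>M) \<longlonglongrightarrow> 0"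
    using D by (auto simp: is_mean_square_limit_def)
  have Xm[measurable]: "?X N \<in> borel_measurable M" for N by (rule part_measurable, rule fourier_sum_measurable(1)[OF y])
  have Ym[measurable]: "?Y \<in> borel_measurable M" by (rule part_measurable, rule vec_nth_borel_measurable[OF Dm])
  have Xi: "integrable M (\<lambda>\<omega>. (?X N \<omega>)\<^sup>2)" for N
  proof (rule Bochner_Integration.integrable_bound[OF fourier_sum_moment(1)[OF y F[of i i], of g N g N]])
    show "AE \<omega> in M. norm ((?X N \<omega>)\<^sup>2) \<le> norm (?V N \<omega> $ i * cnj (?V N \<omega> $ i))"
    proof (rule AE_I2)
      fix \<omega>
      have "(?X N \<omega>)\<^sup>2 \<le> (cmod (?V N \<omega> $ i))\<^sup>2" using abs_part_le[of b "?V N \<omega> $ i"] by (simp add: abs_le_square_iff[symmetric])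
      then show "norm ((?X N \<omega>)\<^sup>2) \<le> norm (?V N \<omega> $ i * cnj (?V N \<omega> $ i))" by (simp add: norm_mult power2_eq_square)
    qed
  qed measurable
  have le: "(?X N \<omega> - ?Y \<omega>)\<^sup>2 \<le> (norm (?V N \<omega> - D \<omega>))\<^sup>2" for N \<omega>
  proof -
    have "\<bar>?X N \<omega> - ?Y \<omega>\<bar> \<le> cmod ((?V N \<omega> - D \<omega>) $ i)" unfolding part_diff[symmetric] using abs_part_le by simp
    also have "\<dots> \<le> norm (?V N \<omega> - D \<omega>)" by (rule Finite_Cartesian_Product.norm_nth_le)
    finally show ?thesis by (simp add: abs_le_square_iff[symmetric])
  qed
  define d where "d N = (\<integral>\<^sup>+\<omega>. ennreal ((?X N \<omega> - ?Y \<omega>)\<^sup>2) \<partial>M)" for N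
  have d0: "d \<longlonglongrightarrow> 0"
  proof (rule tendsto_sandwich[OF _ _ tendsto_const lim])
    show "\<forall>\<^sub>F N in sequentially. d N \<le> (\<integral>\<^sup>+\<omega>. ennreal ((norm (?V N \<omega> - D \<omega>))\<^sup>2) \<partial>M)"
      unfolding d_def by (intro always_eventually allI nn_integral_mono ennreal_leI le)
  qed simp
  have "\<forall>\<^sub>F N in sequentially. d N < 1" by (rule order_tendstoD(2)[OF d0]) simp
  then obtain N0 where N0: "d N0 < 1" using eventually_happens'[OF sequentially_bot] by blast
  have i0: "integrable M (\<lambda>\<omega>. (?X N0 \<omega> - ?Y \<omega>)\<^sup>2)"
  proof (rule integrableI_bounded)
    have "(\<integral>\<^sup>+\<omega>. ennreal (norm ((?X N0 \<omega> - ?Y \<omega>)\<^sup>2)) \<partial>M) = d N0" by (simp add: d_def)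
    then show "(\<integral>\<^sup>+\<omega>. ennreal (norm ((?X N0 \<omega> - ?Y \<omega>)\<^sup>2)) \<partial>M) < \<infinity>" using N0 by (auto intro: less_trans)
  qed measurable
  have "integrable M (\<lambda>\<omega>. (?X N0 \<omega> - (?X N0 \<omega> - ?Y \<omega>))\<^sup>2)"
    by (rule square_integrable_diff[OF _ _ Xi i0]) measurable
  then have Yi: "integrable M (\<lambda>\<omega>. (?Y \<omega>)\<^sup>2)" by simp
  have iN: "integrable M (\<lambda>\<omega>. (?X N \<omega> - ?Y \<omega>)\<^sup>2)" for N
    by (rule square_integrable_diff[OF Xm Ym Xi Yi])
  have "d N = ennreal (\<integral>\<omega>. (?X N \<omega> - ?Y \<omega>)\<^sup>2 \<partial>M)" for N
    unfolding d_def by (rule nn_integral_eq_integral[OF iN]) simp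
  then have "(\<lambda>N. ennreal (\<integral>\<omega>. (?X N \<omega> - ?Y \<omega>)\<^sup>2 \<partial>M)) \<longlonglongrightarrow> ennreal 0"
    using d0 by (subst (asm) tendsto_cong[of d]) (auto intro!: always_eventually)
  then have "(\<lambda>N. \<integral>\<omega>. (?X N \<omega> - ?Y \<omega>)\<^sup>2 \<partial>M) \<longlonglongrightarrow> 0"
    by (subst (asm) tendsto_ennreal_iff) auto
  then show ?thesis using Xm Ym Xi Yi by (auto simp: mean_sq_lim_def)
qed

lemma mean_sq_lim_unique:
  assumes "mean_sq_lim M X Y" "mean_sq_lim M X Y'"
  shows "AE \<omega> in M. Y \<omega> = Y' \<omega>"
proof -
  have m[measurable]: "\<And>n. X n \<in> borel_measurable M" "Y \<in> borel_measurable M" "Y' \<in> borel_measurable M"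
    and i: "\<And>n. integrable M (\<lambda>\<omega>. (X n \<omega>)\<^sup>2)" "integrable M (\<lambda>\<omega>. (Y \<omega>)\<^sup>2)" "integrable M (\<lambda>\<omega>. (Y' \<omega>)\<^sup>2)"
    using assms by (auto simp: mean_sq_lim_def)
  have "mean_sq_lim M (\<lambda>n \<omega>. X n \<omega> + (-1) * X n \<omega>) (\<lambda>\<omega>. Y \<omega> + (-1) * Y' \<omega>)"
    by (rule mean_sq_lim_add[OF assms(1) mean_sq_lim_cmult[OF assms(2)]])
  then have "(\<lambda>n. \<integral>\<omega>. (Y \<omega> - Y' \<omega>)\<^sup>2 \<partial>M) \<longlonglongrightarrow> 0" by (simp add: mean_sq_lim_def power2_commute)
  then have z: "(\<integral>\<omega>. (Y \<omega> - Y' \<omega>)\<^sup>2 \<partial>M) = 0" using LIMSEQ_const_iff by blast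
  have int: "integrable M (\<lambda>\<omega>. (Y \<omega> - Y' \<omega>)\<^sup>2)" by (rule square_integrable_diff[OF m(2,3) i(2,3)])
  have "AE \<omega> in M. (Y \<omega> - Y' \<omega>)\<^sup>2 = 0"
    using integral_nonneg_eq_0_iff_AE[OF int] z by simp
  then show ?thesis by eventually_elim simp
qed

text \<open>The process is real, so conjugate coefficients produce conjugate partial sums.\<close>

lemma mean_square_limit_reflect:
  fixes y :: "int \<Rightarrow> 'a \<Rightarrow> real^'m"
  assumes y: "gaussian_process M y F" and F: "\<And>i j. pw_cont (\<lambda>z. F z $ i $ j)"
    and D: "is_mean_square_limit M (fourier_sum y g) D" and D': "is_mean_square_limit M (fourier_sum y g') D'"
    and refl: "\<And>l. fourier_coef g' l = cnj (fourier_coef g l)"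
  shows "AE \<omega> in M. \<forall>i. D' \<omega> $ i = cnj (D \<omega> $ i)"
proof -
  have fs: "fourier_sum y g' N \<omega> $ i = cnj (fourier_sum y g N \<omega> $ i)" for N \<omega> i
    by (simp add: fourier_sum_def refl)
  have "AE \<omega> in M. part b (D' \<omega> $ i) = part b (cnj (D \<omega> $ i))" for b i
  proof -
    have "mean_sq_lim M (\<lambda>N \<omega>. part b (fourier_sum y g' N \<omega> $ i)) (\<lambda>\<omega>. (if b then 1 else -1) * part b (D \<omega> $ i))"
      using mean_sq_lim_cmult[OF increment_parts_converge[OF y F D, of b i], of "if b then 1 else -1"]
      by (cases b) (simp_all add: fs part_def)
    from mean_sq_lim_unique[OF increment_parts_converge[OF y F D'] this]
    show ?thesis by (cases b) (simp_all add: part_def)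
  qed
  then have "AE \<omega> in M. \<forall>b\<in>UNIV. \<forall>i\<in>UNIV. part b (D' \<omega> $ i) = part b (cnj (D \<omega> $ i))"
    by (intro AE_finite_allI) auto
  then show ?thesis
  proof eventually_elim
    case (elim \<omega>)
    show ?case
    proof
      fix i
      show "D' \<omega> $ i = cnj (D \<omega> $ i)"
        using elim[rule_format, of True i] elim[rule_format, of False i] by (intro complex_eqI) (auto simp: part_def)
    qed
  qed
qed

lemma tendsto_rep: "(f \<longlongrightarrow> c) A \<Longrightarrow> ((\<lambda>n. rep (f n) b b') \<longlongrightarrow> rep c b b') A"
  by (auto simp: rep_def intro!: tendsto_intros)

lemma tendsto_rep_refl: "(f \<longlongrightarrow> c) A \<Longrightarrow> ((\<lambda>n. rep_refl (f n) b b') \<longlongrightarrow> rep_refl c b b') A"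
  by (auto simp: rep_refl_def intro!: tendsto_intros)

text \<open>The increment over the conjugate arc being the conjugate, products without conjugation are
  moments between an arc and a conjugate arc; they vanish when these are disjoint.\<close>

lemma increment_moment:
  fixes y :: "int \<Rightarrow> 'a \<Rightarrow> real^'m"
  assumes y: "gaussian_process M y F" and F: "\<And>i j. pw_cont (\<lambda>z. F z $ i $ j)"
    and g: "pw_cont g" and h: "pw_cont h" and h': "pw_cont h'"
    and D: "is_mean_square_limit M (fourier_sum y g) D" and E: "is_mean_square_limit M (fourier_sum y h) E"
    and refl: "\<And>l. fourier_coef h' l = cnj (fourier_coef h l)"
    and disj: "\<And>z. cmod z = 1 \<Longrightarrow> cnj (g z) * h' z = 0"
  shows "(\<integral>\<omega>. part b (D \<omega> $ i) * part b' (E \<omega> $ j) \<partial>M) = rep (mean (\<lambda>z. cnj (g z) * F z $ i $ j * h z)) b b' / 2"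
proof (rule LIMSEQ_unique[OF mean_sq_lim_product[OF increment_parts_converge[OF y F D] increment_parts_converge[OF y F E]]])
  let ?V = "\<lambda>N \<omega>. fourier_sum y g N \<omega> $ i" and ?W = "\<lambda>N \<omega>. fourier_sum y h N \<omega> $ j"
  let ?W' = "\<lambda>N \<omega>. fourier_sum y h' N \<omega> $ j"
  have fs: "?W N \<omega> = cnj (?W' N \<omega>)" for N \<omega>
    by (simp add: fourier_sum_def refl)
  have i1: "integrable M (\<lambda>\<omega>. ?V N \<omega> * cnj (?W N \<omega>))" for N by (rule fourier_sum_moment(1)[OF y F])
  have i2: "integrable M (\<lambda>\<omega>. ?V N \<omega> * ?W N \<omega>)" for N
    unfolding fs by (rule fourier_sum_moment(1)[OF y F])
  have l1: "(\<lambda>N. \<integral>\<omega>. ?V N \<omega> * cnj (?W N \<omega>) \<partial>M) \<longlonglongrightarrow> mean (\<lambda>z. cnj (g z) * F z $ i $ j * h z)"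
    unfolding fourier_sum_moment(2)[OF y F] by (rule mean_triple_tendsto[OF F g h])
  have "(\<lambda>N. \<integral>\<omega>. ?V N \<omega> * ?W N \<omega> \<partial>M) \<longlonglongrightarrow> mean (\<lambda>z. cnj (g z) * F z $ i $ j * h' z)"
    unfolding fs fourier_sum_moment(2)[OF y F] by (rule mean_triple_tendsto[OF F g h'])
  moreover have "mean (\<lambda>z. cnj (g z) * F z $ i $ j * h' z) = mean (\<lambda>z. 0)"
    by (rule mean_cong) (use disj in \<open>auto simp: mult_ac\<close>)
  ultimately have l2: "(\<lambda>N. \<integral>\<omega>. ?V N \<omega> * ?W N \<omega> \<partial>M) \<longlonglongrightarrow> 0" by (simp add: mean_def)
  have ri: "integrable M (\<lambda>\<omega>. rep (f \<omega>) b b')" "(\<integral>\<omega>. rep (f \<omega>) b b' \<partial>M) = rep (\<integral>\<omega>. f \<omega> \<partial>M) b b'"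
    if f: "integrable M f" for f
    using f by (cases b; cases b'; simp add: rep_def)+
  have rj: "integrable M (\<lambda>\<omega>. rep_refl (f \<omega>) b b')" "(\<integral>\<omega>. rep_refl (f \<omega>) b b' \<partial>M) = rep_refl (\<integral>\<omega>. f \<omega> \<partial>M) b b'"
    if f: "integrable M f" for f
    using f by (cases b; cases b'; simp add: rep_refl_def)+
  have e: "(\<integral>\<omega>. part b (?V N \<omega>) * part b' (?W N \<omega>) \<partial>M)
      = (rep (\<integral>\<omega>. ?V N \<omega> * cnj (?W N \<omega>) \<partial>M) b b' + rep_refl (\<integral>\<omega>. ?V N \<omega> * ?W N \<omega> \<partial>M) b b') / 2" for N
    unfolding part_mult_part ri(2)[OF i1, symmetric] rj(2)[OF i2, symmetric]
    by (simp add: Bochner_Integration.integral_add[OF ri(1)[OF i1] rj(1)[OF i2]])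
  have "(\<lambda>N. (rep (\<integral>\<omega>. ?V N \<omega> * cnj (?W N \<omega>) \<partial>M) b b' + rep_refl (\<integral>\<omega>. ?V N \<omega> * ?W N \<omega> \<partial>M) b b') / 2)
     \<longlonglongrightarrow> (rep (mean (\<lambda>z. cnj (g z) * F z $ i $ j * h z)) b b' + rep_refl 0 b b') / 2"
    by (intro tendsto_divide tendsto_add tendsto_rep tendsto_rep_refl l1 l2 tendsto_const) simp
  then show "(\<lambda>N. \<integral>\<omega>. part b (?V N \<omega>) * part b' (?W N \<omega>) \<partial>M) \<longlonglongrightarrow> rep (mean (\<lambda>z. cnj (g z) * F z $ i $ j * h z)) b b' / 2"
    unfolding e by (simp add: rep_refl_zero)
qed

text \<open>Partial sums are finite linear combinations of the process; Gaussianity passes to the limit.\<close>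

lemma increment_parts_gaussian:
  fixes y :: "int \<Rightarrow> 'a \<Rightarrow> real^'m" and g :: "'k \<Rightarrow> complex \<Rightarrow> complex"
  assumes pr: "prob_space M" and y: "gaussian_process M y F" and F: "\<And>i j. pw_cont (\<lambda>z. F z $ i $ j)"
    and K: "finite K" and D: "\<And>k. k \<in> K \<Longrightarrow> is_mean_square_limit M (fourier_sum y (g k)) (D k)"
  defines "I \<equiv> K \<times> (UNIV :: 'm set) \<times> (UNIV :: bool set)"
    and "P \<equiv> (\<lambda>a \<omega>. part (snd (snd a)) (D (fst a) \<omega> $ fst (snd a)))"
  shows "gaussian_family M I P (\<lambda>a b. \<integral>\<omega>. P a \<omega> * P b \<omega> \<partial>M)"
  unfolding gaussian_family_def
proof
  fix u :: "'k \<times> 'm \<times> bool \<Rightarrow> real"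
  define X where "X a N \<omega> = part (snd (snd a)) (fourier_sum y (g (fst a)) N \<omega> $ fst (snd a))" for a :: "'k \<times> 'm \<times> bool" and N \<omega>
  have lim: "mean_sq_lim M (X a) (P a)" if "a \<in> I" for a
    unfolding X_def[abs_def] P_def by (rule increment_parts_converge[OF y F D]) (use that in \<open>auto simp: I_def\<close>)
  have lims: "mean_sq_lim M (\<lambda>N \<omega>. \<Sum>a\<in>I. u a * X a N \<omega>) (\<lambda>\<omega>. \<Sum>a\<in>I. u a * P a \<omega>)"
    by (intro mean_sq_lim_sum mean_sq_lim_cmult lim)
  have pm: "part b (\<Sum>l\<in>L. c l * complex_of_real (r l)) = (\<Sum>l\<in>L. part b (c l) * r l)" for b c r and L :: "int set"
    by (simp add: part_def)
  define v where "v l = (\<chi> i. \<Sum>k\<in>K. \<Sum>b\<in>UNIV. u (k, i, b) * part b (cnj (fourier_coef (g k) l)))" for l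
  have comb: "(\<Sum>a\<in>I. u a * X a N \<omega>) = (\<Sum>l\<in>{- int N..int N}. v l \<bullet> y l \<omega>)" for N \<omega>
  proof -
    have "(\<Sum>a\<in>I. u a * X a N \<omega>) = (\<Sum>k\<in>K. \<Sum>i\<in>UNIV. \<Sum>b\<in>UNIV. \<Sum>l\<in>{- int N..int N}. u (k, i, b) * part b (cnj (fourier_coef (g k) l)) * y l \<omega> $ i)"
    proof -
      have "(\<Sum>a\<in>I. f a) = (\<Sum>k\<in>K. \<Sum>i\<in>UNIV. \<Sum>b\<in>UNIV. f (k, i, b))" for f :: "'k \<times> 'm \<times> bool \<Rightarrow> real"
        unfolding I_def by (simp add: sum.cartesian_product split_def)
      then show ?thesis
        unfolding X_def fourier_sum_def vec_lambda_beta pm by (simp add: sum_distrib_left mult.assoc)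
    qed
    also have "\<dots> = (\<Sum>l\<in>{- int N..int N}. \<Sum>k\<in>K. \<Sum>i\<in>UNIV. \<Sum>b\<in>UNIV. u (k, i, b) * part b (cnj (fourier_coef (g k) l)) * y l \<omega> $ i)"
    proof -
      have "(\<Sum>k\<in>K. \<Sum>i\<in>UNIV. \<Sum>b\<in>UNIV. \<Sum>l\<in>{- int N..int N}. f k i b l) = (\<Sum>k\<in>K. \<Sum>i\<in>UNIV. \<Sum>l\<in>{- int N..int N}. \<Sum>b\<in>UNIV. f k i b l)"
        for f :: "'k \<Rightarrow> 'm \<Rightarrow> bool \<Rightarrow> int \<Rightarrow> real"
        by (intro sum.cong refl, rule sum.swap)
      moreover have "(\<Sum>k\<in>K. \<Sum>i\<in>UNIV. \<Sum>l\<in>{- int N..int N}. \<Sum>b\<in>UNIV. f k i b l) = (\<Sum>k\<in>K. \<Sum>l\<in>{- int N..int N}. \<Sum>i\<in>UNIV. \<Sum>b\<in>UNIV. f k i b l)"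
        for f :: "'k \<Rightarrow> 'm \<Rightarrow> bool \<Rightarrow> int \<Rightarrow> real"
        by (intro sum.cong refl, rule sum.swap)
      ultimately show ?thesis by (simp only:) (rule sum.swap)
    qed
    also have "\<dots> = (\<Sum>l\<in>{- int N..int N}. \<Sum>i\<in>UNIV. \<Sum>k\<in>K. \<Sum>b\<in>UNIV. u (k, i, b) * part b (cnj (fourier_coef (g k) l)) * y l \<omega> $ i)"
      by (intro sum.cong refl, rule sum.swap)
    also have "\<dots> = (\<Sum>l\<in>{- int N..int N}. v l \<bullet> y l \<omega>)"
      unfolding v_def inner_vec_def vec_lambda_beta inner_real_def by (simp only: sum_distrib_right)
    finally show ?thesis .
  qed
  have "(\<integral>\<omega>. iexp (\<Sum>a\<in>I. u a * P a \<omega>) \<partial>M) = of_real (exp (- (\<integral>\<omega>. (\<Sum>a\<in>I. u a * P a \<omega>)\<^sup>2 \<partial>M) / 2))"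
  proof (rule mean_sq_lim_gaussian[OF pr lims])
    show "(\<integral>\<omega>. iexp (\<Sum>a\<in>I. u a * X a n \<omega>) \<partial>M) = of_real (exp (- (\<integral>\<omega>. (\<Sum>a\<in>I. u a * X a n \<omega>)\<^sup>2 \<partial>M) / 2))" for n
      unfolding comb by (rule gaussian_process_char[OF y]) simp
  qed
  moreover have "(\<integral>\<omega>. (\<Sum>a\<in>I. u a * P a \<omega>)\<^sup>2 \<partial>M) = bilin I (\<lambda>a b. \<integral>\<omega>. P a \<omega> * P b \<omega> \<partial>M) u u"
  proof -
    have i: "integrable M (\<lambda>\<omega>. P a \<omega> * P b \<omega>)" if "a \<in> I" "b \<in> I" for a b
      using lim[OF that(1)] lim[OF that(2)] unfolding mean_sq_lim_def by (blast intro: integrable_product_of_squares)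
    have "(\<integral>\<omega>. (\<Sum>a\<in>I. u a * P a \<omega>)\<^sup>2 \<partial>M) = (\<integral>\<omega>. (\<Sum>a\<in>I. \<Sum>b\<in>I. (u a * u b) * (P a \<omega> * P b \<omega>)) \<partial>M)"
      by (simp add: power2_eq_square sum_product mult_ac)
    also have "\<dots> = (\<Sum>a\<in>I. \<Sum>b\<in>I. (u a * u b) * (\<integral>\<omega>. P a \<omega> * P b \<omega> \<partial>M))"
      by (subst Bochner_Integration.integral_sum, intro Bochner_Integration.integrable_sum integrable_mult_right i, assumption+,
          intro sum.cong refl, subst Bochner_Integration.integral_sum, intro integrable_mult_right i, assumption+, simp)
    finally show ?thesis by (simp add: bilin_def mult_ac)
  qed
  ultimately show "(\<integral>\<omega>. iexp (\<Sum>a\<in>I. u a * P a \<omega>) \<partial>M) = of_real (exp (- bilin I (\<lambda>a b. \<integral>\<omega>. P a \<omega> * P b \<omega> \<partial>M) u u / 2))" by simp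
qed

section \<open>Averages over arcs\<close>

text \<open>The mean value of \<open>F\<close> over the arc, of relative length \<open>1 / (2 n)\<close>. Up to a factor these averages are the
  covariance matrices of the spectral increments.\<close>

definition arc_average :: "nat \<Rightarrow> nat \<Rightarrow> (complex \<Rightarrow> complex^'m^'m) \<Rightarrow> complex^'m^'m" where
  "arc_average n k F = (\<chi> i j. of_nat (2 * n) * mean (\<lambda>z. arc_ind n k z * F z $ i $ j))"

lemma mean_arc_ind:
  assumes "0 < n" "k < 2 * n" shows "mean (arc_ind n k) = 1 / of_nat (2 * n)"
proof -
  have "cnj (mean (arc_ind n k)) = of_real ((pi * real (k + 1) / real n - pi * real k / real n) / (2 * pi))"
    using fourier_coef_arc_ind[OF assms, of 0] by (simp add: fourier_coef_def arc_coeff_def)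
  also have "(pi * real (k + 1) / real n - pi * real k / real n) / (2 * pi) = 1 / real (2 * n)"
    using assms(1) by (simp add: field_simps)
  finally have "cnj (mean (arc_ind n k)) = of_real (1 / real (2 * n))" .
  then have "cnj (cnj (mean (arc_ind n k))) = cnj (of_real (1 / real (2 * n)))" by (rule arg_cong)
  then show ?thesis by simp
qed

lemma mean_norm_le:
  assumes f: "pw_cont f" and g: "pw_cont g" and le: "\<And>z. cmod z = 1 \<Longrightarrow> cmod (f z) \<le> Re (g z)"
  shows "cmod (mean f) \<le> Re (mean g)"
proof -
  have "cmod (mean f) \<le> (\<integral>\<theta>. cmod (f (cis \<theta>)) \<partial>angle_measure)" unfolding mean_def by (rule integral_norm_bound)
  also have "\<dots> \<le> (\<integral>\<theta>. Re (g (cis \<theta>)) \<partial>angle_measure)"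
    by (rule integral_mono) (auto intro!: integrable_norm integrable_Re pw_cont_integrable f g le)
  also have "\<dots> = Re (mean g)" unfolding mean_def by (rule integral_Re[OF pw_cont_integrable[OF g]])
  finally show ?thesis .
qed

lemma arc_average_near:
  fixes F :: "complex \<Rightarrow> complex^'m^'m"
  assumes n: "0 < n" "k < 2 * n" and F: "pw_cont (\<lambda>z. F z $ i $ j)"
    and e: "\<And>w. cmod w = 1 \<Longrightarrow> arc_ind n k w = 1 \<Longrightarrow> cmod (F w $ i $ j - c) \<le> e"
  shows "cmod (arc_average n k F $ i $ j - c) \<le> e"
proof -
  have pa: "pw_cont (\<lambda>z. arc_ind n k z * F z $ i $ j)" by (intro pw_cont_mult pw_cont_arc_ind F)
  have "mean (\<lambda>z. arc_ind n k z * F z $ i $ j) - c * mean (arc_ind n k) = mean (\<lambda>z. arc_ind n k z * F z $ i $ j - c * arc_ind n k z)"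
    by (simp add: mean_cmult[symmetric] mean_diff[OF pa pw_cont_mult[OF pw_cont_const pw_cont_arc_ind]])
  then have d: "arc_average n k F $ i $ j - c = of_nat (2 * n) * mean (\<lambda>z. arc_ind n k z * F z $ i $ j - c * arc_ind n k z)"
    using n(1) by (simp add: arc_average_def mean_arc_ind[OF n] field_simps)
  have "cmod (mean (\<lambda>z. arc_ind n k z * F z $ i $ j - c * arc_ind n k z)) \<le> Re (mean (\<lambda>z. of_real e * arc_ind n k z))"
  proof (rule mean_norm_le)
    show "pw_cont (\<lambda>z. arc_ind n k z * F z $ i $ j - c * arc_ind n k z)" "pw_cont (\<lambda>z. of_real e * arc_ind n k z)"
      by (intro pw_cont_diff pa pw_cont_mult pw_cont_const pw_cont_arc_ind)+
    fix w :: complex assume w: "cmod w = 1"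
    have "arc_ind n k w = 0 \<or> arc_ind n k w = 1" by (simp add: arc_ind_def)
    then show "cmod (arc_ind n k w * F w $ i $ j - c * arc_ind n k w) \<le> Re (of_real e * arc_ind n k w)"
      using e[OF w] by auto
  qed
  also have "\<dots> = e / real (2 * n)" unfolding mean_cmult mean_arc_ind[OF n] by (simp add: Re_divide_of_nat)
  finally have "real (2 * n) * cmod (mean (\<lambda>z. arc_ind n k z * F z $ i $ j - c * arc_ind n k z)) \<le> real (2 * n) * (e / real (2 * n))"
    by (rule mult_left_mono) simp
  also have "\<dots> = e" using n(1) by simp
  finally show ?thesis unfolding d norm_mult by (simp only: norm_of_nat)
qed

text \<open>Averaging preserves bounds on quadratic forms, since it commutes with evaluating the form.\<close>

lemma arc_average_form:
  fixes F :: "complex \<Rightarrow> complex^'m^'m"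
  assumes n: "0 < n" "k < 2 * n" and F: "symbol \<alpha> \<beta> F"
  shows "\<alpha> * (norm v)\<^sup>2 \<le> Re (herm_form (arc_average n k F) v)" "Re (herm_form (arc_average n k F) v) \<le> \<beta> * (norm v)\<^sup>2"
proof -
  have pF: "pw_cont (\<lambda>z. F z $ i $ j)" for i j using F by (simp add: symbol_def)
  have pt: "pw_cont (\<lambda>z. arc_ind n k z * F z $ i $ j)" for i j by (intro pw_cont_mult pw_cont_arc_ind pF)
  have pq: "pw_cont (\<lambda>z. arc_ind n k z * herm_form (F z) v)" unfolding herm_form_def by (intro pw_cont_mult pw_cont_sum pw_cont_arc_ind pF pw_cont_const)
  have "mean (\<lambda>z. arc_ind n k z * herm_form (F z) v) = mean (\<lambda>z. \<Sum>i\<in>UNIV. \<Sum>j\<in>UNIV. (cnj (v $ i) * v $ j) * (arc_ind n k z * F z $ i $ j))"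
    unfolding herm_form_def by (rule mean_cong) (simp add: sum_distrib_left mult_ac)
  also have "\<dots> = (\<Sum>i\<in>UNIV. \<Sum>j\<in>UNIV. (cnj (v $ i) * v $ j) * mean (\<lambda>z. arc_ind n k z * F z $ i $ j))"
    by (simp only: mean_sum pw_cont_sum pw_cont_mult pw_cont_const pt mean_cmult)
  finally have q: "herm_form (arc_average n k F) v = of_nat (2 * n) * mean (\<lambda>z. arc_ind n k z * herm_form (F z) v)"
    by (simp add: herm_form_def arc_average_def sum_distrib_left mult_ac)
  have c: "Re (mean (\<lambda>z. of_real s * arc_ind n k z)) = s / real (2 * n)" for s
    unfolding mean_cmult mean_arc_ind[OF n] by (simp add: Re_divide_of_nat)
  have pcc: "pw_cont (\<lambda>z. of_real s * arc_ind n k z)" for s by (intro pw_cont_mult pw_cont_const pw_cont_arc_ind)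
  have b: "\<alpha> * (norm v)\<^sup>2 \<le> Re (herm_form (F z) v)" "Re (herm_form (F z) v) \<le> \<beta> * (norm v)\<^sup>2" if "cmod z = 1" for z
    using F that by (auto simp: symbol_def coercive_mat_def)
  have d: "arc_ind n k z = 0 \<or> arc_ind n k z = 1" for z by (simp add: arc_ind_def)
  have "\<alpha> * (norm v)\<^sup>2 / real (2 * n) \<le> Re (mean (\<lambda>z. arc_ind n k z * herm_form (F z) v))"
    unfolding c[symmetric]
    by (rule mean_Re_mono[OF pcc pq]) (use b d in \<open>metis Re_complex_of_real mult.right_neutral mult_1 mult_zero_left mult_zero_right order_refl\<close>)
  then show "\<alpha> * (norm v)\<^sup>2 \<le> Re (herm_form (arc_average n k F) v)"
    unfolding q using n(1) by (simp add: divide_le_eq mult_ac)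
  have "Re (mean (\<lambda>z. arc_ind n k z * herm_form (F z) v)) \<le> \<beta> * (norm v)\<^sup>2 / real (2 * n)"
    unfolding c[symmetric]
    by (rule mean_Re_mono[OF pq pcc]) (use b d in \<open>metis Re_complex_of_real mult.right_neutral mult_1 mult_zero_left mult_zero_right order_refl\<close>)
  then show "Re (herm_form (arc_average n k F) v) \<le> \<beta> * (norm v)\<^sup>2"
    unfolding q using n(1) by (simp add: le_divide_eq mult_ac)
qed

lemma arc_average_coer:
  "0 < n \<Longrightarrow> k < 2 * n \<Longrightarrow> symbol \<alpha> \<beta> F \<Longrightarrow> coercive_mat \<alpha> (arc_average n k F)"
  unfolding coercive_mat_def using arc_average_form(1) by blast

lemma arc_average_interpolate:
  assumes F: "\<And>i j. pw_cont (\<lambda>z. F z $ i $ j)" and G: "\<And>i j. pw_cont (\<lambda>z. G z $ i $ j)"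
  shows "arc_average n k (interpolate F G t) $ i $ j = arc_average n k G $ i $ j + of_real t * (arc_average n k F $ i $ j - arc_average n k G $ i $ j)"
proof -
  have p: "pw_cont (\<lambda>z. arc_ind n k z * F z $ i $ j)" "pw_cont (\<lambda>z. arc_ind n k z * G z $ i $ j)" by (intro pw_cont_mult pw_cont_arc_ind F G)+
  have "mean (\<lambda>z. arc_ind n k z * interpolate F G t z $ i $ j)
      = mean (\<lambda>z. arc_ind n k z * G z $ i $ j + of_real t * (arc_ind n k z * F z $ i $ j - arc_ind n k z * G z $ i $ j))"
    by (rule mean_cong) (simp add: interpolate_def algebra_simps)
  also have "\<dots> = mean (\<lambda>z. arc_ind n k z * G z $ i $ j) + of_real t * (mean (\<lambda>z. arc_ind n k z * F z $ i $ j) - mean (\<lambda>z. arc_ind n k z * G z $ i $ j))"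
    by (simp only: mean_add pw_cont_mult pw_cont_const pw_cont_diff p mean_cmult mean_diff)
  finally have e: "mean (\<lambda>z. arc_ind n k z * interpolate F G t z $ i $ j)
      = mean (\<lambda>z. arc_ind n k z * G z $ i $ j) + of_real t * (mean (\<lambda>z. arc_ind n k z * F z $ i $ j) - mean (\<lambda>z. arc_ind n k z * G z $ i $ j))" .
  show ?thesis by (simp only: arc_average_def vec_lambda_beta e) (simp add: algebra_simps)
qed

section \<open>A Riemann sum\<close>

definition arc_index :: "nat \<Rightarrow> complex \<Rightarrow> nat" where
  "arc_index n z = nat \<lfloor>real n * Arg2pi z / pi\<rfloor>"

lemma arc_index:
  assumes n: "0 < n"
  shows "arc_index n z < 2 * n" "arc_ind n k z = (if k = arc_index n z then 1 else 0)"
proof -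
  define x where "x = real n * Arg2pi z / pi"
  have x0: "0 \<le> x" unfolding x_def using Arg2pi_ge_0[of z] by simp
  have "real n * Arg2pi z < real n * (2 * pi)" using Arg2pi_lt_2pi[of z] n by simp
  then have x2: "x < 2 * real n" unfolding x_def by (simp add: divide_less_eq mult_ac)
  have "\<lfloor>x\<rfloor> < 2 * int n" using x2 by (simp add: floor_less_iff)
  then show "arc_index n z < 2 * n" unfolding arc_index_def x_def[symmetric] using x0 by linarith
  have "(pi * real k / real n \<le> Arg2pi z) = (real k \<le> x)" "(Arg2pi z < pi * real (k + 1) / real n) = (x < real k + 1)"
    unfolding x_def using n by (simp_all add: field_simps)
  moreover have "(real k \<le> x \<and> x < real k + 1) = (k = nat \<lfloor>x\<rfloor>)" using x0 by linarith
  ultimately show "arc_ind n k z = (if k = arc_index n z then 1 else 0)"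
    unfolding arc_ind_def arc_index_def x_def[symmetric] by simp
qed

lemma same_arc_dist:
  assumes n: "0 < n" and z: "cmod z = 1" and w: "cmod w = 1" and k: "arc_ind n (arc_index n z) w = 1"
  shows "cmod (w - z) \<le> pi / real n"
proof -
  define k where "k = arc_index n z"
  have kz: "pi * real k / real n \<le> Arg2pi z" "Arg2pi z < pi * real (k + 1) / real n"
    and kw: "pi * real k / real n \<le> Arg2pi w" "Arg2pi w < pi * real (k + 1) / real n"
    using k arc_index(2)[OF n, of k z] unfolding k_def[symmetric] by (auto simp: arc_ind_def split: if_splits)
  have len: "pi * real (k + 1) / real n = pi * real k / real n + pi / real n" using n by (simp add: field_simps)
  have "\<bar>Arg2pi w - Arg2pi z\<bar> \<le> pi / real n" using kz kw unfolding len by linarith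
  moreover have "cmod (w - z) \<le> \<bar>Arg2pi w - Arg2pi z\<bar>"
  proof -
    have "w = cis (Arg2pi w)" "z = cis (Arg2pi z)" using cis_Arg2pi z w by auto
    then have "w - z = z * (cis (Arg2pi w - Arg2pi z) - 1)" by (metis cis_mult add.commute diff_add_cancel mult.right_neutral right_diff_distrib)
    then have "cmod (w - z) = cmod (cis (Arg2pi w - Arg2pi z) - 1)" using z by (simp add: norm_mult)
    also have "\<dots> \<le> \<bar>Arg2pi w - Arg2pi z\<bar>"
      using iexp_approx1[of "Arg2pi w - Arg2pi z" 0] by (simp add: cis_conv_exp)
    finally show ?thesis .
  qed
  ultimately show ?thesis by linarith
qed

text \<open>The arcs that contain a point of continuity shrink to it.\<close>

lemma arc_average_tendsto:
  fixes F :: "complex \<Rightarrow> complex^'m^'m"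
  assumes F: "pw_cont (\<lambda>z. F z $ i $ j)" and S: "finite S" "continuous_on (sphere 0 1 - S) (\<lambda>z. F z $ i $ j)"
    and z: "cmod z = 1" "z \<notin> S"
  shows "(\<lambda>n. arc_average (Suc n) (arc_index (Suc n) z) F $ i $ j) \<longlonglongrightarrow> F z $ i $ j"
proof (rule LIMSEQ_I)
  fix e :: real assume e: "0 < e"
  have zs: "z \<in> sphere 0 1 - S" using z by simp
  obtain d where d: "0 < d" "\<And>w. w \<in> sphere 0 1 - S \<Longrightarrow> dist w z < d \<Longrightarrow> dist (F w $ i $ j) (F z $ i $ j) < e / 2"
    using S(2) zs e unfolding continuous_on_iff by (metis half_gt_zero)
  have "open (- S)" using S(1) by (simp add: finite_imp_closed open_Compl)
  then obtain d' where d': "0 < d'" "\<And>w. dist w z < d' \<Longrightarrow> w \<notin> S" using z(2) unfolding open_dist by blast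
  have "(\<lambda>n. pi / real (Suc n)) \<longlonglongrightarrow> 0" by (rule LIMSEQ_Suc) (rule lim_const_over_n)
  then have "\<forall>\<^sub>F n in sequentially. pi / real (Suc n) < min d d'" by (rule order_tendstoD(2)) (use d d' in simp)
  then obtain N where N: "\<And>n. n \<ge> N \<Longrightarrow> pi / real (Suc n) < min d d'" unfolding eventually_sequentially by blast
  show "\<exists>N. \<forall>n\<ge>N. norm (arc_average (Suc n) (arc_index (Suc n) z) F $ i $ j - F z $ i $ j) < e"
  proof (intro exI allI impI)
    fix n assume n: "N \<le> n"
    have "cmod (arc_average (Suc n) (arc_index (Suc n) z) F $ i $ j - F z $ i $ j) \<le> e / 2"
    proof (rule arc_average_near[OF _ arc_index(1) F])
      fix w assume w: "cmod w = 1" "arc_ind (Suc n) (arc_index (Suc n) z) w = 1"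
      have "cmod (w - z) \<le> pi / real (Suc n)" by (rule same_arc_dist[OF _ z(1) w]) simp
      then have "dist w z < d" "dist w z < d'" using N[OF n] by (auto simp: dist_norm)
      then have "dist (F w $ i $ j) (F z $ i $ j) < e / 2" using d'(2) w(1) by (intro d(2)) auto
      then show "cmod (F w $ i $ j - F z $ i $ j) \<le> e / 2" by (simp add: dist_norm)
    qed auto
    then show "norm (arc_average (Suc n) (arc_index (Suc n) z) F $ i $ j - F z $ i $ j) < e" using e by simp
  qed
qed

definition arc_trace :: "(complex \<Rightarrow> complex^'m^'m) \<Rightarrow> (complex \<Rightarrow> complex^'m^'m) \<Rightarrow> real \<Rightarrow> nat \<Rightarrow> nat \<Rightarrow> complex" where
  "arc_trace F G t n k = (\<Sum>i\<in>UNIV. \<Sum>j\<in>UNIV. matrix_inv (arc_average n k (interpolate F G t)) $ i $ j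
      * (arc_average n k F $ j $ i - arc_average n k G $ j $ i))"

text \<open>The normalised sum is the integral of a step function, constant on arcs, that converges pointwise off
  the discontinuities and is bounded by coercivity.\<close>

lemma arc_trace_limit:
  fixes F G :: "complex \<Rightarrow> complex^'m^'m"
  assumes F: "symbol \<alpha> \<beta> F" and G: "symbol \<alpha> \<beta> G" and t: "0 \<le> t" "t \<le> 1"
  shows "(\<lambda>n. (\<Sum>k<2 * Suc n. arc_trace F G t (Suc n) k) / of_nat (2 * Suc n))
    \<longlonglongrightarrow> (\<Sum>i\<in>UNIV. \<Sum>j\<in>UNIV. mean (\<lambda>z. matrix_inv (interpolate F G t z) $ i $ j * (F z $ j $ i - G z $ j $ i)))"
proof -
  have a: "0 < \<alpha>" using F by (simp add: symbol_def)
  have pF: "pw_cont (\<lambda>z. F z $ i $ j)" and pG: "pw_cont (\<lambda>z. G z $ i $ j)" for i j using F G by (auto simp: symbol_def)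
  let ?H = "interpolate F G t"
  have H: "symbol \<alpha> \<beta> ?H" by (rule symbol_interpolate[OF F G t])
  have pH: "pw_cont (\<lambda>z. ?H z $ i $ j)" for i j using H by (simp add: symbol_def)
  have pI: "pw_cont (\<lambda>z. matrix_inv (?H z) $ i $ j)" for i j by (rule symbol_inverse_pw_cont[OF H])
  obtain S1 where S1: "finite S1" "\<And>i j. continuous_on (sphere 0 1 - S1) (\<lambda>z. F z $ i $ j)" using pw_cont_common_exceptions[of F] pF by blast
  obtain S2 where S2: "finite S2" "\<And>i j. continuous_on (sphere 0 1 - S2) (\<lambda>z. G z $ i $ j)" using pw_cont_common_exceptions[of G] pG by blast
  define f where "f z = (\<Sum>i\<in>UNIV. \<Sum>j\<in>UNIV. matrix_inv (?H z) $ i $ j * (F z $ j $ i - G z $ j $ i))" for z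
  have pf: "pw_cont f" unfolding f_def by (intro pw_cont_sum pw_cont_mult pI pw_cont_diff pF pG)
  define h where "h n z = (\<Sum>k<2 * Suc n. arc_trace F G t (Suc n) k * arc_ind (Suc n) k z)" for n z
  have ph: "pw_cont (h n)" for n unfolding h_def by (intro pw_cont_sum pw_cont_mult pw_cont_const pw_cont_arc_ind)
  have h_at: "h n z = arc_trace F G t (Suc n) (arc_index (Suc n) z)" for n z
  proof -
    have i: "arc_index (Suc n) z < 2 * Suc n" by (rule arc_index(1)) simp
    have "h n z = (\<Sum>k<2 * Suc n. if k = arc_index (Suc n) z then arc_trace F G t (Suc n) k else 0)"
      unfolding h_def by (intro sum.cong refl) (simp add: arc_index(2)[OF zero_less_Suc])
    then show ?thesis using i by (simp only: sum.delta finite_lessThan lessThan_iff if_True)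
  qed
  have mh: "mean (h n) = (\<Sum>k<2 * Suc n. arc_trace F G t (Suc n) k) / of_nat (2 * Suc n)" for n
  proof -
    have "mean (h n) = (\<Sum>k<2 * Suc n. arc_trace F G t (Suc n) k * mean (arc_ind (Suc n) k))"
      unfolding h_def by (simp only: mean_sum pw_cont_mult pw_cont_const pw_cont_arc_ind mean_cmult)
    also have "\<dots> = (\<Sum>k<2 * Suc n. arc_trace F G t (Suc n) k * (1 / of_nat (2 * Suc n)))"
      by (intro sum.cong refl) (simp add: mean_arc_ind del: mult_Suc_right)
    finally show ?thesis by (simp only: times_divide_eq_right mult_1_right sum_divide_distrib)
  qed
  have "\<forall>i j. \<exists>B. 0 < B \<and> (\<forall>z. cmod z = 1 \<longrightarrow> cmod (F z $ i $ j) \<le> B)" using pw_contE[OF pF] by metis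
  then obtain BF where BF: "\<And>i j. 0 < BF i j" "\<And>i j z. cmod z = 1 \<Longrightarrow> cmod (F z $ i $ j) \<le> BF i j" by metis
  have "\<forall>i j. \<exists>B. 0 < B \<and> (\<forall>z. cmod z = 1 \<longrightarrow> cmod (G z $ i $ j) \<le> B)" using pw_contE[OF pG] by metis
  then obtain BG where BG: "\<And>i j. 0 < BG i j" "\<And>i j z. cmod z = 1 \<Longrightarrow> cmod (G z $ i $ j) \<le> BG i j" by metis
  define C where "C = (\<Sum>i\<in>(UNIV::'m set). \<Sum>j\<in>(UNIV::'m set). (1 / \<alpha>) * (BF j i + BG j i))"
  have bound: "cmod (h n z) \<le> C" for n z
  proof -
    define k where "k = arc_index (Suc n) z"
    have k: "0 < Suc n" "k < 2 * Suc n" unfolding k_def by (simp, rule arc_index(1)) simp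
    have "cmod (matrix_inv (arc_average (Suc n) k ?H) $ i $ j * (arc_average (Suc n) k F $ j $ i - arc_average (Suc n) k G $ j $ i))
       \<le> (1 / \<alpha>) * (BF j i + BG j i)" for i j
    proof -
      have 1: "cmod (matrix_inv (arc_average (Suc n) k ?H) $ i $ j) \<le> 1 / \<alpha>"
        by (rule coercive_mat_inverse(4)[OF a arc_average_coer[OF k H]])
      have "cmod (arc_average (Suc n) k F $ j $ i - 0) \<le> BF j i" "cmod (arc_average (Suc n) k G $ j $ i - 0) \<le> BG j i"
        by (rule arc_average_near[OF k pF], simp add: BF, rule arc_average_near[OF k pG], simp add: BG)
      then have 2: "cmod (arc_average (Suc n) k F $ j $ i - arc_average (Suc n) k G $ j $ i) \<le> BF j i + BG j i"
        by (intro order_trans[OF norm_triangle_ineq4]) (simp add: add_mono)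
      show ?thesis unfolding norm_mult by (rule mult_mono[OF 1 2]) (use a in auto)
    qed
    then show ?thesis
      unfolding h_at arc_trace_def k_def[symmetric] C_def
      by (intro order_trans[OF norm_sum] sum_mono) 
  qed
  have "(\<lambda>n. mean (h n)) \<longlonglongrightarrow> mean f"
    unfolding mean_def
  proof (rule integral_dominated_convergence[where w="\<lambda>_. C"])
    show "AE \<theta> in angle_measure. (\<lambda>n. h n (cis \<theta>)) \<longlonglongrightarrow> f (cis \<theta>)"
      using AE_unif_cis[OF S1(1)] AE_unif_cis[OF S2(1)]
    proof eventually_elim
      case (elim \<theta>)
      let ?z = "cis \<theta>"
      have tF: "(\<lambda>n. arc_average (Suc n) (arc_index (Suc n) ?z) F $ i $ j) \<longlonglongrightarrow> F ?z $ i $ j" for i j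
        by (rule arc_average_tendsto[OF pF S1]) (use elim in auto)
      have tG: "(\<lambda>n. arc_average (Suc n) (arc_index (Suc n) ?z) G $ i $ j) \<longlonglongrightarrow> G ?z $ i $ j" for i j
        by (rule arc_average_tendsto[OF pG S2]) (use elim in auto)
      have tI: "(\<lambda>n. matrix_inv (arc_average (Suc n) (arc_index (Suc n) ?z) ?H) $ i $ j) \<longlonglongrightarrow> matrix_inv (?H ?z) $ i $ j" for i j
      proof (rule matrix_inv_tendsto[OF a])
        show "coercive_mat \<alpha> (arc_average (Suc n) (arc_index (Suc n) ?z) ?H)" for n
          by (rule arc_average_coer[OF _ arc_index(1) H]) auto
        show "coercive_mat \<alpha> (?H ?z)" using H by (simp add: symbol_def)
        show "(\<lambda>n. arc_average (Suc n) (arc_index (Suc n) ?z) ?H $ i $ j) \<longlonglongrightarrow> ?H ?z $ i $ j" for i j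
          unfolding arc_average_interpolate[OF pF pG] by (simp add: interpolate_def) (intro tendsto_intros tF tG)
      qed
      show ?case unfolding h_at arc_trace_def f_def by (intro tendsto_intros tI tF tG)
    qed
    show "AE \<theta> in angle_measure. cmod (h n (cis \<theta>)) \<le> C" for n by (rule AE_I2) (rule bound)
    show "(\<lambda>\<theta>. f (cis \<theta>)) \<in> borel_measurable angle_measure" using pw_cont_measurable[OF pf] by simp
    show "(\<lambda>\<theta>. h n (cis \<theta>)) \<in> borel_measurable angle_measure" for n using pw_cont_measurable[OF ph] by simp
  qed simp
  moreover have "mean f = (\<Sum>i\<in>UNIV. \<Sum>j\<in>UNIV. mean (\<lambda>z. matrix_inv (interpolate F G t z) $ i $ j * (F z $ j $ i - G z $ j $ i)))"
    unfolding f_def by (simp only: mean_sum pw_cont_sum pw_cont_mult pI pw_cont_diff pF pG)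
  ultimately show ?thesis unfolding mh by simp
qed

section \<open>Conjugate arcs\<close>

lemma fourier_coef_arc_ind_reflect:
  assumes n: "0 < n" and k: "k < 2 * n"
  shows "fourier_coef (arc_ind n (2 * n - 1 - k)) l = cnj (fourier_coef (arc_ind n k) l)"
proof -
  have k': "2 * n - 1 - k < 2 * n" using n by linarith
  have "cnj (fourier_coef (arc_ind n (2 * n - 1 - k)) l) = cnj (cnj (fourier_coef (arc_ind n k) l))"
    unfolding fourier_coef_arc_ind[OF n k'] arc_coeff_reflect[OF n k] fourier_coef_arc_ind[OF n k] ..
  from arg_cong[OF this, of cnj] show ?thesis by (simp only: complex_cnj_cnj)
qed

text \<open>Covariances of a real process are real, so the density takes conjugate values at conjugate points, at
  least in the mean over arcs.\<close>

lemma arc_average_reflect: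
  fixes y :: "int \<Rightarrow> 'a \<Rightarrow> real^'m"
  assumes y: "gaussian_process M y F" and F: "\<And>i j. pw_cont (\<lambda>z. F z $ i $ j)" and n: "0 < n" "k < 2 * n"
  shows "arc_average n (2 * n - 1 - k) F $ i $ j = cnj (arc_average n k F $ i $ j)"
proof -
  let ?k = "2 * n - 1 - k"
  let ?V = "\<lambda>k N i \<omega>. fourier_sum y (arc_ind n k) N \<omega> $ i"
  have lim: "(\<lambda>N. \<integral>\<omega>. ?V k N i \<omega> * cnj (?V k N j \<omega>) \<partial>M) \<longlonglongrightarrow> mean (\<lambda>z. arc_ind n k z * F z $ i $ j)" for k
  proof -
    have "mean (\<lambda>z. cnj (arc_ind n k z) * F z $ i $ j * arc_ind n k z) = mean (\<lambda>z. arc_ind n k z * F z $ i $ j)"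
    proof (rule mean_cong)
      fix z :: complex
      have "arc_ind n k z * arc_ind n k z = arc_ind n k z" using arc_ind_disjoint[OF n(1), of k z k] by simp
      moreover have "cnj (arc_ind n k z) * F z $ i $ j * arc_ind n k z = (arc_ind n k z * arc_ind n k z) * F z $ i $ j"
        by (simp only: arc_ind_cnj mult_ac)
      ultimately show "cnj (arc_ind n k z) * F z $ i $ j * arc_ind n k z = arc_ind n k z * F z $ i $ j" by (simp only:)
    qed
    then show ?thesis
      unfolding fourier_sum_moment(2)[OF y F] using mean_triple_tendsto[OF F pw_cont_arc_ind[of n k] pw_cont_arc_ind[of n k], of i j] by simp
  qed
  have fs: "?V ?k N i \<omega> = cnj (?V k N i \<omega>)" for N i \<omega>
    unfolding fourier_sum_def vec_lambda_beta fourier_coef_arc_ind_reflect[OF n] by simp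
  have "(\<integral>\<omega>. ?V ?k N i \<omega> * cnj (?V ?k N j \<omega>) \<partial>M) = cnj (\<integral>\<omega>. ?V k N i \<omega> * cnj (?V k N j \<omega>) \<partial>M)" for N
    unfolding fs Bochner_Integration.integral_cnj[symmetric] by (simp add: mult_ac)
  then have "(\<lambda>N. \<integral>\<omega>. ?V ?k N i \<omega> * cnj (?V ?k N j \<omega>) \<partial>M) \<longlonglongrightarrow> cnj (mean (\<lambda>z. arc_ind n k z * F z $ i $ j))"
    using tendsto_cnj[OF lim[of k]] by (simp only:)
  from LIMSEQ_unique[OF lim[of ?k] this] show ?thesis by (simp add: arc_average_def)
qed

lemma matrix_inv_cnj:
  fixes A A' :: "complex^'m^'m"
  assumes a: "0 < \<alpha>" and A: "coercive_mat \<alpha> A" and A': "coercive_mat \<alpha> A'" and c: "\<And>i j. A' $ i $ j = cnj (A $ i $ j)"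
  shows "matrix_inv A' $ i $ j = cnj (matrix_inv A $ i $ j)"
proof -
  define C where "C = (\<chi> i j. cnj (matrix_inv A $ i $ j))"
  have "(C ** A') $ i $ j = cnj ((matrix_inv A ** A) $ i $ j)" for i j
    by (simp add: C_def matrix_matrix_mult_def c)
  then have "C ** A' = mat 1" unfolding coercive_mat_inverse(2)[OF a A] by (simp add: vec_eq_iff mat_def)
  then have "(C ** A') ** matrix_inv A' = matrix_inv A'" by simp
  then have "C = matrix_inv A'" unfolding matrix_mul_assoc[symmetric] coercive_mat_inverse(1)[OF a A'] by simp
  then show ?thesis by (metis C_def vec_lambda_beta)
qed

lemma sum_reflect:
  fixes f :: "nat \<Rightarrow> 'b::comm_monoid_add"
  shows "sum f {..<2 * n} = (\<Sum>k<n. f k + f (2 * n - 1 - k))"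
proof -
  have s: "sum f {..<n + m} = sum f {..<n} + (\<Sum>k<m. f (n + k))" for m
    by (induction m) (simp_all add: add.assoc)
  have "(\<Sum>k<n. f (n + k)) = (\<Sum>k<n. f (n + (n - Suc k)))"
    by (rule sum.nat_diff_reindex[symmetric])
  also have "\<dots> = (\<Sum>k<n. f (2 * n - 1 - k))"
    by (intro sum.cong refl arg_cong[of _ _ f]) auto
  finally show ?thesis using s[of n] by (simp add: sum.distrib mult_2)
qed

text \<open>Only the increments over the upper half circle are independent coordinates, but each contributes two real
  ones; by conjugation symmetry this counts every arc of the full circle once.\<close>

lemma arc_trace_sum:
  fixes y z :: "int \<Rightarrow> 'a \<Rightarrow> real^'m"
  assumes y: "gaussian_process M y F" and z: "gaussian_process M z G"
    and F: "symbol \<alpha> \<beta> F" and G: "symbol \<alpha> \<beta> G" and t: "0 \<le> t" "t \<le> 1" and n: "0 < n"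
  shows "Re (\<Sum>k<2 * n. arc_trace F G t n k) = (\<Sum>k<n. 2 * Re (arc_trace F G t n k))"
proof -
  have a: "0 < \<alpha>" using F by (simp add: symbol_def)
  have pF: "pw_cont (\<lambda>z. F z $ i $ j)" and pG: "pw_cont (\<lambda>z. G z $ i $ j)" for i j using F G by (auto simp: symbol_def)
  have H: "symbol \<alpha> \<beta> (interpolate F G t)" by (rule symbol_interpolate[OF F G t])
  have "arc_trace F G t n (2 * n - 1 - k) = cnj (arc_trace F G t n k)" if "k < n" for k
  proof -
    have k: "k < 2 * n" and k': "2 * n - 1 - k < 2 * n" using that by linarith+
    note r = arc_average_reflect[OF y pF n k] arc_average_reflect[OF z pG n k]
    have "arc_average n (2 * n - 1 - k) (interpolate F G t) $ i $ j = cnj (arc_average n k (interpolate F G t) $ i $ j)" for i j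
      by (simp only: arc_average_interpolate[OF pF pG] r complex_cnj_add complex_cnj_mult complex_cnj_diff complex_cnj_complex_of_real)
    from matrix_inv_cnj[OF a arc_average_coer[OF n k H] arc_average_coer[OF n k' H] this]
    show ?thesis unfolding arc_trace_def r by (simp only: cnj_sum complex_cnj_mult complex_cnj_diff)
  qed
  then have "(\<Sum>k<2 * n. arc_trace F G t n k) = (\<Sum>k<n. arc_trace F G t n k + cnj (arc_trace F G t n k))"
    unfolding sum_reflect by (intro sum.cong) auto
  from arg_cong[OF this, of Re]
  have "Re (\<Sum>k<2 * n. arc_trace F G t n k) = (\<Sum>k<n. Re (arc_trace F G t n k + cnj (arc_trace F G t n k)))"
    by (simp only: Re_sum)
  also have "\<dots> = (\<Sum>k<n. 2 * Re (arc_trace F G t n k))" by (intro sum.cong refl) simp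
  finally show ?thesis .
qed

section \<open>Complex block matrices in real coordinates\<close>

definition coords :: "nat \<Rightarrow> (nat \<times> 'm \<times> bool) set" where
  "coords n = {..<n} \<times> UNIV \<times> UNIV"

definition block :: "(nat \<Rightarrow> complex^'m^'m) \<Rightarrow> nat \<times> 'm \<times> bool \<Rightarrow> nat \<times> 'm \<times> bool \<Rightarrow> real" where
  "block H a b = (if fst a = fst b then rep (H (fst a) $ fst (snd a) $ fst (snd b)) (snd (snd a)) (snd (snd b)) else 0)"

lemma finite_coords [simp]: "finite (coords n :: (nat \<times> 'm::finite \<times> bool) set)"
  by (simp add: coords_def)

lemma sum_coords: "(\<Sum>a\<in>coords n. f a) = (\<Sum>k<n. \<Sum>i\<in>(UNIV :: 'm::finite set). \<Sum>b\<in>UNIV. f (k, i, b))"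
  unfolding coords_def by (simp add: sum.cartesian_product split_def)

lemma rep_mult: "(\<Sum>c\<in>UNIV. rep x b c * rep y c b') = rep (x * y) b b'"
  by (cases b; cases b') (simp_all add: rep_def UNIV_bool)

lemma rep_sum: "rep (\<Sum>i\<in>K. f i) b b' = (\<Sum>i\<in>K. rep (f i) b b')"
  by (simp add: rep_def sum_negf)

text \<open>Products of complex blocks may be formed before passing to real coordinates, because \<open>rep\<close> is
  multiplicative.\<close>

lemma mat_prod_block:
  fixes H K :: "nat \<Rightarrow> complex^'m^'m"
  assumes "a \<in> coords n"
  shows "mat_prod (coords n) (block H) (block K) a b = block (\<lambda>k. H k ** K k) a b"
proof -
  obtain k i c where a: "a = (k, i, c)" by (cases a) auto
  obtain l j d where b: "b = (l, j, d)" by (cases b) auto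
  have k: "k < n" using assms by (simp add: a coords_def)
  have "mat_prod (coords n) (block H) (block K) a b
     = (\<Sum>p<n. if p = k then (if k = l then (\<Sum>q\<in>UNIV. \<Sum>e\<in>UNIV. rep (H k $ i $ q) c e * rep (K k $ q $ j) e d) else 0) else 0)"
    unfolding mat_prod_def sum_coords by (intro sum.cong refl) (auto simp: a b block_def)
  also have "\<dots> = (if k = l then (\<Sum>q\<in>UNIV. \<Sum>e\<in>UNIV. rep (H k $ i $ q) c e * rep (K k $ q $ j) e d) else 0)"
    using k by simp
  also have "\<dots> = block (\<lambda>k. H k ** K k) a b"
    by (simp add: a b block_def rep_mult rep_sum matrix_matrix_mult_def)
  finally show ?thesis .
qed

lemma mat_trace_block:
  fixes H :: "nat \<Rightarrow> complex^'m^'m"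
  shows "mat_trace (coords n) (block H) = (\<Sum>k<n. 2 * Re (\<Sum>i\<in>UNIV. H k $ i $ i))"
  unfolding mat_trace_def sum_coords by (simp add: block_def rep_def UNIV_bool sum_distrib_left)

lemma bilin_block:
  fixes H :: "nat \<Rightarrow> complex^'m^'m"
  shows "bilin (coords n) (block H) u u = (\<Sum>k<n. Re (herm_form (H k) (\<chi> i. Complex (u (k, i, True)) (u (k, i, False)))))"
proof -
  have "bilin (coords n) (block H) u u
     = (\<Sum>k<n. \<Sum>i\<in>UNIV. \<Sum>c\<in>UNIV. \<Sum>l<n. if k = l then (\<Sum>j\<in>UNIV. \<Sum>d\<in>UNIV. u (k, i, c) * rep (H k $ i $ j) c d * u (l, j, d)) else 0)"
    unfolding bilin_def sum_coords by (intro sum.cong refl) (auto simp: block_def)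
  also have "\<dots> = (\<Sum>k<n. \<Sum>i\<in>UNIV. \<Sum>c\<in>UNIV. \<Sum>j\<in>UNIV. \<Sum>d\<in>UNIV. u (k, i, c) * rep (H k $ i $ j) c d * u (k, j, d))"
    by (intro sum.cong refl) simp
  also have "\<dots> = (\<Sum>k<n. Re (herm_form (H k) (\<chi> i. Complex (u (k, i, True)) (u (k, i, False)))))"
    by (intro sum.cong refl) (simp add: herm_form_def rep_def UNIV_bool sum.distrib[symmetric] algebra_simps)
  finally show ?thesis .
qed

lemma sum_squares_coords:
  fixes u :: "nat \<times> 'm::finite \<times> bool \<Rightarrow> real"
  shows "(\<Sum>a\<in>coords n. (u a)\<^sup>2) = (\<Sum>k<n. (norm (\<chi> i. Complex (u (k, i, True)) (u (k, i, False))))\<^sup>2)"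
  unfolding sum_coords norm_vec_power2 by (simp add: cmod_power2 UNIV_bool add.commute)

lemma block_average_bounds:
  fixes F :: "complex \<Rightarrow> complex^'m^'m"
  assumes n: "0 < n" and F: "symbol \<alpha> \<beta> F" and s: "0 < s"
  shows "(\<alpha> / s) * (\<Sum>a\<in>coords n. (u a)\<^sup>2) \<le> bilin (coords n) (\<lambda>a b. block (\<lambda>k. arc_average n k F) a b / s) u u"
    "bilin (coords n) (\<lambda>a b. block (\<lambda>k. arc_average n k F) a b / s) u u \<le> (\<beta> / s) * (\<Sum>a\<in>coords n. (u a)\<^sup>2)"
proof -
  have e: "bilin (coords n) (\<lambda>a b. block (\<lambda>k. arc_average n k F) a b / s) u u = bilin (coords n) (block (\<lambda>k. arc_average n k F)) u u / s"
    unfolding bilin_def by (simp add: sum_divide_distrib)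
  have "\<alpha> * (\<Sum>a\<in>coords n. (u a)\<^sup>2) \<le> bilin (coords n) (block (\<lambda>k. arc_average n k F)) u u"
    unfolding bilin_block sum_squares_coords sum_distrib_left by (intro sum_mono arc_average_form(1)[OF n _ F]) simp
  then show "(\<alpha> / s) * (\<Sum>a\<in>coords n. (u a)\<^sup>2) \<le> bilin (coords n) (\<lambda>a b. block (\<lambda>k. arc_average n k F) a b / s) u u"
    unfolding e using s by (simp add: divide_right_mono)
  have "bilin (coords n) (block (\<lambda>k. arc_average n k F)) u u \<le> \<beta> * (\<Sum>a\<in>coords n. (u a)\<^sup>2)"
    unfolding bilin_block sum_squares_coords sum_distrib_left by (intro sum_mono arc_average_form(2)[OF n _ F]) simp
  then show "bilin (coords n) (\<lambda>a b. block (\<lambda>k. arc_average n k F) a b / s) u u \<le> (\<beta> / s) * (\<Sum>a\<in>coords n. (u a)\<^sup>2)"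
    unfolding e using s by (simp add: divide_right_mono)
qed

section \<open>The joint law of the increments\<close>

definition increment_part :: "(nat \<Rightarrow> 'a \<Rightarrow> complex^'m) \<Rightarrow> nat \<times> 'm \<times> bool \<Rightarrow> 'a \<Rightarrow> real" where
  "increment_part D a \<omega> = part (snd (snd a)) (D (fst a) \<omega> $ fst (snd a))"

lemma rep_scale: "rep (c / of_real s) b b' = rep c b b' / s"
  by (auto simp: rep_def Re_divide_of_real Im_divide_of_real)

text \<open>Increments over distinct arcs of the upper half circle are uncorrelated, and each is uncorrelated
  with the conjugates of all of them; hence the covariance matrix is block diagonal, with complex blocks.\<close>

lemma grid_increment_family:
  fixes y :: "int \<Rightarrow> 'a \<Rightarrow> real^'m"
  assumes pr: "prob_space M" and y: "gaussian_process M y F" and F: "\<And>i j. pw_cont (\<lambda>z. F z $ i $ j)" and n: "0 < n"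
  defines "A \<equiv> (\<lambda>a b. block (\<lambda>k. arc_average n k F) a b / (4 * real n))"
  shows "gaussian_family M (coords n) (increment_part (grid_increment M y n)) A"
    "\<forall>a\<in>coords n. \<forall>b\<in>coords n. A a b = A b a"
proof -
  let ?P = "increment_part (grid_increment M y n)"
  have lim: "is_mean_square_limit M (fourier_sum y (arc_ind n k)) (grid_increment M y n k)" if "k < 2 * n" for k
    by (rule grid_increment_limit[OF pr y F n that])
  have covar: "(\<integral>\<omega>. ?P a \<omega> * ?P b \<omega> \<partial>M) = A a b" if ab: "a \<in> coords n" "b \<in> coords n" for a b
  proof -
    obtain k i c where a: "a = (k, i, c)" by (cases a) auto
    obtain l j d where b: "b = (l, j, d)" by (cases b) auto
    have k: "k < n" and l: "l < n" using ab by (auto simp: a b coords_def)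
    have k2: "k < 2 * n" and l2: "l < 2 * n" and ne: "k \<noteq> 2 * n - 1 - l" using k l by linarith+
    have "(\<integral>\<omega>. ?P a \<omega> * ?P b \<omega> \<partial>M) = rep (mean (\<lambda>z. cnj (arc_ind n k z) * F z $ i $ j * arc_ind n l z)) c d / 2"
      unfolding increment_part_def a b fst_conv snd_conv
    proof (rule increment_moment[OF y F pw_cont_arc_ind pw_cont_arc_ind pw_cont_arc_ind lim[OF k2] lim[OF l2] fourier_coef_arc_ind_reflect[OF n l2]])
      show "cnj (arc_ind n k z) * arc_ind n (2 * n - 1 - l) z = 0" for z
        using arc_ind_disjoint[OF n, of k z "2 * n - 1 - l"] ne by simp
    qed
    also have "mean (\<lambda>z. cnj (arc_ind n k z) * F z $ i $ j * arc_ind n l z) = mean (\<lambda>z. if k = l then arc_ind n k z * F z $ i $ j else 0)"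
    proof (rule mean_cong)
      fix z :: complex
      have "cnj (arc_ind n k z) * F z $ i $ j * arc_ind n l z = (arc_ind n k z * arc_ind n l z) * F z $ i $ j"
        by (simp only: arc_ind_cnj mult_ac)
      then show "cnj (arc_ind n k z) * F z $ i $ j * arc_ind n l z = (if k = l then arc_ind n k z * F z $ i $ j else 0)"
        by (simp only: arc_ind_disjoint[OF n]) simp
    qed
    also have "\<dots> = (if k = l then arc_average n k F $ i $ j / of_real (2 * real n) else 0)"
      using n by (simp add: arc_average_def mean_def)
    finally have v: "(\<integral>\<omega>. ?P a \<omega> * ?P b \<omega> \<partial>M) = rep (if k = l then arc_average n k F $ i $ j / of_real (2 * real n) else 0) c d / 2" .
    have 1: "rep (x / of_real (2 * real n)) c d / 2 = rep x c d / (4 * real n)" for x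
      by (simp only: rep_scale) simp
    have 2: "rep 0 c d = 0" by (simp add: rep_def)
    show ?thesis
      unfolding v unfolding A_def a b block_def fst_conv snd_conv
      by (cases "k = l") (simp_all only: if_True if_False simp_thms 1 2 div_0)
  qed
  have "gaussian_family M (coords n) ?P (\<lambda>a b. \<integral>\<omega>. ?P a \<omega> * ?P b \<omega> \<partial>M)"
    unfolding increment_part_def[abs_def] coords_def
    by (rule increment_parts_gaussian[OF pr y F finite_lessThan lim]) simp
  then show "gaussian_family M (coords n) ?P A"
    unfolding gaussian_family_def bilin_def by (simp add: covar cong: sum.cong)
  show "\<forall>a\<in>coords n. \<forall>b\<in>coords n. A a b = A b a"
    by (intro ballI) (simp add: covar[symmetric] mult.commute)
qed

text \<open>All \<open>2 n\<close> increments are functions of the first \<open>n\<close>, the others being their conjugates almost surely. The joint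
  law is therefore degenerate, but has independent coordinates in the real and imaginary parts of those.\<close>

lemma spectral_rel_entropy:
  fixes y z :: "int \<Rightarrow> 'a \<Rightarrow> real^'m"
  assumes pr: "prob_space M" and y: "gaussian_process M y F" and z: "gaussian_process M z G"
    and F: "symbol \<alpha> \<beta> F" and G: "symbol \<alpha> \<beta> G" and n: "0 < n"
  obtains \<mu> where "relative_spectrum (coords n) (\<lambda>a b. block (\<lambda>k. arc_average n k F) a b / (4 * real n))
      (\<lambda>a b. block (\<lambda>k. arc_average n k G) a b / (4 * real n)) \<mu>"
    "rel_entropy (joint_law M {..<2 * n} (grid_increment M y n)) (joint_law M {..<2 * n} (grid_increment M z n))
      = ereal (\<Sum>a\<in>coords n. (\<mu> a - 1 - ln (\<mu> a)) / 2)"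
proof -
  have a: "0 < \<alpha>" using F by (simp add: symbol_def)
  have pF: "pw_cont (\<lambda>z. F z $ i $ j)" and pG: "pw_cont (\<lambda>z. G z $ i $ j)" for i j using F G by (auto simp: symbol_def)
  let ?K = "{..<2 * n}" and ?I = "coords n :: (nat \<times> 'm \<times> bool) set"
  let ?A = "\<lambda>H a b. block (\<lambda>k. arc_average n k H) a b / (4 * real n)"
  let ?X = "\<lambda>x \<omega>. \<lambda>k\<in>?K. grid_increment M x n k \<omega>"
  define E where "E = Pi\<^sub>M ?K (\<lambda>_. borel :: (complex^'m) measure)"
  define T where "T x = (\<lambda>a\<in>?I. part (snd (snd a)) (x (fst a) $ fst (snd a)))" for x :: "nat \<Rightarrow> complex^'m"
  define S where "S v = (\<lambda>k\<in>?K. if k < n then \<chi> i. Complex (v (k, i, True)) (v (k, i, False))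
      else \<chi> i. Complex (v (2 * n - 1 - k, i, True)) (- v (2 * n - 1 - k, i, False)))" for v :: "nat \<times> 'm \<times> bool \<Rightarrow> real"
  have lim: "is_mean_square_limit M (fourier_sum x (arc_ind n k)) (grid_increment M x n k)"
    if "gaussian_process M x H" "symbol \<alpha> \<beta> H" "k < 2 * n" for x H k
    by (rule grid_increment_limit[OF pr that(1) _ n that(3)]) (use that(2) in \<open>simp add: symbol_def\<close>)
  have XE: "?X x \<in> measurable M E" if "gaussian_process M x H" "symbol \<alpha> \<beta> H" for x H
    unfolding E_def using lim[OF that] by (intro measurable_restrict) (auto simp: is_mean_square_limit_def)
  have Tm: "T \<in> measurable E (Pi\<^sub>M ?I (\<lambda>_. borel))"
    unfolding T_def E_def
  proof (rule measurable_restrict)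
    fix b :: "nat \<times> 'm \<times> bool" assume "b \<in> ?I"
    then have "fst b \<in> ?K" by (auto simp: coords_def)
    then have "(\<lambda>x. x (fst b)) \<in> borel_measurable (Pi\<^sub>M ?K (\<lambda>_. borel :: (complex^'m) measure))"
      by (rule measurable_component_singleton)
    then show "(\<lambda>x. part (snd (snd b)) (x (fst b) $ fst (snd b))) \<in> borel_measurable (Pi\<^sub>M ?K (\<lambda>_. borel :: (complex^'m) measure))"
      by (intro part_measurable vec_nth_borel_measurable)
  qed
  have cm: "(\<lambda>v. \<chi> i. Complex (v (p, i, True)) (s * v (p, i, False))) \<in> borel_measurable (Pi\<^sub>M ?I (\<lambda>_. borel))"
    if "p < n" for p and s :: real
  proof (rule borel_measurable_vec_lambda)
    fix i
    have c: "(\<lambda>v. v (p, i, b)) \<in> borel_measurable (Pi\<^sub>M ?I (\<lambda>_. borel :: real measure))" for b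
      by (rule measurable_component_singleton) (use that in \<open>simp add: coords_def\<close>)
    show "(\<lambda>v. Complex (v (p, i, True)) (s * v (p, i, False))) \<in> borel_measurable (Pi\<^sub>M ?I (\<lambda>_. borel))"
      unfolding Complex_eq using c[of True] c[of False] by measurable
  qed
  have Sm: "S \<in> measurable (Pi\<^sub>M ?I (\<lambda>_. borel)) E"
    unfolding S_def E_def
  proof (rule measurable_restrict)
    fix k assume "k \<in> ?K"
    then have k: "\<not> k < n \<Longrightarrow> 2 * n - 1 - k < n" by auto
    show "(\<lambda>v. if k < n then \<chi> i. Complex (v (k, i, True)) (v (k, i, False))
      else \<chi> i. Complex (v (2 * n - 1 - k, i, True)) (- v (2 * n - 1 - k, i, False))) \<in> borel_measurable (Pi\<^sub>M ?I (\<lambda>_. borel))"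
      using cm[of k 1] cm[OF k, of "-1"] by (cases "k < n") simp_all
  qed
  have Tx: "T (?X x \<omega>) b = increment_part (grid_increment M x n) b \<omega>" if "b \<in> ?I" for x \<omega> b
    using that by (auto simp: T_def coords_def increment_part_def)
  have STE: "AE \<omega> in M. S (T (?X x \<omega>)) = ?X x \<omega>" if x: "gaussian_process M x H" and H: "symbol \<alpha> \<beta> H" for x H
  proof -
    have pH: "pw_cont (\<lambda>z. H z $ i $ j)" for i j using H by (simp add: symbol_def)
    have "AE \<omega> in M. \<forall>i. grid_increment M x n (2 * n - 1 - k) \<omega> $ i = cnj (grid_increment M x n k \<omega> $ i)" if "k \<in> {..<n}" for k
    proof -
      have k: "k < 2 * n" "2 * n - 1 - k < 2 * n" using that n by auto
      show ?thesis by (rule mean_square_limit_reflect[OF x pH lim[OF x H k(1)] lim[OF x H k(2)] fourier_coef_arc_ind_reflect[OF n k(1)]])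
    qed
    then have "AE \<omega> in M. \<forall>k\<in>{..<n}. \<forall>i. grid_increment M x n (2 * n - 1 - k) \<omega> $ i = cnj (grid_increment M x n k \<omega> $ i)"
      by (rule AE_finite_allI[OF finite_lessThan])
    then show ?thesis
    proof eventually_elim
      case (elim \<omega>)
      show ?case
      proof
        fix k
        consider "\<not> k < 2 * n" | "k < n" | "k < 2 * n" "\<not> k < n" by linarith
        then show "S (T (?X x \<omega>)) k = ?X x \<omega> k"
        proof cases
          case 1
          then show ?thesis by (simp add: S_def)
        next
          case 2
          then have "T (?X x \<omega>) (k, i, b) = part b (grid_increment M x n k \<omega> $ i)" for i b
            by (simp add: T_def coords_def)
          then show ?thesis using 2 by (simp add: S_def vec_eq_iff part_def complex_eq_iff)
        next
          case 3
          define p where "p = 2 * n - 1 - k"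
          have p: "p < n" "k = 2 * n - 1 - p" using 3 by (auto simp: p_def)
          have Tp: "T (?X x \<omega>) (p, i, b) = part b (grid_increment M x n p \<omega> $ i)" for i b
            using p(1) by (simp add: T_def coords_def)
          have "grid_increment M x n k \<omega> $ i = cnj (grid_increment M x n p \<omega> $ i)" for i
            using elim p by auto
          moreover have "S v k = (\<chi> i. Complex (v (p, i, True)) (- v (p, i, False)))" for v
            using 3 by (simp add: S_def p_def)
          ultimately show ?thesis using 3 by (simp add: Tp vec_eq_iff part_def complex_eq_iff)
        qed
      qed
    qed
  qed
  have gf: "gaussian_family M ?I (\<lambda>b \<omega>. T (?X x \<omega>) b) (?A H)"
    if "gaussian_process M x H" "symbol \<alpha> \<beta> H" for x H
    using grid_increment_family(1)[OF pr that(1) _ n] that(2) unfolding gaussian_family_def symbol_def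
    by (simp add: Tx cong: sum.cong)
  have sym: "\<forall>a\<in>?I. \<forall>b\<in>?I. ?A H a b = ?A H b a" if "gaussian_process M x H" "symbol \<alpha> \<beta> H" for x H
    by (rule grid_increment_family(2)[OF pr that(1) _ n]) (use that(2) in \<open>simp add: symbol_def\<close>)
  have pos: "0 < bilin ?I (?A H) u u" if H: "symbol \<alpha> \<beta> H" and u: "\<exists>k\<in>?I. u k \<noteq> 0" for H u
    by (rule positive_form[OF finite_coords _ block_average_bounds(1)[OF n H] u]) (use a n in auto)
  show ?thesis
    by (rule gaussian_rel_entropy[where Y="?X y" and Z="?X z" and A="?A F" and B="?A G",
          OF pr finite_coords XE[OF y F] XE[OF z G] Tm Sm STE[OF y F] STE[OF z G] gf[OF y F] gf[OF z G]
            sym[OF y F] sym[OF z G] pos[OF F] pos[OF G]])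
      (use that in \<open>simp_all add: joint_law_def E_def\<close>)
qed

section \<open>The spectral rate\<close>

lemma mat_prod_scaled: "s \<noteq> 0 \<Longrightarrow> mat_prod I (\<lambda>a b. s * X a b) (\<lambda>a b. Y a b / s) = mat_prod I X (Y :: 'i \<Rightarrow> 'i \<Rightarrow> real)"
  unfolding mat_prod_def by simp

text \<open>For block diagonal matrices the inverse is explicit, with the inverses of the averages as blocks.\<close>

lemma block_resolvent:
  fixes F G :: "complex \<Rightarrow> complex^'m^'m"
  assumes F: "symbol \<alpha> \<beta> F" and G: "symbol \<alpha> \<beta> G" and t: "0 \<le> t" "t \<le> 1" and n: "0 < n"
  defines "A \<equiv> (\<lambda>H a b. block (\<lambda>k. arc_average n k H) a b / (4 * real n))"
    and "R \<equiv> (\<lambda>a b. 4 * real n * block (\<lambda>k. matrix_inv (arc_average n k (interpolate F G t))) a b)"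
  shows "eq_on (coords n) (mat_prod (coords n) R (\<lambda>a b. A G a b + t * (A F a b - A G a b))) (diag_mat (\<lambda>_. 1))"
    "mat_trace (coords n) (mat_prod (coords n) R (\<lambda>a b. A F a b - A G a b)) = (\<Sum>k<n. 2 * Re (arc_trace F G t n k))"
proof -
  have a: "0 < \<alpha>" using F by (simp add: symbol_def)
  have pF: "pw_cont (\<lambda>z. F z $ i $ j)" and pG: "pw_cont (\<lambda>z. G z $ i $ j)" for i j using F G by (auto simp: symbol_def)
  have H: "symbol \<alpha> \<beta> (interpolate F G t)" by (rule symbol_interpolate[OF F G t])
  have s: "4 * real n \<noteq> 0" using n by simp
  let ?inv = "\<lambda>k. matrix_inv (arc_average n k (interpolate F G t))"
  let ?D = "\<lambda>k. \<chi> i j. arc_average n k F $ i $ j - arc_average n k G $ i $ j"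
  have aff: "rep (x + of_real t * (y - x)) b b' = rep x b b' + t * (rep y b b' - rep x b b')" for x y b b'
    by (simp add: rep_def algebra_simps)
  have m: "A G a b + t * (A F a b - A G a b) = block (\<lambda>k. arc_average n k (interpolate F G t)) a b / (4 * real n)" for a b
  proof (cases "fst a = fst b")
    case True
    show ?thesis
      by (simp only: A_def block_def True simp_thms if_True arc_average_interpolate[OF pF pG] aff)
        (simp only: add_divide_distrib diff_divide_distrib right_diff_distrib times_divide_eq_right)
  qed (simp add: A_def block_def)
  have "rep (x - y) b b' = rep x b b' - rep y b b'" for x y b b'
    by (simp add: rep_def)
  then have d: "A F a b - A G a b = block ?D a b / (4 * real n)" for a b
    unfolding A_def block_def by (simp add: diff_divide_distrib)
  show "eq_on (coords n) (mat_prod (coords n) R (\<lambda>a b. A G a b + t * (A F a b - A G a b))) (diag_mat (\<lambda>_. 1))"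
    unfolding m R_def mat_prod_scaled[OF s] eq_on_def
  proof (intro ballI)
    fix a b :: "nat \<times> 'm \<times> bool" assume ab: "a \<in> coords n" "b \<in> coords n"
    then have k: "fst a < 2 * n" by (auto simp: coords_def)
    have "mat_prod (coords n) (block ?inv) (block (\<lambda>k. arc_average n k (interpolate F G t))) a b
        = block (\<lambda>k. ?inv k ** arc_average n k (interpolate F G t)) a b" by (rule mat_prod_block[OF ab(1)])
    also have "\<dots> = diag_mat (\<lambda>_. 1) a b"
      unfolding block_def coercive_mat_inverse(2)[OF a arc_average_coer[OF n k H]]
      by (cases a; cases b) (auto simp: diag_mat_def mat_def rep_def)
    finally show "mat_prod (coords n) (block ?inv) (block (\<lambda>k. arc_average n k (interpolate F G t))) a b = diag_mat (\<lambda>_. 1) a b" .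
  qed
  have "mat_trace (coords n) (mat_prod (coords n) R (\<lambda>a b. A F a b - A G a b)) = mat_trace (coords n) (block (\<lambda>k. ?inv k ** ?D k))"
    unfolding d R_def mat_prod_scaled[OF s] mat_trace_def by (intro sum.cong refl mat_prod_block)
  also have "\<dots> = (\<Sum>k<n. 2 * Re (arc_trace F G t n k))"
    unfolding mat_trace_block by (simp add: arc_trace_def matrix_matrix_mult_def)
  finally show "mat_trace (coords n) (mat_prod (coords n) R (\<lambda>a b. A F a b - A G a b)) = (\<Sum>k<n. 2 * Re (arc_trace F G t n k))" .
qed

text \<open>The averages over arcs take the place of the Toeplitz matrices, and a Riemann sum that of the trace
  limit.\<close>

theorem spectral_entropy_rate:
  fixes y z :: "int \<Rightarrow> 'a \<Rightarrow> real^'m"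
  assumes pr: "prob_space M" and y: "gaussian_process M y F" and z: "gaussian_process M z G"
    and F: "symbol \<alpha> \<beta> F" and G: "symbol \<alpha> \<beta> G" and ab: "\<alpha> \<le> \<beta>"
  shows "has_spectral_entropy_rate M y z (rate F G)"
proof -
  have a: "0 < \<alpha>" using F by (simp add: symbol_def)
  let ?I = "\<lambda>n. coords (Suc n) :: (nat \<times> 'm \<times> bool) set"
  let ?A = "\<lambda>n H a b. block (\<lambda>k. arc_average (Suc n) k H) a b / (4 * real (Suc n))"
  let ?e = "\<lambda>n. rel_entropy (joint_law M {..<2 * n} (grid_increment M y n)) (joint_law M {..<2 * n} (grid_increment M z n))"
  \<comment> \<open>The grid with \<open>n = 0\<close> is degenerate, so the sequence is shifted by one.\<close>
  have ex: "\<exists>\<mu>. relative_spectrum (?I n) (?A n F) (?A n G) \<mu> \<and> ?e (Suc n) = ereal (\<Sum>i\<in>?I n. (\<mu> i - 1 - ln (\<mu> i)) / 2)" for n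
    by (rule spectral_rel_entropy[OF pr y z F G, of "Suc n"]) (simp, blast)
  have "\<exists>\<mu>. \<forall>n. relative_spectrum (?I n) (?A n F) (?A n G) (\<mu> n) \<and> ?e (Suc n) = ereal (\<Sum>i\<in>?I n. (\<mu> n i - 1 - ln (\<mu> n i)) / 2)"
    by (rule choice, rule allI, rule ex)
  then obtain \<mu> where mu: "\<forall>n. relative_spectrum (?I n) (?A n F) (?A n G) (\<mu> n) \<and> ?e (Suc n) = ereal (\<Sum>i\<in>?I n. (\<mu> n i - 1 - ln (\<mu> n i)) / 2)" ..
  have spec: "relative_spectrum (?I n) (?A n F) (?A n G) (\<mu> n)"
    and mu1: "?e (Suc n) = ereal (\<Sum>i\<in>?I n. (\<mu> n i - 1 - ln (\<mu> n i)) / 2)" for n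
    using mu by blast+
  have mu3: "\<alpha> / \<beta> \<le> \<mu> n i \<and> \<mu> n i \<le> \<beta> / \<alpha>" if i: "i \<in> ?I n" for n i
  proof -
    define s where "s = 4 * real (Suc n)"
    have s: "0 < s" by (simp add: s_def)
    have q: "(\<alpha> / s) / (\<beta> / s) = \<alpha> / \<beta>" "(\<beta> / s) / (\<alpha> / s) = \<beta> / \<alpha>" using s by auto
    have as: "0 < \<alpha> / s" and abs: "\<alpha> / s \<le> \<beta> / s" using a ab s by (auto simp: divide_right_mono)
    have sn: "0 \<le> (\<Sum>b\<in>?I n. (x b)\<^sup>2)" for x :: "nat \<times> 'm \<times> bool \<Rightarrow> real" by (rule sum_nonneg) simp
    have lo: "(\<alpha> / \<beta>) * bilin (?I n) (?A n G) x x \<le> bilin (?I n) (?A n F) x x" for x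
      unfolding s_def[symmetric]
      by (rule compare_forms(1)[OF as block_average_bounds[OF zero_less_Suc F s] block_average_bounds[OF zero_less_Suc G s] sn abs, unfolded q])
    have hi: "bilin (?I n) (?A n F) x x \<le> (\<beta> / \<alpha>) * bilin (?I n) (?A n G) x x" for x
      unfolding s_def[symmetric]
      by (rule compare_forms(2)[OF as block_average_bounds[OF zero_less_Suc F s] block_average_bounds[OF zero_less_Suc G s] sn abs, unfolded q])
    have 1: "\<forall>c. (\<forall>x. bilin (?I n) (?A n F) x x \<le> c * bilin (?I n) (?A n G) x x) \<longrightarrow> (\<forall>i\<in>?I n. \<mu> n i \<le> c)"
      and 2: "\<forall>c. (\<forall>x. c * bilin (?I n) (?A n G) x x \<le> bilin (?I n) (?A n F) x x) \<longrightarrow> (\<forall>i\<in>?I n. c \<le> \<mu> n i)"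
      using spec[of n] unfolding relative_spectrum_def by simp_all
    show ?thesis
      using 1[THEN HOL.spec, THEN mp, OF allI, OF hi] 2[THEN HOL.spec, THEN mp, OF allI, OF lo] i by simp
  qed
  have "(\<lambda>n. (\<Sum>i\<in>?I n. (\<mu> n i - 1 - ln (\<mu> n i)) / 2) / real (2 * Suc n)) \<longlonglongrightarrow> rate F G"
    unfolding rate_def
  proof (rule entropy_rate_limit[where K="real CARD('m)" and c="\<alpha> / \<beta>" and C="\<beta> / \<alpha>"])
    show "real (card (?I n)) \<le> real CARD('m) * real (2 * Suc n)" for n
      by (simp add: coords_def card_cartesian_product algebra_simps)
    show "0 < \<alpha> / \<beta>" "\<alpha> / \<beta> \<le> 1" using a ab by auto
    show "\<alpha> / \<beta> \<le> \<mu> n i \<and> \<mu> n i \<le> \<beta> / \<alpha>" if "i \<in> ?I n" for n i by (rule mu3[OF that])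
    fix t :: real assume t: "0 \<le> t" "t \<le> 1"
    have e: "(\<Sum>i\<in>?I n. (\<mu> n i - 1) / (1 + t * (\<mu> n i - 1))) = Re (\<Sum>k<2 * Suc n. arc_trace F G t (Suc n) k)" for n
    proof -
      have S: "\<forall>R. eq_on (?I n) (mat_prod (?I n) R (\<lambda>i j. ?A n G i j + t * (?A n F i j - ?A n G i j))) (diag_mat (\<lambda>_. 1)) \<longrightarrow>
        mat_trace (?I n) (mat_prod (?I n) R (\<lambda>i j. ?A n F i j - ?A n G i j)) = (\<Sum>i\<in>?I n. (\<mu> n i - 1) / (1 + t * (\<mu> n i - 1)))"
        using spec[of n] t unfolding relative_spectrum_def by blast
      note S[THEN HOL.spec, THEN mp, OF block_resolvent(1)[OF F G t zero_less_Suc]]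
      then show ?thesis
        unfolding block_resolvent(2)[OF F G t zero_less_Suc] arc_trace_sum[OF y z F G t zero_less_Suc] by (rule sym)
    qed
    have "(\<lambda>n. Re ((\<Sum>k<2 * Suc n. arc_trace F G t (Suc n) k) / of_nat (2 * Suc n))) \<longlonglongrightarrow> limit_trace F G t"
      unfolding limit_trace_def by (rule tendsto_Re[OF arc_trace_limit[OF F G t]])
    then show "(\<lambda>n. (\<Sum>i\<in>?I n. (\<mu> n i - 1) / (1 + t * (\<mu> n i - 1))) / real (2 * Suc n)) \<longlonglongrightarrow> limit_trace F G t"
      unfolding e Re_divide_of_nat .
  qed auto
  then have "(\<lambda>n. ereal ((\<Sum>i\<in>?I n. (\<mu> n i - 1 - ln (\<mu> n i)) / 2) / real (2 * Suc n))) \<longlonglongrightarrow> ereal (rate F G)" by (rule tendsto_ereal)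
  moreover have "ereal r / ereal (2 * real (Suc n)) = ereal (r / real (2 * Suc n))" for r n by simp
  ultimately have "(\<lambda>n. ?e (Suc n) / ereal (2 * real (Suc n))) \<longlonglongrightarrow> ereal (rate F G)"
    unfolding mu1 by (simp only:)
  then show ?thesis
    unfolding has_spectral_entropy_rate_def by (rule LIMSEQ_imp_Suc)
qed

section \<open>Equality of the two rates\<close>

theorem mainTheorem1:
  fixes M :: "'a measure"
    and y z :: "int \<Rightarrow> 'a \<Rightarrow> real^'m"
    and \<Phi>\<^sub>y \<Phi>\<^sub>z :: "complex \<Rightarrow> complex^'m^'m"
  assumes "prob_space M"
    and "jointly_gaussian M y z"
    and "zero_mean M y" and "zero_mean M z"
    and "stationary M y" and "stationary M z"
    and "purely_nondeterministic M y" and "purely_nondeterministic M z"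
    and "is_spectral_density M y \<Phi>\<^sub>y" and "is_spectral_density M z \<Phi>\<^sub>z"
    and "piecewise_continuous_on_circle \<Phi>\<^sub>y" and "piecewise_continuous_on_circle \<Phi>\<^sub>z"
    and "coercive \<Phi>\<^sub>y" and "coercive \<Phi>\<^sub>z"
  shows "\<exists>D. has_time_entropy_rate M y z D \<and> has_spectral_entropy_rate M y z D"
proof -
  obtain \<alpha>1 \<beta>1 F S where F: "symbol \<alpha>1 \<beta>1 F" and S: "finite S" "\<And>w. w \<notin> S \<Longrightarrow> F w = \<Phi>\<^sub>y w"
    using regular_version[OF assms(11,13)] by blast
  obtain \<alpha>2 \<beta>2 G S' where G: "symbol \<alpha>2 \<beta>2 G" and S': "finite S'" "\<And>w. w \<notin> S' \<Longrightarrow> G w = \<Phi>\<^sub>z w"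
    using regular_version[OF assms(12,14)] by blast
  define \<alpha> where "\<alpha> = min \<alpha>1 \<alpha>2"
  \<comment> \<open>The quotient \<open>\<alpha> / \<beta>\<close> bounds the relative eigenvalues from below and has to be at most \<open>1\<close>.\<close>
  define \<beta> where "\<beta> = max \<alpha> (max \<beta>1 \<beta>2)"
  have pos: "0 < \<alpha>" using F G by (auto simp: \<alpha>_def symbol_def)
  have F': "symbol \<alpha> \<beta> F" by (rule symbol_mono[OF F pos]) (auto simp: \<alpha>_def \<beta>_def)
  have G': "symbol \<alpha> \<beta> G" by (rule symbol_mono[OF G pos]) (auto simp: \<alpha>_def \<beta>_def)
  have ab: "\<alpha> \<le> \<beta>" by (simp add: \<beta>_def)
  have y: "gaussian_process M y F"
    by (rule gaussian_processI[OF assms(1,2,3,5,9) _ S]) (use F in \<open>simp add: symbol_def\<close>)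
  have z: "gaussian_process M z G"
    by (rule gaussian_processI[OF assms(1) jointly_gaussian_commute[OF assms(2)] assms(4,6,10) _ S']) (use G in \<open>simp add: symbol_def\<close>)
  show ?thesis
    using time_entropy_rate[OF assms(1) y z F' G' ab] spectral_entropy_rate[OF assms(1) y z F' G' ab] by blast
qed

end
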